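(* For every constant $c>0$ there exists a randomized algorithm that, given a matrix $A\in\mathbb{Z}^{n\times n}$ with integer entries in $[-U,U]$ and $\mathrm{nnz}$ nonzero entries, outputs $\det(A)$ with probability at least $1-n^{-c}$, runs in $\tilde O(n^2(\mathrm{nnz}+n))$ bit operations, and uses $O(n\log(nU))$ bits of working space. Here $\tilde O$ hides factors $\log^{O(1)}(nU)$.
   Context: Computational model: RAM model with read-only input; time measured in bit operations, space in bits of working space excluding the read-only input. *)

theory Defs
  imports
    "Jordan_Normal_Form.Determinant"
    "HOL-Probability.Probability"
    "HOL-Library.Log_Nat"
begin

text \<open>
  The machine is a random access machine with logarithmic (bit) cost: a fixed finite
  instruction list, a read-only input that can be accessed at any index, an unbounded working
  memory of integer cells with indirect addressing, and a one-way source of fair coin flips.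
  Every instruction is charged the number of bit operations of the schoolbook method on the
  numbers involved, including the addresses.
\<close>

text \<open>Length in bits, including a sign bit; in particular \<open>nbits 0 = 1\<close>.\<close>

definition nbits :: "int \<Rightarrow> nat" where
  "nbits x = nat (bitlen \<bar>x\<bar>) + 1"

datatype binop = Plus | Minus | Times | Quot | Rem

datatype target = Cell nat | CellAt nat

datatype operand = Lit int | Val target

datatype instr =
    Arith target binop operand operand
  | Read_Input target operand
  | Coin target
  | Goto nat
  | Goto_If_Pos operand nat
  | Goto_If_Zero operand nat

type_synonym program = "instr list"

record config =
  pc :: nat
  mem :: "nat \<Rightarrow> int"
  coins :: nat

text \<open>\<open>CellAt i\<close> is indirect addressing through cell \<open>i\<close>; a negative address is read as 0.\<close>

fun address :: "(nat \<Rightarrow> int) \<Rightarrow> target \<Rightarrow> nat" where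
  "address m (Cell i) = i"
| "address m (CellAt i) = nat (m i)"

fun operand_value :: "(nat \<Rightarrow> int) \<Rightarrow> operand \<Rightarrow> int" where
  "operand_value m (Lit k) = k"
| "operand_value m (Val a) = m (address m a)"

fun arith :: "binop \<Rightarrow> int \<Rightarrow> int \<Rightarrow> int" where
  "arith Plus x y = x + y"
| "arith Minus x y = x - y"
| "arith Times x y = x * y"
| "arith Quot x y = x div y"
| "arith Rem x y = x mod y"

text \<open>Reading the input outside its range yields 0.\<close>

definition input_at :: "int list \<Rightarrow> int \<Rightarrow> int" where
  "input_at xs i = (if 0 \<le> i \<and> i < int (length xs) then xs ! nat i else 0)"

fun exec :: "int list \<Rightarrow> (nat \<Rightarrow> bool) \<Rightarrow> instr \<Rightarrow> config \<Rightarrow> config" where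
  "exec xs \<omega> (Arith a f x y) s =
     s\<lparr>pc := Suc (pc s),
       mem := (mem s)(address (mem s) a :=
         arith f (operand_value (mem s) x) (operand_value (mem s) y))\<rparr>"
| "exec xs \<omega> (Read_Input a x) s =
     s\<lparr>pc := Suc (pc s),
       mem := (mem s)(address (mem s) a := input_at xs (operand_value (mem s) x))\<rparr>"
| "exec xs \<omega> (Coin a) s =
     s\<lparr>pc := Suc (pc s),
       mem := (mem s)(address (mem s) a := of_bool (\<omega> (coins s))),
       coins := Suc (coins s)\<rparr>"
| "exec xs \<omega> (Goto l) s = s\<lparr>pc := l\<rparr>"
| "exec xs \<omega> (Goto_If_Pos x l) s =
     s\<lparr>pc := (if operand_value (mem s) x > 0 then l else Suc (pc s))\<rparr>"
| "exec xs \<omega> (Goto_If_Zero x l) s =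
     s\<lparr>pc := (if operand_value (mem s) x = 0 then l else Suc (pc s))\<rparr>"

text \<open>Bit costs: addressing, fetching operands, and the arithmetic itself.\<close>

fun address_cost :: "(nat \<Rightarrow> int) \<Rightarrow> target \<Rightarrow> nat" where
  "address_cost m (Cell i) = nbits (int i)"
| "address_cost m (CellAt i) = nbits (int i) + nbits (m i)"

fun operand_cost :: "(nat \<Rightarrow> int) \<Rightarrow> operand \<Rightarrow> nat" where
  "operand_cost m (Lit k) = nbits k"
| "operand_cost m (Val a) = address_cost m a + nbits (m (address m a))"

fun arith_cost :: "binop \<Rightarrow> int \<Rightarrow> int \<Rightarrow> nat" where
  "arith_cost Plus x y = nbits x + nbits y"
| "arith_cost Minus x y = nbits x + nbits y"
| "arith_cost Times x y = nbits x * nbits y"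
| "arith_cost Quot x y = nbits x * nbits y"
| "arith_cost Rem x y = nbits x * nbits y"

fun instr_cost :: "int list \<Rightarrow> instr \<Rightarrow> (nat \<Rightarrow> int) \<Rightarrow> nat" where
  "instr_cost xs (Arith a f x y) m =
     address_cost m a + operand_cost m x + operand_cost m y
       + arith_cost f (operand_value m x) (operand_value m y)"
| "instr_cost xs (Read_Input a x) m =
     address_cost m a + operand_cost m x + nbits (input_at xs (operand_value m x))"
| "instr_cost xs (Coin a) m = address_cost m a + 1"
| "instr_cost xs (Goto l) m = 1"
| "instr_cost xs (Goto_If_Pos x l) m = operand_cost m x + 1"
| "instr_cost xs (Goto_If_Zero x l) m = operand_cost m x + 1"

text \<open>The machine halts when the program counter leaves the program.\<close>

definition halted :: "program \<Rightarrow> config \<Rightarrow> bool" where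
  "halted P s \<longleftrightarrow> length P \<le> pc s"

definition step :: "program \<Rightarrow> int list \<Rightarrow> (nat \<Rightarrow> bool) \<Rightarrow> config \<Rightarrow> config" where
  "step P xs \<omega> s = (if halted P s then s else exec xs \<omega> (P ! pc s) s)"

definition step_cost :: "program \<Rightarrow> int list \<Rightarrow> config \<Rightarrow> nat" where
  "step_cost P xs s = (if halted P s then 0 else instr_cost xs (P ! pc s) (mem s))"

definition initial :: config where
  "initial = \<lparr>pc = 0, mem = (\<lambda>_. 0), coins = 0\<rparr>"

definition run :: "program \<Rightarrow> int list \<Rightarrow> (nat \<Rightarrow> bool) \<Rightarrow> nat \<Rightarrow> config" where
  "run P xs \<omega> t = (step P xs \<omega> ^^ t) initial"

definition time_used :: "program \<Rightarrow> int list \<Rightarrow> (nat \<Rightarrow> bool) \<Rightarrow> nat \<Rightarrow> nat" where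
  "time_used P xs \<omega> t = (\<Sum>s<t. step_cost P xs (run P xs \<omega> s))"

text \<open>
  The working space is the initial segment of the memory up to the last cell that is ever
  nonzero, each cell being charged the length of the longest number it ever holds. Charging the
  whole segment prevents information from being hidden in the choice of addresses.
\<close>

definition cells_used :: "program \<Rightarrow> int list \<Rightarrow> (nat \<Rightarrow> bool) \<Rightarrow> nat \<Rightarrow> nat" where
  "cells_used P xs \<omega> t = (LEAST k. \<forall>s\<le>t. \<forall>a\<ge>k. mem (run P xs \<omega> s) a = 0)"

definition space_used :: "program \<Rightarrow> int list \<Rightarrow> (nat \<Rightarrow> bool) \<Rightarrow> nat \<Rightarrow> nat" where
  "space_used P xs \<omega> t =
     (\<Sum>a<cells_used P xs \<omega> t. MAX s\<in>{..t}. nbits (mem (run P xs \<omega> s) a))"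

text \<open>The result is left in cell 0, so it counts towards the working space.\<close>

definition outputs :: "program \<Rightarrow> int list \<Rightarrow> (nat \<Rightarrow> bool) \<Rightarrow> int \<Rightarrow> bool" where
  "outputs P xs \<omega> v \<longleftrightarrow> (\<exists>t. halted P (run P xs \<omega> t) \<and> mem (run P xs \<omega> t) 0 = v)"

definition coin_space :: "(nat \<Rightarrow> bool) measure" where
  "coin_space = PiM UNIV (\<lambda>_. measure_pmf (bernoulli_pmf (1 / 2)))"

definition nonzeros :: "int mat \<Rightarrow> (nat \<times> nat) set" where
  "nonzeros A = {(i, j). i < dim_row A \<and> j < dim_col A \<and> A $$ (i, j) \<noteq> 0}"

definition nnz :: "int mat \<Rightarrow> nat" where
  "nnz A = card (nonzeros A)"

text \<open>
  Coordinate-list encoding of a square matrix: the dimension and the number of nonzero entries,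
  followed by one triple (row, column, value) for each nonzero entry, in an arbitrary order.
  Rows and columns are numbered from 0.
\<close>

definition sparse_encoding :: "int mat \<Rightarrow> int list \<Rightarrow> bool" where
  "sparse_encoding A xs \<longleftrightarrow>
     (\<exists>ps. distinct ps \<and> set ps = nonzeros A \<and>
        xs = [int (dim_row A), int (length ps)]
             @ concat (map (\<lambda>(i, j). [int i, int j, A $$ (i, j)]) ps))"

end

theory Submission
  imports Defs "HOL-Number_Theory.Cong"
begin

text \<open>The determinant is recovered by Chinese remaindering from its residues modulo about
  \<open>n log (nU)\<close> primes of \<open>O(log (nU))\<close> bits each. Modulo a prime \<open>q\<close> one computes, in Wiedemann's manner,
  the scalar sequence \<open>s\<^sub>m = u\<^sup>T B\<^sup>m v\<close> for the randomly preconditioned matrix \<open>B = D A (I + x y\<^sup>T)\<close>;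
  only \<open>O(n)\<close> residues are stored at a time. A division-free two-term recurrence for the two families of
  orthogonal polynomials of \<open>s\<close> yields the Hankel determinants of \<open>s\<close> and of its shift, whose quotient is
  \<open>det B\<close>, and hence \<open>det A\<close>. All the determinants involved are nonzero polynomial functions of the random
  choices of degree \<open>O(n\<^sup>2)\<close>, so a trial over a prime \<open>q \<ge> 64 n\<^sup>2\<close> fails with probability at most \<open>1/2\<close>,
  and a failed trial is recognised. Over \<open>\<int>\<close>, congruences modulo \<open>q\<close> replace the field with \<open>q\<close> elements.
  The algorithm is written in a small structured language whose compilation to the machine preserves
  results and bounds time and space.\<close>

section \<open>Determinants of integer arrays\<close>

text \<open>The recurrence works modulo \<open>q\<close> when all leading Hankel minors of
  \<open>s\<close> and of its shift are units, and this shapes the preconditioner. Leading blocks of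
  an invertible matrix may be singular, but after one simultaneous permutation of rows and columns
  each has corank at most one, so a generic rank-one term repairs them all. A generic diagonal then
  makes some vector cyclic, by induction on the size with the newest diagonal entry set to zero, and
  generic \<open>u\<close>, \<open>v\<close> make the minors units. Space admits only a constant
  number of numbers of \<open>n log(nU)\<close> bits, so primes are treated one at a time and each
  residue is absorbed at once by Chinese remaindering. \<open>U\<close> is not part of the input;
  the program measures the largest entry itself. Up to logarithms, \<open>n\<close> primes of size
  \<open>n^2\<close> are used. Hence exhaustive search for a modular quotient (\<open>n^2\<close>
  each) and trial division of \<open>n^2\<close> candidates by \<open>n\<close> divisors cost
  \<open>n^3\<close>, within the bound. Which candidates are used depends on the input alone, so the
  coins of each trial have fixed positions and the failure probability is a union bound.\<close>

definition detn :: "nat \<Rightarrow> (nat \<Rightarrow> nat \<Rightarrow> int) \<Rightarrow> int" where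
  "detn n A = Determinant.det (Matrix.mat n n (\<lambda>(i, j). A i j))"

definition unit_row :: "nat \<Rightarrow> nat \<Rightarrow> int" where
  "unit_row c j = (if j = c then 1 else 0)"

lemma detn_Leibniz:
  "detn n A = (\<Sum>\<pi> | \<pi> permutes {0..<n}. signof \<pi> * (\<Prod>i = 0..<n. A i (\<pi> i)))"
proof -
  have "(\<Prod>i = 0..<n. Matrix.mat n n (\<lambda>(i, j). A i j) $$ (i, \<pi> i)) = (\<Prod>i = 0..<n. A i (\<pi> i))"
    if "\<pi> permutes {0..<n}" for \<pi>
    using permutes_in_image[OF that] by (intro prod.cong) auto
  then show ?thesis
    unfolding detn_def by (subst det_def'[of _ n]) auto
qed

lemma detn_eqI:
  assumes "\<And>i j. i < n \<Longrightarrow> j < n \<Longrightarrow> A i j = B i j"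
  shows "detn n A = detn n B"
  unfolding detn_def by (rule arg_cong[of _ _ Determinant.det]) (auto simp: assms)

lemma detn_cong:
  assumes "\<And>i j. i < n \<Longrightarrow> j < n \<Longrightarrow> [A i j = B i j] (mod p)"
  shows "[detn n A = detn n B] (mod p)"
  unfolding detn_Leibniz
proof (intro cong_sum cong_scalar_left cong_prod)
  fix \<pi> i assume "\<pi> \<in> {\<pi>. \<pi> permutes {0..<n}}" "i \<in> {0..<n}"
  then show "[A i (\<pi> i) = B i (\<pi> i)] (mod p)"
    using permutes_in_image[of \<pi> "{0..<n}" i] assms by auto
qed

lemma detn_0 [simp]: "detn 0 A = 1"
  by (simp add: detn_def)

lemma detn_transpose: "detn n (\<lambda>i j. A j i) = detn n A"
proof -
  have "Matrix.mat n n (\<lambda>(i, j). A j i) = transpose_mat (Matrix.mat n n (\<lambda>(i, j). A i j))"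
    by auto
  then show ?thesis
    unfolding detn_def by (simp add: Determinant.det_transpose[of _ n])
qed

lemma detn_mult: "detn n (\<lambda>i j. \<Sum>l<n. A i l * B l j) = detn n A * detn n B"
proof -
  have "Matrix.mat n n (\<lambda>(i, j). \<Sum>l<n. A i l * B l j)
      = Matrix.mat n n (\<lambda>(i, j). A i j) * Matrix.mat n n (\<lambda>(i, j). B i j)"
    by (auto simp: scalar_prod_def atLeast0LessThan)
  then show ?thesis
    unfolding detn_def by (metis det_mult mat_carrier)
qed

text \<open>In each Leibniz term row \<open>i\<close> contributes exactly one factor; once it is
  pulled out, the remaining product does not see that row.\<close>

lemma detn_row_linear:
  assumes "i < n" "finite C"
  shows "detn n (A(i := \<lambda>j. \<Sum>c\<in>C. r c * F c j)) = (\<Sum>c\<in>C. r c * detn n (A(i := F c)))"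
proof -
  have *: "(\<Prod>k = 0..<n. (A(i := f)) k (\<pi> k)) = f (\<pi> i) * (\<Prod>k\<in>{0..<n}-{i}. A k (\<pi> k))" for f \<pi>
    using assms by (subst prod.remove[of _ i]) (auto intro!: prod.cong)
  show ?thesis
    unfolding detn_Leibniz *
    by (simp add: sum_distrib_left sum_distrib_right mult_ac) (rule sum.swap)
qed

lemma detn_row_add:
  assumes "i < n"
  shows "detn n (A(i := \<lambda>j. f j + c * g j)) = detn n (A(i := f)) + c * detn n (A(i := g))"
  using detn_row_linear[OF assms, of "{True, False}" A "\<lambda>t. if t then 1 else c"
      "\<lambda>t. if t then f else g"] by simp

lemma detn_row_expand:
  assumes "i < n"
  shows "detn n (A(i := r)) = (\<Sum>c<n. r c * detn n (A(i := unit_row c)))"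
proof -
  have "detn n (A(i := r)) = detn n (A(i := \<lambda>j. \<Sum>c<n. r c * unit_row c j))"
    by (rule detn_eqI) (auto simp: unit_row_def if_distrib cong: if_cong)
  then show ?thesis using detn_row_linear[OF assms, of "{..<n}" A r unit_row] by simp
qed

lemma detn_equal_rows:
  assumes "i < n" "k < n" "i \<noteq> k" "A i = A k"
  shows "detn n A = 0"
  unfolding detn_def using assms
  by (intro Determinant.det_identical_rows[of _ n i k]) (auto simp: Matrix.row_def)

text \<open>Polarisation: with \<open>f + g\<close> in both rows the determinant vanishes, and after
  bilinear expansion only the two mixed terms survive.\<close>

lemma detn_swap_rows:
  assumes "i < n" "k < n" "i \<noteq> k"
  shows "detn n (A(i := f, k := g)) = - detn n (A(i := g, k := f))"
proof -
  have "detn n (A(i := \<lambda>j. f j + 1 * g j, k := \<lambda>j. f j + 1 * g j)) = 0"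
    by (rule detn_equal_rows[of i n k]) (use assms in auto)
  moreover have "detn n (A(i := h, k := h)) = 0" for h
    by (rule detn_equal_rows[of i n k]) (use assms in auto)
  moreover have "detn n (A(i := \<lambda>j. f j + 1 * g j, k := \<lambda>j. f j + 1 * g j))
      = detn n (A(i := f, k := f)) + detn n (A(i := g, k := f)) + detn n (A(i := f, k := g))
        + detn n (A(i := g, k := g))"
    unfolding detn_row_add[OF assms(2)]
    unfolding fun_upd_twist[OF assms(3)] detn_row_add[OF assms(1)] by simp
  ultimately show ?thesis by simp
qed

lemma detn_permute_rows:
  assumes "\<pi> permutes {0..<n}"
  shows "detn n (\<lambda>i j. A (\<pi> i) j) = signof \<pi> * detn n A"
proof -
  have "Matrix.mat n n (\<lambda>(i, j). A (\<pi> i) j) = Matrix.mat n n (\<lambda>(i, j). Matrix.mat n n (\<lambda>(i, j). A i j) $$ (\<pi> i, j))"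
    using permutes_in_image[OF assms] by (intro eq_matI) auto
  then show ?thesis unfolding detn_def
    using Determinant.det_permute_rows[OF _ assms, of "Matrix.mat n n (\<lambda>(i, j). A i j)"] by simp
qed

lemma signof_square: "signof \<pi> * signof \<pi> = (1::int)"
  by (simp add: sign_def)

lemma detn_permute:
  assumes "\<pi> permutes {0..<n}"
  shows "detn n (\<lambda>i j. A (\<pi> i) (\<pi> j)) = detn n A"
proof -
  have "detn n (\<lambda>i j. A (\<pi> i) (\<pi> j)) = signof \<pi> * detn n (\<lambda>i j. A i (\<pi> j))"
    by (rule detn_permute_rows[OF assms, of "\<lambda>i j. A i (\<pi> j)"])
  also have "detn n (\<lambda>i j. A i (\<pi> j)) = detn n (\<lambda>i j. A j (\<pi> i))"
    by (rule detn_transpose[of n "\<lambda>i j. A j (\<pi> i)"])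
  also have "\<dots> = signof \<pi> * detn n (\<lambda>i j. A j i)"
    by (rule detn_permute_rows[OF assms, of "\<lambda>i j. A j i"])
  finally show ?thesis
    by (simp only: mult.assoc[symmetric] signof_square mult_1 detn_transpose[of n A])
qed

lemma detn_upper_triangular:
  assumes "\<And>i j. i < n \<Longrightarrow> j < i \<Longrightarrow> A i j = 0"
  shows "detn n A = (\<Prod>i<n. A i i)"
proof -
  have "detn n A = prod_list (diag_mat (Matrix.mat n n (\<lambda>(i, j). A i j)))"
    unfolding detn_def by (rule det_upper_triangular[of _ n]) (auto simp: upper_triangular_def assms)
  also have "diag_mat (Matrix.mat n n (\<lambda>(i, j). A i j)) = map (\<lambda>i. A i i) [0..<n]"
    by (auto simp: diag_mat_def)
  also have "prod_list (map (\<lambda>i. A i i) [0..<n]) = (\<Prod>i<n. A i i)"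
    by (subst prod.distinct_set_conv_list[symmetric]) (auto simp: atLeast0LessThan)
  finally show ?thesis .
qed

lemma detn_lower_triangular:
  assumes "\<And>i j. j < n \<Longrightarrow> i < j \<Longrightarrow> A i j = 0"
  shows "detn n A = (\<Prod>i<n. A i i)"
  using detn_upper_triangular[of n "\<lambda>i j. A j i"] assms by (simp add: detn_transpose[of n A])

lemma detn_last_unit_row: "detn (Suc n) (A(n := unit_row n)) = detn n A"
proof -
  let ?M = "Matrix.mat (Suc n) (Suc n) (\<lambda>(i, j). (A(n := unit_row n)) i j)"
  have "Determinant.det ?M = (\<Sum>j<Suc n. ?M $$ (n, j) * cofactor ?M n j)"
    by (rule laplace_expansion_row) auto
  also have "\<dots> = cofactor ?M n n"
    by (simp add: unit_row_def)
  also have "\<dots> = Determinant.det (mat_delete ?M n n)"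
    by (simp add: cofactor_def)
  also have "mat_delete ?M n n = Matrix.mat n n (\<lambda>(i, j). A i j)"
    by (auto simp: mat_delete_def)
  finally show ?thesis by (simp add: detn_def)
qed

lemma mod_inverse:
  fixes a :: int
  assumes "prime p" "\<not> p dvd a"
  shows "\<exists>z. [a * z = 1] (mod p)"
  using assms by (metis cong_solve_coprime_int coprime_commute prime_imp_coprime)

text \<open>Cramer's rule with the adjugate, where division by the determinant becomes
  multiplication by its inverse \<open>z\<close> modulo \<open>p\<close>.\<close>

lemma detn_solvable:
  assumes "prime p" "\<not> p dvd detn n A"
  shows "\<exists>x. \<forall>i<n. [(\<Sum>j<n. A i j * x j) = b i] (mod p)"
proof -
  let ?M = "Matrix.mat n n (\<lambda>(i, j). A i j)"
  let ?N = "adj_mat ?M"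
  obtain z where z: "[detn n A * z = 1] (mod p)"
    using mod_inverse assms by blast
  have N: "?N \<in> carrier_mat n n" and MN: "?M * ?N = Determinant.det ?M \<cdot>\<^sub>m 1\<^sub>m n"
    using adj_mat[of ?M n] by auto
  have eq: "(\<Sum>j<n. A i j * ?N $$ (j, k)) = (if i = k then detn n A else 0)" if "i < n" "k < n" for i k
  proof -
    have "(?M * ?N) $$ (i, k) = (\<Sum>j<n. A i j * ?N $$ (j, k))"
      using that N by (auto simp: scalar_prod_def atLeast0LessThan intro!: sum.cong)
    then show ?thesis using that unfolding MN by (auto simp: detn_def)
  qed
  define x where "x j = z * (\<Sum>k<n. ?N $$ (j, k) * b k)" for j
  have "[(\<Sum>j<n. A i j * x j) = b i] (mod p)" if "i < n" for i
  proof -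
    have "(\<Sum>j<n. A i j * x j) = (\<Sum>j<n. \<Sum>k<n. z * (A i j * ?N $$ (j, k) * b k))"
      by (simp add: x_def sum_distrib_left mult_ac)
    also have "\<dots> = (\<Sum>k<n. \<Sum>j<n. z * (A i j * ?N $$ (j, k) * b k))"
      by (rule sum.swap)
    also have "\<dots> = (\<Sum>k<n. z * (\<Sum>j<n. A i j * ?N $$ (j, k)) * b k)"
      by (simp add: sum_distrib_left sum_distrib_right mult_ac)
    also have "\<dots> = (\<Sum>k<n. if i = k then z * detn n A * b k else 0)"
      by (rule sum.cong) (auto simp: eq that)
    also have "\<dots> = detn n A * z * b i"
      using that by (simp add: mult_ac)
    finally show ?thesis using cong_scalar_right[OF z, of "b i"] by simp
  qed
  then show ?thesis by blast
qed

text \<open>The matrix determinant lemma, proved by switching rows one at a time from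
  \<open>unit_row i\<close> to the updated row. By row linearity, switching row \<open>m\<close>
  adds \<open>x m\<close> times a determinant with \<open>y\<close> in row \<open>m\<close>, which
  \<open>key\<close> evaluates to \<open>y m\<close>.\<close>

lemma detn_identity_rank_one:
  "detn n (\<lambda>i j. unit_row i j + x i * y j) = 1 + (\<Sum>i<n. x i * y i)"
proof -
  define F where "F m i j = (if i < m then unit_row i j + x i * y j else unit_row i j)" for m i j
  have row: "F (Suc m) = (F m)(m := \<lambda>j. unit_row m j + x m * y j)" for m
    by (auto simp: F_def fun_eq_iff less_Suc_eq)
  have row0: "(F m)(m := unit_row m) = F m" for m
    by (auto simp: F_def fun_eq_iff)
  have key: "detn n ((F m)(m := y)) = y m" if "m < n" for m
  proof -
    \<comment> \<open>With \<open>y\<close> itself standing in row \<open>m\<close>, adding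
      \<open>x l * y\<close> to another row \<open>l\<close> leaves the determinant unchanged. So
      the rows updated so far can be reset to unit rows, where the value is read off by expanding
      row \<open>m\<close>.\<close>
    define G where "G l i j = (if i = m then y j else if i < l then unit_row i j + x i * y j else unit_row i j)"
      for l i j
    have "detn n (G l) = y m" if "l \<le> m" for l
      using that
    proof (induction l)
      case 0
      have "G 0 = unit_row(m := y)" by (auto simp: G_def fun_eq_iff)
      then have "detn n (G 0) = (\<Sum>c<n. y c * detn n (unit_row(m := unit_row c)))"
        using detn_row_expand[OF \<open>m < n\<close>, of unit_row y] by simp
      also have "detn n (unit_row(m := unit_row c)) = (if c = m then 1 else 0)" if "c < n" for c
      proof (cases "c = m")
        case True
        then have "unit_row(m := unit_row c) = unit_row" by auto
        then show ?thesis using True detn_upper_triangular[of n unit_row] by (simp add: unit_row_def)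
      next
        case False
        then show ?thesis
          using detn_equal_rows[of m n c "unit_row(m := unit_row c)"] that \<open>m < n\<close> by simp
      qed
      then have "(\<Sum>c<n. y c * detn n (unit_row(m := unit_row c))) = (\<Sum>c<n. if c = m then y c else 0)"
        by (intro sum.cong) auto
      finally show ?case using \<open>m < n\<close> by simp
    next
      case (Suc l)
      have l: "l < n" "l \<noteq> m" using Suc.prems \<open>m < n\<close> by auto
      have "G (Suc l) = (G l)(l := \<lambda>j. unit_row l j + x l * y j)"
        using l by (auto simp: G_def fun_eq_iff less_Suc_eq)
      moreover have "(G l)(l := unit_row l) = G l" using l by (auto simp: G_def fun_eq_iff)
      moreover have "detn n ((G l)(l := y)) = 0"
        using detn_equal_rows[of l n m "(G l)(l := y)"] l \<open>m < n\<close> by (auto simp: G_def fun_eq_iff)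
      ultimately show ?case
        using detn_row_add[OF l(1), of "G l" "unit_row l" "x l" y] Suc by (metis (no_types) Suc_leD add.right_neutral mult_zero_right)
    qed
    from this[of m] have "detn n (G m) = y m" by simp
    moreover have "G m = (F m)(m := y)" by (auto simp: G_def F_def fun_eq_iff)
    ultimately show ?thesis by simp
  qed
  have "detn n (F m) = 1 + (\<Sum>i<m. x i * y i)" if "m \<le> n" for m
    using that
  proof (induction m)
    case 0
    have "F 0 = unit_row" by (auto simp: F_def fun_eq_iff)
    moreover have "detn n unit_row = 1"
      using detn_upper_triangular[of n unit_row] by (simp add: unit_row_def)
    ultimately show ?case by simp
  next
    case (Suc m)
    then have m: "m < n" by simp
    have "detn n (F (Suc m)) = detn n ((F m)(m := unit_row m)) + x m * detn n ((F m)(m := y))"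
      unfolding row by (rule detn_row_add[OF m])
    also have "\<dots> = 1 + (\<Sum>i<m. x i * y i) + x m * y m"
      using Suc m by (simp only: row0 key[OF m] Suc_leD)
    finally show ?case by simp
  qed
  moreover have "detn n (F n) = detn n (\<lambda>i j. unit_row i j + x i * y j)"
    by (rule detn_eqI) (simp add: F_def)
  ultimately show ?thesis by simp
qed

section \<open>Hankel determinants from orthogonal polynomials\<close>

text \<open>The pair \<open>(\<phi>\<^sub>k, \<psi>\<^sub>k)\<close> of coefficient sequences satisfies, for the functional
  \<open>x\<^sup>m \<mapsto> s m\<close>, that \<open>\<phi>\<^sub>k\<close> is orthogonal to \<open>1, \<dots>, x\<^sup>k\<^sup>-\<^sup>1\<close> and \<open>\<psi>\<^sub>k\<close> to \<open>x, \<dots>, x\<^sup>k\<close>.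
  Division is avoided, so the recursion makes sense over the integers.\<close>

primrec orth :: "nat \<Rightarrow> (nat \<Rightarrow> int) \<Rightarrow> nat \<Rightarrow> (nat \<Rightarrow> int) \<times> (nat \<Rightarrow> int)" where
  "orth n s 0 = (unit_row 0, unit_row 0)"
| "orth n s (Suc k) =
    (let f = fst (orth n s k); h = snd (orth n s k);
         g = (\<Sum>i<n. h i * s (i + k + 1)); e = (\<Sum>i<n. f i * s (i + k));
         f' = (\<lambda>i. g * f i - e * (if i = 0 then 0 else h (i - 1)));
         e' = (\<Sum>i<n. f' i * s (i + Suc k))
     in (f', \<lambda>i. g * f' i - e' * h i))"

definition phi where "phi n s k = fst (orth n s k)"
definition psi where "psi n s k = snd (orth n s k)"
definition ee where "ee n s k = (\<Sum>i<n. phi n s k i * s (i + k))"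
definition gg where "gg n s k = (\<Sum>i<n. psi n s k i * s (i + k + 1))"

lemma phi_0: "phi n s 0 = unit_row 0" and psi_0: "psi n s 0 = unit_row 0"
  by (simp_all add: phi_def psi_def)

lemma phi_Suc: "phi n s (Suc k) i = gg n s k * phi n s k i
    - ee n s k * (if i = 0 then 0 else psi n s k (i - 1))"
  by (simp add: phi_def psi_def gg_def ee_def Let_def)

lemma psi_Suc: "psi n s (Suc k) i = gg n s k * phi n s (Suc k) i - ee n s (Suc k) * psi n s k i"
  by (simp add: phi_def psi_def gg_def ee_def Let_def)

lemma phi_psi_support: "k < i \<Longrightarrow> phi n s k i = 0 \<and> psi n s k i = 0"
proof (induction k arbitrary: i)
  case 0
  then show ?case by (simp add: phi_0 psi_0 unit_row_def)
next
  case (Suc k)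
  then show ?case by (simp add: phi_Suc psi_Suc)
qed

text \<open>Both recursions combine two functionals whose moments below \<open>k\<close> vanish
  already. The multipliers \<open>gg\<close> and \<open>ee\<close> are the moments at
  \<open>k\<close> themselves, taken crosswise, so the moment at \<open>k\<close> cancels as
  well.\<close>

lemma phi_psi_orthogonal:
  assumes "k < n"
  shows "\<forall>j<k. (\<Sum>i<n. phi n s k i * s (i + j)) = 0 \<and> (\<Sum>i<n. psi n s k i * s (i + j + 1)) = 0"
  using assms
proof (induction k)
  case (Suc k)
  then have k: "k < n" by simp
  note IH = Suc.IH[OF k]
  obtain m where n: "n = Suc m" using k by (cases n) auto
  \<comment> \<open>The factor \<open>x\<close> in \<open>x psi\<close> turns into an index shift of
    \<open>s\<close>. The coefficient that would leave the range is zero because the degree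
    \<open>k\<close> is below \<open>n - 1\<close>.\<close>
  have shift: "(\<Sum>i<n. (if i = 0 then 0 else psi n s k (i - 1)) * s (i + j))
      = (\<Sum>i<n. psi n s k i * s (i + j + 1))" for j
  proof -
    have "(\<Sum>i<n. (if i = 0 then 0 else psi n s k (i - 1)) * s (i + j))
        = (\<Sum>i<m. psi n s k i * s (i + j + 1))"
      unfolding n by (subst sum.lessThan_Suc_shift) simp
    also have "\<dots> = (\<Sum>i<n. psi n s k i * s (i + j + 1))"
      using phi_psi_support[of k m n s] Suc.prems by (simp add: n)
    finally show ?thesis .
  qed
  have phi_step: "(\<Sum>i<n. phi n s (Suc k) i * s (i + j)) = gg n s k * (\<Sum>i<n. phi n s k i * s (i + j))
      - ee n s k * (\<Sum>i<n. psi n s k i * s (i + j + 1))" for j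
    unfolding shift[symmetric]
    by (simp only: phi_Suc left_diff_distrib sum_subtractf sum_distrib_left mult.assoc)
  have psi_step: "(\<Sum>i<n. psi n s (Suc k) i * s (i + j)) = gg n s k * (\<Sum>i<n. phi n s (Suc k) i * s (i + j))
      - ee n s (Suc k) * (\<Sum>i<n. psi n s k i * s (i + j))" for j
    by (simp only: psi_Suc left_diff_distrib sum_subtractf sum_distrib_left mult.assoc)
  have phi: "(\<Sum>i<n. phi n s (Suc k) i * s (i + j)) = 0" if "j < Suc k" for j
  proof (cases "j = k")
    case True
    then show ?thesis unfolding phi_step by (simp add: ee_def gg_def)
  next
    case False
    then show ?thesis using IH that unfolding phi_step by simp
  qed
  have psi: "(\<Sum>i<n. psi n s (Suc k) i * s (i + (j + 1))) = 0" if "j < Suc k" for j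
  proof (cases "j = k")
    case True
    then show ?thesis unfolding psi_step by (simp add: ee_def gg_def)
  next
    case False
    then show ?thesis using IH that phi[of "j + 1"] unfolding psi_step by simp
  qed
  show ?case using phi psi by (simp add: add.assoc)
qed simp

lemma phi_lead: "phi n s (Suc k) (Suc k) = - ee n s k * psi n s k k"
  and psi_lead: "psi n s (Suc k) (Suc k) = gg n s k * phi n s (Suc k) (Suc k)"
  using phi_psi_support[of k "Suc k" n s] by (simp_all add: phi_Suc psi_Suc)

text \<open>The coefficient rows \<open>f i\<close> form a lower triangular matrix. Its product with
  the Hankel matrix is upper triangular by orthogonality, so both sides are determinants of the same
  product.\<close>

lemma triangular_hankel:
  assumes kn: "k \<le> n" and supp: "\<And>i l. i < l \<Longrightarrow> f i l = 0"
    and orth: "\<And>i j. j < i \<Longrightarrow> i < k \<Longrightarrow> (\<Sum>l<n. f i l * s (l + j)) = 0"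
  shows "(\<Prod>i<k. f i i) * detn k (\<lambda>i j. s (i + j)) = (\<Prod>i<k. \<Sum>l<n. f i l * s (l + i))"
proof -
  have trunc: "(\<Sum>l<k. f i l * s (l + j)) = (\<Sum>l<n. f i l * s (l + j))" if "i < k" for i j
    by (rule sum.mono_neutral_left) (use that kn supp in auto)
  have "(\<Prod>i<k. f i i) * detn k (\<lambda>i j. s (i + j)) = detn k f * detn k (\<lambda>i j. s (i + j))"
    using detn_lower_triangular[of k f] supp by simp
  also have "\<dots> = detn k (\<lambda>i j. \<Sum>l<k. f i l * s (l + j))"
    by (rule detn_mult[symmetric])
  also have "\<dots> = detn k (\<lambda>i j. \<Sum>l<n. f i l * s (l + j))"
    by (rule detn_eqI) (simp add: trunc)
  also have "\<dots> = (\<Prod>i<k. \<Sum>l<n. f i l * s (l + i))"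
    by (rule detn_upper_triangular) (use orth in auto)
  finally show ?thesis .
qed

lemma phi_hankel:
  assumes "k \<le> n"
  shows "(\<Prod>i<k. phi n s i i) * detn k (\<lambda>i j. s (i + j)) = (\<Prod>i<k. ee n s i)"
  unfolding ee_def
  by (rule triangular_hankel[OF assms])
     (use phi_psi_support phi_psi_orthogonal assms in \<open>auto dest: less_le_trans\<close>)

lemma psi_hankel:
  assumes "k \<le> n"
  shows "(\<Prod>i<k. psi n s i i) * detn k (\<lambda>i j. s (i + j + 1)) = (\<Prod>i<k. gg n s i)"
  using triangular_hankel[OF assms, of "psi n s" "\<lambda>m. s (m + 1)"] phi_psi_support phi_psi_orthogonal assms
  by (auto simp: gg_def dest: less_le_trans)

text \<open>Lets the leading coefficients of the two families be eliminated against each other when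
  the two Hankel determinants are divided.\<close>

lemma prod_psi_lead:
  "(\<Prod>i<Suc m. psi n s i i) = (\<Prod>i<m. gg n s i) * (\<Prod>i<Suc m. phi n s i i)"
proof (induction m)
  case 0
  then show ?case by (simp add: phi_0 psi_0)
next
  case (Suc m)
  have "(\<Prod>i<Suc (Suc m). psi n s i i) = (\<Prod>i<Suc m. psi n s i i) * psi n s (Suc m) (Suc m)"
    by (rule prod.lessThan_Suc)
  also have "\<dots> = (\<Prod>i<m. gg n s i) * (\<Prod>i<Suc m. phi n s i i) * (gg n s m * phi n s (Suc m) (Suc m))"
    by (simp only: Suc psi_lead)
  also have "\<dots> = (\<Prod>i<Suc m. gg n s i) * (\<Prod>i<Suc (Suc m). phi n s i i)"
    by (simp only: prod.lessThan_Suc mult_ac)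
  finally show ?case .
qed

text \<open>All leading coefficients telescope away.\<close>

lemma hankel_quotient:
  assumes n: "n > 0"
    and shift: "detn n (\<lambda>i j. s (i + j + 1)) = \<Delta> * detn n (\<lambda>i j. s (i + j))"
    and p: "prime p" and ok: "\<not> p dvd (\<Prod>k<n. ee n s k * gg n s k)"
  shows "[\<Delta> * (\<Prod>k<n. ee n s k) = gg n s (n - 1)] (mod p)"
proof -
  obtain m where m: "n = Suc m" using n by (cases n) auto
  have "(\<Prod>i<m. gg n s i) * (\<Delta> * (\<Prod>i<n. ee n s i))
      = (\<Prod>i<m. gg n s i) * (\<Prod>i<n. phi n s i i) * (\<Delta> * detn n (\<lambda>i j. s (i + j)))"
    by (simp add: phi_hankel[of n n s, symmetric])
  also have "\<dots> = (\<Prod>i<n. psi n s i i) * detn n (\<lambda>i j. s (i + j + 1))"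
    using prod_psi_lead[of n s m] by (simp only: shift[unfolded m] m mult.assoc)
  also have "\<dots> = (\<Prod>i<n. gg n s i)" by (rule psi_hankel) simp
  also have "\<dots> = (\<Prod>i<m. gg n s i) * gg n s (n - 1)" by (simp add: m)
  finally have eq: "(\<Prod>i<m. gg n s i) * (\<Delta> * (\<Prod>i<n. ee n s i)) = (\<Prod>i<m. gg n s i) * gg n s (n - 1)" .
  \<comment> \<open>The common factor on both sides of \<open>eq\<close> divides the tested product,
    so it is a unit modulo \<open>p\<close> and may be cancelled.\<close>
  have "\<not> p dvd (\<Prod>i<m. gg n s i)"
  proof
    assume "p dvd (\<Prod>i<m. gg n s i)"
    then have "p dvd (\<Prod>k<n. gg n s k)" by (simp add: m)
    then show False using ok by (simp add: prod.distrib)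
  qed
  then have "coprime (\<Prod>i<m. gg n s i) p"
    using p by (metis coprime_commute prime_imp_coprime)
  then show ?thesis using eq by (metis cong_mult_lcancel cong_refl)
qed

lemma prime_dvd_prod_lessThan: "prime p \<Longrightarrow> p dvd (\<Prod>i<(k::nat). f i) \<longleftrightarrow> (\<exists>i<k. p dvd (f i :: int))"
  by (subst prime_dvd_prod_iff) auto

text \<open>A leading coefficient is, up to sign, a product of earlier \<open>ee\<close> and
  \<open>gg\<close>, hence a unit by induction. Then \<open>phi_hankel\<close> and
  \<open>psi_hankel\<close> carry the regularity of the next minors over to the next
  \<open>ee\<close> and \<open>gg\<close>.\<close>

lemma hankel_regular_imp_ee_gg:
  assumes p: "prime (p::int)"
    and h: "\<And>k. 1 \<le> k \<Longrightarrow> k \<le> n \<Longrightarrow> \<not> p dvd detn k (\<lambda>i j. s (i + j))"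
    and h': "\<And>k. 1 \<le> k \<Longrightarrow> k \<le> n \<Longrightarrow> \<not> p dvd detn k (\<lambda>i j. s (i + j + 1))"
  shows "\<not> p dvd (\<Prod>k<n. ee n s k * gg n s k)"
proof -
  have "\<forall>i<k. \<not> p dvd ee n s i \<and> \<not> p dvd gg n s i \<and> \<not> p dvd phi n s i i \<and> \<not> p dvd psi n s i i"
    if "k \<le> n" for k
    using that
  proof (induction k)
    case (Suc k)
    then have IH: "i < k \<Longrightarrow> \<not> p dvd ee n s i \<and> \<not> p dvd gg n s i \<and> \<not> p dvd phi n s i i \<and> \<not> p dvd psi n s i i" for i
      by simp
    have phi: "\<not> p dvd phi n s k k"
    proof (cases k)
      case 0
      then show ?thesis using prime_gt_1_int[OF p] by (simp add: phi_0 unit_row_def)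
    next
      case (Suc l)
      then show ?thesis using IH[of l] p by (simp add: phi_lead prime_dvd_mult_iff)
    qed
    have psi: "\<not> p dvd psi n s k k"
    proof (cases k)
      case 0
      then show ?thesis using prime_gt_1_int[OF p] by (simp add: psi_0 unit_row_def)
    next
      case (Suc l)
      then show ?thesis using IH[of l] p phi by (simp add: psi_lead prime_dvd_mult_iff)
    qed
    have "\<not> p dvd (\<Prod>i<Suc k. phi n s i i) * detn (Suc k) (\<lambda>i j. s (i + j))"
      using h[of "Suc k"] Suc.prems IH phi p
      unfolding prime_dvd_mult_iff[OF p] prime_dvd_prod_lessThan[OF p] by (auto simp: less_Suc_eq)
    then have "\<not> p dvd (\<Prod>i<Suc k. ee n s i)"
      using phi_hankel[of "Suc k" n s] Suc.prems by simp
    then have e: "\<not> p dvd ee n s k" by auto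
    have "\<not> p dvd (\<Prod>i<Suc k. psi n s i i) * detn (Suc k) (\<lambda>i j. s (i + j + 1))"
      using h'[of "Suc k"] Suc.prems IH psi p
      unfolding prime_dvd_mult_iff[OF p] prime_dvd_prod_lessThan[OF p] by (auto simp: less_Suc_eq)
    then have "\<not> p dvd (\<Prod>i<Suc k. gg n s i)"
      using psi_hankel[of "Suc k" n s] Suc.prems by simp
    then have g: "\<not> p dvd gg n s k" by auto
    show ?case using IH phi psi e g by (auto simp: less_Suc_eq)
  qed simp
  from this[of n] show ?thesis
    using p by (auto simp: prime_dvd_prod_lessThan prime_dvd_mult_iff)
qed

section \<open>Krylov sequences\<close>

definition mv :: "nat \<Rightarrow> (nat \<Rightarrow> nat \<Rightarrow> int) \<Rightarrow> (nat \<Rightarrow> int) \<Rightarrow> nat \<Rightarrow> int" where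
  "mv n B v i = (\<Sum>j<n. B i j * v j)"

definition kry where "kry n B v m = (mv n B ^^ m) v"

definition krylov_seq where "krylov_seq n B u v m = (\<Sum>i<n. u i * kry n B v m i)"

lemma kry_0 [simp]: "kry n B v 0 = v" and kry_Suc: "kry n B v (Suc m) = mv n B (kry n B v m)"
  by (simp_all add: kry_def)

text \<open>Powers of \<open>B\<close> move one at a time to the left factor as powers of the
  transpose, by exchanging two sums. Thereby the Hankel matrix factors into two Krylov
  matrices.\<close>

lemma krylov_seq_split:
  "krylov_seq n B u v (i + j) = (\<Sum>l<n. kry n (\<lambda>a b. B b a) u i l * kry n B v j l)"
proof (induction i arbitrary: j)
  case 0
  then show ?case by (simp add: krylov_seq_def)
next
  case (Suc i)
  have "krylov_seq n B u v (Suc i + j) = krylov_seq n B u v (i + Suc j)" by simp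
  also have "\<dots> = (\<Sum>l<n. \<Sum>m<n. kry n (\<lambda>a b. B b a) u i l * (B l m * kry n B v j m))"
    by (simp only: Suc kry_Suc mv_def sum_distrib_left)
  also have "\<dots> = (\<Sum>m<n. \<Sum>l<n. kry n (\<lambda>a b. B b a) u i l * (B l m * kry n B v j m))"
    by (rule sum.swap)
  also have "\<dots> = (\<Sum>m<n. kry n (\<lambda>a b. B b a) u (Suc i) m * kry n B v j m)"
    by (simp add: kry_Suc mv_def sum_distrib_left sum_distrib_right mult_ac)
  finally show ?case .
qed

lemma krylov_hankel:
  "detn n (\<lambda>i j. krylov_seq n B u v (i + j))
    = detn n (kry n (\<lambda>a b. B b a) u) * detn n (kry n B v)"
proof -
  have "detn n (\<lambda>i j. krylov_seq n B u v (i + j))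
      = detn n (kry n (\<lambda>a b. B b a) u) * detn n (\<lambda>i j. kry n B v j i)"
    unfolding krylov_seq_split by (rule detn_mult)
  then show ?thesis by (simp only: detn_transpose[of n "kry n B v"])
qed

text \<open>The shift inserts one more \<open>B\<close> between the two Krylov factors. This
  identity is what makes the quotient of the two Hankel determinants equal to
  \<open>det B\<close>.\<close>

lemma krylov_hankel_shift:
  "detn n (\<lambda>i j. krylov_seq n B u v (i + j + 1))
    = detn n B * detn n (\<lambda>i j. krylov_seq n B u v (i + j))"
proof -
  have "detn n (\<lambda>i j. krylov_seq n B u v (i + j + 1))
      = detn n (\<lambda>i j. krylov_seq n B u v (i + Suc j))" by simp
  also have "\<dots> = detn n (kry n (\<lambda>a b. B b a) u) * detn n (\<lambda>i j. kry n B v (Suc j) i)"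
    unfolding krylov_seq_split by (rule detn_mult)
  also have "detn n (\<lambda>i j. kry n B v (Suc j) i) = detn n B * detn n (\<lambda>i j. kry n B v j i)"
    unfolding kry_Suc mv_def by (rule detn_mult)
  finally show ?thesis
    by (simp only: krylov_hankel detn_transpose[of n "kry n B v"] mult_ac)
qed

text \<open>The vectors \<open>v, B v, ...\<close> are independent modulo \<open>p\<close>, so a
  left vector can prescribe the first \<open>n\<close> terms at will. This produces the witnesses
  for nonvanishing Hankel minors.\<close>

lemma krylov_seq_linear_solvable:
  assumes "prime p" "\<not> p dvd detn n (kry n B v)"
  shows "\<exists>u. \<forall>i<n. [krylov_seq n B u v i = b i] (mod p)"
proof -
  obtain u where "\<forall>i<n. [(\<Sum>j<n. kry n B v i j * u j) = b i] (mod p)"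
    using detn_solvable[OF assms] by blast
  then show ?thesis
    by (intro exI[of _ u]) (simp add: krylov_seq_def mult.commute)
qed

text \<open>Reversing the rows (multiplication by \<open>?J\<close>) makes the matrix upper
  triangular modulo \<open>p\<close> with ones on the diagonal: the prescribed terms fill the
  diagonal and everything below it, the free later terms lie above.\<close>

lemma antitriangular_hankel_unit:
  assumes p: "prime (p::int)" and s: "\<And>i. i \<le> k \<Longrightarrow> [s i = (if i = k then 1 else 0)] (mod p)"
  shows "\<not> p dvd detn (Suc k) (\<lambda>i j. s (i + j))"
proof
  assume dvd: "p dvd detn (Suc k) (\<lambda>i j. s (i + j))"
  let ?J = "\<lambda>i l. if l = k - i then 1 else (0::int)"
  let ?T = "\<lambda>i j. if i \<le> j then s (k - i + j) else 0"
  have "detn (Suc k) ?J * detn (Suc k) (\<lambda>i j. s (i + j))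
      = detn (Suc k) (\<lambda>i j. \<Sum>l<Suc k. ?J i l * s (l + j))"
    by (rule detn_mult[symmetric])
  also have "\<dots> = detn (Suc k) (\<lambda>i j. s (k - i + j))"
  proof (rule detn_eqI)
    fix i j assume "i < Suc k"
    then have "(\<Sum>l<Suc k. ?J i l * s (l + j)) = (\<Sum>l<Suc k. if l = k - i then s (l + j) else 0)"
      by (intro sum.cong) auto
    then show "(\<Sum>l<Suc k. ?J i l * s (l + j)) = s (k - i + j)" by simp
  qed
  finally have "p dvd detn (Suc k) (\<lambda>i j. s (k - i + j))" using dvd by (metis dvd_mult)
  moreover have "[detn (Suc k) (\<lambda>i j. s (k - i + j)) = detn (Suc k) ?T] (mod p)"
  proof (rule detn_cong)
    fix i j assume "i < Suc k" "j < Suc k"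
    then show "[s (k - i + j) = ?T i j] (mod p)"
    proof (cases "i \<le> j")
      case False
      then have "k - i + j \<le> k" "k - i + j \<noteq> k" using \<open>i < Suc k\<close> by auto
      then show ?thesis using s[of "k - i + j"] False by simp
    qed simp
  qed
  moreover have "detn (Suc k) ?T = (\<Prod>i<Suc k. s k)"
    by (subst detn_upper_triangular) (auto intro!: prod.cong)
  moreover have "[(\<Prod>i<Suc k. s k) = (\<Prod>i<Suc k. 1)] (mod p)"
    by (rule cong_prod) (use s[of k] in simp)
  ultimately have "p dvd 1" by (metis cong_dvd_iff prod.neutral_const)
  then show False using prime_gt_1_int[OF p] by simp
qed

section \<open>Polynomial functions and the Schwartz-Zippel bound\<close>

text \<open>Polynomial functions on integer points; the index is an upper bound for the total
  degree. The slack \<open>m\<close> in the product rule lets degree estimates be rounded up on the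
  fly.\<close>

inductive pf :: "nat \<Rightarrow> ((nat \<Rightarrow> int) \<Rightarrow> int) \<Rightarrow> bool" where
  pf_const: "pf d (\<lambda>_. c)"
| pf_var: "1 \<le> d \<Longrightarrow> pf d (\<lambda>x. x i)"
| pf_add: "pf d f \<Longrightarrow> pf d g \<Longrightarrow> pf d (\<lambda>x. f x + g x)"
| pf_mult_le: "pf d f \<Longrightarrow> pf e g \<Longrightarrow> d + e \<le> m \<Longrightarrow> pf m (\<lambda>x. f x * g x)"

lemma pf_mult: "pf d f \<Longrightarrow> pf e g \<Longrightarrow> pf (d + e) (\<lambda>x. f x * g x)"
  by (rule pf_mult_le) auto

lemma pf_sum: "(\<And>i. i \<in> I \<Longrightarrow> pf d (f i)) \<Longrightarrow> pf d (\<lambda>x. \<Sum>i\<in>I. f i x)"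
  by (induction I rule: infinite_finite_induct) (auto intro: pf_const pf_add)

lemma pf_prod: "(\<And>i. i \<in> I \<Longrightarrow> pf (d i) (f i)) \<Longrightarrow> pf (\<Sum>i\<in>I. d i) (\<lambda>x. \<Prod>i\<in>I. f i x)"
  by (induction I rule: infinite_finite_induct) (auto intro: pf_const pf_mult)

lemma pf_detn:
  assumes "\<And>i j. i < n \<Longrightarrow> j < n \<Longrightarrow> pf (d i) (\<lambda>x. A x i j)"
  shows "pf (\<Sum>i<n. d i) (\<lambda>x. detn n (A x))"
  unfolding detn_Leibniz atLeast0LessThan
proof (rule pf_sum)
  fix \<pi> assume "\<pi> \<in> {\<pi>. \<pi> permutes {..<n}}"
  then have "pf (\<Sum>i<n. d i) (\<lambda>x. \<Prod>i<n. A x i (\<pi> i))"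
    using permutes_in_image[of \<pi> "{..<n}"] assms by (intro pf_prod) auto
  then show "pf (\<Sum>i<n. d i) (\<lambda>x. signof \<pi> * (\<Prod>i<n. A x i (\<pi> i)))"
    by (intro pf_mult_le[OF pf_const[of 0]]) auto
qed

text \<open>This is the one-variable view that the induction in \<open>schwartz_zippel\<close>
  consumes. For a product the coefficients convolve over pairs with a fixed exponent sum, and their
  degree bounds add up accordingly.\<close>

lemma pf_decompose:
  assumes "pf d f"
  shows "\<exists>g. (\<forall>j\<le>d. pf (d - j) (g j) \<and> (\<forall>x t. g j (x(i := t)) = g j x)) \<and>
           (\<forall>x. f x = (\<Sum>j\<le>d. x i ^ j * g j x))"
  using assms
proof induction
  case (pf_const d c)
  show ?case
    by (rule exI[of _ "\<lambda>j _. if j = 0 then c else 0"])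
       (auto intro: pf.pf_const simp: if_distrib cong: if_cong)
next
  case (pf_var d k)
  show ?case
  proof (cases "k = i")
    case True
    have "x i = (\<Sum>j\<le>d. x i ^ j * (if j = 1 then 1 else 0))" for x :: "nat \<Rightarrow> int"
      using pf_var by (simp add: if_distrib cong: if_cong)
    with True show ?thesis
      by (intro exI[of _ "\<lambda>j _. if j = 1 then 1 else 0"]) (auto intro: pf.pf_const)
  next
    case False
    have "x k = (\<Sum>j\<le>d. x i ^ j * (if j = 0 then x k else 0))" for x :: "nat \<Rightarrow> int"
      by (simp add: if_distrib cong: if_cong)
    moreover have "pf (d - j) (\<lambda>x. if j = 0 then x k else 0)" for j
      using pf_var by (cases "j = 0") (auto intro: pf.pf_const pf.pf_var)
    ultimately show ?thesis using False
      by (intro exI[of _ "\<lambda>j x. if j = 0 then x k else 0"]) (auto intro: pf.pf_const pf.pf_var split: if_splits)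
  qed
next
  case (pf_add d f g)
  then obtain F G where F: "\<forall>j\<le>d. pf (d - j) (F j) \<and> (\<forall>x t. F j (x(i := t)) = F j x)"
      "\<forall>x. f x = (\<Sum>j\<le>d. x i ^ j * F j x)"
    and G: "\<forall>j\<le>d. pf (d - j) (G j) \<and> (\<forall>x t. G j (x(i := t)) = G j x)"
      "\<forall>x. g x = (\<Sum>j\<le>d. x i ^ j * G j x)" by blast
  show ?case
  proof (intro exI[of _ "\<lambda>j x. F j x + G j x"] conjI allI impI)
    show "f x + g x = (\<Sum>j\<le>d. x i ^ j * (F j x + G j x))" for x
      using F(2) G(2) by (simp add: distrib_left sum.distrib)
  qed (use F(1) G(1) in \<open>simp_all add: pf.pf_add del: fun_upd_apply\<close>)
next
  case (pf_mult_le d f e g m)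
  then obtain F G where F: "\<forall>j\<le>d. pf (d - j) (F j) \<and> (\<forall>x t. F j (x(i := t)) = F j x)"
      "\<forall>x. f x = (\<Sum>j\<le>d. x i ^ j * F j x)"
    and G: "\<forall>j\<le>e. pf (e - j) (G j) \<and> (\<forall>x t. G j (x(i := t)) = G j x)"
      "\<forall>x. g x = (\<Sum>j\<le>e. x i ^ j * G j x)" by blast
  let ?P = "\<lambda>l. {q \<in> {..d} \<times> {..e}. fst q + snd q = l}"
  show ?case
  proof (intro exI[of _ "\<lambda>l x. \<Sum>q\<in>?P l. F (fst q) x * G (snd q) x"] conjI allI impI)
    fix l assume "l \<le> m"
    show "pf (m - l) (\<lambda>x. \<Sum>q\<in>?P l. F (fst q) x * G (snd q) x)"
    proof (rule pf_sum)
      fix q assume q: "q \<in> ?P l"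
      show "pf (m - l) (\<lambda>x. F (fst q) x * G (snd q) x)"
        by (rule pf.pf_mult_le[of "d - fst q" _ "e - snd q"])
           (use q F(1) G(1) pf_mult_le.hyps in \<open>auto simp: mem_Times_iff\<close>)
    qed
    show "(\<Sum>q\<in>?P l. F (fst q) (x(i := t)) * G (snd q) (x(i := t))) = (\<Sum>q\<in>?P l. F (fst q) x * G (snd q) x)"
      for x t
      by (rule sum.cong) (use F(1) G(1) in \<open>auto simp del: fun_upd_apply\<close>)
  next
    fix x
    have "f x * g x = (\<Sum>q\<in>{..d} \<times> {..e}. x i ^ (fst q + snd q) * (F (fst q) x * G (snd q) x))"
      unfolding F(2)[rule_format] G(2)[rule_format] sum_product sum.cartesian_product
      by (simp add: case_prod_unfold power_add mult_ac)
    also have "\<dots> = (\<Sum>l\<le>m. \<Sum>q\<in>?P l. x i ^ (fst q + snd q) * (F (fst q) x * G (snd q) x))"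
      by (rule sum.group[symmetric]) (use pf_mult_le.hyps in auto)
    also have "\<dots> = (\<Sum>l\<le>m. x i ^ l * (\<Sum>q\<in>?P l. F (fst q) x * G (snd q) x))"
      by (simp add: sum_distrib_left)
    finally show "f x * g x = (\<Sum>l\<le>m. x i ^ l * (\<Sum>q\<in>?P l. F (fst q) x * G (snd q) x))" .
  qed
qed

text \<open>Division by the monic \<open>X - a\<close> is possible over the integers, keeps the
  leading coefficient and leaves the remainder \<open>poly P a\<close>, which \<open>p\<close>
  divides. Any root modulo \<open>p\<close> other than \<open>a\<close> is therefore a root of the
  quotient; distinct elements of \<open>S\<close> are incongruent because \<open>S\<close> lies in
  one residue system.\<close>

lemma poly_roots_mod_prime:
  fixes p :: int and P :: "int poly"
  assumes p: "prime p" and "degree P \<le> J" "\<not> p dvd coeff P J" and S: "S \<subseteq> {0..<p}"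
  shows "card {t \<in> S. p dvd poly P t} \<le> J"
  using assms(2,3)
proof (induction J arbitrary: P)
  case 0
  then have "{t \<in> S. p dvd poly P t} = {}"
    by (auto elim!: degree_eq_zeroE)
  then show ?case by (metis card.empty le0)
next
  case (Suc J)
  have fin: "finite {t \<in> S. p dvd poly P t}" using S finite_subset by fastforce
  show ?case
  proof (cases "{t \<in> S. p dvd poly P t} = {}")
    case True
    then show ?thesis by (metis card.empty le0)
  next
    case False
    then obtain a where a: "a \<in> S" "p dvd poly P a" by blast
    define Q where "Q = synthetic_div P a"
    have P: "P = [:- a, 1:] * Q + [:poly P a:]"
      unfolding Q_def by (rule synthetic_div_correct'[symmetric])
    have dQ: "degree Q \<le> J" using Suc.prems(1) by (simp add: Q_def degree_synthetic_div)
    have "coeff P (Suc J) = coeff Q J - a * coeff Q (Suc J)"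
      by (subst P) simp
    then have "\<not> p dvd coeff Q J" using Suc.prems(2) dQ by (simp add: coeff_eq_0)
    then have IH: "card {t \<in> S. p dvd poly Q t} \<le> J" using Suc.IH dQ by blast
    have "t = a" if t: "t \<in> S" "p dvd poly P t" "\<not> p dvd poly Q t" for t
    proof -
      have "poly P t = (t - a) * poly Q t + poly P a"
        by (subst P) (simp add: algebra_simps)
      then have "p dvd (t - a) * poly Q t" using t(2) a(2) by (metis dvd_add_left_iff)
      then have "p dvd t - a" using t(3) p by (simp add: prime_dvd_mult_iff)
      moreover have "0 \<le> t" "t < p" "0 \<le> a" "a < p" using t(1) a(1) S by auto
      ultimately show "t = a" by (metis mod_eq_dvd_iff mod_pos_pos_trivial)
    qed
    then have "{t \<in> S. p dvd poly P t} \<subseteq> insert a {t \<in> S. p dvd poly Q t}" by blast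
    then have "card {t \<in> S. p dvd poly P t} \<le> card (insert a {t \<in> S. p dvd poly Q t})"
      using S finite_subset[OF S] by (intro card_mono) auto
    also have "\<dots> \<le> Suc J" using IH finite_subset[OF S] by (simp add: card_insert_if)
    finally show ?thesis .
  qed
qed

text \<open>Coefficients above \<open>J\<close> vanish modulo \<open>p\<close>, so the polynomial
  may be cut at \<open>J\<close> before its roots are counted.\<close>

lemma roots_mod_prime:
  fixes p :: int
  assumes p: "prime p" and J: "J \<le> d" "\<not> p dvd c J" and "\<And>j. J < j \<Longrightarrow> j \<le> d \<Longrightarrow> p dvd c j"
    and S: "S \<subseteq> {0..<p}"
  shows "card {t \<in> S. p dvd (\<Sum>j\<le>d. t ^ j * c j)} \<le> J"
proof -
  define P where "P = (\<Sum>j\<le>J. monom (c j) j)"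
  have coeff: "coeff P k = (if k \<le> J then c k else 0)" for k
    by (simp add: P_def coeff_sum if_distrib cong: if_cong)
  have "p dvd (\<Sum>j\<le>d. t ^ j * c j) \<longleftrightarrow> p dvd poly P t" for t
  proof -
    have "(\<Sum>j\<le>d. t ^ j * c j) = (\<Sum>j\<le>J. t ^ j * c j) + (\<Sum>j\<in>{..d}-{..J}. t ^ j * c j)"
      using J(1) by (subst sum.subset_diff[of "{..J}"]) auto
    moreover have "p dvd (\<Sum>j\<in>{..d}-{..J}. t ^ j * c j)"
      using assms(4) by (intro dvd_sum dvd_mult) auto
    moreover have "poly P t = (\<Sum>j\<le>J. t ^ j * c j)"
      by (simp add: P_def poly_sum poly_monom mult.commute)
    ultimately show ?thesis by (metis dvd_add_left_iff)
  qed
  moreover have "degree P \<le> J" by (rule degree_le) (simp add: coeff)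
  ultimately show ?thesis using poly_roots_mod_prime[OF p, of P J S] J S by (simp add: coeff)
qed

text \<open>Expectation when the listed coordinates are drawn independently and uniformly from \<open>S\<close>.\<close>

primrec average :: "int set \<Rightarrow> nat list \<Rightarrow> ((nat \<Rightarrow> int) \<Rightarrow> real) \<Rightarrow> (nat \<Rightarrow> int) \<Rightarrow> real" where
  "average S [] F x = F x"
| "average S (i # is) F x = (\<Sum>t\<in>S. average S is F (x(i := t))) / card S"

lemma average_append: "average S (is @ js) F x = average S is (average S js F) x"
  by (induction "is" arbitrary: x) simp_all

lemma average_mono:
  assumes "\<And>y. (\<And>k. k \<notin> set is \<Longrightarrow> y k = x k) \<Longrightarrow> F y \<le> G y"
  shows "average S is F x \<le> average S is G x"
  using assms
proof (induction "is" arbitrary: x)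
  case (Cons i "is")
  have "average S is F (x(i := t)) \<le> average S is G (x(i := t))" for t
    by (rule Cons.IH, rule Cons.prems) auto
  then show ?case by (simp add: sum_mono divide_right_mono)
qed simp

lemma average_cong:
  assumes "\<And>y. (\<And>k. k \<notin> set is \<Longrightarrow> y k = x k) \<Longrightarrow> F y = G y"
  shows "average S is F x = average S is G x"
  by (intro antisym average_mono) (simp_all add: assms)

lemma average_const:
  assumes "finite S" "S \<noteq> {}"
  shows "average S is (\<lambda>_. c) x = c"
  using assms by (induction "is" arbitrary: x) simp_all

lemma average_add: "average S is (\<lambda>x. F x + G x) x = average S is F x + average S is G x"
  by (induction "is" arbitrary: x) (simp_all add: sum.distrib add_divide_distrib)

lemma average_sum:
  assumes "finite S" "S \<noteq> {}" "finite K"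
  shows "average S is (\<lambda>x. \<Sum>k\<in>K. F k x) x = (\<Sum>k\<in>K. average S is (F k) x)"
  using assms(3) by induction (simp_all add: average_add average_const assms)

lemma average_cmult: "average S is (\<lambda>x. c * F x) x = c * average S is F x"
  by (induction "is" arbitrary: x) (simp_all add: sum_distrib_left)

lemma average_shift:
  "average S (map ((+) c) is) (\<lambda>x. F (\<lambda>i. x (c + i))) x = average S is F (\<lambda>i. x (c + i))"
proof (induction "is" arbitrary: x)
  case (Cons i "is")
  have "(\<lambda>k. (x(c + i := t)) (c + k)) = (\<lambda>k. x (c + k))(i := t)" for t
    by auto
  then show ?case by (simp add: Cons)
qed simp

text \<open>Nonvanishing is witnessed by a point \<open>z\<close> instead of a nonzero polynomial,
  so the bound applies with all other coordinates frozen at \<open>x\<close>. The last coordinate is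
  averaged innermost, and \<open>J\<close> is the highest power of it whose coefficient is not zero
  throughout the slice. Either that coefficient vanishes, with probability at most
  \<open>(d - J) / card S\<close>, or a polynomial of degree \<open>J\<close> in one variable does,
  with probability at most \<open>J / card S\<close>.\<close>

theorem schwartz_zippel:
  fixes p :: int
  assumes p: "prime p" and S: "finite S" "S \<noteq> {}" "S \<subseteq> {0..<p}"
    and "pf d f" "\<not> p dvd f z" "\<And>k. k \<notin> set is \<Longrightarrow> z k = x k"
  shows "average S is (\<lambda>x. of_bool (p dvd f x)) x \<le> d / card S"
  using assms(5-7)
proof (induction "is" arbitrary: f d x z rule: rev_induct)
  case Nil
  then have "z = x" by auto
  then show ?case using Nil by simp
next
  case (snoc i "is")
  obtain g where g: "\<And>j. j \<le> d \<Longrightarrow> pf (d - j) (g j)" "\<And>j x t. j \<le> d \<Longrightarrow> g j (x(i := t)) = g j x"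
    and f: "\<And>x. f x = (\<Sum>j\<le>d. x i ^ j * g j x)"
    using pf_decompose[OF snoc.prems(1), of i] by blast
  \<comment> \<open>Only points that agree with \<open>x\<close> outside the averaged coordinates
    occur in the average; the maximality of \<open>J\<close> is meant relative to them.\<close>
  define agr where "agr y \<longleftrightarrow> (\<forall>k. k \<notin> set (is @ [i]) \<longrightarrow> y k = x k)" for y
  define Js where "Js = {j. j \<le> d \<and> (\<exists>y. agr y \<and> \<not> p dvd g j y)}"
  have "\<exists>j\<le>d. \<not> p dvd g j z"
    using snoc.prems(2) unfolding f by (metis (no_types, lifting) atMost_iff dvd_mult dvd_sum)
  then have "Js \<noteq> {}" using snoc.prems(3) by (auto simp: Js_def agr_def)
  moreover have fin: "finite Js" by (auto simp: Js_def)
  ultimately have J: "Max Js \<in> Js" by simp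
  define J where "J = Max Js"
  obtain y where y: "J \<le> d" "agr y" "\<not> p dvd g J y" using J by (auto simp: Js_def J_def)
  have gt: "p dvd g j y'" if "J < j" "j \<le> d" "agr y'" for j y'
  proof (rule ccontr)
    assume "\<not> p dvd g j y'"
    then have "j \<in> Js" using that by (auto simp: Js_def)
    then show False using that(1) Max_ge[OF fin] by (fastforce simp: J_def)
  qed
  \<comment> \<open>The witness \<open>y\<close> may differ from \<open>x\<close> at coordinate
    \<open>i\<close>. As \<open>g J\<close> ignores that coordinate, resetting it gives a witness
    for the shorter list.\<close>
  have IH: "average S is (\<lambda>x. of_bool (p dvd g J x)) x \<le> real (d - J) / card S"
    using y by (intro snoc.IH[of _ _ "y(i := x i)"]) (auto simp: agr_def g simp del: fun_upd_apply, auto)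
  have "average S (is @ [i]) (\<lambda>x. of_bool (p dvd f x)) x
      = average S is (average S [i] (\<lambda>x. of_bool (p dvd f x))) x"
    by (rule average_append)
  also have "\<dots> \<le> average S is (\<lambda>x. of_bool (p dvd g J x) + J / card S) x"
  proof (rule average_mono)
    fix y assume y': "\<And>k. k \<notin> set is \<Longrightarrow> y k = x k"
    show "average S [i] (\<lambda>x. of_bool (p dvd f x)) y \<le> of_bool (p dvd g J y) + J / card S"
    proof (cases "p dvd g J y")
      case True
      have "average S [i] (\<lambda>x. of_bool (p dvd f x)) y \<le> average S [i] (\<lambda>_. 1) y"
        by (rule average_mono) auto
      also have "\<dots> = 1" using S by (intro average_const)
      finally show ?thesis using True by (simp add: add_increasing2)
    next
      case False
      have "average S [i] (\<lambda>x. of_bool (p dvd f x)) y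
          = real (card {t \<in> S. p dvd (\<Sum>j\<le>d. t ^ j * g j y)}) / card S"
        using S(1) by (simp add: f g(2) sum.If_cases of_bool_def Int_def)
      also have "\<dots> \<le> real J / card S"
      proof (rule divide_right_mono)
        have "card {t \<in> S. p dvd (\<Sum>j\<le>d. t ^ j * g j y)} \<le> J"
          by (rule roots_mod_prime[where c = "\<lambda>j. g j y", OF p y(1) False _ S(3)])
             (use gt y' in \<open>auto simp: agr_def\<close>)
        then show "real (card {t \<in> S. p dvd (\<Sum>j\<le>d. t ^ j * g j y)}) \<le> real J" by simp
      qed simp
      finally show ?thesis using False by simp
    qed
  qed
  also have "\<dots> = average S is (\<lambda>x. of_bool (p dvd g J x)) x + J / card S"
    using S by (simp add: average_add average_const)
  also have "\<dots> \<le> (real (d - J) + real J) / card S"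
    using IH by (simp add: add_divide_distrib)
  also have "\<dots> = d / card S" using y(1) by simp
  finally show ?case .
qed

text \<open>Union bound over the full residue system: the expected number of vanishing
  \<open>f k\<close> is below one. It merges the separate witnesses \<open>z k\<close> into one
  point.\<close>

lemma common_nonroot:
  fixes p :: int
  assumes p: "prime p" and K: "finite K" and pf: "\<And>k. k \<in> K \<Longrightarrow> pf (d k) (f k)"
    and z: "\<And>k. k \<in> K \<Longrightarrow> \<not> p dvd f k (z k)" "\<And>k i. k \<in> K \<Longrightarrow> i \<notin> set is \<Longrightarrow> z k i = x i"
    and d: "int (\<Sum>k\<in>K. d k) < p"
  shows "\<exists>y. (\<forall>k\<in>K. \<not> p dvd f k y) \<and> (\<forall>i. i \<notin> set is \<longrightarrow> y i = x i)"
proof (rule ccontr)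
  assume no: "\<not> ?thesis"
  let ?S = "{0..<p}"
  have S: "finite ?S" "?S \<noteq> {}" "?S \<subseteq> {0..<p}" using prime_gt_0_int[OF p] by auto
  have "1 = average ?S is (\<lambda>_. 1) x" using S by (simp add: average_const)
  also have "\<dots> \<le> average ?S is (\<lambda>y. \<Sum>k\<in>K. of_bool (p dvd f k y)) x"
  proof (rule average_mono)
    fix y assume "\<And>i. i \<notin> set is \<Longrightarrow> y i = x i"
    then obtain k where k: "k \<in> K" "p dvd f k y" using no by blast
    have "of_bool (p dvd f k y) \<le> (\<Sum>k\<in>K. of_bool (p dvd f k y) :: real)"
      by (rule member_le_sum) (use k K in auto)
    then show "1 \<le> (\<Sum>k\<in>K. of_bool (p dvd f k y) :: real)" using k by simp
  qed
  also have "\<dots> = (\<Sum>k\<in>K. average ?S is (\<lambda>y. of_bool (p dvd f k y)) x)"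
    by (rule average_sum[OF S(1,2) K])
  also have "\<dots> \<le> (\<Sum>k\<in>K. d k / card ?S)"
    by (intro sum_mono schwartz_zippel[OF p S pf z(1)]) (use z(2) in auto)
  also have "\<dots> = real (\<Sum>k\<in>K. d k) / nat p"
    by (simp add: sum_divide_distrib)
  also have "\<dots> < 1" using d prime_gt_0_int[OF p] by (simp add: divide_less_eq) (metis of_int_less_iff of_int_of_nat_eq of_nat_sum)
  finally show False by simp
qed

section \<open>Preconditioning by a diagonal and a rank-one matrix\<close>

text \<open>Replacing a row by a unit row isolates, up to sign, a minor of size
  \<open>k - 1\<close>. So this says that the leading block of size \<open>k\<close> has rank at
  least \<open>k - 1\<close> modulo \<open>p\<close>, in terms that suit row expansion.\<close>

definition corank1 :: "int \<Rightarrow> nat \<Rightarrow> (nat \<Rightarrow> nat \<Rightarrow> int) \<Rightarrow> bool" where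
  "corank1 p k A \<longleftrightarrow> (\<exists>i<k. \<exists>c<k. \<not> p dvd detn k (A(i := unit_row c)))"

lemma row_expand_nonzero:
  assumes "\<not> p dvd detn n M" "i < n"
  shows "\<exists>c<n. \<not> p dvd detn n (M(i := unit_row c))"
proof (rule ccontr)
  assume "\<not> ?thesis"
  then have "p dvd (\<Sum>c<n. M i c * detn n (M(i := unit_row c)))"
    by (intro dvd_sum dvd_mult) auto
  then show False
    using assms detn_row_expand[OF assms(2), of M "M i"] by simp
qed

text \<open>The index \<open>j\<close> is one whose row and column can be deleted while the rest
  keeps corank at most one. It is the column of the given nonzero minor. Expanding another row over
  unit rows then yields \<open>c\<close>, and \<open>c = j\<close> is impossible because two rows
  would coincide.\<close>

lemma corank1_step:
  assumes "corank1 p (Suc k) A" "k \<ge> 1"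
  shows "\<exists>j<Suc k. \<exists>i<Suc k. \<exists>c<Suc k. i \<noteq> j \<and> c \<noteq> j \<and>
           \<not> p dvd detn (Suc k) (A(i := unit_row c, j := unit_row j))"
proof -
  obtain i0 j where i0: "i0 < Suc k" and j: "j < Suc k"
    and nz: "\<not> p dvd detn (Suc k) (A(i0 := unit_row j))"
    using assms(1) unfolding corank1_def by blast
  show ?thesis
  proof (cases "i0 = j")
    case True
    define i where "i = (if j = 0 then 1 else (0::nat))"
    have i: "i < Suc k" "i \<noteq> j" using assms(2) by (auto simp: i_def)
    obtain c where c: "c < Suc k" "\<not> p dvd detn (Suc k) (A(i0 := unit_row j, i := unit_row c))"
      using row_expand_nonzero[OF nz i(1)] by blast
    have "c \<noteq> j"
    proof
      assume "c = j"
      then have "detn (Suc k) (A(i0 := unit_row j, i := unit_row c)) = 0"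
        using i j True by (intro detn_equal_rows[of i _ j]) auto
      then show False using c by simp
    qed
    then show ?thesis using c i j True by (metis fun_upd_twist)
  next
    case False
    obtain c where c: "c < Suc k" "\<not> p dvd detn (Suc k) (A(i0 := unit_row j, j := unit_row c))"
      using row_expand_nonzero[OF nz j] by blast
    have "c \<noteq> j"
    proof
      assume "c = j"
      then have "detn (Suc k) (A(i0 := unit_row j, j := unit_row c)) = 0"
        using i0 j False by (intro detn_equal_rows[of i0 _ j]) auto
      then show False using c by simp
    qed
    moreover have "\<not> p dvd detn (Suc k) (A(i0 := unit_row c, j := unit_row j))"
      using c(2) detn_swap_rows[OF i0 j False, of A "unit_row j" "unit_row c"] by simp
    ultimately show ?thesis using c i0 j False by blast
  qed
qed

lemma unit_row_permute: "inj \<pi> \<Longrightarrow> unit_row (\<pi> c) (\<pi> b) = unit_row c b"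
  by (auto simp: unit_row_def inj_def)

lemma fun_upd_permute:
  assumes "inj \<pi>"
  shows "(\<lambda>a b. (A(\<pi> i := unit_row (\<pi> c))) (\<pi> a) (\<pi> b)) = (\<lambda>a b. A (\<pi> a) (\<pi> b))(i := unit_row c)"
  using assms unit_row_permute[OF assms] by (auto simp: fun_eq_iff inj_def)

lemma corank1_permute:
  assumes \<pi>: "\<pi> permutes {0..<n}" and "corank1 p n A"
  shows "corank1 p n (\<lambda>a b. A (\<pi> a) (\<pi> b))"
proof -
  obtain i c where ic: "i < n" "c < n" "\<not> p dvd detn n (A(i := unit_row c))"
    using assms(2) unfolding corank1_def by blast
  have inv_lt: "inv_into UNIV \<pi> x < n" if "x < n" for x
    using permutes_in_image[OF permutes_inv[OF \<pi>], of x] that by auto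
  have eq: "\<pi> (inv_into UNIV \<pi> x) = x" for x using permutes_inverses[OF \<pi>] by simp
  have "detn n (A(i := unit_row c)) = detn n (\<lambda>a b. (A(\<pi> (inv_into UNIV \<pi> i) := unit_row (\<pi> (inv_into UNIV \<pi> c)))) (\<pi> a) (\<pi> b))"
    unfolding eq by (rule detn_permute[OF \<pi>, symmetric])
  also have "\<dots> = detn n ((\<lambda>a b. A (\<pi> a) (\<pi> b))(inv_into UNIV \<pi> i := unit_row (inv_into UNIV \<pi> c)))"
    by (simp only: fun_upd_permute[OF permutes_inj[OF \<pi>]])
  finally show ?thesis unfolding corank1_def using ic inv_lt by metis
qed

text \<open>Rows and columns are permuted together, a similarity that only renames coordinates of
  Krylov vectors and can be undone later. A transposition moves the index from
  \<open>corank1_step\<close> to the end; the smaller block is handled by induction.\<close>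

lemma corank1_chain:
  assumes "corank1 p n A" "n \<ge> 1"
  shows "\<exists>\<pi>. \<pi> permutes {0..<n} \<and> (\<forall>k. 1 \<le> k \<and> k \<le> n \<longrightarrow> corank1 p k (\<lambda>a b. A (\<pi> a) (\<pi> b)))"
  using assms(2,1)
proof (induction n arbitrary: A rule: nat_induct_at_least)
  case base
  have "k = 1" if "1 \<le> k \<and> k \<le> (1::nat)" for k using that by simp
  then show ?case using base by (intro exI[of _ id]) (auto simp: permutes_id)
next
  case (Suc k)
  obtain j i c where jic: "j < Suc k" "i < Suc k" "c < Suc k" "i \<noteq> j" "c \<noteq> j"
    and nz: "\<not> p dvd detn (Suc k) (A(i := unit_row c, j := unit_row j))"
    using corank1_step[OF Suc.prems Suc.hyps] by blast
  define \<tau> where "\<tau> = Transposition.transpose j k"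
  have \<tau>: "\<tau> permutes {0..<Suc k}" unfolding \<tau>_def using jic by (intro permutes_swap_id) auto
  have \<tau>\<tau>: "\<tau> (\<tau> x) = x" for x by (simp add: \<tau>_def)
  have inj: "inj \<tau>" by (rule permutes_inj[OF \<tau>])
  let ?A = "\<lambda>a b. A (\<tau> a) (\<tau> b)"
  have lt: "\<tau> i < k" "\<tau> c < k"
    using jic by (auto simp: \<tau>_def Transposition.transpose_def)
  have "detn (Suc k) (A(i := unit_row c, j := unit_row j))
      = detn (Suc k) (\<lambda>a b. (A(i := unit_row c, j := unit_row j)) (\<tau> a) (\<tau> b))"
    by (rule detn_permute[OF \<tau>, symmetric])
  also have "(\<lambda>a b. (A(i := unit_row c, j := unit_row j)) (\<tau> a) (\<tau> b))
      = ?A(\<tau> i := unit_row (\<tau> c), k := unit_row k)"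
  proof -
    have "j = \<tau> k" by (simp add: \<tau>_def)
    then have "(\<lambda>a b. (A(i := unit_row c, j := unit_row j)) (\<tau> a) (\<tau> b))
        = (\<lambda>a b. (A(\<tau> (\<tau> i) := unit_row (\<tau> (\<tau> c)), \<tau> k := unit_row (\<tau> k))) (\<tau> a) (\<tau> b))"
      by (simp only: \<tau>\<tau>)
    also have "\<dots> = ?A(\<tau> i := unit_row (\<tau> c), k := unit_row k)"
      by (simp only: fun_upd_permute[OF inj])
    finally show ?thesis .
  qed
  also have "detn (Suc k) (?A(\<tau> i := unit_row (\<tau> c), k := unit_row k)) = detn k (?A(\<tau> i := unit_row (\<tau> c)))"
    by (rule detn_last_unit_row)
  finally have "corank1 p k ?A" using nz lt unfolding corank1_def by metis
  then obtain \<rho> where \<rho>: "\<rho> permutes {0..<k}"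
    and cor: "\<And>l. 1 \<le> l \<and> l \<le> k \<Longrightarrow> corank1 p l (\<lambda>a b. A (\<tau> (\<rho> a)) (\<tau> (\<rho> b)))"
    using Suc.IH by blast
  have \<pi>: "\<tau> \<circ> \<rho> permutes {0..<Suc k}"
    using \<tau> permutes_subset[OF \<rho>, of "{0..<Suc k}"] by (intro permutes_compose) auto
  show ?case
  proof (intro exI[of _ "\<tau> \<circ> \<rho>"] conjI allI impI \<pi>)
    fix l assume l: "1 \<le> l \<and> l \<le> Suc k"
    show "corank1 p l (\<lambda>a b. A ((\<tau> \<circ> \<rho>) a) ((\<tau> \<circ> \<rho>) b))"
    proof (cases "l = Suc k")
      case True
      then show ?thesis using corank1_permute[OF \<pi> Suc.prems] by simp
    next
      case False
      then show ?thesis using cor[of l] l by simp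
    qed
  qed
qed

text \<open>Along \<open>t\<close> times the elementary matrix at \<open>(i, c)\<close> the
  determinant is affine in \<open>t\<close>, with the nonzero minor as slope; hence
  \<open>t = 0\<close> or \<open>t = 1\<close> avoids zero.\<close>

lemma corank1_rank_one:
  assumes "corank1 p k A"
  shows "\<exists>a y. \<not> p dvd detn k (\<lambda>i j. A i j + a i * y j)"
proof -
  obtain i c where i: "i < k" and nz: "\<not> p dvd detn k (A(i := unit_row c))"
    using assms unfolding corank1_def by blast
  have eq: "detn k (\<lambda>l j. A l j + (t * unit_row i l) * unit_row c j)
      = detn k A + t * detn k (A(i := unit_row c))" for t
  proof -
    have "detn k (\<lambda>l j. A l j + (t * unit_row i l) * unit_row c j)
        = detn k (A(i := \<lambda>j. A i j + t * unit_row c j))"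
      by (rule detn_eqI) (auto simp: unit_row_def)
    also have "\<dots> = detn k (A(i := A i)) + t * detn k (A(i := unit_row c))"
      by (rule detn_row_add[OF i])
    finally show ?thesis by simp
  qed
  have "\<exists>t. \<not> p dvd detn k A + t * detn k (A(i := unit_row c))"
  proof (cases "p dvd detn k A")
    case True
    then show ?thesis using nz by (intro exI[of _ 1]) (simp add: dvd_add_right_iff)
  next
    case False
    then show ?thesis by (intro exI[of _ 0]) simp
  qed
  then obtain t where "\<not> p dvd detn k A + t * detn k (A(i := unit_row c))" ..
  then show ?thesis unfolding eq[symmetric]
    by (intro exI[of _ "\<lambda>l. t * unit_row i l"] exI[of _ "unit_row c"])
qed

lemma kry_cong:
  assumes "\<And>i j. i < n \<Longrightarrow> j < n \<Longrightarrow> [B i j = B' i j] (mod p)" "\<And>i. i < n \<Longrightarrow> [v i = v' i] (mod p)" "i < n"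
  shows "[kry n B v m i = kry n B' v' m i] (mod p)"
  using assms(3)
proof (induction m arbitrary: i)
  case (Suc m)
  then show ?case unfolding kry_Suc mv_def by (intro cong_sum cong_mult) (auto simp: assms)
qed (simp add: assms)

lemma pf_kry:
  assumes "\<And>i j. i < n \<Longrightarrow> j < n \<Longrightarrow> pf b (\<lambda>x. B x i j)" "\<And>i. i < n \<Longrightarrow> pf c (\<lambda>x. v x i)" "i < n"
  shows "pf (b * m + c) (\<lambda>x. kry n (B x) (v x) m i)"
  using assms(3)
proof (induction m arbitrary: i)
  case (Suc m)
  show ?case unfolding kry_Suc mv_def
  proof (rule pf_sum)
    fix j assume "j \<in> {..<n}"
    then show "pf (b * Suc m + c) (\<lambda>x. B x i j * kry n (B x) (v x) m j)"
      using Suc assms(1) by (intro pf_mult_le[of b _ "b * m + c"]) auto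
  qed
qed (simp add: assms)

lemma sum_lessThan_mult_le: "(\<Sum>m<n. b * m + c) \<le> b * n * n + c * (n::nat)"
proof -
  have "(\<Sum>m<n. b * m + c) \<le> (\<Sum>m<n. b * n + c)"
    by (intro sum_mono add_mono mult_mono) auto
  then show ?thesis by (simp add: algebra_simps)
qed

lemma pf_detn_kry:
  assumes "\<And>i j. i < n \<Longrightarrow> j < n \<Longrightarrow> pf b (\<lambda>x. B x i j)" "\<And>i. i < n \<Longrightarrow> pf c (\<lambda>x. v x i)"
  shows "pf (\<Sum>m<n. b * m + c) (\<lambda>x. detn n (kry n (B x) (v x)))"
  by (rule pf_detn) (rule pf_kry[OF assms], auto)

lemma prime_dvd_signof_mult: "p dvd signof \<pi> * (x::int) \<longleftrightarrow> p dvd x"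
  by (simp add: sign_def)

text \<open>The cyclic shift that moves the initial Krylov vector behind the others, where it forms
  the border of the matrix.\<close>

definition cyc :: "nat \<Rightarrow> nat \<Rightarrow> nat" where
  "cyc n m = (if m < n then Suc m else if m = n then 0 else m)"

lemma cyc_permutes: "cyc n permutes {0..<Suc n}"
proof (rule bij_imp_permutes)
  show "bij_betw (cyc n) {0..<Suc n} {0..<Suc n}"
    by (rule bij_betw_byWitness[where f' = "\<lambda>m. if m = 0 then n else m - 1"])
       (auto simp: cyc_def split: if_splits)
qed (auto simp: cyc_def)

text \<open>Setting the last diagonal entry to zero reduces the Krylov determinant to the leading
  block, because one application of the matrix then kills the last coordinate.\<close>

lemma krylov_determinant_border:
  assumes p: "prime p"
    and minor: "\<not> p dvd detn n (\<lambda>i j. d i * F i j)"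
    and w: "\<not> p dvd detn n (kry n (\<lambda>i j. d i * F i j) w)"
  shows "\<exists>v. \<not> p dvd detn (Suc n) (kry (Suc n) (\<lambda>i j. (d(n := 0)) i * F i j) v)"
proof -
  let ?B = "\<lambda>i j. d i * F i j" and ?C = "\<lambda>i j. (d(n := 0)) i * F i j"
  \<comment> \<open>The vector is built so that one application of the bordered matrix gives
    \<open>w\<close> in the first \<open>n\<close> coordinates. Its last entry will be 1, so column
    \<open>n\<close> contributes \<open>d i * F i n\<close>, which is subtracted from the target
    beforehand.\<close>
  obtain v' where v': "\<forall>i<n. [(\<Sum>j<n. ?B i j * v' j) = w i - d i * F i n] (mod p)"
    using detn_solvable[OF p minor, of "\<lambda>i. w i - d i * F i n"] by blast
  define v where "v = v'(n := 1)"
  have kry: "kry (Suc n) ?C v (Suc m) n = 0 \<and> (\<forall>i<n. [kry (Suc n) ?C v (Suc m) i = kry n ?B w m i] (mod p))" for m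
  proof (induction m)
    case 0
    have "[kry (Suc n) ?C v (Suc 0) i = w i] (mod p)" if "i < n" for i
    proof -
      have "kry (Suc n) ?C v (Suc 0) i = (\<Sum>j<n. ?B i j * v' j) + d i * F i n"
        using that by (simp add: kry_Suc mv_def v_def)
      also have "[\<dots> = (w i - d i * F i n) + d i * F i n] (mod p)"
        using v' that by (intro cong_add) auto
      finally show ?thesis by simp
    qed
    then show ?case by (simp add: kry_Suc mv_def)
  next
    case (Suc m)
    have "[kry (Suc n) ?C v (Suc (Suc m)) i = kry n ?B w (Suc m) i] (mod p)" if "i < n" for i
    proof -
      have 1: "kry (Suc n) ?C v (Suc (Suc m)) i = (\<Sum>j<n. ?B i j * kry (Suc n) ?C v (Suc m) j)"
        using that Suc unfolding kry_Suc[of _ _ _ "Suc m"] by (simp add: mv_def)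
      have 2: "kry n ?B w (Suc m) i = (\<Sum>j<n. ?B i j * kry n ?B w m j)"
        unfolding kry_Suc by (rule mv_def)
      show ?thesis unfolding 1 2
        using Suc by (intro cong_sum cong_scalar_left) auto
    qed
    moreover have "kry (Suc n) ?C v (Suc (Suc m)) n = 0"
      unfolding kry_Suc[of _ _ _ "Suc m"] by (simp add: mv_def)
    ultimately show ?case by simp
  qed
  let ?K = "kry (Suc n) ?C v"
  let ?M = "\<lambda>i j. if i < n then kry n ?B w j i else if j = n then 1 else 0"
  have 1: "detn (Suc n) (\<lambda>i j. ?K (cyc n i) j) = signof (cyc n) * detn (Suc n) ?K"
    by (rule detn_permute_rows[OF cyc_permutes])
  have 2: "detn (Suc n) (\<lambda>i j. ?K (cyc n i) j) = detn (Suc n) (\<lambda>i j. ?K (cyc n j) i)"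
    by (rule detn_transpose[of "Suc n" "\<lambda>i j. ?K (cyc n j) i"])
  \<comment> \<open>All vectors except \<open>v\<close> have last coordinate zero, so after the
    shift the last row is a unit row and only the Krylov matrix of \<open>w\<close> remains.\<close>
  have 3: "[detn (Suc n) (\<lambda>i j. ?K (cyc n j) i)
      = detn (Suc n) ((\<lambda>i j. if j < n then kry n ?B w j i else v i)(n := unit_row n))] (mod p)"
  proof (rule detn_cong)
    fix i j assume "i < Suc n" "j < Suc n"
    then show "[?K (cyc n j) i = ((\<lambda>i j. if j < n then kry n ?B w j i else v i)(n := unit_row n)) i j] (mod p)"
      using kry[of j] by (auto simp: cyc_def unit_row_def v_def less_Suc_eq)
  qed
  have 4: "detn (Suc n) ((\<lambda>i j. if j < n then kry n ?B w j i else v i)(n := unit_row n))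
      = detn n (\<lambda>i j. if j < n then kry n ?B w j i else v i)"
    by (rule detn_last_unit_row)
  have 5: "detn n (\<lambda>i j. if j < n then kry n ?B w j i else v i) = detn n (\<lambda>i j. kry n ?B w j i)"
    by (rule detn_eqI) simp
  have 6: "detn n (\<lambda>i j. kry n ?B w j i) = detn n (kry n ?B w)" by (rule detn_transpose)
  have "\<not> p dvd signof (cyc n) * detn (Suc n) ?K"
    unfolding 1[symmetric] 2 using cong_dvd_iff[OF 3] w unfolding 4 5 6 by blast
  then have "\<not> p dvd detn (Suc n) ?K" by (simp only: prime_dvd_signof_mult not_False_eq_True)
  then show ?thesis by blast
qed

lemma detn_scale_rows: "detn n (\<lambda>i j. d i * F i j) = (\<Prod>i<n. d i) * detn n F"
proof -
  have "detn n (\<lambda>i j. d i * F i j) = detn n (\<lambda>i j. \<Sum>l<n. (d i * unit_row i l) * F l j)"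
  proof (rule detn_eqI)
    fix i j assume "i < n"
    have "(\<Sum>l<n. (d i * unit_row i l) * F l j) = (\<Sum>l<n. if l = i then d i * F l j else 0)"
      by (rule sum.cong) (auto simp: unit_row_def)
    then show "d i * F i j = (\<Sum>l<n. (d i * unit_row i l) * F l j)" using \<open>i < n\<close> by simp
  qed
  also have "\<dots> = detn n (\<lambda>i l. d i * unit_row i l) * detn n F" by (rule detn_mult)
  also have "detn n (\<lambda>i l. d i * unit_row i l) = (\<Prod>i<n. d i)"
    by (subst detn_upper_triangular) (auto simp: unit_row_def)
  finally show ?thesis .
qed

text \<open>The bordering lemma supplies a witness whose newest diagonal entry is 0. That entry is
  then moved to a generic value, since the next bordering step needs the leading block, hence every
  \<open>d i\<close>, to be invertible.\<close>

lemma diagonal_krylov_witness: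
  assumes p: "prime p" and "\<And>k. 1 \<le> k \<Longrightarrow> k \<le> n \<Longrightarrow> \<not> p dvd detn k F" "int (n * n + 1) < p"
  shows "\<exists>d v. (\<forall>i<n. \<not> p dvd d i) \<and> \<not> p dvd detn n (kry n (\<lambda>i j. d i * F i j) v)"
  using assms(2,3)
proof (induction n)
  case 0
  then show ?case using prime_gt_1_int[OF p] by simp
next
  case (Suc n)
  have "n * n + 1 \<le> Suc n * Suc n + 1" by simp
  then have "int (n * n + 1) < p" using Suc.prems(2) by linarith
  moreover have "\<And>k. 1 \<le> k \<Longrightarrow> k \<le> n \<Longrightarrow> \<not> p dvd detn k F" using Suc.prems(1) by simp
  ultimately obtain d w where d: "\<forall>i<n. \<not> p dvd d i" and w: "\<not> p dvd detn n (kry n (\<lambda>i j. d i * F i j) w)"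
    using Suc.IH by blast
  have "\<not> p dvd detn n F" using Suc.prems(1)[of n] prime_gt_1_int[OF p] by (cases "n = 0") auto
  then have minor: "\<not> p dvd detn n (\<lambda>i j. d i * F i j)"
    using d p by (simp add: detn_scale_rows prime_dvd_mult_iff prime_dvd_prod_lessThan)
  obtain v where v: "\<not> p dvd detn (Suc n) (kry (Suc n) (\<lambda>i j. (d(n := 0)) i * F i j) v)"
    using krylov_determinant_border[OF p minor w] by blast
  define f where "f k = (if k = (0::nat) then (\<lambda>x. detn (Suc n) (kry (Suc n) (\<lambda>i j. x i * F i j) v))
      else (\<lambda>x. x n))" for k
  define deg where "deg k = (if k = (0::nat) then \<Sum>m<Suc n. 1 * m + 0 else 1)" for k
  have "pf (\<Sum>m<Suc n. 1 * m + 0) (\<lambda>x. detn (Suc n) (kry (Suc n) (\<lambda>i j. x i * F i j) v))"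
  proof (rule pf_detn_kry)
    fix i j
    show "pf 1 (\<lambda>x. x i * F i j)" by (rule pf_mult_le[OF pf_var[of 1] pf_const[of 0]]) auto
    show "pf 0 (\<lambda>x. v i)" by (rule pf_const)
  qed
  then have pf: "pf (deg k) (f k)" for k
    by (auto simp: f_def deg_def simp del: sum.lessThan_Suc intro: pf_var)
  have degs: "int (\<Sum>k\<in>{0, 1}. deg k) < p"
  proof -
    have "(\<Sum>k\<in>{0, 1}. deg k) \<le> Suc n * Suc n + 1"
      using sum_lessThan_mult_le[of 1 0 "Suc n"] by (simp add: deg_def del: sum.lessThan_Suc)
    then show ?thesis using Suc.prems(2) by linarith
  qed
  \<comment> \<open>Index 0 stands for the Krylov determinant, witnessed by the entry 0; index 1 for
    the entry itself, witnessed by the value 1. This is why the witness is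
    \<open>int k\<close>.\<close>
  have "\<exists>y. (\<forall>k\<in>{0, 1}. \<not> p dvd f k y) \<and> (\<forall>i. i \<notin> set [n] \<longrightarrow> y i = d i)"
    by (rule common_nonroot[OF p _ pf _ _ degs, where z = "\<lambda>k. d(n := int k)"])
       (use v prime_gt_1_int[OF p] in \<open>auto simp: f_def\<close>)
  then obtain y where "\<not> p dvd f 0 y" "\<not> p dvd f 1 y" "\<forall>i. i \<noteq> n \<longrightarrow> y i = d i" by auto
  then show ?case using d by (intro exI[of _ y] exI[of _ v]) (auto simp: f_def less_Suc_eq)
qed

text \<open>This is \<open>D (A + A a y^T)\<close>, that is \<open>D A (I + a y^T)\<close>, with
  \<open>D\<close> the diagonal matrix of \<open>d\<close>.\<close>

definition prec where
  "prec n A d a y i j = d i * (A i j + (\<Sum>l<n. A i l * a l) * y (j::nat))"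

lemma detn_prec:
  "detn n (prec n A d a y) = (\<Prod>i<n. d i) * (detn n A * (1 + (\<Sum>i<n. a i * y i)))"
proof -
  have "detn n (prec n A d a y) = (\<Prod>i<n. d i) * detn n (\<lambda>i j. A i j + (\<Sum>l<n. A i l * a l) * y j)"
    using detn_scale_rows[of n d "\<lambda>i j. A i j + (\<Sum>l<n. A i l * a l) * y j"]
    by (simp add: prec_def[abs_def])
  also have "detn n (\<lambda>i j. A i j + (\<Sum>l<n. A i l * a l) * y j)
      = detn n (\<lambda>i j. \<Sum>l<n. A i l * (unit_row l j + a l * y j))"
  proof (rule detn_eqI)
    fix i j assume "j < n"
    have "(\<Sum>l<n. A i l * unit_row l j) = (\<Sum>l<n. if l = j then A i l else 0)"
      by (rule sum.cong) (auto simp: unit_row_def)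
    then show "A i j + (\<Sum>l<n. A i l * a l) * y j = (\<Sum>l<n. A i l * (unit_row l j + a l * y j))"
      using \<open>j < n\<close> by (simp add: distrib_left sum.distrib sum_distrib_right mult.assoc)
  qed
  also have "\<dots> = detn n A * detn n (\<lambda>i j. unit_row i j + a i * y j)" by (rule detn_mult)
  finally show ?thesis by (simp only: detn_identity_rank_one)
qed

text \<open>A rank-one term \<open>x y^T\<close> making all leading minors of the permuted matrix
  units is found first; with it a diagonal and a cyclic vector exist. The permutation is undone at
  the end and costs only a sign.\<close>

theorem krylov_witness:
  assumes p: "prime p" and n: "n \<ge> 1" and A: "\<not> p dvd detn n A" and big: "int (2 * n * n + 1) < p"
  shows "\<exists>d a y v. \<not> p dvd detn n (kry n (prec n A d a y) v)"
proof -
  have "corank1 p n A"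
    using row_expand_nonzero[OF A, of 0] n unfolding corank1_def by (auto simp: Suc_le_eq)
  then obtain \<pi> where \<pi>: "\<pi> permutes {0..<n}"
    and cor: "\<And>k. 1 \<le> k \<Longrightarrow> k \<le> n \<Longrightarrow> corank1 p k (\<lambda>a b. A (\<pi> a) (\<pi> b))"
    using corank1_chain n by blast
  let ?A = "\<lambda>a b. A (\<pi> a) (\<pi> b)"
  have "\<forall>k\<in>{1..n}. \<exists>a y. \<not> p dvd detn k (\<lambda>i j. ?A i j + a i * y j)"
    using cor corank1_rank_one by fastforce
  then obtain a where "\<forall>k\<in>{1..n}. \<exists>y. \<not> p dvd detn k (\<lambda>i j. ?A i j + a k i * y j)"
    using bchoice[of "{1..n}" "\<lambda>k a. \<exists>y. \<not> p dvd detn k (\<lambda>i j. ?A i j + a i * y j)"] by blast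
  then obtain y where ay: "\<forall>k\<in>{1..n}. \<not> p dvd detn k (\<lambda>i j. ?A i j + a k i * y k j)"
    using bchoice[of "{1..n}" "\<lambda>k y. \<not> p dvd detn k (\<lambda>i j. ?A i j + a k i * y j)"] by blast
  \<comment> \<open>Each \<open>k\<close> has its own rank-one witness; as polynomials in
    \<open>2 n\<close> common variables they are merged. Their degrees \<open>2 k\<close> sum to
    \<open>n (n + 1)\<close>, at most \<open>2 n^2\<close>.\<close>
  define f where "f k x = detn k (\<lambda>i j. ?A i j + x i * x (n + j))" for k and x :: "nat \<Rightarrow> int"
  define z where "z k i = (if i < n then a k i else if i < 2 * n then y k (i - n) else 0)" for k i
  have "\<exists>x. (\<forall>k\<in>{1..n}. \<not> p dvd f k x) \<and> (\<forall>i. i \<notin> set [0..<2*n] \<longrightarrow> x i = 0)"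
  proof (rule common_nonroot[OF p, where d = "\<lambda>k. \<Sum>i<k. 2" and z = z])
    show "pf (\<Sum>i<k. 2) (f k)" for k unfolding f_def
      by (rule pf_detn) (intro pf_add pf_const pf_mult_le[of 1 _ 1] pf_var, auto)
    show "\<not> p dvd f k (z k)" if "k \<in> {1..n}" for k
    proof -
      have "f k (z k) = detn k (\<lambda>i j. ?A i j + a k i * y k j)"
        unfolding f_def by (rule detn_eqI) (use that in \<open>auto simp: z_def\<close>)
      then show ?thesis using ay that by simp
    qed
    have "(\<Sum>k\<in>{1..n}. \<Sum>i<k. 2) \<le> (\<Sum>k\<in>{1..n}. 2 * n)" by (intro sum_mono) auto
    then have "(\<Sum>k\<in>{1..n}. \<Sum>i<k. 2) \<le> 2 * n * n" by simp
    then show "int (\<Sum>k\<in>{1..n}. \<Sum>i<k. 2) < p" using big by linarith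
  qed (auto simp: z_def)
  then obtain x where x: "\<forall>k\<in>{1..n}. \<not> p dvd f k x" by blast
  let ?F = "\<lambda>i j. ?A i j + x i * x (n + j)"
  have "n * n \<le> 2 * n * n" by simp
  then have big': "int (n * n + 1) < p" using big by linarith
  obtain d v where dv: "\<not> p dvd detn n (kry n (\<lambda>i j. d i * ?F i j) v)"
    using diagonal_krylov_witness[OF p, of n ?F] x big' unfolding f_def by force
  let ?i = "inv_into UNIV \<pi>"
  have inv: "?i (\<pi> i) = i" for i using permutes_inverses[OF \<pi>] by simp
  \<comment> \<open>The preconditioner offers only terms of the form \<open>A b y^T\<close>. Since
    \<open>A\<close> is invertible modulo \<open>p\<close>, the left vector \<open>x\<close> can be
    written as \<open>A b\<close>.\<close>
  obtain b where b: "\<forall>i<n. [(\<Sum>j<n. A i j * b j) = x (?i i)] (mod p)"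
    using detn_solvable[OF p A, of "\<lambda>i. x (?i i)"] by blast
  let ?B = "prec n A (d \<circ> ?i) b (\<lambda>j. x (n + ?i j))" and ?v = "v \<circ> ?i"
  have lt: "\<pi> i < n" if "i < n" for i using permutes_in_image[OF \<pi>] that by simp
  have entry: "[d i * ?F i j = ?B (\<pi> i) (\<pi> j)] (mod p)" if "i < n" "j < n" for i j
  proof -
    have "[x i = (\<Sum>l<n. A (\<pi> i) l * b l)] (mod p)"
      using b lt[OF that(1)] by (metis cong_sym inv)
    then show ?thesis
      unfolding prec_def comp_def inv by (intro cong_scalar_left cong_add cong_scalar_right cong_refl)
  qed
  \<comment> \<open>Conjugation by a permutation matrix: the Krylov vectors are the same up to
    renaming the coordinates by \<open>\<pi>\<close>.\<close>
  have "[kry n (\<lambda>i j. d i * ?F i j) v m i = kry n ?B ?v m (\<pi> i)] (mod p)" if "i < n" for m i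
    using that
  proof (induction m arbitrary: i)
    case 0
    then show ?case by (simp add: inv)
  next
    case (Suc m)
    have 1: "kry n (\<lambda>i j. d i * ?F i j) v (Suc m) i
        = (\<Sum>j<n. d i * ?F i j * kry n (\<lambda>i j. d i * ?F i j) v m j)"
      unfolding kry_Suc by (rule mv_def)
    have "kry n ?B ?v (Suc m) (\<pi> i) = (\<Sum>j<n. ?B (\<pi> i) j * kry n ?B ?v m j)"
      unfolding kry_Suc by (rule mv_def)
    also have "\<dots> = (\<Sum>j<n. ?B (\<pi> i) (\<pi> j) * kry n ?B ?v m (\<pi> j))"
      unfolding atLeast0LessThan[symmetric]
      by (rule sum.reindex_bij_betw[OF permutes_imp_bij[OF \<pi>], symmetric])
    finally have 2: "kry n ?B ?v (Suc m) (\<pi> i) = (\<Sum>j<n. ?B (\<pi> i) (\<pi> j) * kry n ?B ?v m (\<pi> j))" .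
    show ?case unfolding 1 2
      by (rule cong_sum, rule cong_mult) (use Suc entry in \<open>simp_all only: lessThan_iff\<close>)
  qed
  then have 1: "[detn n (kry n (\<lambda>i j. d i * ?F i j) v) = detn n (\<lambda>m i. kry n ?B ?v m (\<pi> i))] (mod p)"
    by (intro detn_cong)
  have 2: "detn n (\<lambda>m i. kry n ?B ?v m (\<pi> i)) = detn n (\<lambda>i m. kry n ?B ?v m (\<pi> i))"
    by (rule detn_transpose[of n "\<lambda>i m. kry n ?B ?v m (\<pi> i)"])
  have 3: "detn n (\<lambda>i m. kry n ?B ?v m (\<pi> i)) = signof \<pi> * detn n (\<lambda>i m. kry n ?B ?v m i)"
    by (rule detn_permute_rows[OF \<pi>, of "\<lambda>i m. kry n ?B ?v m i"])
  have 4: "detn n (\<lambda>i m. kry n ?B ?v m i) = detn n (kry n ?B ?v)"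
    by (rule detn_transpose)
  have "\<not> p dvd signof \<pi> * detn n (kry n ?B ?v)"
    using cong_dvd_iff[OF 1] dv unfolding 2 3 4 by blast
  then have "\<not> p dvd detn n (kry n ?B ?v)" by (simp only: prime_dvd_signof_mult not_False_eq_True)
  then show ?thesis by blast
qed

section \<open>A lower bound for the number of primes\<close>

text \<open>Leibniz's harmonic triangle: \<open>a\<close>, \<open>b\<close>, \<open>c\<close> are
  the denominators of three adjacent entries and satisfy \<open>1/c = 1/a - 1/b\<close>. A common
  multiple \<open>D\<close> of \<open>a\<close> and \<open>b\<close> gives the integer
  \<open>D/c = D/a - D/b\<close>, which is \<open>X - Y\<close> in the proof.\<close>

lemma binomial_dvd_Lcm:
  "k \<le> n \<Longrightarrow> (n + 1) * (n choose k) dvd Lcm {1..n + 1}"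
proof (induction k arbitrary: n)
  case 0
  then show ?case by (simp add: dvd_Lcm)
next
  case (Suc k)
  then obtain m where n: "n = Suc m" by (cases n) auto
  define D where "D = Lcm {1..n + 1}"
  define a where "a = n * (m choose k)"
  define b where "b = (n + 1) * (n choose k)"
  define c where "c = (n + 1) * (n choose Suc k)"
  have "Lcm {1..m + 1} dvd D" unfolding D_def by (rule Lcm_subset) (auto simp: n)
  then have "a dvd D" using Suc.IH[of m] Suc.prems unfolding a_def n by (auto intro: dvd_trans)
  then obtain X where X: "D = a * X" by (elim dvdE)
  have "b dvd D" using Suc.IH[of n] Suc.prems by (simp add: b_def D_def)
  then obtain Y where Y: "D = b * Y" by (elim dvdE)
  have kc: "Suc k * (n choose Suc k) = a" using binomial_absorption[of k n] by (simp add: a_def n)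
  have ka: "(n - k) * (n choose k) = a" using binomial_absorb_comp[of n k] by (simp add: a_def n)
  have pos: "a > 0" "b > 0" using Suc.prems by (auto simp: a_def b_def n)
  have ba: "int b - int a = int (Suc k * (n choose k))"
    unfolding b_def ka[symmetric] using Suc.prems by (simp add: of_nat_diff algebra_simps)
  have c: "int c * (int b - int a) = int a * int b"
  proof -
    have "c * (Suc k * (n choose k)) = a * b"
      unfolding c_def b_def kc[symmetric] by (simp only: mult_ac)
    then show ?thesis unfolding ba by (simp only: of_nat_mult[symmetric])
  qed
  have "int c * (int X - int Y) * (int a * int b) = int c * (int (a * X) * int b - int (b * Y) * int a)"
    by (simp only: of_nat_mult right_diff_distrib left_diff_distrib mult_ac)
  also have "\<dots> = int D * (int c * (int b - int a))"
    unfolding X[symmetric] Y[symmetric]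
    by (simp only: right_diff_distrib left_diff_distrib mult_ac)
  finally have "int c * (int X - int Y) * (int a * int b) = int D * (int a * int b)"
    unfolding c .
  then have "int D = int c * (int X - int Y)" using pos by simp
  then have "c dvd D" by (metis dvd_triv_left int_dvd_int_iff)
  then show ?case unfolding c_def D_def .
qed

text \<open>The multiplicity in a least common multiple is a maximum, so the prime power already
  divides one of the numbers up to \<open>x\<close>.\<close>

lemma prime_power_dvd_Lcm:
  fixes p :: nat
  assumes "prime p" "p ^ m dvd Lcm {1..x}" "m > 0"
  shows "p ^ m \<le> x"
  using assms(2)
proof (induction x)
  case 0
  then show ?case using assms prime_gt_1_nat[of p] by auto
next
  case (Suc x)
  have "{1..Suc x} = insert (Suc x) {1..x}" by auto
  then have L: "Lcm {1..Suc x} = lcm (Suc x) (Lcm {1..x})" by simp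
  have nz: "Lcm {1..x} \<noteq> 0" by (simp add: Lcm_0_iff)
  have "m \<le> multiplicity p (lcm (Suc x) (Lcm {1..x}))"
    using Suc.prems assms(1) nz unfolding L
    by (intro multiplicity_geI) (auto simp: lcm_eq_0_iff prime_gt_1_nat)
  then have "m \<le> max (multiplicity p (Suc x)) (multiplicity p (Lcm {1..x}))"
    using assms(1) nz by (subst (asm) multiplicity_lcm) auto
  then have "p ^ m dvd Suc x \<or> p ^ m dvd Lcm {1..x}"
    by (auto simp: le_max_iff_disj intro: multiplicity_dvd')
  then show ?case using Suc.IH by (auto dest: dvd_imp_le)
qed

lemma Lcm_le_power_primes:
  assumes "x \<ge> 1"
  shows "Lcm {1..x} \<le> x ^ card {p::nat. prime p \<and> p \<le> x}"
proof -
  define L where "L = Lcm {1..x}"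
  have nz: "L \<noteq> 0" by (simp add: L_def Lcm_0_iff)
  have le: "p ^ multiplicity p L \<le> x \<and> p \<le> x" if "p \<in> prime_factors L" for p
  proof -
    have p: "prime p" "multiplicity p L > 0"
      using that by (auto simp: prime_factors_multiplicity)
    have "p ^ multiplicity p L \<le> x" using prime_power_dvd_Lcm[OF p(1) _ p(2), of x] multiplicity_dvd[of p L]
      by (simp add: L_def)
    moreover have "p \<le> p ^ multiplicity p L" using p prime_gt_0_nat by (intro self_le_power) (auto simp: Suc_leI)
    ultimately show ?thesis by simp
  qed
  have "L = (\<Prod>p\<in>prime_factors L. p ^ multiplicity p L)"
    using prod_prime_factors[OF nz] by simp
  also have "\<dots> \<le> (\<Prod>p\<in>prime_factors L. x)"
    by (rule prod_mono) (simp add: le)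
  also have "\<dots> = x ^ card (prime_factors L)" by simp
  also have "\<dots> \<le> x ^ card {p::nat. prime p \<and> p \<le> x}"
  proof (intro power_increasing card_mono)
    show "prime_factors L \<subseteq> {p. prime p \<and> p \<le> x}"
      using le in_prime_factors_imp_prime by blast
  qed (use assms in auto)
  finally show ?thesis unfolding L_def .
qed

text \<open>Chebyshev's lower bound from the central binomial coefficient, where
  \<open>(2 N + 1)\<close> times it divides the lcm of \<open>1, ..., 2 N + 1\<close>. Taking
  \<open>2 N + 2 = 2 ^ E\<close> turns the logarithm of the range into the integer
  \<open>E\<close>.\<close>

theorem primes_below_power_of_two:
  assumes "E \<ge> 1"
  shows "2 ^ E \<le> E * card {p::nat. prime p \<and> p \<le> 2 ^ E} + 2"
proof -
  define N where "N = 2 ^ (E - 1) - (1::nat)"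
  have E: "2 ^ E = 2 * N + 2"
  proof -
    have "(1::nat) \<le> 2 ^ (E - 1)" by simp
    then show ?thesis using assms by (simp add: N_def power_eq_if)
  qed
  have "4 ^ N \<le> (2 * N + 1) * ((2 * N) choose N)"
  proof (cases "N = 0")
    case False
    then have "4 ^ N / (2 * real N) \<le> real ((2 * N) choose N)"
      by (intro central_binomial_lower_bound) auto
    then have "real (4 ^ N) \<le> real (2 * N * ((2 * N) choose N))"
      using False by (simp add: field_simps)
    then have "4 ^ N \<le> 2 * N * ((2 * N) choose N)" by (simp only: of_nat_le_iff)
    then show ?thesis by simp
  qed simp
  also have "\<dots> \<le> Lcm {1..2 * N + 1}"
    by (rule dvd_imp_le[OF binomial_dvd_Lcm]) (auto simp: Lcm_0_iff neq0_conv[symmetric] simp del: neq0_conv)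
  also have "\<dots> \<le> (2 * N + 1) ^ card {p::nat. prime p \<and> p \<le> 2 * N + 1}"
    by (rule Lcm_le_power_primes) simp
  also have "\<dots> \<le> (2 ^ E) ^ card {p::nat. prime p \<and> p \<le> 2 * N + 1}"
    by (rule power_mono) (auto simp: E)
  also have "\<dots> \<le> (2 ^ E) ^ card {p::nat. prime p \<and> p \<le> 2 ^ E}"
    by (intro power_increasing card_mono) (auto simp: E)
  finally have "(2::nat) ^ (2 * N) \<le> 2 ^ (E * card {p::nat. prime p \<and> p \<le> 2 ^ E})"
    by (simp add: power_mult)
  then have "2 * N \<le> E * card {p::nat. prime p \<and> p \<le> 2 ^ E}"
    by (simp add: power_increasing_iff)
  then show ?thesis by (simp add: E)
qed

section \<open>One trial of the randomised determinant computation modulo a prime\<close>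

text \<open>A single sequence \<open>x\<close> holds the diagonal, the two vectors of the rank-one matrix, and the
  left and right Krylov vectors, one after the other.\<close>

definition trial_matrix where
  "trial_matrix n A x = prec n A x (\<lambda>i. x (n + i)) (\<lambda>i. x (2 * n + i))"

definition trial_seq where
  "trial_seq n A x = krylov_seq n (trial_matrix n A x) (\<lambda>i. x (3 * n + i)) (\<lambda>i. x (4 * n + i))"

definition trial_scale :: "nat \<Rightarrow> (nat \<Rightarrow> int) \<Rightarrow> int" where
  "trial_scale n x = (\<Prod>i<n. x i) * (1 + (\<Sum>i<n. x (n + i) * x (2 * n + i)))"

text \<open>A sufficient condition for success, phrased with determinants so that degree bounds
  apply to it. The program itself tests the product of the scale and of all \<open>ee\<close> and
  \<open>gg\<close>.\<close>

definition good_trial :: "int \<Rightarrow> nat \<Rightarrow> (nat \<Rightarrow> nat \<Rightarrow> int) \<Rightarrow> (nat \<Rightarrow> int) \<Rightarrow> bool" where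
  "good_trial p n A x \<longleftrightarrow> \<not> p dvd trial_scale n x \<and>
     (\<forall>k\<in>{1..n}. \<not> p dvd detn k (\<lambda>i j. trial_seq n A x (i + j)) \<and>
                 \<not> p dvd detn k (\<lambda>i j. trial_seq n A x (i + j + 1)))"

lemma detn_trial_matrix: "detn n (trial_matrix n A x) = trial_scale n x * detn n A"
  by (simp add: trial_matrix_def detn_prec trial_scale_def)

text \<open>Here only the product that the program can compute is assumed to be a unit. Hence an
  accepted trial is always right, and randomness affects acceptance alone.\<close>

theorem trial_sound:
  assumes "n > 0" "prime p" "s = trial_seq n A x" "\<not> p dvd (\<Prod>k<n. ee n s k * gg n s k)"
  shows "[detn n A * (trial_scale n x * (\<Prod>k<n. ee n s k)) = gg n s (n - 1)] (mod p)"
proof -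
  have "[detn n (trial_matrix n A x) * (\<Prod>k<n. ee n s k) = gg n s (n - 1)] (mod p)"
  proof (rule hankel_quotient[OF assms(1) _ assms(2,4)])
    show "detn n (\<lambda>i j. s (i + j + 1)) = detn n (trial_matrix n A x) * detn n (\<lambda>i j. s (i + j))"
      unfolding assms(3) trial_seq_def by (rule krylov_hankel_shift)
  qed
  then show ?thesis by (simp add: detn_trial_matrix mult_ac)
qed

theorem trial_complete:
  assumes "prime p" "s = trial_seq n A x" "good_trial p n A x"
  shows "\<not> p dvd trial_scale n x * (\<Prod>k<n. ee n s k * gg n s k)"
proof -
  have "\<not> p dvd (\<Prod>k<n. ee n s k * gg n s k)"
    by (rule hankel_regular_imp_ee_gg) (use assms in \<open>auto simp: good_trial_def\<close>)
  then show ?thesis using assms by (simp add: prime_dvd_mult_iff good_trial_def)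
qed

lemma kry_eqI:
  assumes "\<And>i j. i < n \<Longrightarrow> j < n \<Longrightarrow> B i j = B' i j" "\<And>i. i < n \<Longrightarrow> v i = v' i" "i < n"
  shows "kry n B v m i = kry n B' v' m i"
  using kry_cong[of n B B' 0 v v' i m] assms by (simp add: cong_0_iff)

lemma krylov_seq_eqI:
  assumes "\<And>i j. i < n \<Longrightarrow> j < n \<Longrightarrow> B i j = B' i j" "\<And>i. i < n \<Longrightarrow> v i = v' i"
    "\<And>i. i < n \<Longrightarrow> u i = u' i"
  shows "krylov_seq n B u v m = krylov_seq n B' u' v' m"
  unfolding krylov_seq_def
proof (rule sum.cong)
  fix i assume "i \<in> {..<n}"
  then show "u i * kry n B v m i = u' i * kry n B' v' m i"
    using kry_eqI[of n B B' v v' i m] assms by simp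
qed simp

lemma trial_seq_eqI:
  assumes "\<And>i. i < 5 * n \<Longrightarrow> x i = y i"
  shows "trial_seq n A x = trial_seq n A y"
proof
  fix m
  show "trial_seq n A x m = trial_seq n A y m"
    unfolding trial_seq_def trial_matrix_def
    by (rule krylov_seq_eqI) (auto simp: assms prec_def)
qed

lemma trial_scale_eqI:
  assumes "\<And>i. i < 5 * n \<Longrightarrow> x i = y i"
  shows "trial_scale n x = trial_scale n y"
  using assms by (simp add: trial_scale_def)

lemma good_trial_eqI:
  assumes "\<And>i. i < 5 * n \<Longrightarrow> x i = y i"
  shows "good_trial p n A x = good_trial p n A y"
  using trial_seq_eqI[of n x y A] trial_scale_eqI[of n x y] assms by (simp add: good_trial_def)

section \<open>Failure probability of trials\<close>

lemma pf_krylov_seq: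
  assumes "\<And>i. i < n \<Longrightarrow> pf 1 (\<lambda>x. u x i)" "\<And>i. i < n \<Longrightarrow> pf 1 (\<lambda>x. v x i)"
  shows "pf 2 (\<lambda>x. krylov_seq n B (u x) (v x) m)"
  unfolding krylov_seq_def
proof (rule pf_sum)
  fix i assume "i \<in> {..<n}"
  then have "pf (0 * m + 1) (\<lambda>x. kry n B (v x) m i)"
    using assms by (intro pf_kry[of n 0 "\<lambda>x. B" 1] pf_const) auto
  then show "pf 2 (\<lambda>x. u x i * kry n B (v x) m i)"
    using assms \<open>i \<in> {..<n}\<close> by (intro pf_mult_le[of 1 _ 1]) auto
qed

lemma hankel_degree: "(\<Sum>k\<in>{1..n}. \<Sum>i<k. 2) = n * (n + 1 :: nat)"
  by (induction n) auto

text \<open>The coordinates are averaged in two stages. The first \<open>3 n\<close> (diagonal and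
  rank-one vectors) should make the Krylov matrix of the fixed witness \<open>v\<close> and the
  scale units. Given that, each of the \<open>2 n\<close> Hankel minors is a nonvanishing polynomial
  of degree \<open>2 k\<close> in the last \<open>2 n\<close> coordinates. The degrees sum to at
  most \<open>16 n^2\<close>, half of the \<open>32 n^2\<close> required of
  \<open>s\<close>.\<close>

theorem bad_trial_average:
  assumes p: "prime p" and n: "n \<ge> 1" and A: "\<not> p dvd detn n A"
    and s: "s \<le> p" "int (32 * n * n) \<le> s"
  shows "average {0..<s} [0..<5 * n] (\<lambda>x. of_bool (\<not> good_trial p n A x)) x0 \<le> 1 / 2"
proof -
  let ?S = "{0..<s}"
  have nn: "n \<le> n * n" using n by simp
  have "0 < s" using s n nn by linarith
  then have S: "finite ?S" "?S \<noteq> {}" "?S \<subseteq> {0..<p}" using s by auto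
  have card: "real (card ?S) = real_of_int s" using \<open>0 < s\<close> by simp
  have "2 * n * n + 1 < 32 * n * n" using n nn by linarith
  then have "int (2 * n * n + 1) < p" using s by linarith
  then obtain d a y v where wit: "\<not> p dvd detn n (kry n (prec n A d a y) v)"
    using krylov_witness[OF p n A] by blast
  define f1 where "f1 x = detn n (kry n (trial_matrix n A x) v)" for x
  have pf_entry: "pf 3 (\<lambda>x. trial_matrix n A x i j)" for i j
  proof -
    have "pf 1 (\<lambda>x. \<Sum>l<n. A i l * x (n + l))"
      by (rule pf_sum, rule pf_mult_le[OF pf_const[of 0] pf_var[of 1]]) auto
    then have "pf 2 (\<lambda>x. (\<Sum>l<n. A i l * x (n + l)) * x (2 * n + j))"
      by (rule pf_mult_le[OF _ pf_var[of 1]]) auto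
    then show ?thesis unfolding trial_matrix_def prec_def
      by (intro pf_mult_le[OF pf_var[of 1] pf_add[OF pf_const]]) auto
  qed
  have pf1: "pf (\<Sum>m<n. 3 * m + 0) f1" unfolding f1_def
    by (rule pf_detn_kry) (auto intro: pf_entry pf_const)
  have deg1: "(\<Sum>m<n. 3 * m + 0) \<le> 3 * n * n" using sum_lessThan_mult_le[of 3 0 n] by simp
  have pf2: "pf (n + 2) (trial_scale n)"
  proof -
    have "pf (\<Sum>i<n. 1) (\<lambda>x. \<Prod>i<n. x i)" by (intro pf_prod pf_var) auto
    moreover have "pf 2 (\<lambda>x. 1 + (\<Sum>i<n. x (n + i) * x (2 * n + i)))"
      by (intro pf_add pf_const pf_sum pf_mult_le[of 1 _ 1] pf_var) auto
    ultimately show ?thesis unfolding trial_scale_def by (intro pf_mult_le) auto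
  qed
  have inner: "average ?S [3 * n..<5 * n] (\<lambda>x. of_bool (\<not> good_trial p n A x)) z
      \<le> of_bool (p dvd f1 z) + of_bool (p dvd trial_scale n z) + 2 * real (n * (n + 1)) / card ?S" for z
  proof (cases "p dvd f1 z \<or> p dvd trial_scale n z")
    case True
    have "average ?S [3 * n..<5 * n] (\<lambda>x. of_bool (\<not> good_trial p n A x)) z
        \<le> average ?S [3 * n..<5 * n] (\<lambda>_. 1) z" by (rule average_mono) auto
    also have "\<dots> = 1" using S by (intro average_const)
    also have "1 \<le> of_bool (p dvd f1 z) + of_bool (p dvd trial_scale n z) + 2 * real (n * (n + 1)) / card ?S"
      using True by auto
    finally show ?thesis .
  next
    case False
    define B where "B = trial_matrix n A z"
    define h where "h e k x = detn k (\<lambda>i j. krylov_seq n B (\<lambda>i. x (3 * n + i)) (\<lambda>i. x (4 * n + i)) (i + j + e))"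
      for e k and x :: "nat \<Rightarrow> int"
    have pf_h: "pf (\<Sum>i<k. 2) (h e k)" for e k
      unfolding h_def by (intro pf_detn pf_krylov_seq pf_var) auto
    have B: "\<not> p dvd detn n B"
      using False A p by (simp add: B_def detn_trial_matrix prime_dvd_mult_iff)
    have K: "\<not> p dvd detn n (kry n B v)" using False by (simp add: f1_def B_def)
    have witness: "\<exists>w. \<not> p dvd h e k w \<and> (\<forall>i. i \<notin> set [3 * n..<5 * n] \<longrightarrow> w i = z i)"
      if k: "k \<in> {1..n}" and e: "e \<in> {0, 1}" for e k
    proof -
      \<comment> \<open>The position of the single 1 among the first \<open>n\<close> prescribed
        terms. For the shifted sequence it moves up by one, which is possible only for
        \<open>k < n\<close>; for \<open>k = n\<close> the shifted minor is instead obtained as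
        \<open>det B\<close> times the unshifted one.\<close>
      define l where "l = (if e = 1 \<and> k < n then k else k - 1)"
      obtain u where u: "\<forall>i<n. [krylov_seq n B u v i = (if i = l then 1 else 0)] (mod p)"
        using krylov_seq_linear_solvable[OF p K, of "\<lambda>i. if i = l then 1 else 0"] by blast
      define w where "w i = (if 3 * n \<le> i \<and> i < 4 * n then u (i - 3 * n)
          else if 4 * n \<le> i \<and> i < 5 * n then v (i - 4 * n) else z i)" for i
      have eq: "krylov_seq n B (\<lambda>i. w (3 * n + i)) (\<lambda>i. w (4 * n + i)) = krylov_seq n B u v"
        by (rule ext, rule krylov_seq_eqI) (auto simp: w_def)
      have "\<not> p dvd detn k (\<lambda>i j. krylov_seq n B u v (i + j + e))"
      proof (cases "e = 1 \<and> k < n")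
        case True
        have "[krylov_seq n B u v (Suc i) = (if i = k - 1 then 1 else 0)] (mod p)" if "i \<le> k - 1" for i
        proof -
          have "Suc i < n" "Suc i = l \<longleftrightarrow> i = k - 1" using that True k by (auto simp: l_def)
          then show ?thesis using u by auto
        qed
        then have "\<not> p dvd detn (Suc (k - 1)) (\<lambda>i j. krylov_seq n B u v (Suc (i + j)))"
          by (rule antitriangular_hankel_unit[OF p, of _ "\<lambda>i. krylov_seq n B u v (Suc i)"])
        then show ?thesis using k True by simp
      next
        case False
        then have l: "l = k - 1" using e by (auto simp: l_def)
        have h0: "\<not> p dvd detn k (\<lambda>i j. krylov_seq n B u v (i + j))"
        proof -
          have "[krylov_seq n B u v i = (if i = k - 1 then 1 else 0)] (mod p)" if "i \<le> k - 1" for i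
          proof -
            have "i < n" using that k by auto
            then show ?thesis using u l by simp
          qed
          then have "\<not> p dvd detn (Suc (k - 1)) (\<lambda>i j. krylov_seq n B u v (i + j))"
            by (rule antitriangular_hankel_unit[OF p])
          then show ?thesis using k by simp
        qed
        show ?thesis
        proof (cases "e = 0")
          case True
          then show ?thesis using h0 by simp
        next
          case e1: False
          then have "e = 1" "k = n" using e False k by auto
          then show ?thesis using h0 B p krylov_hankel_shift[of n B u v] by (simp add: prime_dvd_mult_iff)
        qed
      qed
      then have "\<not> p dvd h e k w" unfolding h_def eq .
      moreover have "\<forall>i. i \<notin> set [3 * n..<5 * n] \<longrightarrow> w i = z i" by (auto simp: w_def)
      ultimately show ?thesis by blast
    qed
    have "average ?S [3 * n..<5 * n] (\<lambda>x. of_bool (\<not> good_trial p n A x)) z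
        \<le> average ?S [3 * n..<5 * n]
            (\<lambda>x. \<Sum>q\<in>{0, 1 :: nat} \<times> {1..n}. of_bool (p dvd h (fst q) (snd q) x)) z"
    proof (rule average_mono)
      fix x assume x: "\<And>k. k \<notin> set [3 * n..<5 * n] \<Longrightarrow> x k = z k"
      have Bx: "prec n A x (\<lambda>i. x (n + i)) (\<lambda>i. x (2 * n + i)) i j = B i j" if "i < n" "j < n" for i j
        using that by (simp add: B_def trial_matrix_def prec_def x)
      have seq: "trial_seq n A x m = krylov_seq n B (\<lambda>i. x (3 * n + i)) (\<lambda>i. x (4 * n + i)) m" for m
        unfolding trial_seq_def trial_matrix_def by (rule krylov_seq_eqI) (auto simp: Bx)
      have sc: "trial_scale n x = trial_scale n z" by (simp add: trial_scale_def x)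
      show "of_bool (\<not> good_trial p n A x)
          \<le> (\<Sum>q\<in>{0, 1 :: nat} \<times> {1..n}. of_bool (p dvd h (fst q) (snd q) x) :: real)"
      proof (cases "good_trial p n A x")
        case True
        then show ?thesis by (simp add: sum_nonneg)
      next
        case bad: False
        then obtain k where k: "k \<in> {1..n}" "p dvd h 0 k x \<or> p dvd h 1 k x"
          using False unfolding good_trial_def sc seq h_def add_0_right by blast
        then obtain e where ek: "e \<in> {0, 1}" "k \<in> {1..n}" "p dvd h e k x"
          by blast
        have "of_bool (p dvd h (fst (e, k)) (snd (e, k)) x)
            \<le> (\<Sum>q\<in>{0, 1 :: nat} \<times> {1..n}. of_bool (p dvd h (fst q) (snd q) x) :: real)"
          by (rule member_le_sum) (use ek in auto)
        then show ?thesis using ek bad by simp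
      qed
    qed
    also have "\<dots> = (\<Sum>q\<in>{0, 1 :: nat} \<times> {1..n}.
        average ?S [3 * n..<5 * n] (\<lambda>x. of_bool (p dvd h (fst q) (snd q) x)) z)"
      by (rule average_sum) (use S in auto)
    also have "\<dots> \<le> (\<Sum>q\<in>{0, 1 :: nat} \<times> {1..n}. real (\<Sum>i<snd q. 2) / card ?S)"
    proof (intro sum_mono)
      fix q assume "q \<in> {0, 1::nat} \<times> {1..n}"
      then obtain w where "\<not> p dvd h (fst q) (snd q) w" "\<forall>i. i \<notin> set [3 * n..<5 * n] \<longrightarrow> w i = z i"
        using witness[of "snd q" "fst q"] by auto
      then show "average ?S [3 * n..<5 * n] (\<lambda>x. of_bool (p dvd h (fst q) (snd q) x)) z
          \<le> real (\<Sum>i<snd q. 2) / card ?S"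
        using schwartz_zippel[OF p S pf_h] by blast
    qed
    also have "\<dots> = (\<Sum>e\<in>{0, 1 :: nat}. \<Sum>k\<in>{1..n}. real (\<Sum>i<k. 2) / card ?S)"
      by (subst sum.cartesian_product) (simp only: case_prod_unfold)
    also have "\<dots> = 2 * (\<Sum>k\<in>{1..n}. real (\<Sum>i<k. 2) / card ?S)" by simp
    also have "(\<Sum>k\<in>{1..n}. real (\<Sum>i<k. 2) / card ?S) = real (\<Sum>k\<in>{1..n}. \<Sum>i<k. 2) / card ?S"
      by (simp only: of_nat_sum[of _ "{1..n}"] sum_divide_distrib)
    also have "2 * \<dots> = 2 * real (n * (n + 1)) / card ?S" by (simp only: hankel_degree times_divide_eq_right)
    finally show ?thesis using False by simp
  qed
  have "[0..<5 * n] = [0..<3 * n] @ [3 * n..<5 * n]"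
    using upt_add_eq_append[of 0 "3 * n" "2 * n"] by simp
  then have "average ?S [0..<5 * n] (\<lambda>x. of_bool (\<not> good_trial p n A x)) x0
      = average ?S [0..<3 * n] (average ?S [3 * n..<5 * n] (\<lambda>x. of_bool (\<not> good_trial p n A x))) x0"
    by (simp only: average_append)
  also have "\<dots> \<le> average ?S [0..<3 * n] (\<lambda>z. of_bool (p dvd f1 z) + of_bool (p dvd trial_scale n z)
      + 2 * real (n * (n + 1)) / card ?S) x0"
    by (rule average_mono) (rule inner)
  also have "\<dots> = average ?S [0..<3 * n] (\<lambda>z. of_bool (p dvd f1 z)) x0
      + average ?S [0..<3 * n] (\<lambda>z. of_bool (p dvd trial_scale n z)) x0 + 2 * real (n * (n + 1)) / card ?S"
    by (simp only: average_add average_const[OF S(1,2)])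
  also have "average ?S [0..<3 * n] (\<lambda>z. of_bool (p dvd f1 z)) x0 \<le> real (\<Sum>m<n. 3 * m + 0) / card ?S"
  proof (rule schwartz_zippel[OF p S pf1])
    let ?z = "\<lambda>i. if i < n then d i else if i < 2 * n then a (i - n) else if i < 3 * n then y (i - 2 * n) else x0 i"
    have "kry n (trial_matrix n A ?z) v m i = kry n (prec n A d a y) v m i" if "i < n" for m i
      by (rule kry_eqI) (use that in \<open>auto simp: trial_matrix_def prec_def\<close>)
    then have "f1 ?z = detn n (kry n (prec n A d a y) v)" unfolding f1_def by (intro detn_eqI)
    then show "\<not> p dvd f1 ?z" using wit by simp
  qed auto
  also have "average ?S [0..<3 * n] (\<lambda>z. of_bool (p dvd trial_scale n z)) x0 \<le> real (n + 2) / card ?S"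
  proof (rule schwartz_zippel[OF p S pf2])
    show "\<not> p dvd trial_scale n (\<lambda>i. if i < n then 1 else if i < 3 * n then 0 else x0 i)"
      using prime_gt_1_int[OF p] by (simp add: trial_scale_def)
  qed auto
  also have "real (\<Sum>m<n. 3 * m + 0) / card ?S + real (n + 2) / card ?S + 2 * real (n * (n + 1)) / card ?S
      = real ((\<Sum>m<n. 3 * m + 0) + (n + 2) + 2 * (n * (n + 1))) / card ?S"
    by (simp add: add_divide_distrib)
  also have "\<dots> \<le> real (16 * n * n) / card ?S"
  proof (rule divide_right_mono)
    have "(\<Sum>m<n. 3 * m + 0) + (n + 2) + 2 * (n * (n + 1)) \<le> 3 * n * n + (n * n + 2 * (n * n)) + 2 * (n * n + n * n)"
      using deg1 nn n by (intro add_mono) (auto simp: algebra_simps)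
    also have "\<dots> \<le> 16 * n * n" by simp
    finally show "real ((\<Sum>m<n. 3 * m + 0) + (n + 2) + 2 * (n * (n + 1))) \<le> real (16 * n * n)"
      by (simp only: of_nat_le_iff)
  qed simp
  also have "\<dots> \<le> 1 / 2"
  proof -
    have "2 * real (16 * n * n) \<le> card ?S" unfolding card using s(2)
      by (metis (no_types, lifting) mult.assoc mult_2 of_int_le_iff of_int_of_nat_eq of_nat_add numeral_Bit0_eq_double of_nat_mult of_nat_numeral)
    then show ?thesis using \<open>0 < s\<close> card by (simp add: field_simps)
  qed
  finally show ?thesis by simp
qed

text \<open>Trials read disjoint blocks of \<open>5 n\<close> coordinates. Averaging the last block
  with the earlier ones fixed pulls out one factor \<open>1/2\<close>.\<close>

theorem bad_trials_average:
  assumes "prime p" "n \<ge> 1" "\<not> p dvd detn n A" "s \<le> p" "int (32 * n * n) \<le> s"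
  shows "average {0..<s} [0..<T * (5 * n)]
      (\<lambda>x. of_bool (\<forall>t<T. \<not> good_trial p n A (\<lambda>i. x (t * (5 * n) + i)))) x0 \<le> (1 / 2) ^ T"
proof (induction T)
  case (Suc T)
  let ?N = "T * (5 * n)"
  let ?bad = "\<lambda>T x. \<forall>t<T. \<not> good_trial p n A (\<lambda>i. x (t * (5 * n) + i))"
  let ?F = "\<lambda>x. of_bool (\<not> good_trial p n A x) :: real"
  let ?av = "average {0..<s} (map ((+) ?N) [0..<5 * n])"
  have "[0..<Suc T * (5 * n)] = [0..<?N] @ map ((+) ?N) [0..<5 * n]"
  proof -
    have "map ((+) ?N) [0..<5 * n] = [?N..<?N + 5 * n]" by (rule nth_equalityI) auto
    then show ?thesis using upt_add_eq_append[of 0 ?N "5 * n"] by (simp add: add.commute)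
  qed
  then have "average {0..<s} [0..<Suc T * (5 * n)] (\<lambda>x. of_bool (?bad (Suc T) x)) x0
      = average {0..<s} [0..<?N] (?av (\<lambda>x. of_bool (?bad (Suc T) x))) x0"
    by (simp only: average_append)
  also have "\<dots> \<le> average {0..<s} [0..<?N] (\<lambda>y. (1 / 2) * of_bool (?bad T y)) x0"
  proof (rule average_mono)
    fix y
    have "?av (\<lambda>x. of_bool (?bad (Suc T) x)) y
        = ?av (\<lambda>x. of_bool (?bad T y) * ?F (\<lambda>i. x (?N + i))) y"
    proof (rule average_cong)
      fix x assume x: "\<And>k. k \<notin> set (map ((+) ?N) [0..<5 * n]) \<Longrightarrow> x k = y k"
      have "good_trial p n A (\<lambda>i. x (t * (5 * n) + i)) = good_trial p n A (\<lambda>i. y (t * (5 * n) + i))" if "t < T" for t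
      proof (rule good_trial_eqI)
        fix i assume "i < 5 * n"
        then have "t * (5 * n) + i < Suc t * (5 * n)" by simp
        also have "\<dots> \<le> ?N" using that by (intro mult_right_mono) auto
        finally show "x (t * (5 * n) + i) = y (t * (5 * n) + i)" by (intro x) auto
      qed
      then have "?bad T x = ?bad T y" by auto
      then show "of_bool (?bad (Suc T) x) = of_bool (?bad T y) * ?F (\<lambda>i. x (?N + i))"
        by (auto simp: less_Suc_eq)
    qed
    also have "\<dots> = of_bool (?bad T y) * ?av (\<lambda>x. ?F (\<lambda>i. x (?N + i))) y"
      by (rule average_cmult)
    also have "?av (\<lambda>x. ?F (\<lambda>i. x (?N + i))) y = average {0..<s} [0..<5 * n] ?F (\<lambda>i. y (?N + i))"
      by (rule average_shift)
    also have "of_bool (?bad T y) * \<dots> \<le> of_bool (?bad T y) * (1 / 2)"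
      by (rule mult_left_mono) (use bad_trial_average[OF assms] in auto)
    finally show "?av (\<lambda>x. of_bool (?bad (Suc T) x)) y \<le> (1 / 2) * of_bool (?bad T y)" by simp
  qed
  also have "\<dots> = (1 / 2) * average {0..<s} [0..<?N] (\<lambda>y. of_bool (?bad T y)) x0"
    by (rule average_cmult)
  also have "\<dots> \<le> (1 / 2) * (1 / 2) ^ T" using Suc by simp
  finally show ?case by simp
qed simp

section \<open>A structured language for the random access machine\<close>

datatype opd = Const int | Reg nat

text \<open>\<open>For i N c\<close> runs the body with \<open>i\<close> counting down from \<open>N - 1\<close> to \<open>0\<close>; \<open>Bits r t\<close> stores
  the length in bits of \<open>t\<close> in \<open>r\<close> and clears \<open>t\<close>; \<open>Ld r k i\<close> and \<open>St k i x\<close> access array \<open>k\<close> at the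
  index held in register \<open>i\<close>.\<close>

datatype com =
    Op nat binop opd opd
  | Ld nat nat nat
  | St nat nat opd
  | Inp nat opd
  | Flip nat
  | Seq com com (infixr ";;" 60)
  | IfP nat com
  | For nat nat com
  | Bits nat nat

record state =
  regs :: "nat \<Rightarrow> int"
  arr :: "nat \<Rightarrow> nat \<Rightarrow> int"
  cn :: nat

fun val :: "opd \<Rightarrow> state \<Rightarrow> int" where
  "val (Const k) s = k"
| "val (Reg r) s = regs s r"

definition set_reg :: "nat \<Rightarrow> int \<Rightarrow> state \<Rightarrow> state" where
  "set_reg r v s = s\<lparr>regs := (regs s)(r := v)\<rparr>"

lemma set_reg_simps [simp]:
  "regs (set_reg r v s) = (regs s)(r := v)" "arr (set_reg r v s) = arr s" "cn (set_reg r v s) = cn s"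
  by (simp_all add: set_reg_def)

primrec ev :: "int list \<Rightarrow> (nat \<Rightarrow> bool) \<Rightarrow> com \<Rightarrow> state \<Rightarrow> state" where
  "ev xs \<omega> (Op r f x y) s = set_reg r (arith f (val x s) (val y s)) s"
| "ev xs \<omega> (Ld r k i) s = set_reg r (arr s k (nat (regs s i))) s"
| "ev xs \<omega> (St k i x) s = s\<lparr>arr := (arr s)(k := (arr s k)(nat (regs s i) := val x s))\<rparr>"
| "ev xs \<omega> (Inp r x) s = set_reg r (input_at xs (val x s)) s"
| "ev xs \<omega> (Flip r) s = (set_reg r (of_bool (\<omega> (cn s))) s)\<lparr>cn := Suc (cn s)\<rparr>"
| "ev xs \<omega> (c ;; d) s = ev xs \<omega> d (ev xs \<omega> c s)"
| "ev xs \<omega> (IfP r c) s = (if regs s r > 0 then ev xs \<omega> c s else s)"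
| "ev xs \<omega> (For i N c) s =
     ((\<lambda>s. ev xs \<omega> c (set_reg i (regs s i - 1) s)) ^^ nat (regs s N)) (set_reg i (regs s N) s)"
| "ev xs \<omega> (Bits r t) s = set_reg t 0 (set_reg r (bitlen (regs s t)) s)"

primrec wr :: "com \<Rightarrow> nat set" where
  "wr (Op r f x y) = {r}"
| "wr (Ld r k i) = {r}"
| "wr (St k i x) = {}"
| "wr (Inp r x) = {r}"
| "wr (Flip r) = {r}"
| "wr (c ;; d) = wr c \<union> wr d"
| "wr (IfP r c) = wr c"
| "wr (For i N c) = insert i (wr c)"
| "wr (Bits r t) = {r, t}"

primrec awr :: "com \<Rightarrow> nat set" where
  "awr (Op r f x y) = {}"
| "awr (Ld r k i) = {}"
| "awr (St k i x) = {k}"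
| "awr (Inp r x) = {}"
| "awr (Flip r) = {}"
| "awr (c ;; d) = awr c \<union> awr d"
| "awr (IfP r c) = awr c"
| "awr (For i N c) = awr c"
| "awr (Bits r t) = {}"

primrec flips :: "com \<Rightarrow> bool" where
  "flips (Op r f x y) = False"
| "flips (Ld r k i) = False"
| "flips (St k i x) = False"
| "flips (Inp r x) = False"
| "flips (Flip r) = True"
| "flips (c ;; d) = (flips c \<or> flips d)"
| "flips (IfP r c) = flips c"
| "flips (For i N c) = flips c"
| "flips (Bits r t) = False"

lemma ev_frame:
  "(\<forall>r. r \<notin> wr c \<longrightarrow> regs (ev xs \<omega> c s) r = regs s r) \<and>
   (\<forall>k. k \<notin> awr c \<longrightarrow> arr (ev xs \<omega> c s) k = arr s k) \<and> (\<not> flips c \<longrightarrow> cn (ev xs \<omega> c s) = cn s)"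
proof (induction c arbitrary: s)
  case (For i N c)
  let ?F = "\<lambda>s. ev xs \<omega> c (set_reg i (regs s i - 1) s)"
  have "(\<forall>r. r \<notin> wr (For i N c) \<longrightarrow> regs ((?F ^^ k) s) r = regs s r) \<and>
    (\<forall>l. l \<notin> awr c \<longrightarrow> arr ((?F ^^ k) s) l = arr s l) \<and> (\<not> flips c \<longrightarrow> cn ((?F ^^ k) s) = cn s)" for k s
    using For by (induction k) simp_all
  then show ?case by simp
qed auto

lemma ev_regs: "r \<notin> wr c \<Longrightarrow> regs (ev xs \<omega> c s) r = regs s r"
  and ev_arr: "k \<notin> awr c \<Longrightarrow> arr (ev xs \<omega> c s) k = arr s k"
  and ev_cn: "\<not> flips c \<Longrightarrow> cn (ev xs \<omega> c s) = cn s"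
  using ev_frame by blast+

text \<open>Registers 0 to 3 may hold numbers of about \<open>n log (nU)\<close> bits, all other cells are short.\<close>

definition big :: "nat \<Rightarrow> bool" where "big r \<longleftrightarrow> r < 4"

fun bigo :: "opd \<Rightarrow> bool" where
  "bigo (Const k) = False"
| "bigo (Reg r) = big r"

fun wfo :: "opd \<Rightarrow> bool" where
  "wfo (Const k) = True"
| "wfo (Reg r) = (r < 63)"

text \<open>Products and divisions with two long operands are forbidden, as their schoolbook cost
  would be quadratic in \<open>n\<close>. Registers stay below 63, since cell 63 is kept for
  addresses; 16 is the stride of the interleaved arrays.\<close>

primrec wf :: "com \<Rightarrow> bool" where
  "wf (Op r f x y) = (r < 63 \<and> wfo x \<and> wfo y \<and> (f \<in> {Times, Quot, Rem} \<longrightarrow> \<not> (bigo x \<and> bigo y)))"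
| "wf (Ld r k i) = (r < 63 \<and> \<not> big r \<and> k < 16 \<and> i < 63 \<and> \<not> big i)"
| "wf (St k i x) = (k < 16 \<and> i < 63 \<and> \<not> big i \<and> wfo x \<and> \<not> bigo x)"
| "wf (Inp r x) = (r < 63 \<and> \<not> big r \<and> wfo x \<and> \<not> bigo x)"
| "wf (Flip r) = (r < 63 \<and> \<not> big r)"
| "wf (c ;; d) = (wf c \<and> wf d)"
| "wf (IfP r c) = (r < 63 \<and> wf c)"
| "wf (For i N c) = (i < 63 \<and> N < 63 \<and> \<not> big i \<and> \<not> big N \<and> i \<notin> wr c \<and> wf c)"
| "wf (Bits r t) = (r < 63 \<and> t < 63 \<and> \<not> big r \<and> \<not> big t \<and> r \<noteq> t)"

text \<open>Costs come in two units, \<open>w\<close> for an instruction on short numbers and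
  \<open>W\<close> for one that touches a long register. The bound follows the actual run because
  branches and loop lengths depend on the state.\<close>

primrec ct :: "int list \<Rightarrow> (nat \<Rightarrow> bool) \<Rightarrow> nat \<Rightarrow> nat \<Rightarrow> com \<Rightarrow> state \<Rightarrow> nat" where
  "ct xs \<omega> w W (Op r f x y) s = (if big r \<or> bigo x \<or> bigo y then W else w)"
| "ct xs \<omega> w W (Ld r k i) s = 3 * w"
| "ct xs \<omega> w W (St k i x) s = 3 * w"
| "ct xs \<omega> w W (Inp r x) s = w"
| "ct xs \<omega> w W (Flip r) s = w"
| "ct xs \<omega> w W (c ;; d) s = ct xs \<omega> w W c s + ct xs \<omega> w W d (ev xs \<omega> c s)"
| "ct xs \<omega> w W (IfP r c) s = 2 * (if big r then W else w) + (if regs s r > 0 then ct xs \<omega> w W c s else 0)"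
| "ct xs \<omega> w W (For i N c) s = 3 * w + (\<Sum>k<nat (regs s N). 4 * w +
     ct xs \<omega> w W c ((\<lambda>s. set_reg i (regs s i - 1) s)
       (((\<lambda>s. ev xs \<omega> c (set_reg i (regs s i - 1) s)) ^^ k) (set_reg i (regs s N) s))))"
| "ct xs \<omega> w W (Bits r t) s = 3 * w + nat (bitlen (regs s t)) * (4 * w)"

fun safeo :: "int \<Rightarrow> opd \<Rightarrow> bool" where
  "safeo X (Const k) = (\<bar>k\<bar> \<le> X)"
| "safeo X (Reg r) = True"

definition bnd :: "int \<Rightarrow> int \<Rightarrow> nat \<Rightarrow> int \<Rightarrow> bool" where
  "bnd X Y r v \<longleftrightarrow> \<bar>v\<bar> \<le> (if big r then Y else X)"

text \<open>Collected along the run, these bounds on written values and array indices limit the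
  lengths of all numbers, and thereby both the price of each instruction and the space.\<close>

primrec safe :: "int list \<Rightarrow> (nat \<Rightarrow> bool) \<Rightarrow> int \<Rightarrow> int \<Rightarrow> nat \<Rightarrow> com \<Rightarrow> state \<Rightarrow> bool" where
  "safe xs \<omega> X Y I (Op r f x y) s = (safeo X x \<and> safeo X y \<and> bnd X Y r (arith f (val x s) (val y s)))"
| "safe xs \<omega> X Y I (Ld r k i) s = (0 \<le> regs s i \<and> regs s i < int I)"
| "safe xs \<omega> X Y I (St k i x) s = (0 \<le> regs s i \<and> regs s i < int I \<and> safeo X x)"
| "safe xs \<omega> X Y I (Inp r x) s = (safeo X x \<and> \<bar>input_at xs (val x s)\<bar> \<le> X)"
| "safe xs \<omega> X Y I (Flip r) s = True"
| "safe xs \<omega> X Y I (c ;; d) s = (safe xs \<omega> X Y I c s \<and> safe xs \<omega> X Y I d (ev xs \<omega> c s))"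
| "safe xs \<omega> X Y I (IfP r c) s = (regs s r > 0 \<longrightarrow> safe xs \<omega> X Y I c s)"
| "safe xs \<omega> X Y I (For i N c) s = (\<forall>k<nat (regs s N).
     safe xs \<omega> X Y I c ((\<lambda>s. set_reg i (regs s i - 1) s)
       (((\<lambda>s. ev xs \<omega> c (set_reg i (regs s i - 1) s)) ^^ k) (set_reg i (regs s N) s))))"
| "safe xs \<omega> X Y I (Bits r t) s = (0 \<le> regs s t)"

fun cop :: "opd \<Rightarrow> operand" where
  "cop (Const k) = Lit k"
| "cop (Reg r) = Val (Cell r)"

text \<open>Register \<open>r\<close> lives in cell \<open>r\<close>, cell 63 holds computed addresses, and entry \<open>i\<close> of array \<open>k\<close>
  is cell \<open>64 + 16 i + k\<close>.\<close>

definition point :: "nat \<Rightarrow> nat \<Rightarrow> instr list" where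
  "point k i = [Arith (Cell 63) Times (Val (Cell i)) (Lit 16),
                Arith (Cell 63) Plus (Val (Cell 63)) (Lit (int (64 + k)))]"

primrec len :: "com \<Rightarrow> nat" where
  "len (Op r f x y) = 1"
| "len (Ld r k i) = 3"
| "len (St k i x) = 3"
| "len (Inp r x) = 1"
| "len (Flip r) = 1"
| "len (c ;; d) = len c + len d"
| "len (IfP r c) = 2 + len c"
| "len (For i N c) = 5 + len c"
| "len (Bits r t) = 6"

primrec comp :: "nat \<Rightarrow> com \<Rightarrow> instr list" where
  "comp a (Op r f x y) = [Arith (Cell r) f (cop x) (cop y)]"
| "comp a (Ld r k i) = point k i @ [Arith (Cell r) Plus (Val (CellAt 63)) (Lit 0)]"
| "comp a (St k i x) = point k i @ [Arith (CellAt 63) Plus (cop x) (Lit 0)]"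
| "comp a (Inp r x) = [Read_Input (Cell r) (cop x)]"
| "comp a (Flip r) = [Coin (Cell r)]"
| "comp a (c ;; d) = comp a c @ comp (a + len c) d"
| "comp a (IfP r c) = [Goto_If_Pos (Val (Cell r)) (a + 2), Goto (a + 2 + len c)] @ comp (a + 2) c"
| "comp a (For i N c) = [Arith (Cell i) Plus (Val (Cell N)) (Lit 0), Goto_If_Pos (Val (Cell i)) (a + 3),
     Goto (a + 5 + len c), Arith (Cell i) Minus (Val (Cell i)) (Lit 1)] @ comp (a + 4) c @ [Goto (a + 1)]"
| "comp a (Bits r t) = [Arith (Cell r) Plus (Lit 0) (Lit 0), Goto_If_Pos (Val (Cell t)) (a + 3),
     Goto (a + 6), Arith (Cell t) Quot (Val (Cell t)) (Lit 2), Arith (Cell r) Plus (Val (Cell r)) (Lit 1),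
     Goto (a + 1)]"

lemma length_comp [simp]: "length (comp a c) = len c"
  by (induction c arbitrary: a) (simp_all add: point_def)

definition code_at :: "program \<Rightarrow> nat \<Rightarrow> instr list \<Rightarrow> bool" where
  "code_at P a is \<longleftrightarrow> (\<forall>i<length is. a + i < length P \<and> P ! (a + i) = is ! i)"

lemma code_at_append: "code_at P a (is @ js) \<longleftrightarrow> code_at P a is \<and> code_at P (a + length is) js"
proof
  assume L: "code_at P a (is @ js)"
  show "code_at P a is \<and> code_at P (a + length is) js"
  proof (unfold code_at_def, intro conjI allI impI)
    fix i assume i: "i < length is"
    then show "a + i < length P" "P ! (a + i) = is ! i"
      using L[unfolded code_at_def, rule_format, of i] by (auto simp: nth_append)
  next
    fix i assume i: "i < length js"
    then show "a + length is + i < length P" "P ! (a + length is + i) = js ! i"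
      using L[unfolded code_at_def, rule_format, of "length is + i"] by (auto simp: nth_append add.assoc)
  qed
next
  assume R: "code_at P a is \<and> code_at P (a + length is) js"
  show "code_at P a (is @ js)"
  proof (unfold code_at_def, intro allI impI)
    fix i assume i: "i < length (is @ js)"
    show "a + i < length P \<and> P ! (a + i) = (is @ js) ! i"
    proof (cases "i < length is")
      case True
      then show ?thesis using R by (auto simp: code_at_def nth_append)
    next
      case False
      then have "i - length is < length js" "a + length is + (i - length is) = a + i" using i by auto
      then show ?thesis using R False unfolding code_at_def by (metis nth_append)
    qed
  qed
qed

lemma code_at_Cons: "code_at P a (i # is) \<longleftrightarrow> a < length P \<and> P ! a = i \<and> code_at P (Suc a) is"
  using code_at_append[of P a "[i]" "is"] by (simp add: code_at_def)

lemma code_at_Nil [simp]: "code_at P a []"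
  by (simp add: code_at_def)

section \<open>Correctness of the compiler\<close>

lemma nbits_mono: "\<bar>a\<bar> \<le> \<bar>b\<bar> \<Longrightarrow> nbits a \<le> nbits b"
  unfolding nbits_def bitlen_def by (simp add: floorlog_mono nat_mono)

lemma nbits_le: "\<bar>a\<bar> \<le> X \<Longrightarrow> nbits a \<le> nbits X"
  by (rule nbits_mono) simp

lemma nbits_ge_2: "x \<noteq> 0 \<Longrightarrow> 2 \<le> nbits x"
  using bitlen_eq_zero_iff[of "\<bar>x\<bar>"] bitlen_nonneg[of "\<bar>x\<bar>"] unfolding nbits_def by linarith

definition minv :: "int \<Rightarrow> int \<Rightarrow> nat \<Rightarrow> (nat \<Rightarrow> int) \<Rightarrow> bool" where
  "minv X Y I m \<longleftrightarrow> (\<forall>a. bnd X Y a (m a) \<and> (64 + 16 * I \<le> a \<longrightarrow> m a = 0))"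

text \<open>Besides the final configuration this records the cost and a memory bound at every
  intermediate step, because space is charged by the maximum over the whole run.\<close>

definition path :: "program \<Rightarrow> int list \<Rightarrow> (nat \<Rightarrow> bool) \<Rightarrow> int \<Rightarrow> int \<Rightarrow> nat \<Rightarrow> nat \<Rightarrow> config \<Rightarrow> config \<Rightarrow> bool" where
  "path P xs \<omega> X Y I \<kappa> \<sigma> \<sigma>' \<longleftrightarrow> (\<exists>t. (step P xs \<omega> ^^ t) \<sigma> = \<sigma>' \<and>
     (\<Sum>j<t. step_cost P xs ((step P xs \<omega> ^^ j) \<sigma>)) \<le> \<kappa> \<and>
     (\<forall>j\<le>t. minv X Y I (mem ((step P xs \<omega> ^^ j) \<sigma>))))"

lemma path_trans:
  assumes "path P xs \<omega> X Y I k1 \<sigma> \<sigma>'" "path P xs \<omega> X Y I k2 \<sigma>' \<sigma>''" "k1 + k2 \<le> k"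
  shows "path P xs \<omega> X Y I k \<sigma> \<sigma>''"
proof -
  let ?f = "step P xs \<omega>"
  obtain t where t: "(?f ^^ t) \<sigma> = \<sigma>'" "(\<Sum>j<t. step_cost P xs ((?f ^^ j) \<sigma>)) \<le> k1"
      "\<forall>j\<le>t. minv X Y I (mem ((?f ^^ j) \<sigma>))"
    using assms(1) unfolding path_def by blast
  obtain u where u: "(?f ^^ u) \<sigma>' = \<sigma>''" "(\<Sum>j<u. step_cost P xs ((?f ^^ j) \<sigma>')) \<le> k2"
      "\<forall>j\<le>u. minv X Y I (mem ((?f ^^ j) \<sigma>'))"
    using assms(2) unfolding path_def by blast
  have shift: "(?f ^^ (t + j)) \<sigma> = (?f ^^ j) \<sigma>'" for j
    using t(1) by (metis add.commute comp_apply funpow_add)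
  have "{..<t + u} = {..<t} \<union> (+) t ` {..<u}"
  proof -
    have "j \<in> {..<t + u} \<longleftrightarrow> j \<in> {..<t} \<union> (+) t ` {..<u}" for j
      by (cases "j < t") (auto intro: image_eqI[of _ _ "j - t"])
    then show ?thesis by blast
  qed
  then have "(\<Sum>j<t + u. step_cost P xs ((?f ^^ j) \<sigma>))
      = (\<Sum>j<t. step_cost P xs ((?f ^^ j) \<sigma>)) + (\<Sum>j\<in>(+) t ` {..<u}. step_cost P xs ((?f ^^ j) \<sigma>))"
    by (simp only:) (rule sum.union_disjoint, auto)
  also have "(\<Sum>j\<in>(+) t ` {..<u}. step_cost P xs ((?f ^^ j) \<sigma>)) = (\<Sum>j<u. step_cost P xs ((?f ^^ j) \<sigma>'))"
    by (subst sum.reindex) (auto simp: shift)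
  finally have cost: "(\<Sum>j<t + u. step_cost P xs ((?f ^^ j) \<sigma>)) \<le> k"
    using t(2) u(2) assms(3) by linarith
  have "minv X Y I (mem ((?f ^^ j) \<sigma>))" if "j \<le> t + u" for j
  proof (cases "j \<le> t")
    case False
    then have "minv X Y I (mem ((?f ^^ (t + (j - t))) \<sigma>))"
      unfolding shift using u(3) that by simp
    then show ?thesis using False by simp
  qed (use t in simp)
  then show ?thesis unfolding path_def using cost shift[of u] u(1) by blast
qed

lemma path_step:
  assumes "minv X Y I (mem \<sigma>)" "pc \<sigma> < length P" "P ! pc \<sigma> = i"
    "instr_cost xs i (mem \<sigma>) \<le> k" "minv X Y I (mem (exec xs \<omega> i \<sigma>))"
  shows "path P xs \<omega> X Y I k \<sigma> (exec xs \<omega> i \<sigma>)"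
proof -
  have "step P xs \<omega> \<sigma> = exec xs \<omega> i \<sigma>" "step_cost P xs \<sigma> = instr_cost xs i (mem \<sigma>)"
    using assms by (simp_all add: step_def step_cost_def halted_def)
  then show ?thesis unfolding path_def
    using assms by (intro exI[of _ 1]) (auto simp: le_Suc_eq)
qed

definition binv :: "int \<Rightarrow> int \<Rightarrow> nat \<Rightarrow> state \<Rightarrow> bool" where
  "binv X Y I s \<longleftrightarrow> (\<forall>r<63. bnd X Y r (regs s r)) \<and>
     (\<forall>k<16. \<forall>i. \<bar>arr s k i\<bar> \<le> X \<and> (I \<le> i \<longrightarrow> arr s k i = 0))"

text \<open>Cell 63 has no counterpart in the structured state; only the size of its content is
  constrained.\<close>

definition rep :: "int \<Rightarrow> int \<Rightarrow> nat \<Rightarrow> state \<Rightarrow> nat \<Rightarrow> config \<Rightarrow> bool" where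
  "rep X Y I s a \<sigma> \<longleftrightarrow> binv X Y I s \<and> pc \<sigma> = a \<and> coins \<sigma> = cn s \<and> \<bar>mem \<sigma> 63\<bar> \<le> X \<and>
     (\<forall>r<63. mem \<sigma> r = regs s r) \<and> (\<forall>k<16. \<forall>i. mem \<sigma> (64 + 16 * i + k) = arr s k i)"

lemma rep_minv:
  assumes "rep X Y I s a \<sigma>"
  shows "minv X Y I (mem \<sigma>)"
  unfolding minv_def
proof
  fix b :: nat
  consider "b < 63" | "b = 63" | "b \<ge> 64" by linarith
  then show "bnd X Y b (mem \<sigma> b) \<and> (64 + 16 * I \<le> b \<longrightarrow> mem \<sigma> b = 0)"
  proof cases
    case 3
    define i k where "i = (b - 64) div 16" and "k = (b - 64) mod 16"
    have b: "b = 64 + 16 * i + k" "k < 16" using 3 by (auto simp: i_def k_def)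
    have "64 + 16 * I \<le> b \<longrightarrow> I \<le> i" using b by linarith
    then show ?thesis using assms b by (auto simp: rep_def binv_def bnd_def big_def)
  qed (use assms in \<open>auto simp: rep_def binv_def bnd_def big_def\<close>)
qed

lemma rep_set_reg:
  assumes "rep X Y I s a \<sigma>" "r < 63" "bnd X Y r v"
  shows "rep X Y I (set_reg r v s) b (\<sigma>\<lparr>pc := b, mem := (mem \<sigma>)(r := v)\<rparr>)"
  using assms by (auto simp: rep_def binv_def)

text \<open>\<open>X\<close> exceeds every cell address in use and the constants that form
  addresses, so addresses count as short numbers.\<close>

locale ram =
  fixes P :: program and xs :: "int list" and \<omega> :: "nat \<Rightarrow> bool" and X Y :: int and I :: nat
  assumes X: "64 + 16 * int (I + 1) \<le> X" and XY: "X \<le> Y"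
begin

text \<open>An instruction involves a bounded number of lengths and at most one product of lengths.
  Lengths of the bounds are at least 2, so each length is at most half of a product; 12 leaves slack
  for the sum.\<close>

definition w :: nat where "w = 12 * (nbits X * nbits X)"
definition W :: nat where "W = 12 * (nbits X * nbits Y)"

abbreviation "\<beta> \<equiv> nbits X"
abbreviation "\<gamma> \<equiv> nbits Y"

lemma bits: "2 \<le> \<beta>" "\<beta> \<le> \<gamma>" "2 * \<beta> \<le> \<beta> * \<beta>" "4 \<le> \<beta> * \<beta>" "2 * \<gamma> \<le> \<beta> * \<gamma>" "\<beta> * \<beta> \<le> \<beta> * \<gamma>"
proof -
  show 1: "2 \<le> \<beta>" using X by (intro nbits_ge_2) auto
  show 2: "\<beta> \<le> \<gamma>" using X XY by (intro nbits_mono) auto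
  show "2 * \<beta> \<le> \<beta> * \<beta>" "2 * \<gamma> \<le> \<beta> * \<gamma>" using 1 by (auto intro: mult_right_mono)
  show "4 \<le> \<beta> * \<beta>" using mult_mono[OF 1 1] by simp
  show "\<beta> * \<beta> \<le> \<beta> * \<gamma>" using 2 by simp
qed

lemma w_le_W: "w \<le> W"
  using bits(6) by (simp add: w_def W_def)

lemma nbits_small: "\<bar>a\<bar> \<le> X \<Longrightarrow> nbits a \<le> \<beta>"
  by (rule nbits_le)

lemma nbits_idx: "r < 64 \<Longrightarrow> nbits (int r) \<le> \<beta>"
  using X by (intro nbits_small) auto

lemma nbits_mem: "minv X Y I m \<Longrightarrow> nbits (m a) \<le> (if big a then \<gamma> else \<beta>)"
  unfolding minv_def bnd_def by (cases "big a"; simp; metis nbits_le)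

lemma operand_cost_cop:
  assumes "minv X Y I m" "safeo X x" "wfo x"
  shows "operand_cost m (cop x) \<le> \<beta> + (if bigo x then \<gamma> else \<beta>)"
proof (cases x)
  case (Const k)
  then show ?thesis using assms nbits_small[of k] by simp
next
  case (Reg r)
  then have "nbits (int r) \<le> \<beta>" "nbits (m r) \<le> (if bigo x then \<gamma> else \<beta>)"
    using assms nbits_idx[of r] nbits_mem[OF assms(1), of r] by auto
  then show ?thesis using Reg by (simp only: cop.simps operand_cost.simps address_cost.simps address.simps)
qed

lemma nbits_cop:
  assumes "minv X Y I m" "safeo X x" "wfo x"
  shows "nbits (operand_value m (cop x)) \<le> (if bigo x then \<gamma> else \<beta>)"
  using assms nbits_small nbits_mem[OF assms(1)] by (cases x) auto

lemma op_cost: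
  assumes m: "minv X Y I m" and s: "safeo X x" "safeo X y" and wf: "wf (Op r f x y)"
  shows "instr_cost xs (Arith (Cell r) f (cop x) (cop y)) m \<le> (if big r \<or> bigo x \<or> bigo y then W else w)"
proof -
  define a where "a = (if bigo x then \<gamma> else \<beta>)"
  define b where "b = (if bigo y then \<gamma> else \<beta>)"
  let ?nx = "nbits (operand_value m (cop x))" and ?ny = "nbits (operand_value m (cop y))"
  have nx: "?nx \<le> a" and ny: "?ny \<le> b"
    using nbits_cop m s wf by (auto simp: a_def b_def)
  have r: "nbits (int r) \<le> \<beta>" using wf by (intro nbits_idx) auto
  have c: "operand_cost m (cop x) \<le> \<beta> + a" "operand_cost m (cop y) \<le> \<beta> + b"
    using operand_cost_cop m s wf by (auto simp: a_def b_def)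
  have mult: "?nx * ?ny \<le> a * b" using nx ny by (rule mult_mono) auto
  have ar: "arith_cost f (operand_value m (cop x)) (operand_value m (cop y)) \<le> a + b
      \<or> f \<in> {Times, Quot, Rem} \<and> arith_cost f (operand_value m (cop x)) (operand_value m (cop y)) \<le> a * b"
    using nx ny mult by (cases f) auto
  have "instr_cost xs (Arith (Cell r) f (cop x) (cop y)) m
      \<le> 3 * \<beta> + a + b + arith_cost f (operand_value m (cop x)) (operand_value m (cop y))"
    using r c by simp
  also have "\<dots> \<le> (if bigo x \<or> bigo y then W else w)"
  proof (cases "bigo x \<or> bigo y")
    case True
    have "a \<le> \<gamma>" "b \<le> \<gamma>" using bits by (auto simp: a_def b_def)
    moreover have "f \<in> {Times, Quot, Rem} \<Longrightarrow> a * b \<le> \<beta> * \<gamma>"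
      using wf True by (auto simp: a_def b_def)
    ultimately have "arith_cost f (operand_value m (cop x)) (operand_value m (cop y)) \<le> 2 * (\<beta> * \<gamma>)"
      using ar bits by (elim disjE conjE) linarith+
    then have "3 * \<beta> + a + b + arith_cost f (operand_value m (cop x)) (operand_value m (cop y)) \<le> W"
      using \<open>a \<le> \<gamma>\<close> \<open>b \<le> \<gamma>\<close> bits unfolding W_def by linarith
    then show ?thesis using True by simp
  next
    case False
    then have ab: "a = \<beta>" "b = \<beta>" by (auto simp: a_def b_def)
    then have "arith_cost f (operand_value m (cop x)) (operand_value m (cop y)) \<le> 2 * (\<beta> * \<beta>)"
      using ar[unfolded ab] bits by (elim disjE conjE) linarith+
    then have "3 * \<beta> + a + b + arith_cost f (operand_value m (cop x)) (operand_value m (cop y)) \<le> w"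
      unfolding ab w_def using bits by linarith
    then show ?thesis using False by simp
  qed
  also have "\<dots> \<le> (if big r \<or> bigo x \<or> bigo y then W else w)" using w_le_W by auto
  finally show ?thesis .
qed

lemma op_step:
  assumes "rep X Y I s a \<sigma>" "a < length P" "P ! a = Arith (Cell r) f (cop x) (cop y)"
    "wf (Op r f x y)" "safe xs \<omega> X Y I (Op r f x y) s"
  shows "\<exists>\<sigma>'. path P xs \<omega> X Y I (ct xs \<omega> w W (Op r f x y) s) \<sigma> \<sigma>' \<and>
    rep X Y I (set_reg r (arith f (val x s) (val y s)) s) (Suc a) \<sigma>'"
proof -
  have pc: "pc \<sigma> = a" using assms(1) by (simp add: rep_def)
  have val: "operand_value (mem \<sigma>) (cop z) = val z s" if "wfo z" for z
    using that assms(1) by (cases z) (auto simp: rep_def)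
  let ?i = "Arith (Cell r) f (cop x) (cop y)"
  have ex: "exec xs \<omega> ?i \<sigma> = \<sigma>\<lparr>pc := Suc a, mem := (mem \<sigma>)(r := arith f (val x s) (val y s))\<rparr>"
    using val assms(4) pc by simp
  have rep: "rep X Y I (set_reg r (arith f (val x s) (val y s)) s) (Suc a) (exec xs \<omega> ?i \<sigma>)"
    unfolding ex by (rule rep_set_reg[OF assms(1)]) (use assms(4,5) in auto)
  have "path P xs \<omega> X Y I (ct xs \<omega> w W (Op r f x y) s) \<sigma> (exec xs \<omega> ?i \<sigma>)"
    using assms pc rep_minv[OF rep] rep_minv[OF assms(1)] op_cost[OF rep_minv[OF assms(1)], of x y r f]
    by (intro path_step) auto
  then show ?thesis using rep by blast
qed

lemma pos_step:
  assumes "rep X Y I s a \<sigma>" "a < length P" "P ! a = Goto_If_Pos (Val (Cell r)) l" "r < 63"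
  shows "\<exists>\<sigma>'. path P xs \<omega> X Y I (if big r then W else w) \<sigma> \<sigma>' \<and>
    rep X Y I s (if regs s r > 0 then l else Suc a) \<sigma>'"
proof -
  have pc: "pc \<sigma> = a" using assms(1) by (simp add: rep_def)
  let ?i = "Goto_If_Pos (Val (Cell r)) l"
  have rep: "rep X Y I s (if regs s r > 0 then l else Suc a) (exec xs \<omega> ?i \<sigma>)"
    using assms(1,4) pc by (auto simp: rep_def)
  have "instr_cost xs ?i (mem \<sigma>) \<le> \<beta> + (if big r then \<gamma> else \<beta>) + 1"
    using nbits_idx[of r] nbits_mem[OF rep_minv[OF assms(1)], of r] assms(4) by auto
  also have "\<dots> \<le> (if big r then W else w)"
    using bits unfolding w_def W_def by (cases "big r"; simp only: if_True if_False; linarith)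
  finally have "path P xs \<omega> X Y I (if big r then W else w) \<sigma> (exec xs \<omega> ?i \<sigma>)"
    using assms pc rep_minv[OF rep] rep_minv[OF assms(1)] by (intro path_step) auto
  then show ?thesis using rep by blast
qed

lemma goto_step:
  assumes "rep X Y I s a \<sigma>" "a < length P" "P ! a = Goto l"
  shows "\<exists>\<sigma>'. path P xs \<omega> X Y I w \<sigma> \<sigma>' \<and> rep X Y I s l \<sigma>'"
proof -
  have pc: "pc \<sigma> = a" using assms(1) by (simp add: rep_def)
  have rep: "rep X Y I s l (exec xs \<omega> (Goto l) \<sigma>)"
    using assms(1) pc by (auto simp: rep_def)
  have "instr_cost xs (Goto l) (mem \<sigma>) \<le> w" using bits unfolding w_def by simp
  then have "path P xs \<omega> X Y I w \<sigma> (exec xs \<omega> (Goto l) \<sigma>)"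
    using assms pc rep_minv[OF rep] rep_minv[OF assms(1)] by (intro path_step) auto
  then show ?thesis using rep by blast
qed

lemma point_steps:
  assumes rep: "rep X Y I s a \<sigma>" and code: "code_at P a (point k i)"
    and k: "k < 16" and i: "i < 63" "\<not> big i" and idx: "0 \<le> regs s i" "regs s i < int I"
  shows "\<exists>\<sigma>'. path P xs \<omega> X Y I (2 * w) \<sigma> \<sigma>' \<and> rep X Y I s (a + 2) \<sigma>' \<and>
    mem \<sigma>' 63 = 64 + 16 * regs s i + int k"
proof -
  have pc: "pc \<sigma> = a" using rep by (simp add: rep_def)
  let ?i1 = "Arith (Cell 63) Times (Val (Cell i)) (Lit 16)"
  let ?i2 = "Arith (Cell 63) Plus (Val (Cell 63)) (Lit (int (64 + k)))"
  have code': "a < length P" "P ! a = ?i1" "Suc a < length P" "P ! Suc a = ?i2"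
    using code unfolding point_def by (auto simp: code_at_Cons)
  define \<sigma>1 where "\<sigma>1 = exec xs \<omega> ?i1 \<sigma>"
  define \<sigma>2 where "\<sigma>2 = exec xs \<omega> ?i2 \<sigma>1"
  have mi: "mem \<sigma> i = regs s i" using rep i by (simp add: rep_def)
  have m1: "mem \<sigma>1 = (mem \<sigma>)(63 := regs s i * 16)" "pc \<sigma>1 = Suc a"
    unfolding \<sigma>1_def using mi pc by simp_all
  have m2: "mem \<sigma>2 63 = 64 + 16 * regs s i + int k" unfolding \<sigma>2_def using m1 by simp
  have b1: "\<bar>regs s i * 16\<bar> \<le> X" using idx X by simp
  have b2: "\<bar>64 + 16 * regs s i + int k\<bar> \<le> X" using idx X k by simp
  have rep1: "rep X Y I s (Suc a) \<sigma>1"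
    using rep b1 pc mi unfolding \<sigma>1_def rep_def by auto
  have rep2: "rep X Y I s (a + 2) \<sigma>2"
    using rep1 b2 m1 unfolding \<sigma>2_def rep_def by auto
  have n63: "nbits 63 \<le> \<beta>" using nbits_idx[of 63] by simp
  have n16: "nbits 16 \<le> \<beta>" using nbits_idx[of 16] by simp
  have nk: "nbits (64 + int k) \<le> \<beta>" using X k by (intro nbits_small) auto
  have ni: "nbits (int i) \<le> \<beta>" using i by (intro nbits_idx) auto
  have nri: "nbits (regs s i) \<le> \<beta>" using idx X by (intro nbits_small) auto
  have n1: "nbits (regs s i * 16) \<le> \<beta>" using b1 by (rule nbits_small)
  have "nbits (regs s i) * nbits 16 \<le> \<beta> * \<beta>" using nri n16 by (intro mult_mono) auto
  then have "instr_cost xs ?i1 (mem \<sigma>) \<le> \<beta> + (\<beta> + \<beta>) + \<beta> + \<beta> * \<beta>"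
    using n63 ni nri n16 by (simp add: mi)
  also have "\<dots> \<le> w" using bits unfolding w_def by linarith
  finally have p1: "path P xs \<omega> X Y I w \<sigma> \<sigma>1"
    unfolding \<sigma>1_def using code' pc rep_minv[OF rep] rep_minv[OF rep1, unfolded \<sigma>1_def]
    by (intro path_step) auto
  have "instr_cost xs ?i2 (mem \<sigma>1) \<le> \<beta> + (\<beta> + \<beta>) + \<beta> + (\<beta> + \<beta>)"
    using n63 nk n1 by (simp add: m1)
  also have "\<dots> \<le> w" using bits unfolding w_def by linarith
  finally have p2: "path P xs \<omega> X Y I w \<sigma>1 \<sigma>2"
    unfolding \<sigma>2_def using code' m1 rep_minv[OF rep1] rep_minv[OF rep2, unfolded \<sigma>2_def]
    by (intro path_step) auto
  have "path P xs \<omega> X Y I (2 * w) \<sigma> \<sigma>2" by (rule path_trans[OF p1 p2]) simp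
  then show ?thesis using rep2 m2 by blast
qed

lemma ld_step:
  assumes rep: "rep X Y I s a \<sigma>" and code: "code_at P a (comp a (Ld r k i))"
    and wf: "wf (Ld r k i)" and safe: "safe xs \<omega> X Y I (Ld r k i) s"
  shows "\<exists>\<sigma>'. path P xs \<omega> X Y I (3 * w) \<sigma> \<sigma>' \<and> rep X Y I (ev xs \<omega> (Ld r k i) s) (a + 3) \<sigma>'"
proof -
  have c1: "code_at P a (point k i)" and c2: "a + 2 < length P"
      "P ! (a + 2) = Arith (Cell r) Plus (Val (CellAt 63)) (Lit 0)"
    using code by (auto simp: code_at_append point_def code_at_Cons)
  obtain \<sigma>1 where p1: "path P xs \<omega> X Y I (2 * w) \<sigma> \<sigma>1" and rep1: "rep X Y I s (a + 2) \<sigma>1"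
    and m: "mem \<sigma>1 63 = 64 + 16 * regs s i + int k"
    using point_steps[OF rep c1] wf safe by auto
  let ?i = "Arith (Cell r) Plus (Val (CellAt 63)) (Lit 0)"
  let ?v = "arr s k (nat (regs s i))"
  have ad: "nat (mem \<sigma>1 63) = 64 + 16 * nat (regs s i) + k" using m safe by (simp add: nat_add_distrib nat_mult_distrib)
  have val: "mem \<sigma>1 (nat (mem \<sigma>1 63)) = ?v" unfolding ad using rep1 wf by (simp add: rep_def)
  have v: "\<bar>?v\<bar> \<le> X" using rep wf by (simp add: rep_def binv_def)
  have pc: "pc \<sigma>1 = a + 2" using rep1 by (simp add: rep_def)
  have ex: "exec xs \<omega> ?i \<sigma>1 = \<sigma>1\<lparr>pc := a + 3, mem := (mem \<sigma>1)(r := ?v)\<rparr>"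
    using val pc by simp
  have rep2: "rep X Y I (ev xs \<omega> (Ld r k i) s) (a + 3) (exec xs \<omega> ?i \<sigma>1)"
    unfolding ex ev.simps by (rule rep_set_reg[OF rep1]) (use wf v in \<open>auto simp: bnd_def\<close>)
  have nr: "nbits (int r) \<le> \<beta>" using wf by (intro nbits_idx) auto
  have n63: "nbits 63 \<le> \<beta>" using nbits_idx[of 63] by simp
  have n0: "nbits 0 \<le> \<beta>" using X by (intro nbits_small) auto
  have np: "nbits (mem \<sigma>1 63) \<le> \<beta>" using rep1 by (intro nbits_small) (simp add: rep_def)
  have nv: "nbits ?v \<le> \<beta>" using v by (rule nbits_small)
  have "instr_cost xs ?i (mem \<sigma>1) \<le> \<beta> + (\<beta> + \<beta> + \<beta>) + \<beta> + (\<beta> + \<beta>)"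
    using nr n63 n0 np nv by (simp add: val)
  also have "\<dots> \<le> w" using bits unfolding w_def by linarith
  finally have "path P xs \<omega> X Y I w \<sigma>1 (exec xs \<omega> ?i \<sigma>1)"
    using c2 pc rep_minv[OF rep1] rep_minv[OF rep2] by (intro path_step) auto
  then have "path P xs \<omega> X Y I (3 * w) \<sigma> (exec xs \<omega> ?i \<sigma>1)" by (rule path_trans[OF p1]) simp
  then show ?thesis using rep2 by blast
qed

lemma st_step:
  assumes rep: "rep X Y I s a \<sigma>" and code: "code_at P a (comp a (St k i x))"
    and wf: "wf (St k i x)" and safe: "safe xs \<omega> X Y I (St k i x) s"
  shows "\<exists>\<sigma>'. path P xs \<omega> X Y I (3 * w) \<sigma> \<sigma>' \<and> rep X Y I (ev xs \<omega> (St k i x) s) (a + 3) \<sigma>'"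
proof -
  have c1: "code_at P a (point k i)" and c2: "a + 2 < length P"
      "P ! (a + 2) = Arith (CellAt 63) Plus (cop x) (Lit 0)"
    using code by (auto simp: code_at_append point_def code_at_Cons)
  obtain \<sigma>1 where p1: "path P xs \<omega> X Y I (2 * w) \<sigma> \<sigma>1" and rep1: "rep X Y I s (a + 2) \<sigma>1"
    and m: "mem \<sigma>1 63 = 64 + 16 * regs s i + int k"
    using point_steps[OF rep c1] wf safe by auto
  let ?i = "Arith (CellAt 63) Plus (cop x) (Lit 0)"
  define j where "j = nat (regs s i)"
  have j: "j < I" using safe by (auto simp: j_def)
  have ad: "nat (mem \<sigma>1 63) = 64 + 16 * j + k" using m safe by (simp add: j_def nat_add_distrib nat_mult_distrib)
  have val: "operand_value (mem \<sigma>1) (cop x) = val x s"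
    using rep1 wf by (cases x) (auto simp: rep_def)
  have v: "\<bar>val x s\<bar> \<le> X" using rep wf safe by (cases x) (auto simp: rep_def binv_def bnd_def)
  have pc: "pc \<sigma>1 = a + 2" using rep1 by (simp add: rep_def)
  have ex: "exec xs \<omega> ?i \<sigma>1 = \<sigma>1\<lparr>pc := a + 3, mem := (mem \<sigma>1)(64 + 16 * j + k := val x s)\<rparr>"
    using val pc ad by simp
  \<comment> \<open>The interleaving is injective for array numbers below 16, so the store disturbs
    no other entry of any array.\<close>
  have inj: "64 + 16 * i' + k' = 64 + 16 * j + k \<longleftrightarrow> i' = j \<and> k' = k" if "k' < 16" for i' k' :: nat
  proof -
    have "k < 16" using wf by simp
    then show ?thesis using that by presburger
  qed
  have rep2: "rep X Y I (ev xs \<omega> (St k i x) s) (a + 3) (exec xs \<omega> ?i \<sigma>1)"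
    using rep1 v j wf inj unfolding ex ev.simps rep_def binv_def j_def[symmetric] by auto
  have n63: "nbits 63 \<le> \<beta>" using nbits_idx[of 63] by simp
  have n0: "nbits 0 \<le> \<beta>" using X by (intro nbits_small) auto
  have np: "nbits (mem \<sigma>1 63) \<le> \<beta>" using rep1 by (intro nbits_small) (simp add: rep_def)
  have nv: "nbits (val x s) \<le> \<beta>" using v by (rule nbits_small)
  have nx: "operand_cost (mem \<sigma>1) (cop x) \<le> \<beta> + \<beta>"
    using operand_cost_cop[OF rep_minv[OF rep1], of x] wf safe by auto
  have "instr_cost xs ?i (mem \<sigma>1) \<le> (\<beta> + \<beta>) + (\<beta> + \<beta>) + \<beta> + (\<beta> + \<beta>)"
    using n63 n0 np nv nx by (simp add: val)
  also have "\<dots> \<le> w" using bits unfolding w_def by linarith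
  finally have "path P xs \<omega> X Y I w \<sigma>1 (exec xs \<omega> ?i \<sigma>1)"
    using c2 pc rep_minv[OF rep1] rep_minv[OF rep2] by (intro path_step) auto
  then have "path P xs \<omega> X Y I (3 * w) \<sigma> (exec xs \<omega> ?i \<sigma>1)" by (rule path_trans[OF p1]) simp
  then show ?thesis using rep2 by blast
qed

lemma inp_step:
  assumes rep: "rep X Y I s a \<sigma>" and code: "code_at P a (comp a (Inp r x))"
    and wf: "wf (Inp r x)" and safe: "safe xs \<omega> X Y I (Inp r x) s"
  shows "\<exists>\<sigma>'. path P xs \<omega> X Y I w \<sigma> \<sigma>' \<and> rep X Y I (ev xs \<omega> (Inp r x) s) (a + 1) \<sigma>'"
proof -
  let ?i = "Read_Input (Cell r) (cop x)"
  have c: "a < length P" "P ! a = ?i" using code by (auto simp: code_at_Cons)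
  have pc: "pc \<sigma> = a" using rep by (simp add: rep_def)
  have val: "operand_value (mem \<sigma>) (cop x) = val x s"
    using rep wf by (cases x) (auto simp: rep_def)
  have rep2: "rep X Y I (ev xs \<omega> (Inp r x) s) (a + 1) (exec xs \<omega> ?i \<sigma>)"
    using rep_set_reg[OF rep, of r "input_at xs (val x s)" "Suc a"] wf safe val pc by (simp add: bnd_def)
  have "instr_cost xs ?i (mem \<sigma>) \<le> \<beta> + (\<beta> + \<beta>) + \<beta>"
    using operand_cost_cop[OF rep_minv[OF rep], of x] wf safe nbits_idx[of r]
      nbits_small[of "input_at xs (val x s)"] val by auto
  also have "\<dots> \<le> w" using bits unfolding w_def by linarith
  finally have "path P xs \<omega> X Y I w \<sigma> (exec xs \<omega> ?i \<sigma>)"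
    using c pc rep_minv[OF rep] rep_minv[OF rep2] by (intro path_step) auto
  then show ?thesis using rep2 by blast
qed

lemma flip_step:
  assumes rep: "rep X Y I s a \<sigma>" and code: "code_at P a (comp a (Flip r))" and wf: "wf (Flip r)"
  shows "\<exists>\<sigma>'. path P xs \<omega> X Y I w \<sigma> \<sigma>' \<and> rep X Y I (ev xs \<omega> (Flip r) s) (a + 1) \<sigma>'"
proof -
  let ?i = "Coin (Cell r)"
  have c: "a < length P" "P ! a = ?i" using code by (auto simp: code_at_Cons)
  have pc: "pc \<sigma> = a" using rep by (simp add: rep_def)
  have rep2: "rep X Y I (ev xs \<omega> (Flip r) s) (a + 1) (exec xs \<omega> ?i \<sigma>)"
    using rep wf X by (auto simp: rep_def binv_def bnd_def)
  have "instr_cost xs ?i (mem \<sigma>) \<le> \<beta> + 1" using nbits_idx[of r] wf by auto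
  also have "\<dots> \<le> w" using bits unfolding w_def by linarith
  finally have "path P xs \<omega> X Y I w \<sigma> (exec xs \<omega> ?i \<sigma>)"
    using c pc rep_minv[OF rep] rep_minv[OF rep2] by (intro path_step) auto
  then show ?thesis using rep2 by blast
qed

end

lemma state_eqI: "regs s = regs s' \<Longrightarrow> arr s = arr s' \<Longrightarrow> cn s = cn s' \<Longrightarrow> s = (s' :: state)"
  by (cases s, cases s') simp

lemma bitlen_le_self: "0 \<le> v \<Longrightarrow> bitlen v \<le> v"
proof -
  assume v: "0 \<le> v"
  have "v < 2 ^ nat v"
    by (metis v less_exp of_nat_less_numeral_power_cancel_iff nat_0_le)
  then show "bitlen v \<le> v" using v by (simp add: bitlen_le_iff_power)
qed

context ram
begin

lemma rep_bnd: "rep X Y I s a \<sigma> \<Longrightarrow> r < 63 \<Longrightarrow> bnd X Y r (regs s r)"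
  by (simp add: rep_def binv_def)

text \<open>Induction on the value being halved. A round takes four instructions, whence
  \<open>4 * w\<close> per bit; the last test and the jump out account for
  \<open>2 * w\<close>.\<close>

lemma bits_loop:
  assumes code: "code_at P a (comp a (Bits r t))" and wf: "wf (Bits r t)"
  shows "rep X Y I s (a + 1) \<sigma> \<Longrightarrow> regs s t = v \<Longrightarrow> 0 \<le> v \<Longrightarrow> 0 \<le> regs s r \<Longrightarrow> regs s r + bitlen v \<le> X \<Longrightarrow>
    \<exists>\<sigma>'. path P xs \<omega> X Y I (2 * w + nat (bitlen v) * (4 * w)) \<sigma> \<sigma>' \<and>
      rep X Y I (set_reg t 0 (set_reg r (regs s r + bitlen v) s)) (a + 6) \<sigma>'"
proof (induction "nat v" arbitrary: v s \<sigma> rule: less_induct)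
  case less
  have c: "a + 1 < length P" "P ! (a + 1) = Goto_If_Pos (Val (Cell t)) (a + 3)"
    "a + 2 < length P" "P ! (a + 2) = Goto (a + 6)"
    "a + 3 < length P" "P ! (a + 3) = Arith (Cell t) Quot (Val (Cell t)) (Lit 2)"
    "a + 4 < length P" "P ! (a + 4) = Arith (Cell r) Plus (Val (Cell r)) (Lit 1)"
    "a + 5 < length P" "P ! (a + 5) = Goto (a + 1)"
    using code by (auto simp: code_at_Cons eval_nat_numeral)
  have rt: "r < 63" "t < 63" "\<not> big r" "\<not> big t" "r \<noteq> t" using wf by auto
  obtain \<sigma>1 where p1: "path P xs \<omega> X Y I w \<sigma> \<sigma>1"
    and r1: "rep X Y I s (if regs s t > 0 then a + 3 else Suc (a + 1)) \<sigma>1"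
    using pos_step[OF less.prems(1) c(1,2) rt(2)] rt(4) by auto
  show ?case
  proof (cases "v = 0")
    case True
    have "rep X Y I s (a + 2) \<sigma>1" using r1 less.prems(2) True by simp
    then obtain \<sigma>2 where p2: "path P xs \<omega> X Y I w \<sigma>1 \<sigma>2" and r2: "rep X Y I s (a + 6) \<sigma>2"
      using goto_step c by blast
    have "set_reg t 0 (set_reg r (regs s r + bitlen v) s) = s"
      using True less.prems(2) by (intro state_eqI) auto
    moreover have "path P xs \<omega> X Y I (2 * w + nat (bitlen v) * (4 * w)) \<sigma> \<sigma>2"
      by (rule path_trans[OF p1 p2]) simp
    ultimately show ?thesis using r2 by auto
  next
    case False
    then have v: "v > 0" using less.prems(3) by simp
    have bl: "bitlen v = bitlen (v div 2) + 1" using v by (subst compute_bitlen) simp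
    have vX: "v \<le> X" using rep_bnd[OF less.prems(1) rt(2)] less.prems(2) rt by (simp add: bnd_def)
    have v2: "v div 2 \<le> X" "0 \<le> v div 2" "v div 2 < v" using v vX by linarith+
    have "rep X Y I s (a + 3) \<sigma>1" using r1 less.prems(2) v by simp
    then obtain \<sigma>2 where p2: "path P xs \<omega> X Y I w \<sigma>1 \<sigma>2" and r2: "rep X Y I (set_reg t (v div 2) s) (Suc (a + 3)) \<sigma>2"
      using op_step[of s "a + 3" \<sigma>1 t Quot "Reg t" "Const 2"] c(5,6) rt X v2 less.prems(2)
      by (auto simp: bnd_def)
    define s2 where "s2 = set_reg t (v div 2) s"
    have "0 \<le> bitlen (v div 2)" by (rule bitlen_nonneg)
    then obtain \<sigma>3 where p3: "path P xs \<omega> X Y I w \<sigma>2 \<sigma>3"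
      and r3: "rep X Y I (set_reg r (regs s r + 1) s2) (Suc (a + 4)) \<sigma>3"
      using op_step[of s2 "a + 4" \<sigma>2 r Plus "Reg r" "Const 1"] c(7,8) rt X r2 less.prems(4,5) bl
      by (auto simp: bnd_def s2_def eval_nat_numeral)
    define s3 where "s3 = set_reg r (regs s r + 1) s2"
    obtain \<sigma>4 where p4: "path P xs \<omega> X Y I w \<sigma>3 \<sigma>4" and r4: "rep X Y I s3 (a + 1) \<sigma>4"
      using goto_step[of s3 "a + 5" \<sigma>3 "a + 1"] c(9,10) r3 by (auto simp: s3_def eval_nat_numeral)
    have s3: "regs s3 t = v div 2" "regs s3 r = regs s r + 1"
      using rt by (auto simp: s3_def s2_def)
    obtain \<sigma>5 where p5: "path P xs \<omega> X Y I (2 * w + nat (bitlen (v div 2)) * (4 * w)) \<sigma>4 \<sigma>5"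
      and r5: "rep X Y I (set_reg t 0 (set_reg r (regs s3 r + bitlen (v div 2)) s3)) (a + 6) \<sigma>5"
      using less.hyps[OF _ r4 s3(1)] v v2 s3 less.prems(4,5) bl by (auto simp: nat_less_eq_zless)
    have "set_reg t 0 (set_reg r (regs s3 r + bitlen (v div 2)) s3)
        = set_reg t 0 (set_reg r (regs s r + bitlen v) s)"
      using rt s3 bl by (intro state_eqI) (auto simp: s3_def s2_def fun_eq_iff)
    moreover have "path P xs \<omega> X Y I (2 * w + nat (bitlen v) * (4 * w)) \<sigma> \<sigma>5"
    proof -
      have "nat (bitlen v) = Suc (nat (bitlen (v div 2)))"
        using bl bitlen_nonneg[of "v div 2"] by linarith
      then show ?thesis
        by (intro path_trans[OF path_trans[OF path_trans[OF path_trans[OF p1 p2 order_refl] p3 order_refl]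
              p4 order_refl] p5]) simp
    qed
    ultimately show ?thesis using r5 by auto
  qed
qed

theorem simulation:
  "code_at P a (comp a c) \<Longrightarrow> wf c \<Longrightarrow> safe xs \<omega> X Y I c s \<Longrightarrow> rep X Y I s a \<sigma> \<Longrightarrow>
    \<exists>\<sigma>'. path P xs \<omega> X Y I (ct xs \<omega> w W c s) \<sigma> \<sigma>' \<and> rep X Y I (ev xs \<omega> c s) (a + len c) \<sigma>'"
proof (induction c arbitrary: a s \<sigma>)
  case (Op r f x y)
  then show ?case using op_step[OF Op.prems(4), of r f x y] by (simp add: code_at_Cons)
next
  case (Ld r k i)
  then show ?case using ld_step[OF Ld.prems(4,1,2,3)] by simp
next
  case (St k i x)
  then show ?case using st_step[OF St.prems(4,1,2,3)] by simp
next
  case (Inp r x)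
  then show ?case using inp_step[OF Inp.prems(4,1,2,3)] by simp
next
  case (Flip r)
  then show ?case using flip_step[OF Flip.prems(4,1,2)] by simp
next
  case (Seq c d)
  obtain \<sigma>1 where p1: "path P xs \<omega> X Y I (ct xs \<omega> w W c s) \<sigma> \<sigma>1"
    and r1: "rep X Y I (ev xs \<omega> c s) (a + len c) \<sigma>1"
    using Seq.IH(1)[of a s \<sigma>] Seq.prems by (auto simp: code_at_append)
  obtain \<sigma>2 where p2: "path P xs \<omega> X Y I (ct xs \<omega> w W d (ev xs \<omega> c s)) \<sigma>1 \<sigma>2"
    and r2: "rep X Y I (ev xs \<omega> d (ev xs \<omega> c s)) (a + len c + len d) \<sigma>2"
    using Seq.IH(2)[OF _ _ _ r1] Seq.prems by (auto simp: code_at_append)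
  have "path P xs \<omega> X Y I (ct xs \<omega> w W (c ;; d) s) \<sigma> \<sigma>2" by (rule path_trans[OF p1 p2]) simp
  then show ?case using r2 by (auto simp: add.assoc)
next
  case (IfP r c)
  have c: "a < length P" "P ! a = Goto_If_Pos (Val (Cell r)) (a + 2)" "Suc a < length P"
    "P ! Suc a = Goto (a + 2 + len c)" "code_at P (a + 2) (comp (a + 2) c)"
    using IfP.prems(1) by (auto simp: code_at_Cons)
  obtain \<sigma>1 where p1: "path P xs \<omega> X Y I (if big r then W else w) \<sigma> \<sigma>1"
    and r1: "rep X Y I s (if regs s r > 0 then a + 2 else Suc a) \<sigma>1"
    using pos_step[OF IfP.prems(4) c(1,2)] IfP.prems(2) by auto
  show ?case
  proof (cases "regs s r > 0")
    case True
    then obtain \<sigma>2 where p2: "path P xs \<omega> X Y I (ct xs \<omega> w W c s) \<sigma>1 \<sigma>2"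
      and r2: "rep X Y I (ev xs \<omega> c s) (a + 2 + len c) \<sigma>2"
      using IfP.IH[OF c(5), of s \<sigma>1] r1 IfP.prems by auto
    have "path P xs \<omega> X Y I (ct xs \<omega> w W (IfP r c) s) \<sigma> \<sigma>2"
      by (rule path_trans[OF p1 p2]) (simp add: True)
    then show ?thesis using r2 True by (auto simp: add.assoc)
  next
    case False
    then obtain \<sigma>2 where p2: "path P xs \<omega> X Y I w \<sigma>1 \<sigma>2" and r2: "rep X Y I s (a + 2 + len c) \<sigma>2"
      using goto_step[of s "Suc a" \<sigma>1] r1 c by auto
    have "path P xs \<omega> X Y I (ct xs \<omega> w W (IfP r c) s) \<sigma> \<sigma>2"
      by (rule path_trans[OF p1 p2]) (use False w_le_W in simp)
    then show ?thesis using r2 False by (auto simp: add.assoc)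
  qed
next
  case (For i N c)
  let ?F = "\<lambda>s. ev xs \<omega> c (set_reg i (regs s i - 1) s)"
  let ?D = "\<lambda>s. set_reg i (regs s i - 1) s"
  define s0 where "s0 = set_reg i (regs s N) s"
  have wf: "i < 63" "N < 63" "\<not> big i" "\<not> big N" "i \<notin> wr c" "wf c" using For.prems(2) by auto
  have code: "a < length P" "P ! a = Arith (Cell i) Plus (Val (Cell N)) (Lit 0)"
    "a + 1 < length P" "P ! (a + 1) = Goto_If_Pos (Val (Cell i)) (a + 3)"
    "a + 2 < length P" "P ! (a + 2) = Goto (a + 5 + len c)"
    "a + 3 < length P" "P ! (a + 3) = Arith (Cell i) Minus (Val (Cell i)) (Lit 1)"
    "code_at P (a + 4) (comp (a + 4) c)"
    "a + 4 + len c < length P" "P ! (a + 4 + len c) = Goto (a + 1)"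
    using For.prems(1) by (auto simp: code_at_Cons code_at_append eval_nat_numeral)
  have NX: "\<bar>regs s N\<bar> \<le> X" using rep_bnd[OF For.prems(4) wf(2)] wf by (simp add: bnd_def)
  obtain \<sigma>0 where p0: "path P xs \<omega> X Y I w \<sigma> \<sigma>0" and r0: "rep X Y I s0 (Suc a) \<sigma>0"
    using op_step[OF For.prems(4), of i Plus "Reg N" "Const 0"] code wf NX X
    by (auto simp: s0_def bnd_def)
  \<comment> \<open>Inner induction on the number of completed rounds, with the machine always back
    at the loop test \<open>a + 1\<close>.\<close>
  have loop: "\<exists>\<sigma>'. path P xs \<omega> X Y I (w + (\<Sum>j<k. 4 * w + ct xs \<omega> w W c (?D ((?F ^^ j) s0)))) \<sigma> \<sigma>' \<and>
      rep X Y I ((?F ^^ k) s0) (a + 1) \<sigma>' \<and> regs ((?F ^^ k) s0) i = regs s N - int k"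
    if "k \<le> nat (regs s N)" for k
    using that
  proof (induction k)
    case 0
    then show ?case using p0 r0 by (auto simp: s0_def)
  next
    case (Suc k)
    define sk where "sk = (?F ^^ k) s0"
    obtain \<sigma>1 where p1: "path P xs \<omega> X Y I (w + (\<Sum>j<k. 4 * w + ct xs \<omega> w W c (?D ((?F ^^ j) s0)))) \<sigma> \<sigma>1"
      and r1: "rep X Y I sk (a + 1) \<sigma>1" and i: "regs sk i = regs s N - int k"
      using Suc by (auto simp: sk_def)
    have pos: "regs sk i > 0" using Suc.prems i by linarith
    obtain \<sigma>2 where p2: "path P xs \<omega> X Y I w \<sigma>1 \<sigma>2" and r2: "rep X Y I sk (a + 3) \<sigma>2"
      using pos_step[OF r1 code(3,4) wf(1)] wf pos by auto
    have "bnd X Y i (regs sk i - 1)" using pos i NX wf by (simp add: bnd_def)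
    then obtain \<sigma>3 where p3: "path P xs \<omega> X Y I w \<sigma>2 \<sigma>3" and r3: "rep X Y I (?D sk) (Suc (a + 3)) \<sigma>3"
      using op_step[OF r2 code(7), of i Minus "Reg i" "Const 1"] code(8) wf X by auto
    have r3: "rep X Y I (?D sk) (a + 4) \<sigma>3" using r3 by (simp add: eval_nat_numeral)
    have "safe xs \<omega> X Y I c (?D sk)" using For.prems(3) Suc.prems by (simp add: sk_def s0_def)
    then obtain \<sigma>4 where p4: "path P xs \<omega> X Y I (ct xs \<omega> w W c (?D sk)) \<sigma>3 \<sigma>4"
      and r4: "rep X Y I (?F sk) (a + 4 + len c) \<sigma>4"
      using For.IH[OF code(9) wf(6) _ r3] by auto
    obtain \<sigma>5 where p5: "path P xs \<omega> X Y I w \<sigma>4 \<sigma>5" and r5: "rep X Y I (?F sk) (a + 1) \<sigma>5"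
      using goto_step[OF r4 code(10,11)] by auto
    have A: "path P xs \<omega> X Y I (w + (\<Sum>j<Suc k. 4 * w + ct xs \<omega> w W c (?D ((?F ^^ j) s0)))) \<sigma> \<sigma>5"
      by (rule path_trans[OF path_trans[OF path_trans[OF path_trans[OF p1 p2 order_refl] p3 order_refl] p4 order_refl] p5])
         (simp add: sk_def)
    have B: "regs (?F sk) i = regs s N - int (Suc k)"
      using ev_regs[OF wf(5), of xs \<omega> "?D sk"] i by simp
    have C: "(?F ^^ Suc k) s0 = ?F sk" by (simp add: sk_def)
    show ?case unfolding C using A B r5 by blast
  qed
  define n where "n = nat (regs s N)"
  obtain \<sigma>1 where p1: "path P xs \<omega> X Y I (w + (\<Sum>j<n. 4 * w + ct xs \<omega> w W c (?D ((?F ^^ j) s0)))) \<sigma> \<sigma>1"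
    and r1: "rep X Y I ((?F ^^ n) s0) (a + 1) \<sigma>1" and i: "regs ((?F ^^ n) s0) i = regs s N - int n"
    using loop[of n] by (auto simp: n_def)
  have "\<not> regs ((?F ^^ n) s0) i > 0" using i by (simp add: n_def)
  then obtain \<sigma>2 where p2: "path P xs \<omega> X Y I w \<sigma>1 \<sigma>2" and r2: "rep X Y I ((?F ^^ n) s0) (a + 2) \<sigma>2"
    using pos_step[OF r1 code(3,4) wf(1)] wf by auto
  obtain \<sigma>3 where p3: "path P xs \<omega> X Y I w \<sigma>2 \<sigma>3" and r3: "rep X Y I ((?F ^^ n) s0) (a + 5 + len c) \<sigma>3"
    using goto_step[OF r2 code(5,6)] by auto
  have "path P xs \<omega> X Y I (ct xs \<omega> w W (For i N c) s) \<sigma> \<sigma>3"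
    by (rule path_trans[OF path_trans[OF p1 p2 order_refl] p3]) (simp add: n_def s0_def)
  then show ?case using r3 by (auto simp: n_def s0_def add.assoc)
next
  case (Bits r t)
  have c: "a < length P" "P ! a = Arith (Cell r) Plus (Lit 0) (Lit 0)"
    using Bits.prems(1) by (auto simp: code_at_Cons)
  have rt: "r < 63" "t < 63" "\<not> big r" "\<not> big t" "r \<noteq> t" using Bits.prems(2) by auto
  obtain \<sigma>1 where p1: "path P xs \<omega> X Y I w \<sigma> \<sigma>1" and r1: "rep X Y I (set_reg r 0 s) (a + 1) \<sigma>1"
    using op_step[OF Bits.prems(4), of r Plus "Const 0" "Const 0"] c rt X by (auto simp: bnd_def)
  have t: "0 \<le> regs s t" using Bits.prems(3) by simp
  have "regs s t \<le> X" using rep_bnd[OF Bits.prems(4) rt(2)] rt by (simp add: bnd_def)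
  then have "bitlen (regs s t) \<le> X" using bitlen_le_self[OF t] by linarith
  then obtain \<sigma>2 where p2: "path P xs \<omega> X Y I (2 * w + nat (bitlen (regs s t)) * (4 * w)) \<sigma>1 \<sigma>2"
    and r2: "rep X Y I (set_reg t 0 (set_reg r (bitlen (regs s t)) (set_reg r 0 s))) (a + 6) \<sigma>2"
    using bits_loop[OF Bits.prems(1,2) r1, of "regs s t"] rt t by auto
  have E: "set_reg t 0 (set_reg r (bitlen (regs s t)) (set_reg r 0 s)) = ev xs \<omega> (Bits r t) s"
    by (intro state_eqI) simp_all
  have "path P xs \<omega> X Y I (ct xs \<omega> w W (Bits r t) s) \<sigma> \<sigma>2"
    by (rule path_trans[OF p1 p2]) simp
  then show ?case using r2 unfolding E len.simps by blast
qed

end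

definition start :: state where
  "start = \<lparr>regs = (\<lambda>_. 0), arr = (\<lambda>_ _. 0), cn = 0\<rparr>"

theorem compiled_run:
  assumes "ram X Y I" "wf c" "safe xs \<omega> X Y I c start" and P: "P = comp 0 c"
  shows "\<exists>t. halted P (run P xs \<omega> t) \<and> mem (run P xs \<omega> t) 0 = regs (ev xs \<omega> c start) 0 \<and>
    time_used P xs \<omega> t \<le> ct xs \<omega> (ram.w X) (ram.W X Y) c start \<and>
    space_used P xs \<omega> t \<le> 4 * nbits Y + (64 + 16 * I) * nbits X"
proof -
  interpret ram P xs \<omega> X Y I by (rule assms(1))
  have "rep X Y I start 0 initial"
    using X XY by (auto simp: rep_def start_def initial_def binv_def bnd_def)
  moreover have "code_at P 0 (comp 0 c)" by (simp add: P code_at_def)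
  ultimately obtain \<sigma>' where p: "path P xs \<omega> X Y I (ct xs \<omega> w W c start) initial \<sigma>'"
    and r: "rep X Y I (ev xs \<omega> c start) (len c) \<sigma>'"
    using simulation[of 0 c start initial] assms by auto
  obtain t where t: "run P xs \<omega> t = \<sigma>'" "time_used P xs \<omega> t \<le> ct xs \<omega> w W c start"
    and inv: "\<And>j. j \<le> t \<Longrightarrow> minv X Y I (mem (run P xs \<omega> j))"
    using p unfolding path_def run_def time_used_def by auto
  have cells: "cells_used P xs \<omega> t \<le> 64 + 16 * I"
    unfolding cells_used_def by (rule Least_le) (use inv in \<open>auto simp: minv_def\<close>)
  let ?b = "\<lambda>a. if big a then nbits Y else nbits X"
  have "space_used P xs \<omega> t \<le> (\<Sum>a<cells_used P xs \<omega> t. ?b a)"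
    unfolding space_used_def
    by (rule sum_mono, subst Max_le_iff) (use nbits_mem[OF inv] in auto)
  also have "\<dots> \<le> (\<Sum>a<64 + 16 * I. ?b a)"
    by (rule sum_mono2) (use cells in auto)
  also have "\<dots> \<le> (\<Sum>a<64 + 16 * I. (if a < 4 then nbits Y else 0) + nbits X)"
    by (rule sum_mono) (auto simp: big_def)
  also have "\<dots> = (\<Sum>a<64 + 16 * I. if a < 4 then nbits Y else 0) + (64 + 16 * I) * nbits X"
    by (simp add: sum.distrib)
  also have "(\<Sum>a<64 + 16 * I. if a < 4 then nbits Y else 0) = (\<Sum>a\<in>{..<4::nat}. nbits Y)"
    by (rule sum.mono_neutral_cong_right) auto
  finally have "space_used P xs \<omega> t \<le> 4 * nbits Y + (64 + 16 * I) * nbits X" by simp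
  moreover have "halted P (run P xs \<omega> t)" using t(1) r by (simp add: halted_def P rep_def)
  moreover have "mem (run P xs \<omega> t) 0 = regs (ev xs \<omega> c start) 0" using t(1) r by (simp add: rep_def)
  ultimately show ?thesis using t(2) by blast
qed

section \<open>Coin flips\<close>

interpretation coin: product_prob_space "\<lambda>_::nat. measure_pmf (bernoulli_pmf (1 / 2))" UNIV
  by (rule product_prob_spaceI) (rule measure_pmf.prob_space_axioms)

lemma space_coin_space [simp]: "space coin_space = UNIV"
  by (simp add: coin_space_def space_PiM PiE_def)

lemma prob_space_coin_space: "prob_space coin_space"
  unfolding coin_space_def by (rule prob_space_PiM) (rule measure_pmf.prob_space_axioms)

lemma cylinder_eq_emb:
  "{\<omega>. \<forall>j\<in>J. \<omega> j = g j} = prod_emb UNIV (\<lambda>_. measure_pmf (bernoulli_pmf (1 / 2))) J (PiE J (\<lambda>j. {g j}))"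
proof -
  have "restrict \<omega> J \<in> PiE J (\<lambda>j. {g j}) \<longleftrightarrow> (\<forall>j\<in>J. \<omega> j = g j)" for \<omega>
    by (simp add: PiE_iff)
  then show ?thesis by (simp add: prod_emb_def vimage_def PiE_UNIV_domain)
qed

lemma cylinder_sets:
  assumes "finite J"
  shows "{\<omega>. \<forall>j\<in>J. \<omega> j = g j} \<in> sets coin_space"
  unfolding cylinder_eq_emb coin_space_def using assms by (intro sets_PiM_I) auto

lemma cylinder_measure:
  assumes "finite J"
  shows "measure coin_space {\<omega>. \<forall>j\<in>J. \<omega> j = g j} = (1 / 2) ^ card J"
proof -
  have half: "measure (measure_pmf (bernoulli_pmf (1 / 2))) {x} = 1 / 2" for x :: bool
    by (cases x) (simp_all add: measure_pmf_single)
  have "measure coin_space {\<omega>. \<forall>j\<in>J. \<omega> j = g j}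
      = (\<Prod>j\<in>J. measure (measure_pmf (bernoulli_pmf (1 / 2))) {g j})"
    unfolding cylinder_eq_emb coin_space_def using assms by (intro coin.measure_PiM_emb) auto
  then show ?thesis by (simp add: half)
qed

text \<open>The first \<open>t\<close> coins have finitely many patterns, so such an event is a
  finite union of cylinders.\<close>

lemma finitely_determined_sets:
  assumes "\<And>\<omega> \<omega>'. (\<And>j. j < t \<Longrightarrow> \<omega> j = \<omega>' j) \<Longrightarrow> \<omega> \<in> E \<Longrightarrow> \<omega>' \<in> E"
  shows "E \<in> sets coin_space"
proof -
  let ?G = "{g \<in> PiE {..<t} (\<lambda>_. UNIV). \<exists>\<omega>\<in>E. \<forall>j<t. \<omega> j = g j}"
  have "E = (\<Union>g\<in>?G. {\<omega>. \<forall>j\<in>{..<t}. \<omega> j = g j})"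
  proof (rule subset_antisym)
    show "E \<subseteq> (\<Union>g\<in>?G. {\<omega>. \<forall>j\<in>{..<t}. \<omega> j = g j})"
    proof
      fix \<omega> assume \<omega>: "\<omega> \<in> E"
      then show "\<omega> \<in> (\<Union>g\<in>?G. {\<omega>. \<forall>j\<in>{..<t}. \<omega> j = g j})"
        by (intro UN_I[of "restrict \<omega> {..<t}"]) auto
    qed
    show "(\<Union>g\<in>?G. {\<omega>. \<forall>j\<in>{..<t}. \<omega> j = g j}) \<subseteq> E"
    proof
      fix \<omega> assume "\<omega> \<in> (\<Union>g\<in>?G. {\<omega>. \<forall>j\<in>{..<t}. \<omega> j = g j})"
      then obtain g \<omega>' where g: "\<forall>j<t. \<omega> j = g j" "\<omega>' \<in> E" "\<forall>j<t. \<omega>' j = g j" by auto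
      show "\<omega> \<in> E" by (rule assms[of \<omega>']) (use g in auto)
    qed
  qed
  moreover have "finite ?G" by (rule finite_subset[of _ "PiE {..<t} (\<lambda>_. UNIV)"]) (auto intro: finite_PiE)
  ultimately show ?thesis using cylinder_sets[of "{..<t}"] by (metis (no_types, lifting) finite_lessThan sets.finite_UN)
qed

text \<open>A step reads at most one coin, and coins are read in order. This makes the output event
  a countable union of measurable events.\<close>

lemma run_determined:
  assumes "\<And>j. j < t \<Longrightarrow> \<omega> j = \<omega>' j"
  shows "run P xs \<omega> t = run P xs \<omega>' t \<and> coins (run P xs \<omega> t) \<le> t"
  using assms
proof (induction t)
  case 0
  then show ?case by (simp add: run_def initial_def)
next
  case (Suc t)
  then have IH: "run P xs \<omega> t = run P xs \<omega>' t" "coins (run P xs \<omega> t) \<le> t" by auto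
  let ?\<sigma> = "run P xs \<omega> t"
  have eq: "step P xs \<omega> ?\<sigma> = step P xs \<omega>' ?\<sigma> \<and> coins (step P xs \<omega> ?\<sigma>) \<le> Suc t"
    using IH(2) Suc.prems[of "coins ?\<sigma>"] by (cases "P ! pc ?\<sigma>") (auto simp: step_def)
  have "run P xs \<omega> (Suc t) = step P xs \<omega> ?\<sigma>" "run P xs \<omega>' (Suc t) = step P xs \<omega>' (run P xs \<omega>' t)"
    by (simp_all add: run_def)
  then show ?case using eq IH(1) by metis
qed

lemma outputs_sets: "{\<omega>. outputs P xs \<omega> v} \<in> sets coin_space"
proof -
  define E where "E t = {\<omega>. halted P (run P xs \<omega> t) \<and> mem (run P xs \<omega> t) 0 = v}" for t
  have "E t \<in> sets coin_space" for t
  proof (rule finitely_determined_sets[of t])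
    fix \<omega> \<omega>' assume "\<And>j. j < t \<Longrightarrow> \<omega> j = \<omega>' j" "\<omega> \<in> E t"
    then show "\<omega>' \<in> E t" using run_determined[of t \<omega> \<omega>' P xs] by (simp add: E_def)
  qed
  then have "(\<Union>t. E t) \<in> sets coin_space" by (intro sets.countable_UN) blast
  moreover have "{\<omega>. outputs P xs \<omega> v} = (\<Union>t. E t)"
    unfolding E_def outputs_def by blast
  ultimately show ?thesis by (simp only:)
qed

text \<open>Most significant bit first, in agreement with the doubling loop of
  \<open>fill\<close>.\<close>

primrec bitval :: "(nat \<Rightarrow> bool) \<Rightarrow> nat \<Rightarrow> nat \<Rightarrow> int" where
  "bitval \<omega> a 0 = 0"
| "bitval \<omega> a (Suc b) = 2 * bitval \<omega> a b + of_bool (\<omega> (a + b))"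

lemma bitval_bounds: "0 \<le> bitval \<omega> a b \<and> bitval \<omega> a b < 2 ^ b"
proof (induction b)
  case (Suc b)
  have "of_bool (\<omega> (a + b)) \<le> (1::int)" by simp
  then show ?case using Suc by simp
qed simp

lemma bitval_eq_iff:
  "0 \<le> t \<Longrightarrow> t < 2 ^ b \<Longrightarrow> bitval \<omega> a b = t \<longleftrightarrow> (\<forall>l<b. \<omega> (a + l) = odd (t div 2 ^ (b - Suc l)))"
proof (induction b arbitrary: t)
  case (Suc b)
  have "bitval \<omega> a (Suc b) = t \<longleftrightarrow> bitval \<omega> a b = t div 2 \<and> \<omega> (a + b) = odd t"
    by (auto elim: oddE evenE)
  also have "bitval \<omega> a b = t div 2 \<longleftrightarrow> (\<forall>l<b. \<omega> (a + l) = odd (t div 2 div 2 ^ (b - Suc l)))"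
    using Suc.prems by (intro Suc.IH) auto
  also have "\<dots> \<longleftrightarrow> (\<forall>l<b. \<omega> (a + l) = odd (t div 2 ^ (Suc b - Suc l)))"
  proof (intro all_cong)
    fix l assume "l < b"
    then have "Suc b - Suc l = Suc (b - Suc l)" by simp
    then show "\<omega> (a + l) = odd (t div 2 div 2 ^ (b - Suc l)) \<longleftrightarrow> \<omega> (a + l) = odd (t div 2 ^ (Suc b - Suc l))"
      by (simp add: zdiv_zmult2_eq)
  qed
  finally show ?case by (auto simp: less_Suc_eq)
qed simp

definition draw :: "(nat \<Rightarrow> bool) \<Rightarrow> nat \<Rightarrow> nat \<Rightarrow> nat \<Rightarrow> int" where
  "draw \<omega> a b i = bitval \<omega> (a + i * b) b"

text \<open>Consecutive draws use consecutive blocks of \<open>b\<close> coins, so fixing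
  \<open>N\<close> draws fixes exactly \<open>N * b\<close> coins; \<open>g\<close> finds the draw
  and the bit of a coin by quotient and remainder.\<close>

lemma draws_cylinder:
  assumes "\<And>i. i < N \<Longrightarrow> 0 \<le> f i \<and> f i < 2 ^ b"
  shows "\<exists>g. {\<omega>. \<forall>i<N. draw \<omega> a b i = f i} = {\<omega>. \<forall>j\<in>{a..<a + N * b}. \<omega> j = g j}"
proof (cases "b = 0")
  case True
  then have "draw \<omega> a b i = f i" if "i < N" for \<omega> i
    using assms[OF that] by (simp add: draw_def)
  then show ?thesis using True by auto
next
  case False
  define g where "g j = odd (f ((j - a) div b) div 2 ^ (b - Suc ((j - a) mod b)))" for j
  have "(\<forall>i<N. draw \<omega> a b i = f i) \<longleftrightarrow> (\<forall>j\<in>{a..<a + N * b}. \<omega> j = g j)" for \<omega>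
  proof
    assume L: "\<forall>i<N. draw \<omega> a b i = f i"
    show "\<forall>j\<in>{a..<a + N * b}. \<omega> j = g j"
    proof
      fix j assume j: "j \<in> {a..<a + N * b}"
      define i l where "i = (j - a) div b" and "l = (j - a) mod b"
      have l: "l < b" using False by (simp add: l_def)
      have "j - a < N * b" using j by auto
      then have i: "i < N" unfolding i_def by (rule less_mult_imp_div_less)
      have "i * b + l = j - a" by (simp add: i_def l_def)
      then have jl: "j = a + i * b + l" using j by auto
      have "\<omega> (a + i * b + l) = odd (f i div 2 ^ (b - Suc l))"
        using L i l bitval_eq_iff[of "f i" b \<omega> "a + i * b"] assms[OF i] by (simp add: draw_def)
      then show "\<omega> j = g j" unfolding g_def i_def[symmetric] l_def[symmetric] using jl by simp
    qed
  next
    assume R: "\<forall>j\<in>{a..<a + N * b}. \<omega> j = g j"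
    show "\<forall>i<N. draw \<omega> a b i = f i"
    proof (intro allI impI)
      fix i assume i: "i < N"
      have "\<omega> (a + i * b + l) = odd (f i div 2 ^ (b - Suc l))" if l: "l < b" for l
      proof -
        have "i * b + l < Suc i * b" using l by simp
        also have "\<dots> \<le> N * b" using i by (intro mult_right_mono) auto
        finally have "a + i * b + l \<in> {a..<a + N * b}" by simp
        moreover have "(a + i * b + l - a) div b = i" "(a + i * b + l - a) mod b = l"
          using l by (simp_all add: add.assoc)
        ultimately show ?thesis using R by (auto simp: g_def)
      qed
      then show "draw \<omega> a b i = f i"
        using bitval_eq_iff[of "f i" b \<omega> "a + i * b"] assms[OF i] by (simp add: draw_def)
    qed
  qed
  then show ?thesis by (intro exI[of _ g]) simp
qed

lemma draws_measure:
  assumes "\<And>i. i < N \<Longrightarrow> 0 \<le> f i \<and> f i < 2 ^ b"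
  shows "{\<omega>. \<forall>i<N. draw \<omega> a b i = f i} \<in> sets coin_space"
    and "measure coin_space {\<omega>. \<forall>i<N. draw \<omega> a b i = f i} = (1 / 2) ^ (N * b)"
proof -
  obtain g where g: "{\<omega>. \<forall>i<N. draw \<omega> a b i = f i} = {\<omega>. \<forall>j\<in>{a..<a + N * b}. \<omega> j = g j}"
    using draws_cylinder[of N f b a] assms by blast
  show "{\<omega>. \<forall>i<N. draw \<omega> a b i = f i} \<in> sets coin_space"
    unfolding g by (rule cylinder_sets) simp
  show "measure coin_space {\<omega>. \<forall>i<N. draw \<omega> a b i = f i} = (1 / 2) ^ (N * b)"
    unfolding g by (subst cylinder_measure) auto
qed

lemma average_PiE:
  "average S [0..<N] F x
    = (\<Sum>f\<in>PiE {..<N} (\<lambda>_. S). F (\<lambda>i. if i < N then f i else x i)) / card S ^ N"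
proof (induction N arbitrary: F)
  case 0
  then show ?case by simp
next
  case (Suc N)
  let ?m = "\<lambda>N f i. if i < N then f i else x i"
  have inj: "inj_on (\<lambda>(t, f). f(N := t)) (S \<times> PiE {..<N} (\<lambda>_. S))"
    using inj_combinator[of N "{..<N}" "\<lambda>_. S"] by simp
  have "average S [0..<Suc N] F x = average S [0..<N] (average S [N] F) x"
    by (simp add: average_append)
  also have "\<dots> = (\<Sum>f\<in>PiE {..<N} (\<lambda>_. S). average S [N] F (?m N f)) / card S ^ N"
    by (rule Suc.IH)
  also have "\<dots> = (\<Sum>f\<in>PiE {..<N} (\<lambda>_. S). \<Sum>t\<in>S. F ((?m N f)(N := t))) / card S ^ Suc N"
    by (simp add: sum_divide_distrib)
  also have "(\<Sum>f\<in>PiE {..<N} (\<lambda>_. S). \<Sum>t\<in>S. F ((?m N f)(N := t)))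
      = (\<Sum>t\<in>S. \<Sum>f\<in>PiE {..<N} (\<lambda>_. S). F (?m (Suc N) (f(N := t))))"
  proof (subst sum.swap, intro sum.cong refl)
    fix t f
    have "(?m N f)(N := t) = ?m (Suc N) (f(N := t))" by (auto simp: less_Suc_eq)
    then show "F ((?m N f)(N := t)) = F (?m (Suc N) (f(N := t)))" by simp
  qed
  also have "\<dots> = (\<Sum>(t, f)\<in>S \<times> PiE {..<N} (\<lambda>_. S). F (?m (Suc N) (f(N := t))))"
    by (rule sum.cartesian_product)
  also have "\<dots> = (\<Sum>f\<in>PiE {..<Suc N} (\<lambda>_. S). F (?m (Suc N) f))"
    unfolding lessThan_Suc PiE_insert_eq
    by (subst sum.reindex[OF inj]) (simp add: case_prod_unfold)
  finally show ?case .
qed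

text \<open>The bridge from counting to probability: the event is a disjoint union of equiprobable
  cylinders, one for each outcome of the \<open>N\<close> draws that satisfies
  \<open>Q\<close>.\<close>

theorem measure_draws:
  fixes Q :: "(nat \<Rightarrow> int) \<Rightarrow> bool"
  assumes Q: "\<And>x y. (\<And>i. i < N \<Longrightarrow> x i = y i) \<Longrightarrow> Q x = Q y"
  shows "{\<omega>. Q (draw \<omega> a b)} \<in> sets coin_space"
    and "measure coin_space {\<omega>. Q (draw \<omega> a b)} = average {0..<2 ^ b} [0..<N] (\<lambda>x. of_bool (Q x)) x0"
proof -
  let ?S = "{0..<2 ^ b} :: int set"
  let ?m = "\<lambda>f i. if i < N then f i else x0 i"
  let ?G = "{f \<in> PiE {..<N} (\<lambda>_. ?S). Q (?m f)}"
  let ?C = "\<lambda>f. {\<omega>. \<forall>i<N. draw \<omega> a b i = f i}"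
  have fin: "finite (PiE {..<N} (\<lambda>_. ?S))" by (intro finite_PiE) auto
  have eq: "{\<omega>. Q (draw \<omega> a b)} = (\<Union>f\<in>?G. ?C f)"
  proof (rule subset_antisym; rule subsetI)
    fix \<omega> assume "\<omega> \<in> {\<omega>. Q (draw \<omega> a b)}"
    then have q: "Q (draw \<omega> a b)" by simp
    let ?f = "restrict (draw \<omega> a b) {..<N}"
    have "Q (?m ?f)" using q Q[of "draw \<omega> a b" "?m ?f"] by simp
    moreover have "?f \<in> PiE {..<N} (\<lambda>_. ?S)" using bitval_bounds by (auto simp: draw_def)
    ultimately show "\<omega> \<in> (\<Union>f\<in>?G. ?C f)" by (intro UN_I[of ?f]) auto
  next
    fix \<omega> assume "\<omega> \<in> (\<Union>f\<in>?G. ?C f)"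
    then obtain f where "Q (?m f)" "\<forall>i<N. draw \<omega> a b i = f i" by auto
    then show "\<omega> \<in> {\<omega>. Q (draw \<omega> a b)}" using Q[of "?m f" "draw \<omega> a b"] by simp
  qed
  have range: "0 \<le> f i \<and> f i < 2 ^ b" if "f \<in> ?G" "i < N" for f i
    using that by (auto simp: PiE_def Pi_def)
  have Csets: "?C f \<in> sets coin_space" if "f \<in> ?G" for f
    by (rule draws_measure(1)) (use range that in blast)
  have finG: "finite ?G" using fin by simp
  show "{\<omega>. Q (draw \<omega> a b)} \<in> sets coin_space"
    unfolding eq by (rule sets.finite_UN[OF finG Csets])
  interpret prob_space coin_space by (rule prob_space_coin_space)
  have "measure coin_space {\<omega>. Q (draw \<omega> a b)} = (\<Sum>f\<in>?G. measure coin_space (?C f))"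
    unfolding eq
  proof (rule finite_measure_finite_Union[OF finG])
    show "?C ` ?G \<subseteq> sets coin_space" using Csets by blast
    show "disjoint_family_on ?C ?G"
    proof (unfold disjoint_family_on_def, intro ballI impI)
      fix f g assume fg: "f \<in> ?G" "g \<in> ?G" "f \<noteq> g"
      show "?C f \<inter> ?C g = {}"
      proof (rule ccontr)
        assume "?C f \<inter> ?C g \<noteq> {}"
        then have "\<forall>i<N. f i = g i" by auto
        then have "f = g" using fg by (intro PiE_ext[of f "{..<N}" _ g]) auto
        then show False using fg(3) by simp
      qed
    qed
  qed
  also have "\<dots> = (\<Sum>f\<in>?G. (1 / 2) ^ (N * b))"
    by (intro sum.cong refl draws_measure(2)) (use range in blast)
  also have "\<dots> = (\<Sum>f\<in>PiE {..<N} (\<lambda>_. ?S). of_bool (Q (?m f)) * (1 / 2) ^ (N * b))"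
    using fin by (intro sum.mono_neutral_cong_left) auto
  also have "\<dots> = (\<Sum>f\<in>PiE {..<N} (\<lambda>_. ?S). of_bool (Q (?m f))) / card ?S ^ N"
  proof -
    have "real (card ?S) ^ N = 2 ^ (N * b)"
      unfolding mult.commute[of N b] by (simp add: power_mult)
    then show ?thesis
      by (simp only: sum_divide_distrib power_one_over times_divide_eq_right mult_1_right of_nat_power)
  qed
  also have "\<dots> = average ?S [0..<N] (\<lambda>x. of_bool (Q x)) x0"
    by (rule average_PiE[of ?S N "\<lambda>x. of_bool (Q x)" x0, symmetric])
  finally show "measure coin_space {\<omega>. Q (draw \<omega> a b)} = average ?S [0..<N] (\<lambda>x. of_bool (Q x)) x0" .
qed

theorem bad_trials_measure:
  fixes a T :: nat
  assumes "prime p" "n \<ge> 1" "\<not> p dvd detn n A" "2 ^ b \<le> p" "int (32 * n * n) \<le> 2 ^ b"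
  defines "bad \<equiv> {\<omega>. \<forall>t<T. \<not> good_trial p n A (\<lambda>i. draw \<omega> a b (t * (5 * n) + i))}"
  shows "bad \<in> sets coin_space" "measure coin_space bad \<le> (1 / 2) ^ T"
proof -
  let ?Q = "\<lambda>x. \<forall>t<T. \<not> good_trial p n A (\<lambda>i. x (t * (5 * n) + i))"
  have Q: "?Q x = ?Q y" if xy: "\<And>i. i < T * (5 * n) \<Longrightarrow> x i = y i" for x y
  proof -
    have "good_trial p n A (\<lambda>i. x (t * (5 * n) + i)) = good_trial p n A (\<lambda>i. y (t * (5 * n) + i))" if "t < T" for t
    proof (rule good_trial_eqI)
      fix i assume "i < 5 * n"
      then have "t * (5 * n) + i < Suc t * (5 * n)" by simp
      also have "\<dots> \<le> T * (5 * n)" using that by (intro mult_right_mono) auto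
      finally show "x (t * (5 * n) + i) = y (t * (5 * n) + i)" by (intro xy) auto
    qed
    then show ?thesis by auto
  qed
  show "bad \<in> sets coin_space"
    unfolding bad_def by (rule measure_draws(1)[of "T * (5 * n)" ?Q, OF Q])
  have "measure coin_space bad = average {0..<2 ^ b} [0..<T * (5 * n)] (\<lambda>x. of_bool (?Q x)) (\<lambda>_. 0)"
    unfolding bad_def by (rule measure_draws(2)[of "T * (5 * n)" ?Q, OF Q])
  then show "measure coin_space bad \<le> (1 / 2) ^ T"
    using bad_trials_average[OF assms(1-5), of T "\<lambda>_. 0"] by simp
qed

section \<open>The program\<close>

text \<open>Arrays 0 to 3 hold the diagonal \<open>D\<close> and the vectors \<open>x\<close>, \<open>y\<close>, \<open>u\<close>; array 4 holds the current
  Krylov vector \<open>B\<^sup>m v\<close>, array 5 an intermediate product, array 6 the sequence \<open>s\<close>, and arrays 7 and 8 the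
  coefficients of \<open>\<phi>\<^sub>k\<close> and of \<open>x \<psi>\<^sub>k\<close>. The candidates for the prime are the \<open>rCnt\<close> numbers
  following \<open>rS\<close>; a residue is divided by trying all quotients below \<open>rPM\<close>.\<close>

abbreviation (input) "rX \<equiv> 0 :: nat"
abbreviation (input) "rM \<equiv> 1 :: nat"
abbreviation (input) "rBnd \<equiv> 2 :: nat"
abbreviation (input) "rBig \<equiv> 3 :: nat"
abbreviation (input) "rN \<equiv> 4 :: nat"
abbreviation (input) "rNz \<equiv> 5 :: nat"
abbreviation (input) "rU \<equiv> 6 :: nat"
abbreviation (input) "rL \<equiv> 7 :: nat"
abbreviation (input) "rLn \<equiv> 8 :: nat"
abbreviation (input) "rLL \<equiv> 9 :: nat"
abbreviation (input) "rB \<equiv> 10 :: nat"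
abbreviation (input) "rS \<equiv> 11 :: nat"
abbreviation (input) "rT \<equiv> 12 :: nat"
abbreviation (input) "rCnt \<equiv> 13 :: nat"
abbreviation (input) "rPM \<equiv> 14 :: nat"
abbreviation (input) "rSq \<equiv> 15 :: nat"
abbreviation (input) "rW \<equiv> 16 :: nat"
abbreviation (input) "rQ \<equiv> 17 :: nat"
abbreviation (input) "rPr \<equiv> 18 :: nat"
abbreviation (input) "rR \<equiv> 19 :: nat"
abbreviation (input) "ri0 \<equiv> 20 :: nat"
abbreviation (input) "ri1 \<equiv> 21 :: nat"
abbreviation (input) "ri2 \<equiv> 22 :: nat"
abbreviation (input) "ri3 \<equiv> 23 :: nat"
abbreviation (input) "rt1 \<equiv> 24 :: nat"
abbreviation (input) "rt2 \<equiv> 25 :: nat"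
abbreviation (input) "rt3 \<equiv> 26 :: nat"
abbreviation (input) "rt4 \<equiv> 27 :: nat"
abbreviation (input) "rE \<equiv> 29 :: nat"
abbreviation (input) "rG \<equiv> 30 :: nat"
abbreviation (input) "rDen \<equiv> 31 :: nat"
abbreviation (input) "rOk \<equiv> 32 :: nat"
abbreviation (input) "rK \<equiv> 33 :: nat"
abbreviation (input) "rZ \<equiv> 34 :: nat"
abbreviation (input) "rSA \<equiv> 35 :: nat"
abbreviation (input) "rSB \<equiv> 36 :: nat"
abbreviation (input) "rE2 \<equiv> 37 :: nat"
abbreviation (input) "rN2 \<equiv> 38 :: nat"
abbreviation (input) "rIdx \<equiv> 39 :: nat"

abbreviation (input) "mov r x \<equiv> Op r Plus x (Const 0)"
abbreviation (input) "modq r \<equiv> Op r Rem (Reg r) (Reg rQ)"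

text \<open>The loop counts down, so storing at \<open>n - 1 - ri2\<close> fills the entries
  upwards, in the order in which coins are consumed. Entry \<open>i\<close> is then the
  \<open>i\<close>-th draw of this block.\<close>

definition fill :: "nat \<Rightarrow> com" where
  "fill k = For ri2 rN (mov rt1 (Const 0) ;;
     For ri3 rB (Flip rt2 ;; Op rt1 Times (Reg rt1) (Const 2) ;; Op rt1 Plus (Reg rt1) (Reg rt2)) ;;
     Op rt3 Minus (Reg rN) (Const 1) ;; Op rt3 Minus (Reg rt3) (Reg ri2) ;; St k rt3 (Reg rt1))"

definition dot :: "nat \<Rightarrow> nat \<Rightarrow> nat \<Rightarrow> com" where
  "dot r k l = mov r (Const 0) ;; For ri3 rN (Ld rt2 k ri3 ;; Ld rt3 l ri3 ;;
     Op rt2 Times (Reg rt2) (Reg rt3) ;; Op r Plus (Reg r) (Reg rt2) ;; modq r)"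

definition rank_one :: com where
  "rank_one = For ri3 rN (Ld rt2 1 ri3 ;; Op rt2 Times (Reg rt2) (Reg rt1) ;; Ld rt3 4 ri3 ;;
     Op rt3 Plus (Reg rt3) (Reg rt2) ;; modq rt3 ;; St 4 ri3 (Reg rt3) ;; St 5 ri3 (Const 0))"

text \<open>The input triples are streamed afresh for each product, so nothing of size
  \<open>nnz\<close> is stored. The offsets 2, 3, 4 skip the two header numbers and select row,
  column and value.\<close>

definition sparse_mult :: com where
  "sparse_mult = For ri3 rNz (Op rIdx Times (Reg ri3) (Const 3) ;; Op rIdx Plus (Reg rIdx) (Const 2) ;;
     Inp rt1 (Reg rIdx) ;; Op rIdx Plus (Reg rIdx) (Const 1) ;; Inp rt2 (Reg rIdx) ;;
     Op rIdx Plus (Reg rIdx) (Const 1) ;; Inp rt3 (Reg rIdx) ;; modq rt3 ;;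
     Ld rt4 4 rt2 ;; Op rt3 Times (Reg rt3) (Reg rt4) ;; Ld rt4 5 rt1 ;; Op rt4 Plus (Reg rt4) (Reg rt3) ;;
     modq rt4 ;; St 5 rt1 (Reg rt4))"

definition diag_mult :: com where
  "diag_mult = For ri3 rN (Ld rt2 0 ri3 ;; Ld rt3 5 ri3 ;; Op rt2 Times (Reg rt2) (Reg rt3) ;; modq rt2 ;;
     St 4 ri3 (Reg rt2))"

text \<open>From right to left: \<open>I + x y^T\<close> by a dot product and an update, then
  \<open>A\<close>, then the diagonal.\<close>

definition matvec :: com where
  "matvec = dot rt1 2 4 ;; rank_one ;; sparse_mult ;; diag_mult"

text \<open>The recurrence reads \<open>s\<close> up to index \<open>(n - 1) + (n - 1) + 1\<close>,
  hence \<open>2 n\<close> terms.\<close>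

definition krylov :: com where
  "krylov = mov rK (Const 0) ;;
     For ri2 rN2 (dot rt1 3 4 ;; St 6 rK (Reg rt1) ;; Op rK Plus (Reg rK) (Const 1) ;; matvec)"

definition orth_init :: com where
  "orth_init = For ri3 rN (St 7 ri3 (Const 0) ;; St 8 ri3 (Const 0)) ;; St 8 rN (Const 0) ;;
     mov rIdx (Const 0) ;; St 7 rIdx (Const 1) ;; Ld rE 6 rIdx ;;
     mov rIdx (Const 1) ;; St 8 rIdx (Const 1) ;;
     mov rDen (Const 1) ;; mov rOk (Const 1) ;; mov rK (Const 0)"

definition orth_g :: com where
  "orth_g = mov rG (Const 0) ;; For ri3 rN (Op rIdx Plus (Reg ri3) (Const 1) ;; Ld rt2 8 rIdx ;;
     Op rIdx Plus (Reg rIdx) (Reg rK) ;; Ld rt3 6 rIdx ;; Op rt2 Times (Reg rt2) (Reg rt3) ;;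
     Op rG Plus (Reg rG) (Reg rt2) ;; modq rG)"

text \<open>\<open>rDen\<close> collects the denominator only. \<open>rOk\<close> collects all
  quantities that must be units, later also the scale, so a final zero reveals a failed
  trial.\<close>

definition orth_den :: com where
  "orth_den = Op rDen Times (Reg rDen) (Reg rE) ;; modq rDen ;; Op rOk Times (Reg rOk) (Reg rE) ;; modq rOk ;;
     Op rOk Times (Reg rOk) (Reg rG) ;; modq rOk"

definition orth_phi :: com where
  "orth_phi = For ri3 rN (Ld rt2 7 ri3 ;; Op rt2 Times (Reg rt2) (Reg rG) ;; Ld rt3 8 ri3 ;;
     Op rt3 Times (Reg rt3) (Reg rE) ;; Op rt2 Minus (Reg rt2) (Reg rt3) ;; modq rt2 ;; St 7 ri3 (Reg rt2))"

definition orth_e :: com where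
  "orth_e = mov rE2 (Const 0) ;; For ri3 rN (Op rIdx Plus (Reg ri3) (Const 1) ;;
     Op rIdx Plus (Reg rIdx) (Reg rK) ;; Ld rt3 6 rIdx ;; Ld rt2 7 ri3 ;; Op rt2 Times (Reg rt2) (Reg rt3) ;;
     Op rE2 Plus (Reg rE2) (Reg rt2) ;; modq rE2)"

definition orth_psi :: com where
  "orth_psi = For ri3 rN (Op rIdx Plus (Reg ri3) (Const 1) ;; Ld rt2 7 ri3 ;;
     Op rt2 Times (Reg rt2) (Reg rG) ;; Ld rt3 8 rIdx ;; Op rt3 Times (Reg rt3) (Reg rE2) ;;
     Op rt2 Minus (Reg rt2) (Reg rt3) ;; modq rt2 ;; St 8 rIdx (Reg rt2))"

definition orth_step :: com where
  "orth_step = orth_g ;; orth_den ;; orth_phi ;; orth_e ;; orth_psi ;; mov rE (Reg rE2) ;;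
     Op rK Plus (Reg rK) (Const 1)"

definition scale :: com where
  "scale = dot rt1 1 2 ;; Op rt1 Plus (Reg rt1) (Const 1) ;; Op rDen Times (Reg rDen) (Reg rt1) ;; modq rDen ;;
     Op rOk Times (Reg rOk) (Reg rt1) ;; modq rOk ;;
     For ri3 rN (Ld rt2 0 ri3 ;; Op rDen Times (Reg rDen) (Reg rt2) ;; modq rDen ;;
       Op rOk Times (Reg rOk) (Reg rt2) ;; modq rOk)"

text \<open>Exhaustive search is affordable: \<open>rPM\<close> is about \<open>n^2\<close> and
  there are about \<open>n\<close> calls, up to logarithmic factors.\<close>

definition solve :: "nat \<Rightarrow> nat \<Rightarrow> nat \<Rightarrow> com" where
  "solve z a b = For ri3 rPM (Op rt1 Times (Reg a) (Reg ri3) ;; Op rt1 Minus (Reg rt1) (Reg b) ;; modq rt1 ;;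
     Op rt1 Minus (Const 1) (Reg rt1) ;; IfP rt1 (mov z (Reg ri3)))"

definition trial :: com where
  "trial = fill 0 ;; fill 1 ;; fill 2 ;; fill 3 ;; fill 4 ;; krylov ;; orth_init ;; For ri2 rN orth_step ;;
     scale ;; IfP rOk (solve rR rDen rG)"

text \<open>Garner's step: the correction is \<open>M z\<close> with \<open>z\<close> solving
  \<open>M z = r - x\<close> modulo \<open>q\<close>. Every long product or remainder has a short
  second operand.\<close>

definition crt :: com where
  "crt = Op rSA Rem (Reg rM) (Reg rQ) ;; Op rSB Rem (Reg rX) (Reg rQ) ;; Op rSB Minus (Reg rR) (Reg rSB) ;;
     solve rZ rSA rSB ;; Op rBig Times (Reg rM) (Reg rZ) ;; Op rX Plus (Reg rX) (Reg rBig) ;;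
     Op rM Times (Reg rM) (Reg rQ)"

text \<open>Trial divisors run from 2 to \<open>rSq + 1\<close>. For tiny \<open>n\<close> the
  candidate itself can lie in that range, so only divisors strictly below it are tried.\<close>

definition prime_test :: com where
  "prime_test = mov rPr (Const 1) ;; For ri1 rSq (Op rt1 Plus (Reg ri1) (Const 2) ;;
     Op rt2 Minus (Reg rQ) (Reg rt1) ;; IfP rt2 (Op rt2 Rem (Reg rQ) (Reg rt1) ;;
       Op rt2 Minus (Const 1) (Reg rt2) ;; IfP rt2 (mov rPr (Const 0))))"

definition prime_body :: com where
  "prime_body = mov rR (Const 0) ;; For ri1 rT trial ;; crt"

text \<open>\<open>rBnd - rM + 1\<close> is positive exactly while the modulus is at most the bound.
  Later candidates are skipped, so coins and time are spent only on the primes that are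
  needed.\<close>

definition candidate :: com where
  "candidate = Op rQ Plus (Reg rQ) (Const 1) ;; Op rBig Minus (Reg rBnd) (Reg rM) ;;
     Op rBig Plus (Reg rBig) (Const 1) ;; IfP rBig (prime_test ;; IfP rPr prime_body)"

definition max_entry :: com where
  "max_entry = For ri1 rNz (Op rt1 Times (Reg ri1) (Const 3) ;; Op rt1 Plus (Reg rt1) (Const 4) ;;
     Inp rt2 (Reg rt1) ;; Op rt3 Minus (Const 0) (Reg rt2) ;; IfP rt3 (mov rt2 (Reg rt3)) ;;
     Op rt3 Minus (Reg rt2) (Reg rU) ;; IfP rt3 (mov rU (Reg rt2)))"

definition pow2 :: "nat \<Rightarrow> nat \<Rightarrow> com" where
  "pow2 r e = mov r (Const 1) ;; For ri1 e (Op r Times (Reg r) (Const 2))"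

text \<open>The powers of two computed here satisfy \<open>rS \<ge> 64 n\<^sup>2\<close>, \<open>rPM = 4 rCnt = rSq\<^sup>2\<close>, and they leave room for
  enough primes between \<open>rS\<close> and \<open>rS + rCnt\<close> to exceed \<open>2 (nU)\<^sup>n\<close>.\<close>

definition sizes :: "nat \<Rightarrow> com" where
  "sizes c = Op rW Times (Reg rN) (Reg rU) ;; mov rt1 (Reg rW) ;; Bits rL rt1 ;; mov rt1 (Reg rN) ;;
     Bits rLn rt1 ;; mov rt1 (Reg rL) ;; Bits rLL rt1 ;;
     Op rB Times (Reg rLn) (Const 2) ;; Op rB Plus (Reg rB) (Const 6) ;; Op rT Times (Reg rL) (Const (int c + 3)) ;;
     Op rN2 Times (Reg rN) (Const 2)"

definition powers :: com where
  "powers = pow2 rS rB ;; Op rt1 Times (Reg rLL) (Const 2) ;; Op rt1 Plus (Reg rt1) (Reg rB) ;;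
     Op rt1 Plus (Reg rt1) (Const 6) ;; pow2 rCnt rt1 ;; Op rPM Times (Reg rCnt) (Const 4) ;;
     Op rt1 Plus (Reg rLn) (Reg rLL) ;; Op rt1 Plus (Reg rt1) (Const 7) ;; pow2 rSq rt1"

definition bound :: com where
  "bound = mov rBnd (Const 2) ;; For ri1 rN (Op rBnd Times (Reg rBnd) (Reg rW)) ;;
     mov rM (Const 1) ;; mov rX (Const 0) ;; mov rQ (Reg rS)"

definition center :: com where
  "center = Op rBig Times (Reg rX) (Const 2) ;; Op rBig Minus (Reg rBig) (Reg rM) ;;
     IfP rBig (Op rX Minus (Reg rX) (Reg rM))"

definition det_com :: "nat \<Rightarrow> com" where
  "det_com c = Inp rN (Const 0) ;; Inp rNz (Const 1) ;; max_entry ;; sizes c ;; powers ;; bound ;;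
     For ri0 rCnt candidate ;; center"

lemmas com_defs = fill_def dot_def rank_one_def sparse_mult_def diag_mult_def matvec_def krylov_def
  orth_init_def orth_g_def orth_den_def orth_phi_def orth_e_def orth_psi_def orth_step_def scale_def
  solve_def trial_def crt_def prime_test_def prime_body_def candidate_def max_entry_def pow2_def
  sizes_def powers_def bound_def center_def det_com_def

lemma wf_det_com: "wf (det_com c)"
  by (simp add: com_defs big_def)

section \<open>Rules for loops\<close>

text \<open>Relates loop entry to an arbitrary round, so that a loop invariant only has to mention
  what the body changes.\<close>

definition same :: "com \<Rightarrow> state \<Rightarrow> state \<Rightarrow> bool" where
  "same c s s' \<longleftrightarrow> (\<forall>r. r \<notin> wr c \<longrightarrow> regs s' r = regs s r) \<and> (\<forall>k. k \<notin> awr c \<longrightarrow> arr s' k = arr s k) \<and>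
     (\<not> flips c \<longrightarrow> cn s' = cn s)"

lemma sameD: "same c s s' \<Longrightarrow> r \<notin> wr c \<Longrightarrow> regs s' r = regs s r"
  "same c s s' \<Longrightarrow> k \<notin> awr c \<Longrightarrow> arr s' k = arr s k"
  "same c s s' \<Longrightarrow> \<not> flips c \<Longrightarrow> cn s' = cn s"
  by (auto simp: same_def)

lemma same_ev: "same c s (ev xs \<omega> c s)"
  using ev_frame by (simp add: same_def)

text \<open>The index of \<open>Inv\<close> counts completed rounds. Between rounds the loop
  register is decremented outside the body, which is why the invariant must be insensitive to it
  (\<open>stable\<close>).\<close>

lemma For_rule:
  assumes i: "i \<notin> wr c" and N: "regs s N = int n"
    and init: "Inv 0 s" and stable: "\<And>k s v. Inv k s \<Longrightarrow> Inv k (set_reg i v s)"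
    and step: "\<And>k s'. k < n \<Longrightarrow> same (For i N c) s s' \<Longrightarrow> Inv k s' \<Longrightarrow> regs s' i = int (n - Suc k) \<Longrightarrow>
      safe xs \<omega> X Y I c s' \<and> Inv (Suc k) (ev xs \<omega> c s')"
  shows "safe xs \<omega> X Y I (For i N c) s \<and> Inv n (ev xs \<omega> (For i N c) s)"
proof -
  let ?D = "\<lambda>s. set_reg i (regs s i - 1) s"
  let ?F = "\<lambda>s. ev xs \<omega> c (?D s)"
  define s0 where "s0 = set_reg i (int n) s"
  have loop: "same (For i N c) s ((?F ^^ k) s0) \<and> Inv k ((?F ^^ k) s0) \<and> regs ((?F ^^ k) s0) i = int (n - k) \<and>
      (\<forall>j<k. safe xs \<omega> X Y I c (?D ((?F ^^ j) s0)))" if "k \<le> n" for k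
    using that
  proof (induction k)
    case 0
    then show ?case using init stable by (auto simp: s0_def same_def)
  next
    case (Suc k)
    define t where "t = ?D ((?F ^^ k) s0)"
    have IH: "same (For i N c) s ((?F ^^ k) s0)" "Inv k ((?F ^^ k) s0)" "regs ((?F ^^ k) s0) i = int (n - k)"
      "\<forall>j<k. safe xs \<omega> X Y I c (?D ((?F ^^ j) s0))" using Suc by auto
    have t: "same (For i N c) s t" "Inv k t" "regs t i = int (n - Suc k)"
      using IH stable Suc.prems by (auto simp: t_def same_def)
    have st: "safe xs \<omega> X Y I c t" "Inv (Suc k) (ev xs \<omega> c t)"
      using step[OF _ t] Suc.prems by auto
    have "same (For i N c) s (ev xs \<omega> c t)"
      using t(1) same_ev[of c t xs \<omega>] by (simp add: same_def)
    moreover have "regs (ev xs \<omega> c t) i = int (n - Suc k)" using ev_regs[OF i, of xs \<omega> t] t(3) by simp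
    moreover have "(?F ^^ Suc k) s0 = ev xs \<omega> c t" by (simp add: t_def)
    ultimately show ?case using st IH(4) by (simp add: less_Suc_eq t_def[symmetric])
  qed
  have "ev xs \<omega> (For i N c) s = (?F ^^ n) s0" by (simp add: N s0_def)
  then show ?thesis using loop[of n] by (simp add: N s0_def)
qed

text \<open>Loops count down, so accumulators hold sums over final segments of the index
  range.\<close>

lemma sum_descending:
  "k < n \<Longrightarrow> (\<Sum>j\<in>{n - Suc k..<n}. f j) = f (n - Suc k) + (\<Sum>j\<in>{n - k..<n}. f j)"
proof -
  assume "k < n"
  then have "{n - Suc k..<n} = insert (n - Suc k) {n - k..<n}" by auto
  moreover have "n - Suc k \<notin> {n - k..<n}" using \<open>k < n\<close> by simp
  ultimately show ?thesis by simp
qed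

definition red :: "int \<Rightarrow> int \<Rightarrow> bool" where
  "red q v \<longleftrightarrow> 0 \<le> v \<and> v < q"

lemma red_mod [simp]: "0 < q \<Longrightarrow> red q (v mod q)"
  by (simp add: red_def)

lemma mult_bounds:
  fixes a b q r :: int
  assumes "0 \<le> a" "a < q" "0 \<le> b" "b < r"
  shows "0 \<le> a * b" "a * b \<le> q * r"
  using assms by (auto intro: mult_mono)

section \<open>Correctness of a trial\<close>

text \<open>The input is seen only through its triples; \<open>sparse\<close> is the link between
  them and the array \<open>A\<close>, in the form needed for matrix-vector products.\<close>

locale det_program =
  fixes xs :: "int list" and \<omega> :: "nat \<Rightarrow> bool" and X Y :: int and I n m :: nat
    and A :: "nat \<Rightarrow> nat \<Rightarrow> int" and row col :: "nat \<Rightarrow> nat" and ent :: "nat \<Rightarrow> int"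
  assumes n: "n \<ge> 1" and I: "I = 2 * n + 1" and IX: "64 + 16 * int (I + 1) \<le> X" and XY: "X \<le> Y"
    and row: "\<And>k. k < m \<Longrightarrow> input_at xs (3 * int k + 2) = int (row k) \<and> row k < n"
    and col: "\<And>k. k < m \<Longrightarrow> input_at xs (3 * int k + 3) = int (col k) \<and> col k < n"
    and ent: "\<And>k. k < m \<Longrightarrow> input_at xs (3 * int k + 4) = ent k \<and> \<bar>ent k\<bar> \<le> X"
    and mX: "3 * int m + 4 \<le> X"
    and sparse: "\<And>i v. i < n \<Longrightarrow> (\<Sum>j<n. A i j * v j) = (\<Sum>k<m. if row k = i then ent k * v (col k) else 0)"
begin

abbreviation "EV \<equiv> ev xs \<omega>"
abbreviation "SF \<equiv> safe xs \<omega> X Y I"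

lemma nX: "int n \<le> X" "2 * int n < X"
  using IX I by auto

lemma fill_spec:
  assumes s: "regs s rN = int n" "regs s rB = int b" "2 ^ b \<le> X"
  shows "SF (fill k) s \<and> cn (EV (fill k) s) = cn s + n * b \<and>
    (\<forall>i<n. arr (EV (fill k) s) k i = bitval \<omega> (cn s + i * b) b)"
proof -
  let ?J = "\<lambda>\<kappa> s'. cn s' = cn s + \<kappa> * b \<and> (\<forall>i<\<kappa>. arr s' k i = bitval \<omega> (cn s + i * b) b)"
  have "SF (fill k) s \<and> ?J n (EV (fill k) s)"
    unfolding fill_def
  proof (rule For_rule[where Inv = ?J])
    fix \<kappa> s'
    assume \<kappa>: "\<kappa> < n" and J: "?J \<kappa> s'" and i: "regs s' ri2 = int (n - Suc \<kappa>)"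
      and sm: "same (For ri2 rN (mov rt1 (Const 0) ;;
        For ri3 rB (Flip rt2 ;; Op rt1 Times (Reg rt1) (Const 2) ;; Op rt1 Plus (Reg rt1) (Reg rt2)) ;;
        Op rt3 Minus (Reg rN) (Const 1) ;; Op rt3 Minus (Reg rt3) (Reg ri2) ;; St k rt3 (Reg rt1))) s s'"
    let ?L = "For ri3 rB (Flip rt2 ;; Op rt1 Times (Reg rt1) (Const 2) ;; Op rt1 Plus (Reg rt1) (Reg rt2))"
    have c: "regs s' rN = int n" "regs s' rB = int b"
      using sameD(1)[OF sm, of rN] sameD(1)[OF sm, of rB] s by simp_all
    define s1 where "s1 = EV (mov rt1 (Const 0)) s'"
    let ?K = "\<lambda>l (t :: state). cn t = cn s1 + l \<and> regs t rt1 = bitval \<omega> (cn s1) l"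
    have L: "SF ?L s1 \<and> ?K b (EV ?L s1)"
    proof (rule For_rule[where Inv = ?K])
      fix l t assume l: "l < b" and K: "?K l t"
      have bd: "0 \<le> bitval \<omega> (cn s1) l" "bitval \<omega> (cn s1) l < 2 ^ l" using bitval_bounds by auto
      have "2 ^ Suc l \<le> (2::int) ^ b" using l by (intro power_increasing) auto
      then have "2 * bitval \<omega> (cn s1) l + 1 \<le> X" using bd s(3) by simp
      then show "SF (Flip rt2 ;; Op rt1 Times (Reg rt1) (Const 2) ;; Op rt1 Plus (Reg rt1) (Reg rt2)) t \<and>
        ?K (Suc l) (EV (Flip rt2 ;; Op rt1 Times (Reg rt1) (Const 2) ;; Op rt1 Plus (Reg rt1) (Reg rt2)) t)"
        using K bd IX by (simp add: bnd_def big_def)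
    qed (use c in \<open>auto simp: s1_def\<close>)
    define s2 where "s2 = EV ?L s1"
    have fr: "regs s2 rN = int n" "regs s2 ri2 = int (n - Suc \<kappa>)" "arr s2 = arr s'"
      using ev_regs[of rN ?L xs \<omega> s1] ev_regs[of ri2 ?L xs \<omega> s1] ev_arr[of _ ?L xs \<omega> s1] c i
      by (auto simp: s2_def s1_def fun_eq_iff)
    have bX: "\<bar>int n - 1\<bar> \<le> X" using n nX by simp
    have idx: "int n - 1 - int (n - Suc \<kappa>) = int \<kappa>" using \<kappa> by simp
    show "SF (mov rt1 (Const 0) ;; ?L ;; Op rt3 Minus (Reg rN) (Const 1) ;;
        Op rt3 Minus (Reg rt3) (Reg ri2) ;; St k rt3 (Reg rt1)) s' \<and>
      ?J (Suc \<kappa>) (EV (mov rt1 (Const 0) ;; ?L ;; Op rt3 Minus (Reg rN) (Const 1) ;;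
        Op rt3 Minus (Reg rt3) (Reg ri2) ;; St k rt3 (Reg rt1)) s')"
      unfolding safe.simps(6) ev.simps(6) s1_def[symmetric] s2_def[symmetric]
      using L fr J \<kappa> bX idx nX IX
      by (simp add: s2_def[symmetric] bnd_def big_def I less_Suc_eq del: ev.simps(8) safe.simps(8))
         (simp add: s1_def bnd_def)
  qed (use s in auto)
  then show ?thesis by blast
qed

text \<open>\<open>4 * q * q \<le> X\<close> leaves room for a product of residues plus an
  accumulator before reduction; the other inner loops rely on the same margin.\<close>

lemma dot_spec:
  assumes s: "regs s rN = int n" "regs s rQ = q" and q: "0 < q" "4 * q * q \<le> X"
    and k: "\<And>i. i < n \<Longrightarrow> red q (arr s k i)" "\<And>i. i < n \<Longrightarrow> red q (arr s l i)"
    and r: "r \<notin> {rN, rQ, ri3, rt2, rt3}" "\<not> big r"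
  shows "SF (dot r k l) s \<and> regs (EV (dot r k l) s) r = (\<Sum>i<n. arr s k i * arr s l i) mod q"
proof -
  let ?B = "Ld rt2 k ri3 ;; Ld rt3 l ri3 ;; Op rt2 Times (Reg rt2) (Reg rt3) ;; Op r Plus (Reg r) (Reg rt2) ;; modq r"
  define s1 where "s1 = EV (mov r (Const 0)) s"
  let ?J = "\<lambda>\<kappa> s'. regs s' r = (\<Sum>i\<in>{n - \<kappa>..<n}. arr s k i * arr s l i) mod q"
  have qq: "q \<le> q * q" using q mult_left_mono[of 1 q q] by simp
  have "SF (For ri3 rN ?B) s1 \<and> ?J n (EV (For ri3 rN ?B) s1)"
  proof (rule For_rule[where Inv = ?J])
    fix \<kappa> s'
    assume \<kappa>: "\<kappa> < n" and sm: "same (For ri3 rN ?B) s1 s'" and J: "?J \<kappa> s'" and i: "regs s' ri3 = int (n - Suc \<kappa>)"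
    define j where "j = n - Suc \<kappa>"
    have j: "j < n" using \<kappa> by (simp add: j_def)
    have c: "regs s' rQ = q" "arr s' k = arr s k" "arr s' l = arr s l"
      using sameD(1)[OF sm, of rQ] sameD(2)[OF sm] s r by (auto simp: s1_def)
    have ab: "0 \<le> arr s k j" "arr s k j < q" "0 \<le> arr s l j" "arr s l j < q"
      using k[OF j] by (auto simp: red_def)
    note mb = mult_bounds[OF ab]
    have acc: "0 \<le> regs s' r" "regs s' r < q" using J q by simp_all
    have b1: "\<bar>arr s k j * arr s l j\<bar> \<le> X" using mb q qq by linarith
    have b2: "\<bar>regs s' r + arr s k j * arr s l j\<bar> \<le> X" using mb acc q qq by linarith
    have b3: "\<bar>(regs s' r + arr s k j * arr s l j) mod q\<bar> \<le> X"
      using q qq pos_mod_bound[of q "regs s' r + arr s k j * arr s l j"]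
        pos_mod_sign[of q "regs s' r + arr s k j * arr s l j"] by linarith
    have v: "(regs s' r + arr s k j * arr s l j) mod q = (\<Sum>i\<in>{n - Suc \<kappa>..<n}. arr s k i * arr s l i) mod q"
      using J sum_descending[OF \<kappa>, of "\<lambda>i. arr s k i * arr s l i"]
      by (simp add: j_def mod_add_right_eq mod_add_left_eq add.commute)
    show "SF ?B s' \<and> ?J (Suc \<kappa>) (EV ?B s')"
      using i c r j b1 b2 b3 v by (simp add: j_def[symmetric] bnd_def big_def I)
  qed (use s r in \<open>auto simp: s1_def\<close>)
  then show ?thesis
    unfolding dot_def safe.simps(6) ev.simps(6) s1_def[symmetric]
    using IX XY by (simp add: bnd_def atLeast0LessThan del: ev.simps(8) safe.simps(8))
qed

lemma rank_one_spec:
  assumes s: "regs s rN = int n" "regs s rQ = q" "red q (regs s rt1)" and q: "0 < q" "4 * q * q \<le> X"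
    and k: "\<And>i. i < n \<Longrightarrow> red q (arr s 1 i)" "\<And>i. i < n \<Longrightarrow> red q (arr s 4 i)"
  shows "SF rank_one s \<and> (\<forall>i<n. arr (EV rank_one s) 4 i = (arr s 4 i + arr s 1 i * regs s rt1) mod q
    \<and> arr (EV rank_one s) 5 i = 0)"
proof -
  let ?v = "\<lambda>i. (arr s 4 i + arr s 1 i * regs s rt1) mod q"
  let ?J = "\<lambda>\<kappa> s'. (\<forall>i<n. arr s' 4 i = (if i < n - \<kappa> then arr s 4 i else ?v i)) \<and> (\<forall>i<n. n - \<kappa> \<le> i \<longrightarrow> arr s' 5 i = 0)"
  have qq: "q \<le> q * q" using q mult_left_mono[of 1 q q] by simp
  let ?B = "Ld rt2 1 ri3 ;; Op rt2 Times (Reg rt2) (Reg rt1) ;; Ld rt3 4 ri3 ;;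
     Op rt3 Plus (Reg rt3) (Reg rt2) ;; modq rt3 ;; St 4 ri3 (Reg rt3) ;; St 5 ri3 (Const 0)"
  have "SF (For ri3 rN ?B) s \<and> ?J n (EV (For ri3 rN ?B) s)"
  proof (rule For_rule[where Inv = ?J])
    fix \<kappa> s'
    assume \<kappa>: "\<kappa> < n" and sm: "same (For ri3 rN ?B) s s'" and J: "?J \<kappa> s'" and i: "regs s' ri3 = int (n - Suc \<kappa>)"
    define j where "j = n - Suc \<kappa>"
    have j: "j < n" "j < n - \<kappa>" using \<kappa> by (auto simp: j_def)
    have c: "regs s' rQ = q" "regs s' rt1 = regs s rt1" "arr s' 1 = arr s 1"
      using sameD(1)[OF sm, of rQ] sameD(1)[OF sm, of rt1] sameD(2)[OF sm, of 1] s by auto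
    have a4: "arr s' 4 j = arr s 4 j" using J j by simp
    have ab: "0 \<le> arr s 1 j" "arr s 1 j < q" "0 \<le> regs s rt1" "regs s rt1 < q"
      using k(1)[OF j(1)] s(3) by (auto simp: red_def)
    have a4': "0 \<le> arr s 4 j" "arr s 4 j < q" using k(2)[OF j(1)] by (auto simp: red_def)
    note mb = mult_bounds[OF ab]
    have b1: "\<bar>arr s 1 j * regs s rt1\<bar> \<le> X" using mb q qq by linarith
    have b2: "\<bar>arr s 4 j + arr s 1 j * regs s rt1\<bar> \<le> X" using mb a4' q qq by linarith
    have b3: "\<bar>?v j\<bar> \<le> X"
      using q qq pos_mod_bound[of q "arr s 4 j + arr s 1 j * regs s rt1"]
        pos_mod_sign[of q "arr s 4 j + arr s 1 j * regs s rt1"] by linarith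
    have up: "i < n - Suc \<kappa> \<longleftrightarrow> i < j" "n - Suc \<kappa> \<le> i \<longleftrightarrow> j \<le> i" for i by (auto simp: j_def)
    have up2: "i < n - \<kappa> \<longleftrightarrow> i \<le> j" "n - \<kappa> \<le> i \<longleftrightarrow> j < i" for i using \<kappa> by (auto simp: j_def)
    show "SF ?B s' \<and> ?J (Suc \<kappa>) (EV ?B s')"
      unfolding up using i c j(1) b1 b2 b3 a4 J[unfolded up2] IX by (auto simp: j_def[symmetric] bnd_def big_def I)
  qed (use s in auto)
  then show ?thesis unfolding rank_one_def by simp
qed

lemma diag_mult_spec:
  assumes s: "regs s rN = int n" "regs s rQ = q" and q: "0 < q" "4 * q * q \<le> X"
    and k: "\<And>i. i < n \<Longrightarrow> red q (arr s 0 i)" "\<And>i. i < n \<Longrightarrow> red q (arr s 5 i)"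
  shows "SF diag_mult s \<and> (\<forall>i<n. arr (EV diag_mult s) 4 i = (arr s 0 i * arr s 5 i) mod q)"
proof -
  let ?v = "\<lambda>i. (arr s 0 i * arr s 5 i) mod q"
  let ?J = "\<lambda>\<kappa> s'. \<forall>i<n. n - \<kappa> \<le> i \<longrightarrow> arr s' 4 i = ?v i"
  have qq: "q \<le> q * q" using q mult_left_mono[of 1 q q] by simp
  let ?B = "Ld rt2 0 ri3 ;; Ld rt3 5 ri3 ;; Op rt2 Times (Reg rt2) (Reg rt3) ;; modq rt2 ;; St 4 ri3 (Reg rt2)"
  have "SF (For ri3 rN ?B) s \<and> ?J n (EV (For ri3 rN ?B) s)"
  proof (rule For_rule[where Inv = ?J])
    fix \<kappa> s'
    assume \<kappa>: "\<kappa> < n" and sm: "same (For ri3 rN ?B) s s'" and J: "?J \<kappa> s'" and i: "regs s' ri3 = int (n - Suc \<kappa>)"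
    define j where "j = n - Suc \<kappa>"
    have j: "j < n" using \<kappa> by (auto simp: j_def)
    have c: "regs s' rQ = q" "arr s' 0 = arr s 0" "arr s' 5 = arr s 5"
      using sameD(1)[OF sm, of rQ] sameD(2)[OF sm, of 0] sameD(2)[OF sm, of 5] s by auto
    have ab: "0 \<le> arr s 0 j" "arr s 0 j < q" "0 \<le> arr s 5 j" "arr s 5 j < q"
      using k[OF j] by (auto simp: red_def)
    note mb = mult_bounds[OF ab]
    have b1: "\<bar>arr s 0 j * arr s 5 j\<bar> \<le> X" using mb q qq by linarith
    have b3: "\<bar>?v j\<bar> \<le> X"
      using q qq pos_mod_bound[of q "arr s 0 j * arr s 5 j"] pos_mod_sign[of q "arr s 0 j * arr s 5 j"] by linarith
    have up: "n - Suc \<kappa> \<le> i \<longleftrightarrow> j \<le> i" "n - \<kappa> \<le> i \<longleftrightarrow> j < i" for i using \<kappa> by (auto simp: j_def)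
    show "SF ?B s' \<and> ?J (Suc \<kappa>) (EV ?B s')"
      unfolding up using i c j b1 b3 J[unfolded up] IX by (auto simp: j_def[symmetric] bnd_def big_def I)
  qed (use s in auto)
  then show ?thesis unfolding diag_mult_def by simp
qed

text \<open>The triples come in arbitrary order, so the invariant describes all \<open>n\<close>
  accumulators at once, each as the partial sum over the triples of its row treated so far.\<close>

lemma sparse_mult_spec:
  assumes s: "regs s rNz = int m" "regs s rQ = q" and q: "0 < q" "4 * q * q \<le> X"
    and k: "\<And>i. i < n \<Longrightarrow> red q (arr s 4 i)" "\<And>i. i < n \<Longrightarrow> arr s 5 i = 0"
  shows "SF sparse_mult s \<and> (\<forall>i<n. arr (EV sparse_mult s) 5 i = (\<Sum>j<n. A i j * arr s 4 j) mod q)"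
proof -
  let ?f = "\<lambda>i k. if row k = i then ent k * arr s 4 (col k) else 0"
  let ?J = "\<lambda>\<kappa> s'. \<forall>i<n. arr s' 5 i = (\<Sum>k\<in>{m - \<kappa>..<m}. ?f i k) mod q"
  have qq: "q \<le> q * q" using q mult_left_mono[of 1 q q] by simp
  let ?B = "Op rIdx Times (Reg ri3) (Const 3) ;; Op rIdx Plus (Reg rIdx) (Const 2) ;;
     Inp rt1 (Reg rIdx) ;; Op rIdx Plus (Reg rIdx) (Const 1) ;; Inp rt2 (Reg rIdx) ;;
     Op rIdx Plus (Reg rIdx) (Const 1) ;; Inp rt3 (Reg rIdx) ;; modq rt3 ;;
     Ld rt4 4 rt2 ;; Op rt3 Times (Reg rt3) (Reg rt4) ;; Ld rt4 5 rt1 ;; Op rt4 Plus (Reg rt4) (Reg rt3) ;;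
     modq rt4 ;; St 5 rt1 (Reg rt4)"
  have "SF (For ri3 rNz ?B) s \<and> ?J m (EV (For ri3 rNz ?B) s)"
  proof (rule For_rule[where Inv = ?J])
    fix \<kappa> s'
    assume \<kappa>: "\<kappa> < m" and sm: "same (For ri3 rNz ?B) s s'" and J: "?J \<kappa> s'" and i: "regs s' ri3 = int (m - Suc \<kappa>)"
    define j where "j = m - Suc \<kappa>"
    have j: "j < m" using \<kappa> by (auto simp: j_def)
    have c: "regs s' rQ = q" "arr s' 4 = arr s 4"
      using sameD(1)[OF sm, of rQ] sameD(2)[OF sm, of 4] s by auto
    have jj: "int j * 3 = 3 * int j" by simp
    have in1: "input_at xs (3 * int j + 2) = int (row j)" "row j < n" using row[OF j] by auto
    have in2: "input_at xs (3 * int j + 3) = int (col j)" "col j < n" using col[OF j] by auto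
    have in3: "input_at xs (3 * int j + 4) = ent j" "\<bar>ent j\<bar> \<le> X" using ent[OF j] by auto
    have jX: "3 * int j + 4 \<le> X" using j mX by linarith
    have em: "0 \<le> ent j mod q" "ent j mod q < q" using q by auto
    have vc: "0 \<le> arr s 4 (col j)" "arr s 4 (col j) < q" using k(1)[OF in2(2)] by (auto simp: red_def)
    note mb = mult_bounds[OF em vc]
    have old: "arr s' 5 (row j) = (\<Sum>k\<in>{m - \<kappa>..<m}. ?f (row j) k) mod q" using J in1 by simp
    have ob: "0 \<le> arr s' 5 (row j)" "arr s' 5 (row j) < q" unfolding old using q by auto
    let ?w = "(arr s' 5 (row j) + ent j mod q * arr s 4 (col j)) mod q"
    have b0: "\<bar>ent j mod q\<bar> \<le> X" using em q qq by linarith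
    have b1: "\<bar>ent j mod q * arr s 4 (col j)\<bar> \<le> X" using mb q qq by linarith
    have b2: "\<bar>arr s' 5 (row j) + ent j mod q * arr s 4 (col j)\<bar> \<le> X" using mb ob q qq by linarith
    have b3: "\<bar>?w\<bar> \<le> X"
      using q qq pos_mod_bound[of q "arr s' 5 (row j) + ent j mod q * arr s 4 (col j)"]
        pos_mod_sign[of q "arr s' 5 (row j) + ent j mod q * arr s 4 (col j)"] by linarith
    have new: "?w = (\<Sum>k\<in>{m - Suc \<kappa>..<m}. ?f (row j) k) mod q"
    proof -
      have "?w = (arr s' 5 (row j) + ent j * arr s 4 (col j)) mod q"
        by (metis mod_add_right_eq mod_mult_left_eq)
      also have "\<dots> = ((\<Sum>k\<in>{m - \<kappa>..<m}. ?f (row j) k) + ent j * arr s 4 (col j)) mod q"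
        unfolding old by (rule mod_add_left_eq)
      finally show ?thesis using sum_descending[OF \<kappa>, of "?f (row j)"] by (simp add: j_def add.commute)
    qed
    have other: "(\<Sum>k\<in>{m - Suc \<kappa>..<m}. ?f i k) = (\<Sum>k\<in>{m - \<kappa>..<m}. ?f i k)" if "i \<noteq> row j" for i
      using sum_descending[OF \<kappa>, of "?f i"] that by (simp add: j_def)
    have nI: "int (row j) < int I" "int (col j) < int I" "int (row j) \<le> X" "int (col j) \<le> X"
      using in1 in2 I nX by auto
    have "SF ?B s' \<and> arr (EV ?B s') 5 = (arr s' 5)(row j := ?w)"
      using i c in1 in2 in3 jX b0 b1 b2 b3 nI IX
      by (simp add: j_def[symmetric] jj bnd_def big_def add.assoc)
    then show "SF ?B s' \<and> ?J (Suc \<kappa>) (EV ?B s')"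
      using new other J by (simp del: ev.simps safe.simps)
  qed (use s k in auto)
  then have r: "SF sparse_mult s" "\<And>i. i < n \<Longrightarrow> arr (EV sparse_mult s) 5 i = (\<Sum>k\<in>{m - m..<m}. ?f i k) mod q"
    unfolding sparse_mult_def by blast+
  have "arr (EV sparse_mult s) 5 i = (\<Sum>j<n. A i j * arr s 4 j) mod q" if "i < n" for i
    unfolding r(2)[OF that] sparse[OF that] by (simp only: diff_self_eq_0 atLeast0LessThan)
  then show ?thesis using r(1) by blast
qed

end

section \<open>Framing of the parts of a trial, and the Krylov phase\<close>

lemma wr_trial_parts [simp]:
  "wr (fill k) = {ri2, ri3, rt1, rt2, rt3}" "wr (dot r k l) = {r, ri3, rt2, rt3}"
  "wr rank_one = {ri3, rt2, rt3}" "wr sparse_mult = {ri3, rIdx, rt1, rt2, rt3, rt4}"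
  "wr diag_mult = {ri3, rt2, rt3}" "wr matvec = {ri3, rIdx, rt1, rt2, rt3, rt4}"
  "wr krylov = {ri2, ri3, rIdx, rt1, rt2, rt3, rt4, rK}"
  "wr orth_init = {ri3, rIdx, rE, rDen, rOk, rK}" "wr orth_g = {ri3, rIdx, rt2, rt3, rG}"
  "wr orth_den = {rDen, rOk}" "wr orth_phi = {ri3, rt2, rt3}" "wr orth_e = {ri3, rIdx, rt2, rt3, rE2}"
  "wr orth_psi = {ri3, rIdx, rt2, rt3}"
  "wr orth_step = {ri3, rIdx, rt2, rt3, rG, rDen, rOk, rE, rE2, rK}"
  "wr scale = {ri3, rt1, rt2, rt3, rDen, rOk}" "wr (solve z a b) = {ri3, rt1, z}"
  "wr trial = {ri2, ri3, rIdx, rt1, rt2, rt3, rt4, rK, rE, rDen, rOk, rG, rE2, rR}"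
  by (auto simp: com_defs)

lemma awr_trial_parts [simp]:
  "awr (fill k) = {k}" "awr (dot r k l) = {}" "awr rank_one = {4, 5}" "awr sparse_mult = {5}"
  "awr diag_mult = {4}" "awr matvec = {4, 5}" "awr krylov = {4, 5, 6}" "awr orth_init = {7, 8}"
  "awr orth_g = {}" "awr orth_den = {}" "awr orth_phi = {7}" "awr orth_e = {}" "awr orth_psi = {8}"
  "awr orth_step = {7, 8}" "awr scale = {}" "awr (solve z a b) = {}"
  by (auto simp: com_defs)

lemma flips_trial_parts [simp]:
  "\<not> flips (dot r k l)" "\<not> flips matvec" "\<not> flips krylov" "\<not> flips orth_init" "\<not> flips orth_step"
  "\<not> flips scale" "\<not> flips (solve z a b)"
  by (auto simp: com_defs)

lemma cong_mod_left: "[a mod q = b] (mod q) \<longleftrightarrow> [a = b] (mod (q::int))"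
  by (simp add: cong_def)

text \<open>The machine runs the recurrence on residues, not on the integers \<open>s\<close>; being
  division-free it respects congruences. For \<open>k < n\<close> only terms below
  \<open>2 n\<close> enter.\<close>

lemma phi_psi_cong:
  fixes q :: int
  assumes s: "\<And>m. m < 2 * n \<Longrightarrow> [s m = s' m] (mod q)" and "k < n"
  shows "(\<forall>i. [phi n s k i = phi n s' k i] (mod q)) \<and> (\<forall>i. [psi n s k i = psi n s' k i] (mod q)) \<and>
    [ee n s k = ee n s' k] (mod q) \<and> [gg n s k = gg n s' k] (mod q)"
  using assms(2)
proof (induction k)
  case 0
  have "[ee n s 0 = ee n s' 0] (mod q)" "[gg n s 0 = gg n s' 0] (mod q)"
    unfolding ee_def gg_def phi_0 psi_0 using 0
    by (intro cong_sum cong_scalar_left s; simp)+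
  then show ?case by (simp add: phi_0 psi_0)
next
  case (Suc k)
  then have IH: "\<And>i. [phi n s k i = phi n s' k i] (mod q)" "\<And>i. [psi n s k i = psi n s' k i] (mod q)"
    "[ee n s k = ee n s' k] (mod q)" "[gg n s k = gg n s' k] (mod q)" by auto
  have phi: "[phi n s (Suc k) i = phi n s' (Suc k) i] (mod q)" for i
    unfolding phi_Suc by (cases "i = 0") (simp_all add: cong_diff cong_mult IH)
  have ee: "[ee n s (Suc k) = ee n s' (Suc k)] (mod q)"
    unfolding ee_def using Suc.prems by (intro cong_sum cong_mult s phi) auto
  have psi: "[psi n s (Suc k) i = psi n s' (Suc k) i] (mod q)" for i
    unfolding psi_Suc by (intro cong_diff cong_mult IH phi ee)
  have gg: "[gg n s (Suc k) = gg n s' (Suc k)] (mod q)"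
    unfolding gg_def using Suc.prems by (intro cong_sum cong_mult s psi) auto
  show ?case using phi ee psi gg by blast
qed

context det_program
begin

lemma matvec_spec:
  assumes s: "regs s rN = int n" "regs s rNz = int m" "regs s rQ = q" and q: "0 < q" "4 * q * q \<le> X"
    and k: "\<And>i. i < n \<Longrightarrow> red q (arr s 0 i) \<and> red q (arr s 1 i) \<and> red q (arr s 2 i) \<and> red q (arr s 4 i)"
  shows "SF matvec s \<and> (\<forall>i<n. red q (arr (EV matvec s) 4 i) \<and>
    [arr (EV matvec s) 4 i = mv n (prec n A (arr s 0) (arr s 1) (arr s 2)) (arr s 4) i] (mod q))"
proof -
  define s1 where "s1 = EV (dot rt1 2 4) s"
  define s2 where "s2 = EV rank_one s1"
  define s3 where "s3 = EV sparse_mult s2"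
  define s4 where "s4 = EV diag_mult s3"
  define t where "t = (\<Sum>i<n. arr s 2 i * arr s 4 i) mod q"
  have 1: "SF (dot rt1 2 4) s" "regs s1 rt1 = t"
    using dot_spec[OF s(1,3) q, of 2 4 rt1] k by (auto simp: s1_def t_def big_def)
  have f1: "regs s1 rN = int n" "regs s1 rNz = int m" "regs s1 rQ = q" "\<And>k. arr s1 k = arr s k"
    using s by (auto simp: s1_def ev_regs ev_arr)
  have t: "red q t" using q by (simp add: t_def)
  have 2: "SF rank_one s1" "\<And>i. i < n \<Longrightarrow> arr s2 4 i = (arr s 4 i + arr s 1 i * t) mod q"
      "\<And>i. i < n \<Longrightarrow> arr s2 5 i = 0"
    using rank_one_spec[OF f1(1,3) _ q] 1 t k by (auto simp: s2_def f1)
  have f2: "regs s2 rN = int n" "regs s2 rNz = int m" "regs s2 rQ = q" "arr s2 0 = arr s 0"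
    using f1 by (auto simp: s2_def ev_regs ev_arr)
  have 3: "SF sparse_mult s2" "\<And>i. i < n \<Longrightarrow> arr s3 5 i = (\<Sum>j<n. A i j * arr s2 4 j) mod q"
    using sparse_mult_spec[OF f2(2,3) q] 2 q by (auto simp: s3_def)
  have f3: "regs s3 rN = int n" "regs s3 rQ = q" "arr s3 0 = arr s 0"
    using f2 by (auto simp: s3_def ev_regs ev_arr)
  have 4: "SF diag_mult s3" "\<And>i. i < n \<Longrightarrow> arr s4 4 i = (arr s 0 i * arr s3 5 i) mod q"
    using diag_mult_spec[OF f3(1,2) q] 3 k q by (auto simp: s4_def f3)
  have ev: "EV matvec s = s4" by (simp add: matvec_def s1_def s2_def s3_def s4_def)
  have "SF matvec s" using 1 2 3 4 by (simp add: matvec_def s1_def s2_def s3_def)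
  moreover have "red q (arr s4 4 i)" if "i < n" for i using 4(2)[OF that] q by simp
  moreover have "[arr s4 4 i = mv n (prec n A (arr s 0) (arr s 1) (arr s 2)) (arr s 4) i] (mod q)" if i: "i < n" for i
  proof -
    let ?t = "\<Sum>i<n. arr s 2 i * arr s 4 i"
    have v: "[arr s2 4 j = arr s 4 j + arr s 1 j * ?t] (mod q)" if "j < n" for j
    proof -
      have "[t = ?t] (mod q)" by (simp add: t_def cong_def)
      then have "[arr s 4 j + arr s 1 j * t = arr s 4 j + arr s 1 j * ?t] (mod q)"
        by (intro cong_add cong_scalar_left cong_refl)
      then show ?thesis using 2(2)[OF that] by (simp add: cong_mod_left)
    qed
    have w: "[arr s3 5 i = (\<Sum>j<n. A i j * (arr s 4 j + arr s 1 j * ?t))] (mod q)"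
      unfolding 3(2)[OF i] cong_mod_left by (intro cong_sum cong_scalar_left v) simp
    have "[arr s4 4 i = arr s 0 i * (\<Sum>j<n. A i j * (arr s 4 j + arr s 1 j * ?t))] (mod q)"
      unfolding 4(2)[OF i] cong_mod_left by (intro cong_scalar_left w)
    moreover have "mv n (prec n A (arr s 0) (arr s 1) (arr s 2)) (arr s 4) i
        = arr s 0 i * (\<Sum>j<n. A i j * (arr s 4 j + arr s 1 j * ?t))"
    proof -
      have e1: "(\<Sum>j<n. (\<Sum>l<n. A i l * arr s 1 l) * arr s 2 j * arr s 4 j) = (\<Sum>l<n. A i l * arr s 1 l) * ?t"
        by (simp add: sum_distrib_left mult.assoc)
      have e2: "(\<Sum>j<n. A i j * (arr s 1 j * ?t)) = (\<Sum>l<n. A i l * arr s 1 l) * ?t"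
        by (simp add: sum_distrib_right mult.assoc)
      have "mv n (prec n A (arr s 0) (arr s 1) (arr s 2)) (arr s 4) i
          = (\<Sum>j<n. arr s 0 i * (A i j * arr s 4 j + (\<Sum>l<n. A i l * arr s 1 l) * arr s 2 j * arr s 4 j))"
        unfolding mv_def prec_def by (intro sum.cong refl) (simp add: distrib_right mult.assoc)
      also have "\<dots> = arr s 0 i * ((\<Sum>j<n. A i j * arr s 4 j) + (\<Sum>l<n. A i l * arr s 1 l) * ?t)"
        unfolding e1[symmetric] sum.distrib[symmetric] sum_distrib_left[symmetric] ..
      also have "\<dots> = arr s 0 i * (\<Sum>j<n. A i j * (arr s 4 j + arr s 1 j * ?t))"
        unfolding e2[symmetric] sum.distrib[symmetric] distrib_left[symmetric] ..
      finally show ?thesis .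
    qed
    ultimately show ?thesis by simp
  qed
  ultimately show ?thesis unfolding ev by blast
qed

lemma krylov_spec:
  assumes s: "regs s rN = int n" "regs s rNz = int m" "regs s rQ = q" "regs s rN2 = 2 * int n"
    and q: "0 < q" "4 * q * q \<le> X"
    and k: "\<And>i. i < n \<Longrightarrow> red q (arr s 0 i) \<and> red q (arr s 1 i) \<and> red q (arr s 2 i) \<and> red q (arr s 3 i) \<and> red q (arr s 4 i)"
    and B: "B = prec n A (arr s 0) (arr s 1) (arr s 2)"
  shows "SF krylov s \<and> (\<forall>i<2 * n. red q (arr (EV krylov s) 6 i) \<and>
    [arr (EV krylov s) 6 i = krylov_seq n B (arr s 3) (arr s 4) i] (mod q))"
proof -
  let ?B = "dot rt1 3 4 ;; St 6 rK (Reg rt1) ;; Op rK Plus (Reg rK) (Const 1) ;; matvec"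
  define s0 where "s0 = EV (mov rK (Const 0)) s"
  let ?J = "\<lambda>\<kappa> s'. regs s' rK = int \<kappa> \<and>
    (\<forall>i<\<kappa>. red q (arr s' 6 i) \<and> [arr s' 6 i = krylov_seq n B (arr s 3) (arr s 4) i] (mod q)) \<and>
    (\<forall>i<n. red q (arr s' 4 i) \<and> [arr s' 4 i = kry n B (arr s 4) \<kappa> i] (mod q))"
  have "SF (For ri2 rN2 ?B) s0 \<and> ?J (2 * n) (EV (For ri2 rN2 ?B) s0)"
  proof (rule For_rule[where Inv = ?J])
    fix \<kappa> s'
    assume \<kappa>: "\<kappa> < 2 * n" and sm: "same (For ri2 rN2 ?B) s0 s'" and J: "?J \<kappa> s'"
    have c: "regs s' rN = int n" "regs s' rNz = int m" "regs s' rQ = q"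
        "arr s' 0 = arr s 0" "arr s' 1 = arr s 1" "arr s' 2 = arr s 2" "arr s' 3 = arr s 3"
      using sameD(1)[OF sm, of rN] sameD(1)[OF sm, of rNz] sameD(1)[OF sm, of rQ] sameD(2)[OF sm, of 0]
        sameD(2)[OF sm, of 1] sameD(2)[OF sm, of 2] sameD(2)[OF sm, of 3] s by (auto simp: s0_def)
    have J4: "\<And>i. i < n \<Longrightarrow> red q (arr s' 4 i)" "\<And>i. i < n \<Longrightarrow> [arr s' 4 i = kry n B (arr s 4) \<kappa> i] (mod q)"
      using J by auto
    define s1 where "s1 = EV (dot rt1 3 4) s'"
    have 1: "SF (dot rt1 3 4) s'" "regs s1 rt1 = (\<Sum>i<n. arr s 3 i * arr s' 4 i) mod q"
      using dot_spec[OF c(1,3) q, of 3 4 rt1] k J4 by (auto simp: s1_def c big_def)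
    have f1: "regs s1 rN = int n" "regs s1 rNz = int m" "regs s1 rQ = q" "regs s1 rK = int \<kappa>" "\<And>k. arr s1 k = arr s' k"
      using c J by (auto simp: s1_def ev_regs ev_arr)
    have d: "[(\<Sum>i<n. arr s 3 i * arr s' 4 i) mod q = krylov_seq n B (arr s 3) (arr s 4) \<kappa>] (mod q)"
      unfolding cong_mod_left krylov_seq_def by (intro cong_sum cong_scalar_left J4) simp
    define s2 where "s2 = EV (St 6 rK (Reg rt1) ;; Op rK Plus (Reg rK) (Const 1)) s1"
    have f2: "regs s2 rN = int n" "regs s2 rNz = int m" "regs s2 rQ = q" "regs s2 rK = int (Suc \<kappa>)"
        "arr s2 0 = arr s 0" "arr s2 1 = arr s 1" "arr s2 2 = arr s 2" "arr s2 4 = arr s' 4"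
        "arr s2 6 = (arr s' 6)(\<kappa> := (\<Sum>i<n. arr s 3 i * arr s' 4 i) mod q)"
      using f1 1 c by (auto simp: s2_def)
    have 2: "SF (St 6 rK (Reg rt1) ;; Op rK Plus (Reg rK) (Const 1)) s1"
      using f1 \<kappa> I IX by (simp add: bnd_def big_def)
    have 3: "SF matvec s2" "\<And>i. i < n \<Longrightarrow> red q (arr (EV matvec s2) 4 i)"
        "\<And>i. i < n \<Longrightarrow> [arr (EV matvec s2) 4 i = mv n B (arr s' 4) i] (mod q)"
      using matvec_spec[OF f2(1,2,3) q] k J4 by (auto simp: f2 B simp del: One_nat_def)
    have m: "[mv n B (arr s' 4) i = kry n B (arr s 4) (Suc \<kappa>) i] (mod q)" for i
      unfolding kry_Suc mv_def by (intro cong_sum cong_scalar_left J4) simp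
    have e: "EV ?B s' = EV matvec s2" by (simp add: s2_def s1_def)
    have f3: "regs (EV matvec s2) rK = int (Suc \<kappa>)" "arr (EV matvec s2) 6 = arr s2 6"
      using f2 by (auto simp: ev_regs ev_arr)
    have sf: "SF ?B s'" using 1 2 3 by (simp add: s2_def s1_def)
    have "red q (arr s2 6 i) \<and> [arr s2 6 i = krylov_seq n B (arr s 3) (arr s 4) i] (mod q)" if "i < Suc \<kappa>" for i
      using that J d q by (cases "i = \<kappa>") (auto simp: f2)
    moreover have "[arr (EV matvec s2) 4 i = kry n B (arr s 4) (Suc \<kappa>) i] (mod q)" if "i < n" for i
      using cong_trans[OF 3(3)[OF that] m] .
    ultimately show "SF ?B s' \<and> ?J (Suc \<kappa>) (EV ?B s')"
      unfolding e using sf f3 3(2) by auto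
  qed (use s k in \<open>auto simp: s0_def\<close>)
  then show ?thesis
    unfolding krylov_def safe.simps(6) ev.simps(6) s0_def[symmetric]
    using IX by (simp add: bnd_def big_def del: ev.simps(8) safe.simps(8))
qed

lemma solve_spec:
  fixes PM :: nat and va vb :: int
  assumes s: "regs s rQ = q" "regs s rPM = int PM" "regs s a = va" "regs s b = vb"
    and q: "0 < q" "q \<le> int PM" "4 * int PM * int PM \<le> X"
    and v: "red q va" "\<bar>vb\<bar> \<le> 2 * int PM"
    and r: "a \<notin> {ri3, rt1, z}" "b \<notin> {ri3, rt1, z}" "z \<notin> {ri3, rt1, rQ, rPM}" "\<not> big z"
    and ex: "j0 < PM" "[va * int j0 = vb] (mod q)"
  shows "SF (solve z a b) s \<and> (\<exists>j\<le>j0. regs (EV (solve z a b) s) z = int j \<and> [va * int j = vb] (mod q))"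
proof -
  let ?B = "Op rt1 Times (Reg a) (Reg ri3) ;; Op rt1 Minus (Reg rt1) (Reg b) ;; modq rt1 ;;
     Op rt1 Minus (Const 1) (Reg rt1) ;; IfP rt1 (mov z (Reg ri3))"
  let ?P = "\<lambda>j. [va * int j = vb] (mod q)"
  \<comment> \<open>Counting down, \<open>j0\<close> is met before any smaller solution, and a later
    hit overwrites \<open>z\<close> by a smaller one. So the claim starts when \<open>j0\<close> has
    been passed and keeps the bound \<open>j \<le> j0\<close>.\<close>
  let ?J = "\<lambda>\<kappa> s'. PM - \<kappa> \<le> j0 \<longrightarrow> (\<exists>j\<le>j0. regs s' z = int j \<and> ?P j)"
  have PM: "int PM \<le> int PM * int PM" using q mult_left_mono[of 1 "int PM" "int PM"] by simp
  have "SF (For ri3 rPM ?B) s \<and> ?J PM (EV (For ri3 rPM ?B) s)"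
  proof (rule For_rule[where Inv = ?J])
    fix \<kappa> s'
    assume \<kappa>: "\<kappa> < PM" and sm: "same (For ri3 rPM ?B) s s'" and J: "?J \<kappa> s'" and i: "regs s' ri3 = int (PM - Suc \<kappa>)"
    define j where "j = PM - Suc \<kappa>"
    have c: "regs s' rQ = q" "regs s' a = va" "regs s' b = vb"
      using sameD(1)[OF sm, of rQ] sameD(1)[OF sm, of a] sameD(1)[OF sm, of b] s r by auto
    have jb: "0 \<le> int j" "int j < int PM" using \<kappa> by (auto simp: j_def)
    have va: "0 \<le> va" "va < int PM" using v q by (auto simp: red_def)
    note mb = mult_bounds[OF va jb]
    have b1: "\<bar>va * int j\<bar> \<le> X" using mb q PM by linarith
    have b2: "\<bar>va * int j - vb\<bar> \<le> X" using mb q PM v by linarith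
    let ?d = "(va * int j - vb) mod q"
    have d: "0 \<le> ?d" "?d < q" using q by auto
    have b3: "\<bar>?d\<bar> \<le> X" "\<bar>1 - ?d\<bar> \<le> X" using d q PM by linarith+
    have Pj: "?P j \<longleftrightarrow> ?d = 0" by (simp add: cong_iff_dvd_diff dvd_eq_mod_eq_0)
    have pos: "0 < 1 - ?d \<longleftrightarrow> ?d = 0" using d by linarith
    have jX: "\<bar>int j\<bar> \<le> X" using jb q PM by linarith
    have sf: "SF ?B s'" and z: "regs (EV ?B s') z = (if ?d = 0 then int j else regs s' z)"
      using i c r b1 b2 b3 jX pos IX by (simp_all add: j_def[symmetric] bnd_def big_def)
    have "?J (Suc \<kappa>) (EV ?B s')"
    proof
      assume le: "PM - Suc \<kappa> \<le> j0"
      show "\<exists>j\<le>j0. regs (EV ?B s') z = int j \<and> ?P j"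
      proof (cases "?d = 0")
        case True
        then show ?thesis using z Pj le unfolding j_def[symmetric] by auto
      next
        case False
        then have "j \<noteq> j0" using Pj ex by auto
        then have "PM - \<kappa> \<le> j0" using le \<kappa> by (simp add: j_def)
        then show ?thesis using J z False by auto
      qed
    qed
    then show "SF ?B s' \<and> ?J (Suc \<kappa>) (EV ?B s')" using sf by blast
  qed (use s r ex in auto)
  then show ?thesis unfolding solve_def by (simp del: ev.simps safe.simps)
qed

end

section \<open>The orthogonal polynomial recurrence in residues\<close>

context det_program
begin

lemma sq_ge: "0 < q \<Longrightarrow> q \<le> q * (q::int)"
  using mult_left_mono[of 1 q q] by simp

lemma mod_le_X: "0 < q \<Longrightarrow> 4 * q * q \<le> X \<Longrightarrow> \<bar>v mod q\<bar> \<le> X"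
  using sq_ge[of q] pos_mod_bound[of q v] pos_mod_sign[of q v] by linarith

lemma red_mult_bounds:
  assumes "red q a" "red q b"
  shows "0 \<le> a * b" "a * b \<le> q * q"
  using assms mult_bounds[of a q b q] by (auto simp: red_def)

lemma orth_init_spec:
  assumes s: "regs s rN = int n" and q: "1 < q" "4 * q * q \<le> X" and k: "red q (arr s 6 0)"
  defines "s' \<equiv> EV orth_init s"
  shows "SF orth_init s \<and> (\<forall>i<n. arr s' 7 i = unit_row 0 i \<and> arr s' 8 (Suc i) = unit_row 0 i) \<and>
    arr s' 8 0 = 0 \<and> regs s' rE = arr s 6 0 \<and> regs s' rDen = 1 \<and> regs s' rOk = 1 \<and> regs s' rK = 0"
proof -
  let ?B = "St 7 ri3 (Const 0) ;; St 8 ri3 (Const 0)"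
  let ?J = "\<lambda>\<kappa> (t :: state). \<forall>i<n. n - \<kappa> \<le> i \<longrightarrow> arr t 7 i = 0 \<and> arr t 8 i = 0"
  have L: "SF (For ri3 rN ?B) s \<and> ?J n (EV (For ri3 rN ?B) s)"
  proof (rule For_rule[where Inv = ?J])
    fix \<kappa> t
    assume \<kappa>: "\<kappa> < n" and J: "?J \<kappa> t" and i: "regs t ri3 = int (n - Suc \<kappa>)"
    have up: "n - Suc \<kappa> \<le> i \<longleftrightarrow> i = n - Suc \<kappa> \<or> n - \<kappa> \<le> i" for i using \<kappa> by auto
    show "SF ?B t \<and> ?J (Suc \<kappa>) (EV ?B t)"
      unfolding up using i J IX by (auto simp: I)
  qed (use s in auto)
  define s1 where "s1 = EV (For ri3 rN ?B) s"
  have f: "regs s1 rN = int n" "arr s1 6 = arr s 6"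
    unfolding s1_def by (simp_all add: ev_regs ev_arr s del: ev.simps)
  have z: "arr s1 7 i = 0" "arr s1 8 i = 0" if "i < n" for i using L that by (auto simp: s1_def simp del: ev.simps)
  have e: "s' = EV (St 8 rN (Const 0) ;;
     mov rIdx (Const 0) ;; St 7 rIdx (Const 1) ;; Ld rE 6 rIdx ;;
     mov rIdx (Const 1) ;; St 8 rIdx (Const 1) ;;
     mov rDen (Const 1) ;; mov rOk (Const 1) ;; mov rK (Const 0)) s1"
    unfolding s'_def orth_init_def by (simp add: s1_def del: ev.simps(8))
  have "SF orth_init s"
    unfolding orth_init_def safe.simps(6)[of _ _ _ _ _ "For ri3 rN ?B"] s1_def[symmetric]
    using L f n IX by (simp add: I bnd_def big_def del: safe.simps(8))
  moreover have "\<forall>i<n. arr s' 7 i = unit_row 0 i \<and> arr s' 8 (Suc i) = unit_row 0 i"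
    using f z n unfolding e by (auto simp: unit_row_def)
  moreover have "arr s' 8 0 = 0" "regs s' rE = arr s 6 0" "regs s' rDen = 1" "regs s' rOk = 1" "regs s' rK = 0"
    using f z n unfolding e by auto
  ultimately show ?thesis by blast
qed

lemma orth_g_spec:
  assumes s: "regs s rN = int n" "regs s rQ = q" "regs s rK = int k" "k < n" and q: "0 < q" "4 * q * q \<le> X"
    and k: "\<And>i. i < n \<Longrightarrow> red q (arr s 8 (Suc i))" "\<And>i. i < 2 * n \<Longrightarrow> red q (arr s 6 i)"
  shows "SF orth_g s \<and> regs (EV orth_g s) rG = (\<Sum>i<n. arr s 8 (Suc i) * arr s 6 (i + k + 1)) mod q"
proof -
  let ?B = "Op rIdx Plus (Reg ri3) (Const 1) ;; Ld rt2 8 rIdx ;;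
     Op rIdx Plus (Reg rIdx) (Reg rK) ;; Ld rt3 6 rIdx ;; Op rt2 Times (Reg rt2) (Reg rt3) ;;
     Op rG Plus (Reg rG) (Reg rt2) ;; modq rG"
  define s1 where "s1 = EV (mov rG (Const 0)) s"
  let ?f = "\<lambda>i. arr s 8 (Suc i) * arr s 6 (i + k + 1)"
  let ?J = "\<lambda>\<kappa> s'. regs s' rG = (\<Sum>i\<in>{n - \<kappa>..<n}. ?f i) mod q"
  note qq = sq_ge[OF q(1)]
  have "SF (For ri3 rN ?B) s1 \<and> ?J n (EV (For ri3 rN ?B) s1)"
  proof (rule For_rule[where Inv = ?J])
    fix \<kappa> s'
    assume \<kappa>: "\<kappa> < n" and sm: "same (For ri3 rN ?B) s1 s'" and J: "?J \<kappa> s'" and i: "regs s' ri3 = int (n - Suc \<kappa>)"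
    define j where "j = n - Suc \<kappa>"
    have j: "j < n" using \<kappa> by (simp add: j_def)
    have c: "regs s' rQ = q" "regs s' rK = int k" "\<And>l. arr s' l = arr s l"
      using sameD(1)[OF sm, of rQ] sameD(1)[OF sm, of rK] sameD(2)[OF sm] s by (auto simp: s1_def)
    have nt: "nat (1 + int j) = Suc j" "nat (1 + int j + int k) = j + k + 1" "int j + 1 = 1 + int j" by auto
    note mb = red_mult_bounds[OF k(1)[OF j] k(2)[of "j + k + 1"]]
    have jk: "j + k + 1 < 2 * n" using j s(4) by simp
    have acc: "0 \<le> regs s' rG" "regs s' rG < q" using J q by simp_all
    have b1: "\<bar>?f j\<bar> \<le> X" using mb jk q qq by linarith
    have b2: "\<bar>regs s' rG + ?f j\<bar> \<le> X" using mb jk acc q qq by linarith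
    have b4: "1 + int j + int k < int I" "1 + int j < int I" "1 + int j + int k \<le> X" "1 + int j \<le> X"
      using jk IX by (auto simp: I)
    have v: "(regs s' rG + ?f j) mod q = (\<Sum>i\<in>{n - Suc \<kappa>..<n}. ?f i) mod q"
      using J sum_descending[OF \<kappa>, of ?f] by (simp add: j_def mod_add_right_eq mod_add_left_eq add.commute)
    show "SF ?B s' \<and> ?J (Suc \<kappa>) (EV ?B s')"
      using i c j b1 b2 b4 v mod_le_X[OF q] IX by (simp add: j_def[symmetric] nt bnd_def big_def)
  qed (use s in \<open>auto simp: s1_def\<close>)
  then show ?thesis
    unfolding orth_g_def safe.simps(6) ev.simps(6) s1_def[symmetric]
    using IX by (simp add: bnd_def big_def atLeast0LessThan del: ev.simps(8) safe.simps(8))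
qed

lemma orth_e_spec:
  assumes s: "regs s rN = int n" "regs s rQ = q" "regs s rK = int k" "k < n" and q: "0 < q" "4 * q * q \<le> X"
    and k: "\<And>i. i < n \<Longrightarrow> red q (arr s 7 i)" "\<And>i. i < 2 * n \<Longrightarrow> red q (arr s 6 i)"
  shows "SF orth_e s \<and> regs (EV orth_e s) rE2 = (\<Sum>i<n. arr s 7 i * arr s 6 (i + Suc k)) mod q"
proof -
  let ?B = "Op rIdx Plus (Reg ri3) (Const 1) ;;
     Op rIdx Plus (Reg rIdx) (Reg rK) ;; Ld rt3 6 rIdx ;; Ld rt2 7 ri3 ;; Op rt2 Times (Reg rt2) (Reg rt3) ;;
     Op rE2 Plus (Reg rE2) (Reg rt2) ;; modq rE2"
  define s1 where "s1 = EV (mov rE2 (Const 0)) s"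
  let ?f = "\<lambda>i. arr s 7 i * arr s 6 (i + Suc k)"
  let ?J = "\<lambda>\<kappa> s'. regs s' rE2 = (\<Sum>i\<in>{n - \<kappa>..<n}. ?f i) mod q"
  note qq = sq_ge[OF q(1)]
  have "SF (For ri3 rN ?B) s1 \<and> ?J n (EV (For ri3 rN ?B) s1)"
  proof (rule For_rule[where Inv = ?J])
    fix \<kappa> s'
    assume \<kappa>: "\<kappa> < n" and sm: "same (For ri3 rN ?B) s1 s'" and J: "?J \<kappa> s'" and i: "regs s' ri3 = int (n - Suc \<kappa>)"
    define j where "j = n - Suc \<kappa>"
    have j: "j < n" using \<kappa> by (simp add: j_def)
    have c: "regs s' rQ = q" "regs s' rK = int k" "\<And>l. arr s' l = arr s l"
      using sameD(1)[OF sm, of rQ] sameD(1)[OF sm, of rK] sameD(2)[OF sm] s by (auto simp: s1_def)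
    have nt: "nat (1 + int j + int k) = j + Suc k" "int j + 1 = 1 + int j" by auto
    note mb = red_mult_bounds[OF k(1)[OF j] k(2)[of "j + Suc k"]]
    have jk: "j + Suc k < 2 * n" using j s(4) by simp
    have acc: "0 \<le> regs s' rE2" "regs s' rE2 < q" using J q by simp_all
    have b1: "\<bar>?f j\<bar> \<le> X" using mb jk q qq by linarith
    have b2: "\<bar>regs s' rE2 + ?f j\<bar> \<le> X" using mb jk acc q qq by linarith
    have b4: "1 + int j + int k < int I" "1 + int j + int k \<le> X" "1 + int j \<le> X" "int j < int I"
      using jk IX by (auto simp: I)
    have v: "(regs s' rE2 + ?f j) mod q = (\<Sum>i\<in>{n - Suc \<kappa>..<n}. ?f i) mod q"
      using J sum_descending[OF \<kappa>, of ?f] by (simp add: j_def mod_add_right_eq mod_add_left_eq add.commute)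
    show "SF ?B s' \<and> ?J (Suc \<kappa>) (EV ?B s')"
      using i c j b1 b2 b4 v mod_le_X[OF q] IX by (simp add: j_def[symmetric] nt bnd_def big_def)
  qed (use s in \<open>auto simp: s1_def\<close>)
  then show ?thesis
    unfolding orth_e_def safe.simps(6) ev.simps(6) s1_def[symmetric]
    using IX by (simp add: bnd_def big_def atLeast0LessThan del: ev.simps(8) safe.simps(8))
qed

lemma orth_phi_spec:
  assumes s: "regs s rN = int n" "regs s rQ = q" "red q (regs s rG)" "red q (regs s rE)" and q: "0 < q" "4 * q * q \<le> X"
    and k: "\<And>i. i < n \<Longrightarrow> red q (arr s 7 i)" "\<And>i. i < n \<Longrightarrow> red q (arr s 8 i)"
  shows "SF orth_phi s \<and> (\<forall>i<n. arr (EV orth_phi s) 7 i = (arr s 7 i * regs s rG - arr s 8 i * regs s rE) mod q)"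
proof -
  let ?v = "\<lambda>i. (arr s 7 i * regs s rG - arr s 8 i * regs s rE) mod q"
  let ?J = "\<lambda>\<kappa> s'. \<forall>i<n. arr s' 7 i = (if i < n - \<kappa> then arr s 7 i else ?v i)"
  note qq = sq_ge[OF q(1)]
  let ?B = "Ld rt2 7 ri3 ;; Op rt2 Times (Reg rt2) (Reg rG) ;; Ld rt3 8 ri3 ;;
     Op rt3 Times (Reg rt3) (Reg rE) ;; Op rt2 Minus (Reg rt2) (Reg rt3) ;; modq rt2 ;; St 7 ri3 (Reg rt2)"
  have "SF (For ri3 rN ?B) s \<and> ?J n (EV (For ri3 rN ?B) s)"
  proof (rule For_rule[where Inv = ?J])
    fix \<kappa> s'
    assume \<kappa>: "\<kappa> < n" and sm: "same (For ri3 rN ?B) s s'" and J: "?J \<kappa> s'" and i: "regs s' ri3 = int (n - Suc \<kappa>)"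
    define j where "j = n - Suc \<kappa>"
    have j: "j < n" "j < n - \<kappa>" using \<kappa> by (auto simp: j_def)
    have c: "regs s' rQ = q" "regs s' rG = regs s rG" "regs s' rE = regs s rE" "arr s' 8 = arr s 8"
      using sameD(1)[OF sm, of rQ] sameD(1)[OF sm, of rG] sameD(1)[OF sm, of rE] sameD(2)[OF sm, of 8] s by auto
    have a: "arr s' 7 j = arr s 7 j" using J j by simp
    note m1 = red_mult_bounds[OF k(1)[OF j(1)] s(3)] and m2 = red_mult_bounds[OF k(2)[OF j(1)] s(4)]
    have b1: "\<bar>arr s 7 j * regs s rG\<bar> \<le> X" "\<bar>arr s 8 j * regs s rE\<bar> \<le> X"
      "\<bar>arr s 7 j * regs s rG - arr s 8 j * regs s rE\<bar> \<le> X" using m1 m2 q qq by linarith+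
    have up: "i < n - Suc \<kappa> \<longleftrightarrow> i < j" for i by (auto simp: j_def)
    have up2: "i < n - \<kappa> \<longleftrightarrow> i \<le> j" for i using \<kappa> by (auto simp: j_def)
    show "SF ?B s' \<and> ?J (Suc \<kappa>) (EV ?B s')"
      unfolding up using i c j(1) b1 a J[unfolded up2] IX mod_le_X[OF q] by (auto simp: j_def[symmetric] bnd_def big_def I)
  qed (use s in auto)
  then show ?thesis unfolding orth_phi_def by (simp del: ev.simps safe.simps)
qed

lemma orth_psi_spec:
  assumes s: "regs s rN = int n" "regs s rQ = q" "red q (regs s rG)" "red q (regs s rE2)" and q: "0 < q" "4 * q * q \<le> X"
    and k: "\<And>i. i < n \<Longrightarrow> red q (arr s 7 i)" "\<And>i. i < n \<Longrightarrow> red q (arr s 8 (Suc i))"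
  shows "SF orth_psi s \<and> arr (EV orth_psi s) 8 0 = arr s 8 0 \<and>
    (\<forall>i<n. arr (EV orth_psi s) 8 (Suc i) = (arr s 7 i * regs s rG - arr s 8 (Suc i) * regs s rE2) mod q)"
proof -
  let ?v = "\<lambda>i. (arr s 7 i * regs s rG - arr s 8 (Suc i) * regs s rE2) mod q"
  let ?J = "\<lambda>\<kappa> s'. arr s' 8 0 = arr s 8 0 \<and> (\<forall>i<n. arr s' 8 (Suc i) = (if i < n - \<kappa> then arr s 8 (Suc i) else ?v i))"
  note qq = sq_ge[OF q(1)]
  let ?B = "Op rIdx Plus (Reg ri3) (Const 1) ;; Ld rt2 7 ri3 ;;
     Op rt2 Times (Reg rt2) (Reg rG) ;; Ld rt3 8 rIdx ;; Op rt3 Times (Reg rt3) (Reg rE2) ;;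
     Op rt2 Minus (Reg rt2) (Reg rt3) ;; modq rt2 ;; St 8 rIdx (Reg rt2)"
  have "SF (For ri3 rN ?B) s \<and> ?J n (EV (For ri3 rN ?B) s)"
  proof (rule For_rule[where Inv = ?J])
    fix \<kappa> s'
    assume \<kappa>: "\<kappa> < n" and sm: "same (For ri3 rN ?B) s s'" and J: "?J \<kappa> s'" and i: "regs s' ri3 = int (n - Suc \<kappa>)"
    define j where "j = n - Suc \<kappa>"
    have j: "j < n" "j < n - \<kappa>" using \<kappa> by (auto simp: j_def)
    have c: "regs s' rQ = q" "regs s' rG = regs s rG" "regs s' rE2 = regs s rE2" "arr s' 7 = arr s 7"
      using sameD(1)[OF sm, of rQ] sameD(1)[OF sm, of rG] sameD(1)[OF sm, of rE2] sameD(2)[OF sm, of 7] s by auto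
    have a: "arr s' 8 (Suc j) = arr s 8 (Suc j)" using J j by simp
    have nt: "nat (int j + 1) = Suc j" "nat (1 + int j) = Suc j" by auto
    note m1 = red_mult_bounds[OF k(1)[OF j(1)] s(3)] and m2 = red_mult_bounds[OF k(2)[OF j(1)] s(4)]
    have b1: "\<bar>arr s 7 j * regs s rG\<bar> \<le> X" "\<bar>arr s 8 (Suc j) * regs s rE2\<bar> \<le> X"
      "\<bar>arr s 7 j * regs s rG - arr s 8 (Suc j) * regs s rE2\<bar> \<le> X" using m1 m2 q qq by linarith+
    have b4: "\<bar>int j + 1\<bar> \<le> X" "int j + 1 < int I" "int j < int I" using j(1) IX by (auto simp: I)
    have up: "i < n - Suc \<kappa> \<longleftrightarrow> i < j" for i by (auto simp: j_def)
    have up2: "i < n - \<kappa> \<longleftrightarrow> i \<le> j" for i using \<kappa> by (auto simp: j_def)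
    show "SF ?B s' \<and> ?J (Suc \<kappa>) (EV ?B s')"
      unfolding up using i c j(1) b1 b4 a J[unfolded up2] IX mod_le_X[OF q]
      by (auto simp: j_def[symmetric] bnd_def big_def nt)
  qed (use s in auto)
  then show ?thesis unfolding orth_psi_def by (simp del: ev.simps safe.simps)
qed

end

lemma prod_descending:
  "k < n \<Longrightarrow> (\<Prod>j\<in>{n - Suc k..<n}. f j) = f (n - Suc k) * (\<Prod>j\<in>{n - k..<n}. f j :: int)"
proof -
  assume "k < n"
  then have "{n - Suc k..<n} = insert (n - Suc k) {n - k..<n}" by auto
  moreover have "n - Suc k \<notin> {n - k..<n}" using \<open>k < n\<close> by simp
  ultimately show ?thesis by simp
qed

lemma red_1: "1 < q \<Longrightarrow> red q 1"
  by (simp add: red_def)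

context det_program
begin

text \<open>The recurrence is the one for the stored residues \<open>S\<close>. Register
  \<open>rG\<close> lags behind by one index, since \<open>gg\<close> at \<open>k\<close> is
  computed in round \<open>k\<close>; before the first round it is unspecified.\<close>

definition orth_inv :: "int \<Rightarrow> (nat \<Rightarrow> int) \<Rightarrow> nat \<Rightarrow> state \<Rightarrow> bool" where
  "orth_inv q S k t \<longleftrightarrow> regs t rK = int k \<and>
     (\<forall>i<n. red q (arr t 7 i) \<and> [arr t 7 i = phi n S k i] (mod q)) \<and>
     (\<forall>i<n. red q (arr t 8 (Suc i)) \<and> [arr t 8 (Suc i) = psi n S k i] (mod q)) \<and> arr t 8 0 = 0 \<and>
     red q (regs t rE) \<and> [regs t rE = ee n S k] (mod q) \<and>
     red q (regs t rDen) \<and> [regs t rDen = (\<Prod>j<k. ee n S j)] (mod q) \<and>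
     red q (regs t rOk) \<and> [regs t rOk = (\<Prod>j<k. ee n S j * gg n S j)] (mod q) \<and>
     (0 < k \<longrightarrow> red q (regs t rG) \<and> [regs t rG = gg n S (k - 1)] (mod q))"

lemma orth_den_spec:
  assumes s: "regs s rQ = q" "red q (regs s rDen)" "red q (regs s rOk)" "red q (regs s rE)" "red q (regs s rG)"
    and q: "0 < q" "4 * q * q \<le> X"
  shows "SF orth_den s \<and> regs (EV orth_den s) rDen = (regs s rDen * regs s rE) mod q \<and>
    regs (EV orth_den s) rOk = ((regs s rOk * regs s rE) mod q * regs s rG) mod q"
proof -
  note qq = sq_ge[OF q(1)]
  have "red q ((regs s rOk * regs s rE) mod q)" using q by simp
  note b = red_mult_bounds[OF s(2,4)] red_mult_bounds[OF s(3,4)] red_mult_bounds[OF this s(5)]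
  have "\<bar>regs s rDen * regs s rE\<bar> \<le> X" "\<bar>regs s rOk * regs s rE\<bar> \<le> X"
    "\<bar>(regs s rOk * regs s rE) mod q * regs s rG\<bar> \<le> X" using b q qq by linarith+
  then show ?thesis using s mod_le_X[OF q] by (simp add: orth_den_def bnd_def big_def)
qed

text \<open>The arrays are updated in place, in the order of the data dependencies:
  \<open>gg\<close> from the old \<open>psi\<close>, then the new \<open>phi\<close>, from it the
  next \<open>ee\<close>, and last the new \<open>psi\<close>, which still reads the old
  one.\<close>

lemma orth_step_spec:
  assumes s: "regs s rN = int n" "regs s rQ = q" "k < n" and q: "1 < q" "4 * q * q \<le> X"
    and S: "arr s 6 = S" "\<And>i. i < 2 * n \<Longrightarrow> red q (S i)" and inv: "orth_inv q S k s"
  shows "SF orth_step s \<and> orth_inv q S (Suc k) (EV orth_step s)"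
proof -
  have q0: "0 < q" using q by simp
  note iv = inv[unfolded orth_inv_def]
  define s1 where "s1 = EV orth_g s"
  define s2 where "s2 = EV orth_den s1"
  define s3 where "s3 = EV orth_phi s2"
  define s4 where "s4 = EV orth_e s3"
  define s5 where "s5 = EV orth_psi s4"
  define s6 where "s6 = EV (mov rE (Reg rE2) ;; Op rK Plus (Reg rK) (Const 1)) s5"
  have ev: "EV orth_step s = s6" by (simp add: orth_step_def s1_def s2_def s3_def s4_def s5_def s6_def)
  have 1: "SF orth_g s" "regs s1 rG = (\<Sum>i<n. arr s 8 (Suc i) * S (i + k + 1)) mod q"
    using orth_g_spec[OF s(1,2) _ s(3) q0 q(2)] iv S by (auto simp: s1_def)
  have f1: "regs s1 rN = int n" "regs s1 rQ = q" "regs s1 rK = int k" "regs s1 rE = regs s rE"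
      "regs s1 rDen = regs s rDen" "regs s1 rOk = regs s rOk" "\<And>l. arr s1 l = arr s l"
    using s iv by (auto simp: s1_def ev_regs ev_arr)
  have g: "red q (regs s1 rG)" "[regs s1 rG = gg n S k] (mod q)"
    unfolding 1(2) using q0 iv
    by (auto simp: cong_mod_left gg_def intro!: cong_sum cong_mult)
  have 2: "SF orth_den s1" "regs s2 rDen = (regs s rDen * regs s rE) mod q"
      "regs s2 rOk = ((regs s rOk * regs s rE) mod q * regs s1 rG) mod q"
    using orth_den_spec[OF f1(2) _ _ _ g(1) q0 q(2)] iv f1 by (auto simp: s2_def)
  have f2: "regs s2 rN = int n" "regs s2 rQ = q" "regs s2 rK = int k" "regs s2 rE = regs s rE"
      "regs s2 rG = regs s1 rG" "\<And>l. arr s2 l = arr s l"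
    using f1 by (auto simp: s2_def ev_regs ev_arr)
  have r8: "red q (arr s 8 i)" if "i < n" for i using iv that q0 by (cases i) (auto simp: red_def)
  have 3: "SF orth_phi s2" "\<And>i. i < n \<Longrightarrow> arr s3 7 i = (arr s 7 i * regs s1 rG - arr s 8 i * regs s rE) mod q"
    using orth_phi_spec[OF f2(1,2) _ _ q0 q(2)] g iv r8 by (auto simp: s3_def f2)
  have f3: "regs s3 rN = int n" "regs s3 rQ = q" "regs s3 rK = int k" "regs s3 rG = regs s1 rG"
      "regs s3 rDen = regs s2 rDen" "regs s3 rOk = regs s2 rOk" "arr s3 8 = arr s 8" "arr s3 6 = S"
    using f2 S by (auto simp: s3_def ev_regs ev_arr)
  have p3: "red q (arr s3 7 i)" "[arr s3 7 i = phi n S (Suc k) i] (mod q)" if i: "i < n" for i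
  proof -
    show "red q (arr s3 7 i)" using 3(2)[OF i] q0 by simp
    have "[arr s 8 i = (if i = 0 then 0 else psi n S k (i - 1))] (mod q)" using iv i by (cases i) auto
    then have "[arr s 7 i * regs s1 rG - arr s 8 i * regs s rE
        = phi n S k i * gg n S k - (if i = 0 then 0 else psi n S k (i - 1)) * ee n S k] (mod q)"
      using iv i g by (intro cong_diff cong_mult) auto
    then show "[arr s3 7 i = phi n S (Suc k) i] (mod q)"
      unfolding 3(2)[OF i] cong_mod_left phi_Suc by (simp add: mult.commute)
  qed
  have 4: "SF orth_e s3" "regs s4 rE2 = (\<Sum>i<n. arr s3 7 i * S (i + Suc k)) mod q"
    using orth_e_spec[OF f3(1,2,3) s(3) q0 q(2)] p3(1) S by (auto simp: s4_def f3)
  have f4: "regs s4 rN = int n" "regs s4 rQ = q" "regs s4 rK = int k" "regs s4 rG = regs s1 rG"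
      "regs s4 rDen = regs s2 rDen" "regs s4 rOk = regs s2 rOk" "\<And>l. arr s4 l = arr s3 l"
    using f3 by (auto simp: s4_def ev_regs ev_arr)
  have e2: "red q (regs s4 rE2)" "[regs s4 rE2 = ee n S (Suc k)] (mod q)"
    unfolding 4(2) using q0 p3
    by (auto simp: cong_mod_left ee_def intro!: cong_sum cong_mult)
  have 5: "SF orth_psi s4" "arr s5 8 0 = 0"
      "\<And>i. i < n \<Longrightarrow> arr s5 8 (Suc i) = (arr s3 7 i * regs s1 rG - arr s 8 (Suc i) * regs s4 rE2) mod q"
    using orth_psi_spec[OF f4(1,2) _ e2(1) q0 q(2)] g p3(1) iv by (auto simp: s5_def f4 f3)
  have f5: "regs s5 rK = int k" "regs s5 rG = regs s1 rG" "regs s5 rE2 = regs s4 rE2"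
      "regs s5 rDen = regs s2 rDen" "regs s5 rOk = regs s2 rOk" "arr s5 7 = arr s3 7"
    using f4 by (auto simp: s5_def ev_regs ev_arr)
  have f6: "regs s6 rK = int (Suc k)" "regs s6 rG = regs s1 rG" "regs s6 rE = regs s4 rE2"
      "regs s6 rDen = regs s2 rDen" "regs s6 rOk = regs s2 rOk" "arr s6 = arr s5"
    using f5 by (auto simp: s6_def)
  have p5: "red q (arr s5 8 (Suc i))" "[arr s5 8 (Suc i) = psi n S (Suc k) i] (mod q)" if i: "i < n" for i
  proof -
    show "red q (arr s5 8 (Suc i))" using 5(3)[OF i] q0 by simp
    have "[arr s3 7 i * regs s1 rG - arr s 8 (Suc i) * regs s4 rE2
        = phi n S (Suc k) i * gg n S k - psi n S k i * ee n S (Suc k)] (mod q)"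
      using iv i g p3 e2 by (intro cong_diff cong_mult) auto
    then show "[arr s5 8 (Suc i) = psi n S (Suc k) i] (mod q)"
      unfolding 5(3)[OF i] cong_mod_left psi_Suc by (simp add: mult.commute)
  qed
  have den: "red q (regs s2 rDen)" "[regs s2 rDen = (\<Prod>j<Suc k. ee n S j)] (mod q)"
    unfolding 2(2) cong_mod_left prod.lessThan_Suc using q0 iv by (auto intro!: cong_mult)
  have ok: "red q (regs s2 rOk)" "[regs s2 rOk = (\<Prod>j<Suc k. ee n S j * gg n S j)] (mod q)"
  proof -
    show "red q (regs s2 rOk)" unfolding 2(3) using q0 by simp
    have "[(regs s rOk * regs s rE) mod q * regs s1 rG = ((\<Prod>j<k. ee n S j * gg n S j) * ee n S k) * gg n S k] (mod q)"
      using iv g by (intro cong_mult) (auto simp: cong_mod_left intro!: cong_mult)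
    then show "[regs s2 rOk = (\<Prod>j<Suc k. ee n S j * gg n S j)] (mod q)"
      unfolding 2(3) cong_mod_left prod.lessThan_Suc by (simp add: mult.assoc)
  qed
  have "q \<le> X" using sq_ge[OF q0] q by linarith
  then have e2b: "\<bar>regs s4 rE2\<bar> \<le> X" using e2(1) by (auto simp: red_def)
  have 6: "SF (mov rE (Reg rE2) ;; Op rK Plus (Reg rK) (Const 1)) s5"
    using f5 e2b s(3) IX by (simp add: bnd_def big_def I)
  have "SF orth_step s" using 1 2 3 4 5 6
    by (simp add: orth_step_def s1_def s2_def s3_def s4_def s5_def)
  moreover have "orth_inv q S (Suc k) s6"
    unfolding orth_inv_def f6 f5 diff_Suc_1 using p3 p5 5(2) e2 den ok g by blast
  ultimately show ?thesis unfolding ev by blast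
qed

lemma orth_loop_spec:
  assumes s: "regs s rN = int n" "regs s rQ = q" and q: "1 < q" "4 * q * q \<le> X"
    and S: "arr s 6 = S" "\<And>i. i < 2 * n \<Longrightarrow> red q (S i)"
  shows "SF (orth_init ;; For ri2 rN orth_step) s \<and> orth_inv q S n (EV (orth_init ;; For ri2 rN orth_step) s)"
proof -
  define s1 where "s1 = EV orth_init s"
  have i: "SF orth_init s" "\<And>i. i < n \<Longrightarrow> arr s1 7 i = unit_row 0 i" "\<And>i. i < n \<Longrightarrow> arr s1 8 (Suc i) = unit_row 0 i"
      "arr s1 8 0 = 0" "regs s1 rE = S 0" "regs s1 rDen = 1" "regs s1 rOk = 1" "regs s1 rK = 0"
    using orth_init_spec[OF s(1) q, unfolded S(1)] S(2)[of 0] n by (auto simp: s1_def)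
  have f: "regs s1 rN = int n" "regs s1 rQ = q" "arr s1 6 = S"
    using s S by (auto simp: s1_def ev_regs ev_arr)
  have u: "red q (unit_row 0 j)" for j using q by (auto simp: unit_row_def red_def)
  have "(\<Sum>j<n. unit_row 0 j * S j) = (\<Sum>j<n. if j = 0 then S j else 0)"
    by (rule sum.cong) (auto simp: unit_row_def)
  then have e0: "ee n S 0 = S 0" using n by (simp add: ee_def phi_0)
  have init: "orth_inv q S 0 s1"
    unfolding orth_inv_def using i u e0 S(2)[of 0] n red_1[OF q(1)] by (simp add: phi_0 psi_0)
  have "SF (For ri2 rN orth_step) s1 \<and> orth_inv q S n (EV (For ri2 rN orth_step) s1)"
  proof (rule For_rule[where Inv = "orth_inv q S"])
    fix k s' assume k: "k < n" and sm: "same (For ri2 rN orth_step) s1 s'" and iv: "orth_inv q S k s'"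
    have "regs s' rN = int n" "regs s' rQ = q" "arr s' 6 = S"
      using sameD(1)[OF sm, of rN] sameD(1)[OF sm, of rQ] sameD(2)[OF sm, of 6] f by auto
    then show "SF orth_step s' \<and> orth_inv q S (Suc k) (EV orth_step s')"
      using orth_step_spec[OF _ _ k q _ S(2) iv] by blast
  qed (use f init in \<open>auto simp: orth_inv_def\<close>)
  then show ?thesis using i(1) by (simp add: s1_def del: ev.simps(8) safe.simps(8))
qed

lemma scale_spec:
  assumes s: "regs s rN = int n" "regs s rQ = q" "red q (regs s rDen)" "red q (regs s rOk)"
    and q: "1 < q" "4 * q * q \<le> X"
    and k: "\<And>i. i < n \<Longrightarrow> red q (arr s 0 i) \<and> red q (arr s 1 i) \<and> red q (arr s 2 i)"
  defines "\<tau> \<equiv> (1 + (\<Sum>i<n. arr s 1 i * arr s 2 i)) * (\<Prod>i<n. arr s 0 i)"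
  shows "SF scale s \<and> red q (regs (EV scale s) rDen) \<and> [regs (EV scale s) rDen = regs s rDen * \<tau>] (mod q) \<and>
    red q (regs (EV scale s) rOk) \<and> [regs (EV scale s) rOk = regs s rOk * \<tau>] (mod q)"
proof -
  have q0: "0 < q" using q by simp
  note qq = sq_ge[OF q0]
  let ?t = "\<Sum>i<n. arr s 1 i * arr s 2 i"
  define s1 where "s1 = EV (dot rt1 1 2) s"
  have 1: "SF (dot rt1 1 2) s" "regs s1 rt1 = ?t mod q"
    using dot_spec[OF s(1,2) q0 q(2), of 1 2 rt1] k by (auto simp: s1_def big_def)
  have f1: "regs s1 rN = int n" "regs s1 rQ = q" "regs s1 rDen = regs s rDen" "regs s1 rOk = regs s rOk"
      "arr s1 0 = arr s 0"
    using s by (auto simp: s1_def ev_regs ev_arr)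
  let ?c = "Op rt1 Plus (Reg rt1) (Const 1) ;; Op rDen Times (Reg rDen) (Reg rt1) ;; modq rDen ;;
     Op rOk Times (Reg rOk) (Reg rt1) ;; modq rOk"
  define s2 where "s2 = EV ?c s1"
  \<comment> \<open>After adding 1 the register is not reduced and may equal \<open>q\<close>, so
    the product bounds here are non-strict.\<close>
  have t: "0 \<le> ?t mod q + 1" "?t mod q + 1 \<le> q" using pos_mod_bound[OF q0, of ?t] pos_mod_sign[OF q0, of ?t] by linarith+
  have d: "0 \<le> regs s rDen" "regs s rDen \<le> q" "0 \<le> regs s rOk" "regs s rOk \<le> q" using s by (auto simp: red_def)
  have b: "\<bar>regs s rDen * (?t mod q + 1)\<bar> \<le> X" "\<bar>regs s rOk * (?t mod q + 1)\<bar> \<le> X"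
    using mult_mono[of "regs s rDen" q "?t mod q + 1" q] mult_mono[of "regs s rOk" q "?t mod q + 1" q]
      mult_nonneg_nonneg[OF d(1) t(1)] mult_nonneg_nonneg[OF d(3) t(1)] d t q qq by linarith+
  have qX: "q \<le> X" using q qq by linarith
  have tX: "?t mod q + 1 \<le> X" using t qX by linarith
  have 2: "SF ?c s1" using 1 f1 t b tX IX mod_le_X[OF q0 q(2)] by (simp add: bnd_def big_def)
  have f2: "regs s2 rN = int n" "regs s2 rQ = q" "arr s2 0 = arr s 0"
      "regs s2 rDen = (regs s rDen * (?t mod q + 1)) mod q" "regs s2 rOk = (regs s rOk * (?t mod q + 1)) mod q"
    using f1 1 by (auto simp: s2_def)
  let ?B = "Ld rt2 0 ri3 ;; Op rDen Times (Reg rDen) (Reg rt2) ;; modq rDen ;; Op rOk Times (Reg rOk) (Reg rt2) ;; modq rOk"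
  let ?L = "For ri3 rN ?B"
  let ?P = "\<lambda>\<kappa>. (1 + ?t) * (\<Prod>i\<in>{n - \<kappa>..<n}. arr s 0 i)"
  let ?J = "\<lambda>\<kappa> s'. red q (regs s' rDen) \<and> [regs s' rDen = regs s rDen * ?P \<kappa>] (mod q) \<and>
    red q (regs s' rOk) \<and> [regs s' rOk = regs s rOk * ?P \<kappa>] (mod q)"
  have L: "SF ?L s2 \<and> ?J n (EV ?L s2)"
  proof (rule For_rule[where Inv = ?J])
    have "[?t mod q + 1 = 1 + ?t] (mod q)" by (simp add: cong_def mod_add_left_eq mod_add_right_eq add.commute)
    then have "[c * (?t mod q + 1) = c * (1 + ?t)] (mod q)" for c by (rule cong_scalar_left)
    then show "?J 0 s2" using q0 by (simp add: f2 cong_mod_left)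
  next
    fix \<kappa> s'
    assume \<kappa>: "\<kappa> < n" and sm: "same ?L s2 s'" and J: "?J \<kappa> s'" and i: "regs s' ri3 = int (n - Suc \<kappa>)"
    define j where "j = n - Suc \<kappa>"
    have j: "j < n" using \<kappa> by (auto simp: j_def)
    have c: "regs s' rQ = q" "arr s' 0 = arr s 0"
      using sameD(1)[OF sm, of rQ] sameD(2)[OF sm, of 0] f2 by auto
    have J1: "red q (regs s' rDen)" "red q (regs s' rOk)" using J by auto
    have kj: "red q (arr s 0 j)" using k j by auto
    note mb = red_mult_bounds[OF J1(1) kj] red_mult_bounds[OF J1(2) kj]
    have b: "\<bar>regs s' rDen * arr s 0 j\<bar> \<le> X" "\<bar>regs s' rOk * arr s 0 j\<bar> \<le> X" using mb q qq by linarith+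
    have P: "?P (Suc \<kappa>) = ?P \<kappa> * arr s 0 j" using prod_descending[OF \<kappa>, of "arr s 0"] by (simp add: j_def mult_ac)
    have st: "SF ?B s'" "regs (EV ?B s') rDen = (regs s' rDen * arr s 0 j) mod q"
        "regs (EV ?B s') rOk = (regs s' rOk * arr s 0 j) mod q"
      using i c j b mod_le_X[OF q0 q(2)] by (simp_all add: j_def[symmetric] bnd_def big_def I)
    have "[regs s' rDen * arr s 0 j = regs s rDen * ?P \<kappa> * arr s 0 j] (mod q)"
      "[regs s' rOk * arr s 0 j = regs s rOk * ?P \<kappa> * arr s 0 j] (mod q)"
      using J by (auto intro!: cong_scalar_right)
    then show "SF ?B s' \<and> ?J (Suc \<kappa>) (EV ?B s')"
      unfolding st(2,3) P cong_mod_left using st(1) q0 by (simp add: mult.assoc del: ev.simps safe.simps)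
  qed (use f2 in auto)
  have ev: "EV scale s = EV ?L s2" by (simp add: scale_def s2_def s1_def)
  have "SF scale s" using 1 2 L by (simp add: scale_def s2_def s1_def del: safe.simps(8))
  then show ?thesis unfolding ev \<tau>_def using L by (simp add: atLeast0LessThan del: ev.simps)
qed

end

section \<open>A whole trial\<close>

context det_program
begin

text \<open>A rejected trial leaves \<open>rR\<close> alone, and every trial consumes the same
  number of coins whatever its outcome, so the coin positions of later trials are known in
  advance.\<close>

lemma trial_spec:
  fixes q :: int and PM b :: nat
  assumes s: "regs s rN = int n" "regs s rNz = int m" "regs s rQ = q" "regs s rN2 = 2 * int n"
      "regs s rB = int b" "regs s rPM = int PM"
    and q: "prime q" "2 ^ b \<le> q" "q \<le> int PM" "4 * int PM * int PM \<le> X"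
  defines "x \<equiv> draw \<omega> (cn s) b" and "s' \<equiv> EV trial s"
  shows "SF trial s \<and> cn s' = cn s + 5 * n * b \<and>
    (regs s' rR = regs s rR \<or> 0 \<le> regs s' rR \<and> regs s' rR < int PM \<and> [regs s' rR = detn n A] (mod q)) \<and>
    (good_trial q n A x \<longrightarrow> [regs s' rR = detn n A] (mod q))"
proof -
  have q1: "1 < q" using prime_gt_1_int[OF q(1)] .
  then have q0: "0 < q" by simp
  have "q * q \<le> int PM * int PM" using q(3) q0 by (intro mult_mono) auto
  then have qX: "4 * q * q \<le> X" using q(4) by linarith
  have qX': "q \<le> X" using sq_ge[OF q0] qX q0 by linarith
  have bX: "2 ^ b \<le> X" using q(2) qX' by linarith
  have fill: "SF (fill k) t \<and> cn (EV (fill k) t) = cn t + n * b \<and>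
      (\<forall>i<n. arr (EV (fill k) t) k i = bitval \<omega> (cn t + i * b) b)"
    if "regs t rN = int n" "regs t rB = int b" for k t
    using fill_spec[OF that bX] .
  define t0 where "t0 = EV (fill 0) s"
  define t1 where "t1 = EV (fill 1) t0"
  define t2 where "t2 = EV (fill 2) t1"
  define t3 where "t3 = EV (fill 3) t2"
  define t4 where "t4 = EV (fill 4) t3"
  have r: "regs t0 r = regs s r" "regs t1 r = regs s r" "regs t2 r = regs s r" "regs t3 r = regs s r"
      "regs t4 r = regs s r" if "r \<notin> {ri2, ri3, rt1, rt2, rt3}" for r
    using that by (auto simp: t0_def t1_def t2_def t3_def t4_def ev_regs)
  have F0: "SF (fill 0) s" "cn t0 = cn s + n * b" "\<And>i. i < n \<Longrightarrow> arr t0 0 i = bitval \<omega> (cn s + i * b) b"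
    using fill[of s 0] s by (auto simp: t0_def)
  have F1: "SF (fill 1) t0" "cn t1 = cn t0 + n * b" "\<And>i. i < n \<Longrightarrow> arr t1 1 i = bitval \<omega> (cn t0 + i * b) b"
    using fill[of t0 1] r[of rN] r[of rB] s by (auto simp: t1_def simp del: One_nat_def)
  have F2: "SF (fill 2) t1" "cn t2 = cn t1 + n * b" "\<And>i. i < n \<Longrightarrow> arr t2 2 i = bitval \<omega> (cn t1 + i * b) b"
    using fill[of t1 2] r[of rN] r[of rB] s by (auto simp: t2_def)
  have F3: "SF (fill 3) t2" "cn t3 = cn t2 + n * b" "\<And>i. i < n \<Longrightarrow> arr t3 3 i = bitval \<omega> (cn t2 + i * b) b"
    using fill[of t2 3] r[of rN] r[of rB] s by (auto simp: t3_def)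
  have F4: "SF (fill 4) t3" "cn t4 = cn t3 + n * b" "\<And>i. i < n \<Longrightarrow> arr t4 4 i = bitval \<omega> (cn t3 + i * b) b"
    using fill[of t3 4] r[of rN] r[of rB] s by (auto simp: t4_def)
  have a: "arr t4 0 = arr t0 0" "arr t4 1 = arr t1 1" "arr t4 2 = arr t2 2" "arr t4 3 = arr t3 3"
    by (auto simp: t0_def t1_def t2_def t3_def t4_def ev_arr)
  have xs: "arr t4 0 i = x i" "arr t4 1 i = x (n + i)" "arr t4 2 i = x (2 * n + i)" "arr t4 3 i = x (3 * n + i)"
      "arr t4 4 i = x (4 * n + i)" if "i < n" for i
  proof -
    have pos: "cn t0 + i * b = cn s + (n + i) * b" "cn t1 + i * b = cn s + (2 * n + i) * b"
        "cn t2 + i * b = cn s + (3 * n + i) * b" "cn t3 + i * b = cn s + (4 * n + i) * b"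
      using F0(2) F1(2) F2(2) F3(2) by (simp_all add: add_mult_distrib mult.assoc)
    show "arr t4 0 i = x i" "arr t4 1 i = x (n + i)" "arr t4 2 i = x (2 * n + i)" "arr t4 3 i = x (3 * n + i)"
        "arr t4 4 i = x (4 * n + i)"
      using F0(3)[OF that] F1(3)[OF that] F2(3)[OF that] F3(3)[OF that] F4(3)[OF that]
      unfolding a x_def draw_def pos by (simp_all only:)
  qed
  have xr: "red q (x i)" for i using bitval_bounds[of \<omega> "cn s + i * b" b] q(2) by (auto simp: x_def draw_def red_def)
  have cn4: "cn t4 = cn s + 5 * n * b" using F0 F1 F2 F3 F4 by simp
  have f4: "regs t4 rN = int n" "regs t4 rNz = int m" "regs t4 rQ = q" "regs t4 rN2 = 2 * int n"
      "regs t4 rPM = int PM" "regs t4 rR = regs s rR"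
    using r s by auto
  define t5 where "t5 = EV krylov t4"
  let ?B = "prec n A (arr t4 0) (arr t4 1) (arr t4 2)"
  have K: "SF krylov t4" "\<And>i. i < 2 * n \<Longrightarrow> red q (arr t5 6 i)"
      "\<And>i. i < 2 * n \<Longrightarrow> [arr t5 6 i = krylov_seq n ?B (arr t4 3) (arr t4 4) i] (mod q)"
    using krylov_spec[OF f4(1-4) q0 qX, of ?B] xs xr by (auto simp: t5_def)
  have Beq: "?B i j = trial_matrix n A x i j" if "i < n" "j < n" for i j
    using that xs by (simp add: prec_def trial_matrix_def)
  have seq: "krylov_seq n ?B (arr t4 3) (arr t4 4) i = trial_seq n A x i" for i
    unfolding trial_seq_def by (rule krylov_seq_eqI) (use Beq xs in auto)
  define S where "S = arr t5 6"
  define ts where "ts = trial_seq n A x"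
  have Scong: "[S i = ts i] (mod q)" if "i < 2 * n" for i using K(3)[OF that] unfolding seq S_def ts_def .
  note pc = phi_psi_cong[of n S ts q, OF Scong]
  have f5: "regs t5 rN = int n" "regs t5 rQ = q" "regs t5 rPM = int PM" "regs t5 rR = regs s rR"
      "arr t5 0 = arr t4 0" "arr t5 1 = arr t4 1" "arr t5 2 = arr t4 2" "cn t5 = cn t4"
    using f4 by (auto simp: t5_def ev_regs ev_arr ev_cn)
  let ?O = "orth_init ;; For ri2 rN orth_step"
  define t6 where "t6 = EV ?O t5"
  have O: "SF ?O t5" "orth_inv q S n t6"
    using orth_loop_spec[OF f5(1,2) q1 qX S_def[symmetric]] K(2) by (auto simp: t6_def S_def simp del: ev.simps safe.simps)
  have f6: "regs t6 rN = int n" "regs t6 rQ = q" "regs t6 rPM = int PM" "regs t6 rR = regs s rR"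
      "arr t6 0 = arr t4 0" "arr t6 1 = arr t4 1" "arr t6 2 = arr t4 2" "cn t6 = cn t4"
    using f5 by (auto simp: t6_def ev_regs ev_arr ev_cn simp del: ev.simps)
  define t7 where "t7 = EV scale t6"
  let ?\<tau> = "(1 + (\<Sum>i<n. arr t6 1 i * arr t6 2 i)) * (\<Prod>i<n. arr t6 0 i)"
  have \<tau>: "?\<tau> = trial_scale n x" unfolding f6 trial_scale_def using xs by (simp add: mult.commute del: One_nat_def)
  have C: "SF scale t6" "red q (regs t7 rDen)" "[regs t7 rDen = regs t6 rDen * trial_scale n x] (mod q)"
      "red q (regs t7 rOk)" "[regs t7 rOk = regs t6 rOk * trial_scale n x] (mod q)"
    using scale_spec[OF f6(1,2) _ _ q1 qX] O(2) xs xr unfolding \<tau> by (auto simp: t7_def f6 orth_inv_def simp del: One_nat_def)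
  have f7: "regs t7 rQ = q" "regs t7 rPM = int PM" "regs t7 rR = regs s rR" "regs t7 rG = regs t6 rG" "cn t7 = cn t4"
    using f6 by (auto simp: t7_def ev_regs ev_cn)
  have s': "s' = EV (IfP rOk (solve rR rDen rG)) t7"
    by (simp add: s'_def trial_def t0_def t1_def t2_def t3_def t4_def t5_def t6_def t7_def del: ev.simps(7,8))
  have SFe: "SF trial s \<longleftrightarrow> SF (IfP rOk (solve rR rDen rG)) t7"
    using F0(1) F1(1) F2(1) F3(1) F4(1) K(1) O(1) C(1)
    unfolding trial_def t0_def t1_def t2_def t3_def t4_def t5_def t6_def t7_def
    by (simp del: ev.simps(7,8) safe.simps(7,8))
  have cn': "cn s' = cn s + 5 * n * b" unfolding s' using f7 cn4 by (simp add: ev_cn)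
  define P where "P = (\<Prod>j<n. ee n ts j * gg n ts j)"
  have okc: "[regs t7 rOk = trial_scale n x * P] (mod q)"
  proof -
    have "[(\<Prod>j<n. ee n S j * gg n S j) = P] (mod q)"
      unfolding P_def using pc by (intro cong_prod cong_mult) auto
    then have "[regs t6 rOk = P] (mod q)"
      using O(2) cong_trans unfolding orth_inv_def by blast
    then have "[regs t6 rOk * trial_scale n x = P * trial_scale n x] (mod q)" by (rule cong_scalar_right)
    then show ?thesis using cong_trans[OF C(5)] by (simp add: mult.commute)
  qed
  have denc: "[regs t7 rDen = trial_scale n x * (\<Prod>j<n. ee n ts j)] (mod q)"
  proof -
    have "[(\<Prod>j<n. ee n S j) = (\<Prod>j<n. ee n ts j)] (mod q)" using pc by (intro cong_prod) auto
    then have "[regs t6 rDen = (\<Prod>j<n. ee n ts j)] (mod q)"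
      using O(2) cong_trans unfolding orth_inv_def by blast
    then have "[regs t6 rDen * trial_scale n x = (\<Prod>j<n. ee n ts j) * trial_scale n x] (mod q)" by (rule cong_scalar_right)
    then show ?thesis using cong_trans[OF C(3)] by (simp add: mult.commute)
  qed
  have gc: "red q (regs t6 rG)" "[regs t6 rG = gg n ts (n - 1)] (mod q)"
    using O(2) pc[of "n - 1"] n cong_trans unfolding orth_inv_def by fastforce+
  show ?thesis
  proof (cases "regs t7 rOk > 0")
    \<comment> \<open>\<open>rOk\<close> is a residue, so not being positive means being 0: the
      tested product vanishes modulo \<open>q\<close>, and by completeness the trial was not
      good.\<close>
    case False
    then have ok: "regs t7 rOk = 0" using C(4) by (auto simp: red_def)
    then have "q dvd trial_scale n x * P" using okc by (simp add: cong_0_iff cong_sym_eq[of 0])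
    then have "\<not> good_trial q n A x" using trial_complete[OF q(1) ts_def] unfolding P_def by blast
    moreover have "regs s' rR = regs s rR" unfolding s' using False f7 by simp
    moreover have "SF trial s" unfolding SFe using False by simp
    ultimately show ?thesis using cn' by blast
  next
    case True
    have "\<not> q dvd regs t7 rOk" using True C(4) by (auto simp: red_def dest: zdvd_imp_le)
    then have nd: "\<not> q dvd trial_scale n x * P" using okc cong_dvd_iff by blast
    then have "\<not> q dvd P" by auto
    then have "[detn n A * (trial_scale n x * (\<Prod>k<n. ee n ts k)) = gg n ts (n - 1)] (mod q)"
      using trial_sound[OF _ q(1) ts_def] n unfolding P_def by simp
    moreover have "[detn n A * regs t7 rDen = detn n A * (trial_scale n x * (\<Prod>k<n. ee n ts k))] (mod q)"
      using denc by (rule cong_scalar_left)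
    ultimately have sound: "[regs t7 rDen * detn n A = regs t6 rG] (mod q)"
      using gc(2) by (metis cong_sym cong_trans mult.commute)
    have "P = (\<Prod>j<n. ee n ts j) * (\<Prod>j<n. gg n ts j)" unfolding P_def by (rule prod.distrib)
    then have "\<not> q dvd trial_scale n x * (\<Prod>j<n. ee n ts j)" using nd by (auto simp: mult.assoc[symmetric])
    then have dn: "\<not> q dvd regs t7 rDen" using denc cong_dvd_iff by blast
    \<comment> \<open>The true residue of the determinant solves the equation handed to
      \<open>solve\<close>, hence the search succeeds; the denominator being a unit makes any
      solution found congruent to it.\<close>
    define j0 where "j0 = nat (detn n A mod q)"
    have j0: "int j0 = detn n A mod q" using q0 by (simp add: j0_def)
    have j0P: "j0 < PM" using j0 pos_mod_bound[OF q0, of "detn n A"] q(3) by linarith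
    have "[regs t7 rDen * int j0 = regs t7 rDen * detn n A] (mod q)"
      unfolding j0 by (intro cong_scalar_left) (simp add: cong_def)
    then have j0c: "[regs t7 rDen * int j0 = regs t7 rG] (mod q)"
      unfolding f7 using sound cong_trans by blast
    have gb: "\<bar>regs t7 rG\<bar> \<le> 2 * int PM" using gc(1) q(3) by (auto simp: f7 red_def)
    have sv: "SF (solve rR rDen rG) t7 \<and> (\<exists>j\<le>j0. regs (EV (solve rR rDen rG) t7) rR = int j \<and>
        [regs t7 rDen * int j = regs t7 rG] (mod q))"
      by (rule solve_spec[OF f7(1,2) refl refl q0 q(3,4) C(2) gb _ _ _ _ j0P j0c]) (auto simp: big_def)
    then obtain j where j: "j \<le> j0" "regs (EV (solve rR rDen rG) t7) rR = int j"
      "[regs t7 rDen * int j = regs t7 rG] (mod q)" by blast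
    have "coprime (regs t7 rDen) q" using dn q(1) by (metis coprime_commute prime_imp_coprime)
    moreover have "[regs t7 rDen * int j = regs t7 rDen * detn n A] (mod q)"
      using j(3) sound unfolding f7 by (metis cong_sym cong_trans)
    ultimately have "[int j = detn n A] (mod q)" by (simp add: cong_mult_lcancel)
    moreover have "regs s' rR = int j" unfolding s' using True j(2) by simp
    moreover have "SF trial s" unfolding SFe using True sv by simp
    moreover have "int j < int PM" using j(1) j0P by simp
    ultimately show ?thesis using cn' by simp
  qed
qed

end

section \<open>One prime: repeated trials, Chinese remaindering, primality testing\<close>

lemma wr_candidate_parts [simp]:
  "wr crt = {rSA, rSB, rZ, ri3, rt1, rBig, rX, rM}"
  "wr prime_test = {rPr, ri1, rt1, rt2}"
  "wr prime_body = {rR, ri1, ri2, ri3, rIdx, rt1, rt2, rt3, rt4, rK, rE, rDen, rOk, rG, rE2, rSA, rSB, rZ, rBig, rX, rM}"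
  "wr candidate = {rQ, rPr, rR, ri1, ri2, ri3, rIdx, rt1, rt2, rt3, rt4, rK, rE, rDen, rOk, rG, rE2, rSA, rSB, rZ, rBig, rX, rM}"
  by (auto simp: crt_def prime_test_def prime_body_def candidate_def)

lemma flips_candidate_parts [simp]: "\<not> flips crt" "\<not> flips prime_test"
  by (auto simp: com_defs)

lemma draw_shift: "draw \<omega> (a + k * b) b i = draw \<omega> a b (k + i)"
  by (simp add: draw_def add_mult_distrib add.assoc)

text \<open>If \<open>q\<close> divides the determinant, the initial residue 0 is already right and
  rejected trials preserve it; otherwise one good trial suffices.\<close>

definition prime_ok :: "(nat \<Rightarrow> bool) \<Rightarrow> nat \<Rightarrow> (nat \<Rightarrow> nat \<Rightarrow> int) \<Rightarrow> nat \<Rightarrow> nat \<Rightarrow> nat \<Rightarrow> int \<Rightarrow> bool" where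
  "prime_ok \<omega> n A b T a q \<longleftrightarrow> q dvd detn n A \<or>
     (\<exists>t<T. good_trial q n A (\<lambda>i. draw \<omega> a b (t * (5 * n) + i)))"

context det_program
begin

lemma trials_spec:
  fixes q :: int and PM b T :: nat
  assumes s: "regs s rN = int n" "regs s rNz = int m" "regs s rQ = q" "regs s rN2 = 2 * int n"
      "regs s rB = int b" "regs s rPM = int PM" "regs s rT = int T" "regs s rR = 0"
    and q: "prime q" "2 ^ b \<le> q" "q \<le> int PM" "4 * int PM * int PM \<le> X"
  defines "c \<equiv> For ri1 rT trial"
  shows "SF c s \<and> cn (EV c s) = cn s + T * (5 * n * b) \<and> 0 \<le> regs (EV c s) rR \<and> regs (EV c s) rR < int PM \<and>
    (prime_ok \<omega> n A b T (cn s) q \<longrightarrow> [regs (EV c s) rR = detn n A] (mod q))"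
proof -
  let ?g = "\<lambda>t. good_trial q n A (\<lambda>i. draw \<omega> (cn s) b (t * (5 * n) + i))"
  let ?J = "\<lambda>\<kappa> t. cn t = cn s + \<kappa> * (5 * n * b) \<and> 0 \<le> regs t rR \<and> regs t rR < int PM \<and>
    (regs t rR = 0 \<or> [regs t rR = detn n A] (mod q)) \<and> ((\<exists>\<tau><\<kappa>. ?g \<tau>) \<longrightarrow> [regs t rR = detn n A] (mod q))"
  have PM: "0 < PM" using prime_gt_0_int[OF q(1)] q(3) by linarith
  have J: "SF c s \<and> ?J T (EV c s)"
    unfolding c_def
  proof (rule For_rule[where Inv = ?J])
    fix \<kappa> s' assume sm: "same (For ri1 rT trial) s s'" and J: "?J \<kappa> s'"
    have f: "regs s' rN = int n" "regs s' rNz = int m" "regs s' rQ = q" "regs s' rN2 = 2 * int n"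
      "regs s' rB = int b" "regs s' rPM = int PM"
      using sameD(1)[OF sm] s by simp_all
    have dr: "draw \<omega> (cn s') b = (\<lambda>i. draw \<omega> (cn s) b (\<kappa> * (5 * n) + i))"
    proof
      fix i
      have "cn s' = cn s + (\<kappa> * (5 * n)) * b" using J by simp
      then show "draw \<omega> (cn s') b i = draw \<omega> (cn s) b (\<kappa> * (5 * n) + i)" by (simp only: draw_shift)
    qed
    have T: "SF trial s'" "cn (EV trial s') = cn s' + 5 * n * b"
        "regs (EV trial s') rR = regs s' rR \<or> 0 \<le> regs (EV trial s') rR \<and> regs (EV trial s') rR < int PM \<and>
          [regs (EV trial s') rR = detn n A] (mod q)"
        "?g \<kappa> \<longrightarrow> [regs (EV trial s') rR = detn n A] (mod q)"
      using trial_spec[OF f q] unfolding dr by blast+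
    show "SF trial s' \<and> ?J (Suc \<kappa>) (EV trial s')"
      using T J by (auto simp: less_Suc_eq)
  qed (use s PM in auto)
  moreover have "[regs (EV c s) rR = detn n A] (mod q)" if "prime_ok \<omega> n A b T (cn s) q"
  proof (cases "\<exists>t<T. ?g t")
    case True
    then show ?thesis using J by blast
  next
    case False
    then have "q dvd detn n A" using that unfolding prime_ok_def by blast
    then show ?thesis using J by (auto simp: cong_iff_dvd_diff)
  qed
  ultimately show ?thesis by blast
qed

lemma crt_spec:
  fixes q :: int and PM :: nat
  assumes s: "regs s rQ = q" "regs s rPM = int PM" "regs s rM = M" "regs s rX = x" "regs s rR = r"
    and q: "1 < q" "q \<le> int PM" "4 * int PM * int PM \<le> X"
    and M: "0 < M" "coprime M q" "0 \<le> x" "x < M" "2 * M * q \<le> Y" and r: "0 \<le> r" "r < int PM"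
  defines "s' \<equiv> EV crt s"
  shows "SF crt s \<and> regs s' rM = M * q \<and> 0 \<le> regs s' rX \<and> regs s' rX < M * q \<and>
    [regs s' rX = x] (mod M) \<and> [regs s' rX = r] (mod q)"
proof -
  have q0: "0 < q" using q by simp
  let ?a = "M mod q" and ?b = "r - x mod q"
  let ?c = "Op rSA Rem (Reg rM) (Reg rQ) ;; Op rSB Rem (Reg rX) (Reg rQ) ;; Op rSB Minus (Reg rR) (Reg rSB)"
  define s1 where "s1 = EV ?c s"
  have PMX: "2 * int PM \<le> X"
  proof -
    have "1 \<le> int PM" using q by simp
    then have "int PM \<le> int PM * int PM" using mult_left_mono[of 1 "int PM" "int PM"] by simp
    then show ?thesis using q by linarith
  qed
  have ab: "0 \<le> ?a" "?a < q" "0 \<le> x mod q" "x mod q < q" using q0 by auto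
  have bb: "\<bar>?b\<bar> \<le> 2 * int PM" using ab r q by linarith
  have f1: "regs s1 rQ = q" "regs s1 rPM = int PM" "regs s1 rSA = ?a" "regs s1 rSB = ?b" "regs s1 rM = M" "regs s1 rX = x"
    using s by (auto simp: s1_def)
  have aX: "?a \<le> X" "x mod q \<le> X" using ab q PMX by linarith+
  have 1: "SF ?c s" using s ab aX bb PMX q by (simp add: bnd_def big_def)
  have cop: "coprime ?a q" using M(2) q0 by (metis coprime_mod_left_iff less_irrefl)
  then obtain y where y: "[?a * y = 1] (mod q)" using cong_solve_coprime_int by blast
  define j0 where "j0 = nat (y * ?b mod q)"
  have j0: "int j0 = y * ?b mod q" using q0 by (simp add: j0_def)
  have j0q: "int j0 < q" unfolding j0 using q0 by simp
  have j0P: "j0 < PM" using j0q q by linarith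
  have j0c: "[?a * int j0 = ?b] (mod q)"
  proof -
    have "[int j0 = y * ?b] (mod q)" unfolding j0 by (simp add: cong_def)
    then have "[?a * int j0 = ?a * (y * ?b)] (mod q)" by (rule cong_scalar_left)
    moreover have "[?a * y * ?b = 1 * ?b] (mod q)" using y by (rule cong_scalar_right)
    ultimately show ?thesis by (simp only: mult.assoc mult_1) (rule cong_trans)
  qed
  have "SF (solve rZ rSA rSB) s1 \<and> (\<exists>j\<le>j0. regs (EV (solve rZ rSA rSB) s1) rZ = int j \<and> [?a * int j = ?b] (mod q))"
    by (rule solve_spec[OF f1(1-4) q0 q(2,3) _ bb _ _ _ _ j0P j0c]) (use ab in \<open>auto simp: red_def big_def\<close>)
  then obtain j where 2: "SF (solve rZ rSA rSB) s1" and j: "j \<le> j0" "regs (EV (solve rZ rSA rSB) s1) rZ = int j"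
    "[?a * int j = ?b] (mod q)" by blast
  define s2 where "s2 = EV (solve rZ rSA rSB) s1"
  have f2: "regs s2 rQ = q" "regs s2 rM = M" "regs s2 rX = x" "regs s2 rZ = int j"
    using f1 j by (auto simp: s2_def ev_regs)
  let ?d = "Op rBig Times (Reg rM) (Reg rZ) ;; Op rX Plus (Reg rX) (Reg rBig) ;; Op rM Times (Reg rM) (Reg rQ)"
  \<comment> \<open>\<open>solve\<close> returns a solution at most \<open>j0\<close>, which is
    below \<open>q\<close>, so the new value stays below \<open>M * q\<close> without any long
    reduction.\<close>
  have jq: "int j + 1 \<le> q" using j j0q by linarith
  have Mj: "0 \<le> M * int j" "M * int j + M \<le> M * q"
    using M(1) mult_left_mono[OF jq, of M] by (auto simp: distrib_left)
  have Mq: "0 \<le> M * q" using M(1) q0 by simp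
  have 3: "SF ?d s2" using f2 Mj Mq M by (simp add: bnd_def big_def)
  have s': "s' = EV ?d s2" by (simp add: s'_def crt_def s2_def s1_def)
  have f3: "regs s' rM = M * q" "regs s' rX = x + M * int j" using f2 by (auto simp: s')
  have "SF crt s" using 1 2 3 by (simp add: crt_def s2_def s1_def)
  moreover have "[x + M * int j = x] (mod M)" by (simp add: cong_iff_dvd_diff)
  moreover have "[x + M * int j = r] (mod q)"
  proof -
    have "[M * int j = ?a * int j] (mod q)" by (intro cong_scalar_right) (simp add: cong_def)
    then have "[M * int j = ?b] (mod q)" using j(3) by (rule cong_trans)
    moreover have "[x = x mod q] (mod q)" by (simp add: cong_def)
    ultimately have "[x + M * int j = x mod q + ?b] (mod q)" by (intro cong_add)
    then show ?thesis by simp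
  qed
  ultimately show ?thesis unfolding f3 using M Mj by simp
qed

lemma prime_test_spec:
  fixes q :: int and SQ :: nat
  assumes s: "regs s rQ = q" "regs s rSq = int SQ" and q: "1 < q" "q \<le> int SQ * int SQ" "q \<le> X" "int SQ + 2 \<le> X"
  shows "SF prime_test s \<and> regs (EV prime_test s) rPr = (if prime q then 1 else 0)"
proof -
  let ?B = "Op rt1 Plus (Reg ri1) (Const 2) ;;
     Op rt2 Minus (Reg rQ) (Reg rt1) ;; IfP rt2 (Op rt2 Rem (Reg rQ) (Reg rt1) ;;
       Op rt2 Minus (Const 1) (Reg rt2) ;; IfP rt2 (mov rPr (Const 0)))"
  define s1 where "s1 = EV (mov rPr (Const 1)) s"
  let ?D = "\<lambda>j. int j + 2 < q \<and> int j + 2 dvd q"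
  let ?J = "\<lambda>\<kappa> t. regs t rPr = (if \<exists>j. SQ - \<kappa> \<le> j \<and> j < SQ \<and> ?D j then 0 else 1)"
  have L: "SF (For ri1 rSq ?B) s1 \<and> ?J SQ (EV (For ri1 rSq ?B) s1)"
  proof (rule For_rule[where Inv = ?J])
    fix \<kappa> s'
    assume \<kappa>: "\<kappa> < SQ" and sm: "same (For ri1 rSq ?B) s1 s'" and J: "?J \<kappa> s'" and i: "regs s' ri1 = int (SQ - Suc \<kappa>)"
    define j where "j = SQ - Suc \<kappa>"
    have jS: "j < SQ" using \<kappa> by (simp add: j_def)
    have c: "regs s' rQ = q" using sameD(1)[OF sm, of rQ] s by (simp add: s1_def)
    let ?d = "int j + 2"
    have b1: "\<bar>?d\<bar> \<le> X" "\<bar>q - ?d\<bar> \<le> X" using jS q by linarith+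
    have m: "0 \<le> q mod ?d" "q mod ?d < ?d" by auto
    have b2: "\<bar>q mod ?d\<bar> \<le> X" "\<bar>1 - q mod ?d\<bar> \<le> X" using m b1 by linarith+
    have pos: "0 < 1 - q mod ?d \<longleftrightarrow> ?d dvd q" unfolding dvd_eq_mod_eq_0 using m by linarith
    have ps2: "0 < q - ?d \<longleftrightarrow> ?d < q" by auto
    have st: "SF ?B s'" "regs (EV ?B s') rPr = (if ?D j then 0 else regs s' rPr)"
      using i c b1 b2 IX pos ps2 by (simp_all add: j_def[symmetric] bnd_def big_def)
    have ex: "(\<exists>j'. SQ - Suc \<kappa> \<le> j' \<and> j' < SQ \<and> ?D j') \<longleftrightarrow> ?D j \<or> (\<exists>j'. SQ - \<kappa> \<le> j' \<and> j' < SQ \<and> ?D j')"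
    proof
      assume "\<exists>j'. SQ - Suc \<kappa> \<le> j' \<and> j' < SQ \<and> ?D j'"
      then obtain j' where j': "SQ - Suc \<kappa> \<le> j'" "j' < SQ" "?D j'" by blast
      show "?D j \<or> (\<exists>j'. SQ - \<kappa> \<le> j' \<and> j' < SQ \<and> ?D j')"
      proof (cases "j' = j")
        case False
        then have "SQ - \<kappa> \<le> j'" using j' by (simp add: j_def)
        then show ?thesis using j' by blast
      qed (use j' in auto)
    next
      assume "?D j \<or> (\<exists>j'. SQ - \<kappa> \<le> j' \<and> j' < SQ \<and> ?D j')"
      then show "\<exists>j'. SQ - Suc \<kappa> \<le> j' \<and> j' < SQ \<and> ?D j'"
      proof
        assume "?D j"
        then show ?thesis using jS j_def by blast
      next
        assume "\<exists>j'. SQ - \<kappa> \<le> j' \<and> j' < SQ \<and> ?D j'"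
        then obtain j' where "SQ - \<kappa> \<le> j'" "j' < SQ" "?D j'" by blast
        then show ?thesis by (intro exI[of _ j']) auto
      qed
    qed
    show "SF ?B s' \<and> ?J (Suc \<kappa>) (EV ?B s')"
      unfolding st(2) ex J using st(1) by auto
  qed (use s in \<open>auto simp: s1_def\<close>)
  have "(\<exists>j<SQ. ?D j) \<longleftrightarrow> \<not> prime q"
  proof
    assume "\<exists>j<SQ. ?D j"
    then obtain j where j: "int j + 2 < q" "int j + 2 dvd q" by blast
    show "\<not> prime q"
    proof
      assume "prime q"
      moreover have "0 \<le> int j + 2" by simp
      ultimately have "int j + 2 = 1 \<or> int j + 2 = q" using j(2) unfolding prime_int_iff by blast
      then show False using j(1) by linarith
    qed
  next
    assume np: "\<not> prime q"
    then obtain d where d0: "0 \<le> d" "d dvd q" "d \<noteq> 1" "d \<noteq> q"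
      using q(1) unfolding prime_int_iff by blast
    have "d \<le> q" using zdvd_imp_le[OF d0(2)] q(1) by simp
    moreover have "d \<noteq> 0" using d0(2) q(1) by auto
    ultimately have d: "d dvd q" "1 < d" "d < q" using d0 by linarith+
    then obtain e where e: "q = d * e" by (elim dvdE)
    have e1: "1 < e" "e < q"
    proof -
      have e0: "0 < e" using e q(1) d(2) zero_less_mult_pos[of d e] by simp
      moreover have "e \<noteq> 1" using e d(3) by auto
      ultimately show "1 < e" by simp
      show "e < q" using e d(2) e0 by simp
    qed
    define f where "f = min d e"
    have f: "1 < f" "f < q" "f dvd q" using d e1 e by (auto simp: f_def min_def)
    have "f * f \<le> d * e" using d(2) e1 by (intro mult_mono) (auto simp: f_def)
    then have "f * f \<le> int SQ * int SQ" using e q(2) by simp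
    then have "f\<^sup>2 \<le> (int SQ)\<^sup>2" by (simp add: power2_eq_square)
    then have fS: "f \<le> int SQ" by (rule power2_le_imp_le) simp
    define j where "j = nat (f - 2)"
    have "int j + 2 = f" using f(1) by (simp add: j_def)
    moreover have "j < SQ" using fS f(1) by (simp add: j_def)
    ultimately show "\<exists>j<SQ. ?D j" using f by (intro exI[of _ j]) simp
  qed
  then show ?thesis using L IX
    unfolding prime_test_def safe.simps(6)[of _ _ _ _ _ "mov rPr (Const 1)"] ev.simps(6)[of _ _ "mov rPr (Const 1)"] s1_def[symmetric]
    by (auto simp: bnd_def big_def simp del: ev.simps(8) safe.simps(8))
qed

end

section \<open>The sequence of moduli\<close>

text \<open>A deterministic model of the register \<open>rM\<close>. Use of a candidate depends on
  primality and on the bound, never on coins, which fixes the coin positions belonging to each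
  prime.\<close>

primrec Ms :: "nat \<Rightarrow> int \<Rightarrow> nat \<Rightarrow> int" where
  "Ms S B 0 = 1"
| "Ms S B (Suc j) = (if Ms S B j \<le> B \<and> prime (int (S + j + 1)) then Ms S B j * int (S + j + 1) else Ms S B j)"

definition active :: "nat \<Rightarrow> int \<Rightarrow> nat \<Rightarrow> bool" where
  "active S B j \<longleftrightarrow> Ms S B j \<le> B \<and> prime (int (S + j + 1))"

definition ks :: "nat \<Rightarrow> int \<Rightarrow> nat \<Rightarrow> nat" where
  "ks S B j = card {i. i < j \<and> active S B i}"

lemma Ms_Suc: "Ms S B (Suc j) = (if active S B j then Ms S B j * int (S + j + 1) else Ms S B j)"
  by (simp add: active_def)

lemma ks_0 [simp]: "ks S B 0 = 0"
  by (simp add: ks_def)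

lemma ks_Suc: "ks S B (Suc j) = (if active S B j then Suc (ks S B j) else ks S B j)"
proof -
  have "{i. i < Suc j \<and> active S B i} = (if active S B j then insert j {i. i < j \<and> active S B i} else {i. i < j \<and> active S B i})"
    by (auto simp: less_Suc_eq)
  then show ?thesis by (simp add: ks_def)
qed

lemma Ms_pos: "1 \<le> Ms S B j"
proof (induction j)
  case (Suc j)
  have "1 * 1 \<le> Ms S B j * int (S + j + 1)" using Suc by (intro mult_mono) auto
  then show ?case using Suc unfolding Ms_Suc by simp
qed simp

lemma Ms_mono: "i \<le> j \<Longrightarrow> Ms S B i \<le> Ms S B j"
proof (induction rule: dec_induct)
  case (step j)
  have "Ms S B j * 1 \<le> Ms S B j * int (S + j + 1)"
    using Ms_pos[of S B j] by (intro mult_left_mono) auto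
  then show ?case using step unfolding Ms_Suc by simp
qed simp

lemma Ms_primes: "prime p \<Longrightarrow> p dvd Ms S B j \<Longrightarrow> p \<le> int (S + j)"
proof (induction j)
  case 0
  then show ?case using prime_gt_1_int[of p] by simp
next
  case (Suc j)
  show ?case
  proof (cases "p dvd Ms S B j")
    case True
    then show ?thesis using Suc by simp
  next
    case False
    then have "active S B j" "p dvd int (S + j + 1)"
      using Suc.prems unfolding Ms_Suc by (auto simp: prime_dvd_mult_iff split: if_splits)
    then show ?thesis by (auto dest: zdvd_imp_le)
  qed
qed

lemma Ms_coprime:
  assumes "prime (int (S + j + 1))"
  shows "coprime (Ms S B j) (int (S + j + 1))"
proof -
  have "\<not> int (S + j + 1) dvd Ms S B j" using Ms_primes[OF assms, of S B j] by auto
  then show ?thesis using assms prime_imp_coprime coprime_commute by blast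
qed

lemma ks_le_Ms: "2 ^ ks S B j \<le> Ms S B j"
proof (induction j)
  case (Suc j)
  show ?case
  proof (cases "active S B j")
    case True
    then have "2 \<le> int (S + j + 1)" using prime_ge_2_int by (simp only: active_def)
    then have "2 ^ ks S B j * 2 \<le> Ms S B j * int (S + j + 1)"
      using Suc Ms_pos[of S B j] by (intro mult_mono) auto
    then show ?thesis using True by (simp add: ks_Suc Ms_Suc del: Ms.simps)
  qed (use Suc in \<open>simp add: ks_Suc Ms_Suc del: Ms.simps\<close>)
qed simp

text \<open>A prime is used only while the modulus is at most \<open>B\<close>, and each used prime
  at least doubles it.\<close>

lemma ks_bound:
  assumes "B < 2 ^ K"
  shows "ks S B j \<le> K"
proof (induction j)
  case (Suc j)
  show ?case
  proof (cases "active S B j")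
    case True
    then have "2 ^ ks S B j < (2::int) ^ K"
      using ks_le_Ms[of S B j] assms unfolding active_def by linarith
    then have "ks S B j < K" by (simp add: power_strict_increasing_iff)
    then show ?thesis by (simp add: ks_Suc)
  qed (use Suc in \<open>simp add: ks_Suc\<close>)
qed simp

text \<open>Controls the overshoot: the last factor is multiplied in while the modulus is still at
  most \<open>B\<close>.\<close>

lemma Ms_le:
  assumes "0 \<le> B"
  shows "Ms S B j \<le> (B + 1) * int (S + j + 1)"
proof (induction j)
  case 0
  have "1 * 1 \<le> (B + 1) * int (S + 1)" using assms by (intro mult_mono) auto
  then show ?case by simp
next
  case (Suc j)
  show ?case
  proof (cases "active S B j")
    case True
    then have "Ms S B j * int (S + j + 1) \<le> (B + 1) * int (S + Suc j + 1)"
      using assms Ms_pos[of S B j] by (intro mult_mono) (auto simp: active_def)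
    then show ?thesis using True unfolding Ms_Suc by simp
  next
    case False
    have "(B + 1) * int (S + j + 1) \<le> (B + 1) * int (S + Suc j + 1)"
      using assms by (intro mult_left_mono) auto
    then show ?thesis using Suc False unfolding Ms_Suc by simp
  qed
qed

text \<open>If the modulus never passed \<open>B\<close>, every prime of the window would be used.
  Discarding at most \<open>S\<close> primes up to \<open>S\<close> leaves at least \<open>K\<close>
  of them, too many for a product at most \<open>B < 2 ^ K\<close>.\<close>

lemma Ms_final:
  assumes K: "B < 2 ^ K" and cnt: "S + K \<le> card {p::nat. prime p \<and> p \<le> N}"
  shows "B < Ms S B N"
proof (rule ccontr)
  assume "\<not> B < Ms S B N"
  then have le: "Ms S B N \<le> B" by simp
  have act: "active S B i \<longleftrightarrow> prime (S + i + 1)" if "i < N" for i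
  proof -
    have "Ms S B i \<le> B" using Ms_mono[of i N S B] le that by simp
    then show ?thesis unfolding active_def prime_nat_int_transfer by simp
  qed
  have "2 ^ ks S B N < (2::int) ^ K" using ks_le_Ms[of S B N] le K by linarith
  then have lt: "ks S B N < K" by (simp add: power_strict_increasing_iff)
  let ?P = "{p::nat. prime p \<and> p \<le> N}"
  have "?P \<subseteq> {..<S + 1} \<union> (\<lambda>i. S + i + 1) ` {i. i < N \<and> active S B i} - {0}"
  proof
    fix p assume p: "p \<in> ?P"
    show "p \<in> {..<S + 1} \<union> (\<lambda>i. S + i + 1) ` {i. i < N \<and> active S B i} - {0}"
    proof (cases "p \<le> S")
      case False
      define i where "i = p - S - 1"
      have "p = S + i + 1" "i < N" using False p by (auto simp: i_def)
      then show ?thesis using p act by auto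
    qed (use p in \<open>auto simp: less_Suc_eq_le intro: Nat.gr0I\<close>)
  qed
  then have "card ?P \<le> card ({..<S + 1} \<union> (\<lambda>i. S + i + 1) ` {i. i < N \<and> active S B i} - {0})"
    by (intro card_mono) auto
  also have "\<dots> \<le> card ({..<S + 1} - {0}) + card ((\<lambda>i. S + i + 1) ` {i. i < N \<and> active S B i})"
  proof -
    have "{..<S + 1} \<union> (\<lambda>i. S + i + 1) ` {i. i < N \<and> active S B i} - {0}
        \<subseteq> ({..<S + 1} - {0}) \<union> (\<lambda>i. S + i + 1) ` {i. i < N \<and> active S B i}" by auto
    then have "card ({..<S + 1} \<union> (\<lambda>i. S + i + 1) ` {i. i < N \<and> active S B i} - {0})
        \<le> card (({..<S + 1} - {0}) \<union> (\<lambda>i. S + i + 1) ` {i. i < N \<and> active S B i})"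
      by (intro card_mono) auto
    then show ?thesis using card_Un_le order_trans by blast
  qed
  also have "\<dots> \<le> S + ks S B N"
  proof -
    have "card ({..<S + 1} - {0}) = S" by simp
    moreover have "card ((\<lambda>i. S + i + 1) ` {i. i < N \<and> active S B i}) \<le> ks S B N"
      unfolding ks_def by (rule card_image_le) simp
    ultimately show ?thesis by linarith
  qed
  finally show False using cnt lt by linarith
qed

section \<open>Correctness of the main loop\<close>

context det_program
begin

text \<open>The congruence is conditional, since trials may fail for some prime. The range and the
  coin count hold regardless, so safety and cost are established for every coin sequence.\<close>

definition main_inv :: "nat \<Rightarrow> nat \<Rightarrow> nat \<Rightarrow> int \<Rightarrow> nat \<Rightarrow> state \<Rightarrow> bool" where
  "main_inv b T S B j t \<longleftrightarrow> regs t rQ = int (S + j) \<and> regs t rM = Ms S B j \<and>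
     cn t = ks S B j * (T * (5 * n * b)) \<and> 0 \<le> regs t rX \<and> regs t rX < Ms S B j \<and>
     ((\<forall>i<j. active S B i \<longrightarrow> prime_ok \<omega> n A b T (ks S B i * (T * (5 * n * b))) (int (S + i + 1))) \<longrightarrow>
       [regs t rX = detn n A] (mod Ms S B j))"

definition main_env :: "nat \<Rightarrow> nat \<Rightarrow> nat \<Rightarrow> nat \<Rightarrow> int \<Rightarrow> state \<Rightarrow> bool" where
  "main_env b T PM SQ B s \<longleftrightarrow> regs s rN = int n \<and> regs s rNz = int m \<and> regs s rN2 = 2 * int n \<and>
     regs s rB = int b \<and> regs s rPM = int PM \<and> regs s rT = int T \<and> regs s rSq = int SQ \<and> regs s rBnd = B"

lemma prime_body_spec:
  fixes q :: int and PM b T :: nat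
  assumes e: "main_env b T PM SQ B s" "regs s rQ = q" "regs s rM = M" "regs s rX = x"
    and q: "prime q" "2 ^ b \<le> q" "q \<le> int PM" "4 * int PM * int PM \<le> X"
    and M: "0 < M" "coprime M q" "0 \<le> x" "x < M" "2 * M * q \<le> Y"
  defines "s' \<equiv> EV prime_body s"
  shows "SF prime_body s \<and> cn s' = cn s + T * (5 * n * b) \<and> regs s' rM = M * q \<and> 0 \<le> regs s' rX \<and> regs s' rX < M * q \<and>
    (prime_ok \<omega> n A b T (cn s) q \<and> [x = detn n A] (mod M) \<longrightarrow> [regs s' rX = detn n A] (mod (M * q)))"
proof -
  define s1 where "s1 = EV (mov rR (Const 0)) s"
  define s2 where "s2 = EV (For ri1 rT trial) s1"
  have q1: "1 < q" using prime_gt_1_int[OF q(1)] .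
  have f1: "regs s1 rN = int n" "regs s1 rNz = int m" "regs s1 rQ = q" "regs s1 rN2 = 2 * int n"
      "regs s1 rB = int b" "regs s1 rPM = int PM" "regs s1 rT = int T" "regs s1 rR = 0"
      "regs s1 rM = M" "regs s1 rX = x" "cn s1 = cn s"
    using e by (auto simp: s1_def main_env_def)
  have t: "SF (For ri1 rT trial) s1" "cn s2 = cn s + T * (5 * n * b)" "0 \<le> regs s2 rR" "regs s2 rR < int PM"
      "prime_ok \<omega> n A b T (cn s) q \<longrightarrow> [regs s2 rR = detn n A] (mod q)"
    using trials_spec[OF f1(1-8) q] f1(11) unfolding s2_def by auto
  have f2: "regs s2 rQ = q" "regs s2 rPM = int PM" "regs s2 rM = M" "regs s2 rX = x"
    using f1 by (auto simp: s2_def ev_regs simp del: ev.simps)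
  have c: "SF crt s2" "regs (EV crt s2) rM = M * q" "0 \<le> regs (EV crt s2) rX" "regs (EV crt s2) rX < M * q"
      "[regs (EV crt s2) rX = x] (mod M)" "[regs (EV crt s2) rX = regs s2 rR] (mod q)"
    using crt_spec[OF f2 refl q1 q(3,4) M t(3,4)] by auto
  have s': "s' = EV crt s2" by (simp add: s'_def prime_body_def s2_def s1_def del: ev.simps(8))
  have "SF prime_body s" using t(1) c(1) IX
    by (simp add: prime_body_def s2_def s1_def[symmetric] bnd_def big_def del: ev.simps(8) safe.simps(8))
       (simp add: s1_def)
  moreover have "cn s' = cn s + T * (5 * n * b)" unfolding s' using t(2) by (simp add: ev_cn)
  moreover have "[regs s' rX = detn n A] (mod (M * q))" if "prime_ok \<omega> n A b T (cn s) q" "[x = detn n A] (mod M)"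
  proof (rule coprime_cong_mult[OF _ _ M(2)])
    show "[regs s' rX = detn n A] (mod M)" unfolding s' using c(5) that(2) by (rule cong_trans)
    show "[regs s' rX = detn n A] (mod q)" unfolding s' using c(6) t(5) that(1) cong_trans by blast
  qed
  ultimately show ?thesis using c unfolding s' by blast
qed

lemma candidate_spec:
  fixes PM b T S N SQ :: nat
  assumes e: "main_env b T PM SQ B s" and inv: "main_inv b T S B j s" and j: "j < N"
    and S: "S = 2 ^ b" and PM: "S + N < PM" "PM = SQ * SQ" "4 * int PM * int PM \<le> X" "int SQ + 2 \<le> X"
    and B: "0 \<le> B" "2 * ((B + 1) * int PM) * int PM \<le> Y"
  shows "SF candidate s \<and> main_inv b T S B (Suc j) (EV candidate s)"
proof -
  define q where "q = int (S + j + 1)"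
  define M where "M = Ms S B j"
  let ?c = "Op rQ Plus (Reg rQ) (Const 1) ;; Op rBig Minus (Reg rBnd) (Reg rM) ;; Op rBig Plus (Reg rBig) (Const 1)"
  define s1 where "s1 = EV ?c s"
  have qP: "q < int PM" using j PM(1) by (simp add: q_def)
  have q1: "1 < q" using add_pos_nonneg[of "2 ^ b :: int" "int j"] by (simp add: q_def S)
  have PM1: "1 \<le> int PM" using PM(1) by simp
  have PP: "int PM \<le> int PM * int PM" using PM1 mult_left_mono[of 1 "int PM" "int PM"] by simp
  have qX: "q \<le> X" using qP PP PM(3) PM1 by linarith
  have M1: "1 \<le> M" by (simp add: M_def Ms_pos)
  have MB: "M \<le> (B + 1) * int PM"
  proof -
    have "(B + 1) * int (S + j + 1) \<le> (B + 1) * int PM" using qP B(1) by (intro mult_left_mono) (auto simp: q_def)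
    then show ?thesis using Ms_le[OF B(1), of S j] by (simp add: M_def)
  qed
  have BP: "B + 1 \<le> (B + 1) * int PM" using B(1) PM1 mult_left_mono[of 1 "int PM" "B + 1"] by simp
  have BPP: "(B + 1) * int PM \<le> (B + 1) * int PM * int PM"
    using BP B(1) PM1 mult_left_mono[of 1 "int PM" "(B + 1) * int PM"] by simp
  have Y1: "2 * ((B + 1) * int PM) \<le> Y" using BPP B(2) by linarith
  have f1: "regs s1 rQ = q" "regs s1 rM = M" "regs s1 rBig = B - M + 1" "regs s1 rX = regs s rX" "cn s1 = cn s"
      "main_env b T PM SQ B s1"
    using e inv by (auto simp: s1_def main_env_def main_inv_def q_def M_def)
  have BY: "\<bar>B - M\<bar> \<le> Y" "\<bar>B - M + 1\<bar> \<le> Y" using M1 MB BP Y1 B(1) by linarith+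
  have f0: "regs s rQ + 1 = q" "regs s rBnd = B" "regs s rM = M"
    using e inv by (auto simp: main_env_def main_inv_def q_def M_def)
  have c1: "SF ?c s" using f0 qX q1 BY IX by (simp add: bnd_def big_def)
  have x: "0 \<le> regs s rX" "regs s rX < M" using inv by (auto simp: main_inv_def M_def)
  let ?P = "prime_test ;; IfP rPr prime_body"
  have ev: "EV candidate s = EV (IfP rBig ?P) s1" by (simp add: candidate_def s1_def)
  have sf: "SF candidate s \<longleftrightarrow> SF (IfP rBig ?P) s1" using c1 by (simp add: candidate_def s1_def)
  have stay: "main_inv b T S B (Suc j) t" if na: "\<not> active S B j" and t: "regs t rQ = q" "regs t rM = M"
      "regs t rX = regs s rX" "cn t = cn s" for t
    using inv na t unfolding main_inv_def Ms_Suc ks_Suc by (auto simp: q_def M_def less_Suc_eq simp del: Ms.simps)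
  show ?thesis
  proof (cases "M \<le> B")
    case False
    then have "\<not> active S B j" by (simp add: active_def M_def)
    then have "main_inv b T S B (Suc j) s1" using f1 by (intro stay) auto
    then show ?thesis unfolding ev sf using False f1(3) by simp
  next
    case True
    define s2 where "s2 = EV prime_test s1"
    have qs: "q \<le> int SQ * int SQ" using qP PM(2) by simp
    have sq: "regs s1 rSq = int SQ" using f1(6) by (simp add: main_env_def)
    have pt: "SF prime_test s1" "regs s2 rPr = (if prime q then 1 else 0)"
      using prime_test_spec[OF f1(1) sq q1 qs qX PM(4)] by (auto simp: s2_def)
    have f2: "regs s2 rQ = q" "regs s2 rM = M" "regs s2 rX = regs s rX" "cn s2 = cn s" "main_env b T PM SQ B s2"
      using f1 by (auto simp: s2_def ev_regs ev_cn main_env_def)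
    show ?thesis
    proof (cases "prime q")
      case False
      then have "\<not> active S B j" by (simp add: active_def q_def)
      then have "main_inv b T S B (Suc j) s2" using f2 by (intro stay) auto
      then show ?thesis unfolding ev sf using True f1(3) pt False by (simp add: s2_def)
    next
      case pr: True
      have act: "active S B j" using True pr by (simp add: active_def q_def M_def)
      have bq: "2 ^ b \<le> q" by (simp add: q_def S)
      have cop: "coprime M q" using Ms_coprime[of S j B] pr by (simp add: q_def M_def)
      have "2 * M * q \<le> 2 * ((B + 1) * int PM) * int PM"
        using MB M1 qP q1 by (intro mult_mono) auto
      then have MqY: "2 * M * q \<le> Y" using B(2) by linarith
      define s3 where "s3 = EV prime_body s2"
      have pb: "SF prime_body s2" "cn s3 = cn s + T * (5 * n * b)" "regs s3 rM = M * q" "0 \<le> regs s3 rX" "regs s3 rX < M * q"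
          "prime_ok \<omega> n A b T (cn s) q \<and> [regs s rX = detn n A] (mod M) \<longrightarrow> [regs s3 rX = detn n A] (mod (M * q))"
        using prime_body_spec[OF f2(5,1,2,3) pr bq _ PM(3) _ cop x MqY] qP M1 f2(4) by (auto simp: s3_def)
      have f3: "regs s3 rQ = q" using f2 by (simp add: s3_def ev_regs)
      have MS: "Ms S B (Suc j) = M * q" using act by (simp add: Ms_Suc q_def M_def del: Ms.simps)
      have "main_inv b T S B (Suc j) s3"
        unfolding main_inv_def MS
      proof (intro conjI impI)
        show "regs s3 rQ = int (S + Suc j)" using f3 by (simp add: q_def)
        show "cn s3 = ks S B (Suc j) * (T * (5 * n * b))" using pb(2) inv act by (simp add: ks_Suc main_inv_def)
        assume "\<forall>i<Suc j. active S B i \<longrightarrow> prime_ok \<omega> n A b T (ks S B i * (T * (5 * n * b))) (int (S + i + 1))"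
        then have "prime_ok \<omega> n A b T (cn s) q" "[regs s rX = detn n A] (mod M)"
          using inv act by (auto simp: main_inv_def q_def M_def)
        then show "[regs s3 rX = detn n A] (mod (M * q))" using pb(6) by blast
      qed (use pb in auto)
      then show ?thesis unfolding ev sf using True f1(3) pt pr pb(1) by (simp add: s2_def s3_def)
    qed
  qed
qed

lemma main_loop_spec:
  fixes PM b T S N SQ :: nat
  assumes e: "main_env b T PM SQ B s" and inv: "main_inv b T S B 0 s" and N: "regs s rCnt = int N"
    and S: "S = 2 ^ b" and PM: "S + N < PM" "PM = SQ * SQ" "4 * int PM * int PM \<le> X" "int SQ + 2 \<le> X"
    and B: "0 \<le> B" "2 * ((B + 1) * int PM) * int PM \<le> Y"
  shows "SF (For ri0 rCnt candidate) s \<and> main_inv b T S B N (EV (For ri0 rCnt candidate) s)"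
proof (rule For_rule[where Inv = "main_inv b T S B"])
  fix j s' assume j: "j < N" and sm: "same (For ri0 rCnt candidate) s s'" and iv: "main_inv b T S B j s'"
  have "main_env b T PM SQ B s'"
    using e sameD(1)[OF sm] by (simp add: main_env_def)
  then show "SF candidate s' \<and> main_inv b T S B (Suc j) (EV candidate s')"
    using candidate_spec[OF _ iv j S PM B] by blast
qed (use N inv in \<open>auto simp: main_inv_def\<close>)

lemma center_spec:
  assumes s: "regs s rX = x" "regs s rM = M" and M: "0 \<le> x" "x < M" "2 * M \<le> Y"
  shows "SF center s" "[x = d] (mod M) \<Longrightarrow> 2 * \<bar>d\<bar> < M \<Longrightarrow> regs (EV center s) rX = d"
proof -
  show "SF center s" using s M IX XY by (simp add: center_def bnd_def big_def)
  assume d: "[x = d] (mod M)" "2 * \<bar>d\<bar> < M"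
  have "M dvd x - d" using d(1) by (simp add: cong_iff_dvd_diff)
  then obtain k where k: "x - d = M * k" by (elim dvdE)
  have k01: "k = 0 \<or> k = 1"
  proof (rule ccontr)
    assume nk: "\<not> ?thesis"
    show False
    proof (cases "k \<ge> 2")
      case True
      then have "M * 2 \<le> M * k" using M by (intro mult_left_mono) auto
      then show False using k M d(2) by linarith
    next
      case False
      then have "k \<le> -1" using nk by linarith
      then have "M * k \<le> M * (-1)" using M by (intro mult_left_mono) auto
      then show False using k M d(2) by linarith
    qed
  qed
  show "regs (EV center s) rX = d"
    using s M d(2) k k01 by (auto simp: center_def)
qed

end

section \<open>Parameters of the algorithm\<close>

definition lb :: "nat \<Rightarrow> nat" where "lb x = nat (bitlen (int x))"

definition cbits :: "nat \<Rightarrow> nat" where "cbits n = 2 * lb n + 6"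

definition esize :: "nat \<Rightarrow> nat \<Rightarrow> nat" where "esize n W = 2 * lb (lb W) + cbits n + 6"

definition ncand :: "nat \<Rightarrow> nat \<Rightarrow> nat" where "ncand n W = 2 ^ esize n W"

definition rsize :: "nat \<Rightarrow> nat \<Rightarrow> nat" where "rsize n W = 2 ^ (lb n + lb (lb W) + 7)"

lemma lb_less: "x < 2 ^ lb x"
proof -
  have "int x < 2 ^ nat (bitlen (int x))" using bitlen_bounds[of "int x"] by (cases "x = 0") auto
  then show ?thesis unfolding lb_def by (metis of_nat_less_iff of_nat_numeral of_nat_power)
qed

lemma lb_le: "x \<ge> 1 \<Longrightarrow> 2 ^ lb x \<le> 2 * x"
proof -
  assume x: "x \<ge> 1"
  then have "2 ^ nat (bitlen (int x) - 1) \<le> int x" using bitlen_bounds[of "int x"] by auto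
  moreover have "bitlen (int x) > 0" using x by (simp add: bitlen_nonneg bitlen_eq_zero_iff order_less_le)
  then have "nat (bitlen (int x)) = Suc (nat (bitlen (int x) - 1))" by simp
  ultimately have "(2::int) ^ lb x \<le> 2 * int x" by (simp add: lb_def)
  then show ?thesis by (metis of_nat_le_iff of_nat_mult of_nat_numeral of_nat_power)
qed

lemma lb_mono: "x \<le> y \<Longrightarrow> lb x \<le> lb y"
proof (rule ccontr)
  assume xy: "x \<le> y" and "\<not> lb x \<le> lb y"
  then have lt: "lb y < lb x" by simp
  then have "x \<noteq> 0" by (auto simp: lb_def bitlen_def floorlog_def split: if_splits)
  then have "2 ^ lb x \<le> 2 * y" using lb_le[of x] xy by simp
  moreover have "2 * y < 2 ^ Suc (lb y)" using lb_less[of y] by simp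
  moreover have "(2::nat) ^ Suc (lb y) \<le> 2 ^ lb x" using lt by (intro power_increasing) auto
  ultimately show False by linarith
qed

lemma lb_pos: "x \<ge> 1 \<Longrightarrow> lb x \<ge> 1"
  using lb_less[of x] by (cases "lb x") auto

lemma lb_le_self: "lb x \<le> x"
proof (cases "x = 0")
  case False
  then have "2 ^ lb x \<le> 2 * x" using lb_le by simp
  moreover have "2 * lb x \<le> 2 ^ lb x"
  proof (cases "lb x")
    case (Suc k)
    have "Suc k \<le> 2 ^ k" unfolding Suc_le_eq by (rule less_exp)
    then show ?thesis using Suc by simp
  qed simp
  ultimately show ?thesis by linarith
qed (simp add: lb_def)

text \<open>With \<open>?l = 2 ^ lb (lb W)\<close> one has \<open>S + K \<le> 2 S l\<close> and
  \<open>E < 32 l\<close>, while \<open>2 ^ E = 64 S l^2\<close> by the choice of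
  \<open>esize\<close>. So \<open>2 ^ E / E\<close> exceeds \<open>S + K\<close>: one factor
  \<open>l\<close> pays for the number of primes, the other for their density. \<open>W = 0\<close>
  is the zero matrix, where the empty product 1 already exceeds the bound.\<close>

lemma moduli_suffice:
  assumes n: "n \<ge> 1" and W: "W = 0 \<or> n \<le> W"
  shows "2 * int W ^ n < Ms (2 ^ cbits n) (2 * int W ^ n) (ncand n W)"
    and "W \<ge> 1 \<Longrightarrow> 2 * int W ^ n < 2 ^ (n * lb W + 1)"
proof -
  show pw: "2 * int W ^ n < 2 ^ (n * lb W + 1)" if "W \<ge> 1"
  proof -
    have "int W < 2 ^ lb W" using lb_less[of W] by (metis of_nat_less_iff of_nat_numeral of_nat_power)
    then have "int W ^ n < (2 ^ lb W) ^ n" using n by (intro power_strict_mono) auto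
    then show ?thesis by (simp add: power_mult[symmetric] mult.commute)
  qed
  show "2 * int W ^ n < Ms (2 ^ cbits n) (2 * int W ^ n) (ncand n W)"
  proof (cases "W = 0")
    case True
    then have "2 * int W ^ n = 0" using n by simp
    then show ?thesis using Ms_pos[of "2 ^ cbits n" "2 * int W ^ n" "ncand n W"] by linarith
  next
    case False
    then have W1: "W \<ge> 1" "n \<le> W" using W by auto
    let ?S = "2 ^ cbits n :: nat" and ?K = "n * lb W + 1" and ?E = "esize n W" and ?l = "2 ^ lb (lb W) :: nat"
    let ?\<pi> = "card {p::nat. prime p \<and> p \<le> 2 ^ ?E}"
    have E: "?E = 2 * lb (lb W) + 2 * lb n + 12" by (simp add: esize_def cbits_def)
    have pi: "2 ^ ?E \<le> ?E * ?\<pi> + 2" by (rule primes_below_power_of_two) (simp add: E)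
    have l1: "lb W < ?l" "lb (lb W) < ?l" "lb n < ?l" "1 \<le> ?l"
      using lb_less[of "lb W"] lb_mono[OF W1(2)] by (auto intro: le_less_trans)
    have El: "?E < 32 * ?l" unfolding E using l1 by linarith
    have S: "?S = 64 * (2 ^ lb n * 2 ^ lb n)"
    proof -
      have "cbits n = lb n + lb n + 6" by (simp add: cbits_def)
      then show ?thesis by (simp only: power_add) simp
    qed
    have nl: "n * lb W \<le> 2 ^ lb n * ?l" using lb_less[of n] l1 by (intro mult_mono) auto
    have n2: "(2::nat) ^ lb n \<le> 2 ^ lb n * 2 ^ lb n" by simp
    have "2 ^ lb n * ?l \<le> ?S * ?l" unfolding S using n2 by (intro mult_right_mono) linarith+
    moreover have "64 * (2 ^ lb n * ?l) \<le> ?S * ?l"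
    proof -
      have "(64 * 2 ^ lb n) * ?l \<le> ?S * ?l" unfolding S using n2 by (intro mult_right_mono) linarith+
      then show ?thesis by simp
    qed
    moreover have "?S \<le> ?S * ?l" using l1(4) by simp
    moreover have "64 \<le> ?S * ?l"
    proof -
      have "64 * 1 \<le> ?S * ?l" unfolding S by (intro mult_mono) auto
      then show ?thesis by simp
    qed
    ultimately have SK: "?S + ?K \<le> 2 * (?S * ?l)" using nl by linarith
    have pw2: "2 ^ ?E = 64 * ?S * (?l * ?l)"
    proof -
      have "?E = 6 + cbits n + (lb (lb W) + lb (lb W))" by (simp add: esize_def)
      then show ?thesis by (simp only: power_add) simp
    qed
    have "?S + ?K \<le> ?\<pi>"
    proof (rule ccontr)
      assume "\<not> ?S + ?K \<le> ?\<pi>"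
      then have "?\<pi> + 1 \<le> 2 * (?S * ?l)" using SK by linarith
      then have "?E * (?\<pi> + 1) \<le> ?E * (2 * (?S * ?l))" by (rule mult_left_mono) simp
      also have "\<dots> < 32 * ?l * (2 * (?S * ?l))" using El by (intro mult_strict_right_mono) auto
      also have "\<dots> = 2 ^ ?E" unfolding pw2 by simp
      finally have "?E * ?\<pi> + ?E < 2 ^ ?E" by simp
      moreover have "2 \<le> ?E" unfolding E by simp
      ultimately show False using pi by linarith
    qed
    then have "2 * int W ^ n < Ms ?S (2 * int W ^ n) (2 ^ ?E)"
      by (intro Ms_final[OF pw[OF W1(1)]])
    then show ?thesis by (simp add: ncand_def)
  qed
qed

text \<open>Leibniz with \<open>n! \<le> n^n\<close>; the resulting bound still has length
  \<open>O(n log(nU))\<close>.\<close>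

lemma detn_bound:
  assumes n: "n \<ge> 1" and A: "\<And>i j. i < n \<Longrightarrow> j < n \<Longrightarrow> \<bar>A i j\<bar> \<le> int U"
  shows "\<bar>detn n A\<bar> \<le> int (n * U) ^ n"
proof -
  let ?P = "{p. p permutes {0..<n}}"
  have "detn n A = (\<Sum>p\<in>?P. signof p * (\<Prod>i = 0..<n. A i (p i)))"
    by (rule detn_Leibniz)
  also have "\<bar>\<dots>\<bar> \<le> (\<Sum>p\<in>?P. \<bar>signof p * (\<Prod>i = 0..<n. A i (p i))\<bar>)" by (rule sum_abs)
  also have "\<dots> \<le> (\<Sum>p\<in>?P. int U ^ n)"
  proof (rule sum_mono)
    fix p assume p: "p \<in> ?P"
    have "(\<Prod>i = 0..<n. \<bar>A i (p i)\<bar>) \<le> (\<Prod>i = 0..<n. int U)"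
      using A permutes_in_image[of p "{0..<n}"] p by (intro prod_mono) auto
    then show "\<bar>signof p * (\<Prod>i = 0..<n. A i (p i))\<bar> \<le> int U ^ n"
      by (simp add: abs_mult abs_prod sign_def)
  qed
  also have "\<dots> = int (fact n) * int U ^ n"
    by (simp add: card_permutations)
  also have "\<dots> \<le> int (n ^ n) * int U ^ n"
  proof (rule mult_right_mono)
    show "int (fact n) \<le> int (n ^ n)" using fact_le_power[of n, where 'a = int] by simp
  qed simp
  finally show ?thesis by (simp add: power_mult_distrib)
qed

section \<open>Correctness of the program\<close>

text \<open>The program is not told \<open>U\<close> and scales its parameters by the largest entry
  it reads; the inserted 0 covers an empty list of nonzero entries.\<close>

definition max_abs :: "(nat \<Rightarrow> int) \<Rightarrow> nat \<Rightarrow> nat" where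
  "max_abs f m = nat (Max (insert 0 ((\<lambda>k. \<bar>f k\<bar>) ` {..<m})))"

lemma max_abs_eqI:
  assumes "0 \<le> v" "\<And>k. k < m \<Longrightarrow> \<bar>f k\<bar> \<le> v" "v = 0 \<or> (\<exists>k<m. v = \<bar>f k\<bar>)"
  shows "v = int (max_abs f m)"
proof -
  have "Max (insert 0 ((\<lambda>k. \<bar>f k\<bar>) ` {..<m})) = v"
    using assms by (intro Max_eqI) auto
  then show ?thesis using assms(1) by (simp add: max_abs_def)
qed

lemma max_abs_ge: "k < m \<Longrightarrow> \<bar>f k\<bar> \<le> int (max_abs f m)"
  and max_abs_le: "0 \<le> v \<Longrightarrow> (\<And>k. k < m \<Longrightarrow> \<bar>f k\<bar> \<le> v) \<Longrightarrow> int (max_abs f m) \<le> v"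
proof -
  have M: "Max (insert 0 ((\<lambda>k. \<bar>f k\<bar>) ` {..<m})) = int (max_abs f m)"
    unfolding max_abs_def by (simp add: Max_ge_iff)
  show "\<bar>f k\<bar> \<le> int (max_abs f m)" if "k < m" unfolding M[symmetric] using that by (intro Max_ge) auto
  show "int (max_abs f m) \<le> v" if "0 \<le> v" "\<And>k. k < m \<Longrightarrow> \<bar>f k\<bar> \<le> v"
    unfolding M[symmetric] using that by (subst Max_le_iff) auto
qed

lemma wr_setup_loops [simp]:
  "wr max_entry = {ri1, rt1, rt2, rt3, rU}" "wr (pow2 r e) = {r, ri1}"
  by (auto simp: max_entry_def pow2_def)

context det_program
begin

lemma max_entry_spec:
  assumes s: "regs s rNz = int m" "regs s rU = 0"
  shows "SF max_entry s \<and> regs (EV max_entry s) rU = int (max_abs ent m)"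
proof -
  let ?J = "\<lambda>\<kappa> (t :: state). 0 \<le> regs t rU \<and> regs t rU \<le> X \<and> (\<forall>k. m - \<kappa> \<le> k \<and> k < m \<longrightarrow> \<bar>ent k\<bar> \<le> regs t rU) \<and>
    (regs t rU = 0 \<or> (\<exists>k<m. regs t rU = \<bar>ent k\<bar>))"
  let ?B = "Op rt1 Times (Reg ri1) (Const 3) ;; Op rt1 Plus (Reg rt1) (Const 4) ;;
     Inp rt2 (Reg rt1) ;; Op rt3 Minus (Const 0) (Reg rt2) ;; IfP rt3 (mov rt2 (Reg rt3)) ;;
     Op rt3 Minus (Reg rt2) (Reg rU) ;; IfP rt3 (mov rU (Reg rt2))"
  have "SF max_entry s \<and> ?J m (EV max_entry s)"
    unfolding max_entry_def
  proof (rule For_rule[where Inv = ?J])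
    fix \<kappa> s' assume \<kappa>: "\<kappa> < m" and J: "?J \<kappa> s'" and i: "regs s' ri1 = int (m - Suc \<kappa>)"
    define j where "j = m - Suc \<kappa>"
    have jm: "j < m" using \<kappa> by (simp add: j_def)
    have en: "input_at xs (int j * 3 + 4) = ent j" "\<bar>ent j\<bar> \<le> X" using ent[OF jm] by (auto simp: mult.commute)
    have jX: "int j * 3 + 4 \<le> X" using mX jm by linarith
    have dX: "\<bar>\<bar>ent j\<bar> - regs s' rU\<bar> \<le> X" using J en(2) by linarith
    have st: "SF ?B s'" "regs (EV ?B s') rU = max (regs s' rU) \<bar>ent j\<bar>"
      using i en jX dX IX by (auto simp: j_def[symmetric] bnd_def big_def max_def)
    have all: "\<bar>ent k\<bar> \<le> max (regs s' rU) \<bar>ent j\<bar>" if "m - Suc \<kappa> \<le> k" "k < m" for k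
    proof (cases "k = j")
      case False
      then have "m - \<kappa> \<le> k" using that by (simp add: j_def)
      then have "\<bar>ent k\<bar> \<le> regs s' rU" using J that by blast
      then show ?thesis by simp
    qed simp
    show "SF ?B s' \<and> ?J (Suc \<kappa>) (EV ?B s')"
      unfolding st(2) using st(1) all J en jm by (auto simp: max_def)
  qed (use s IX in auto)
  then show ?thesis using max_abs_eqI[of "regs (EV max_entry s) rU" m ent] by auto
qed

lemma pow2_spec:
  assumes s: "regs s e = int k" "2 ^ k \<le> X" and r: "\<not> big r" "r \<noteq> ri1" "e \<noteq> r" "e \<noteq> ri1"
  shows "SF (pow2 r e) s \<and> regs (EV (pow2 r e) s) r = 2 ^ k"
proof -
  define s1 where "s1 = EV (mov r (Const 1)) s"
  let ?J = "\<lambda>\<kappa> (t :: state). regs t r = 2 ^ \<kappa>"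
  have "SF (For ri1 e (Op r Times (Reg r) (Const 2))) s1 \<and> ?J k (EV (For ri1 e (Op r Times (Reg r) (Const 2))) s1)"
  proof (rule For_rule[where Inv = ?J])
    fix \<kappa> s' assume \<kappa>: "\<kappa> < k" and J: "?J \<kappa> s'"
    have "(2::int) ^ Suc \<kappa> \<le> 2 ^ k" using \<kappa> by (intro power_increasing) auto
    then show "SF (Op r Times (Reg r) (Const 2)) s' \<and> ?J (Suc \<kappa>) (EV (Op r Times (Reg r) (Const 2)) s')"
      using J s(2) r(1) IX by (simp add: bnd_def)
  qed (use s r in \<open>auto simp: s1_def\<close>)
  then show ?thesis using IX r(1)
    unfolding pow2_def safe.simps(6) ev.simps(6) s1_def[symmetric] by (simp add: bnd_def del: ev.simps(8) safe.simps(8))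
qed

lemma sizes_spec:
  fixes c :: nat and W :: nat
  assumes s: "regs s rN = int n" "regs s rU = int U" and W: "W = n * U"
    and X: "int W \<le> X" "int (lb W * (c + 3)) \<le> X" "int c + 3 \<le> X" "int (cbits n) \<le> X"
  shows "SF (sizes c) s \<and> (let t = EV (sizes c) s in regs t rW = int W \<and> regs t rL = int (lb W) \<and>
    regs t rLn = int (lb n) \<and> regs t rLL = int (lb (lb W)) \<and> regs t rB = int (cbits n) \<and>
    regs t rT = int (lb W * (c + 3)) \<and> regs t rN2 = 2 * int n)"
proof -
  have lb: "bitlen (int x) = int (lb x)" for x by (simp add: lb_def bitlen_nonneg)
  have "lb W \<le> lb W * (c + 3)" by simp
  then have L: "int (lb W) \<le> X" using X(2) by linarith
  have W': "int n * int U = int W" by (simp add: W)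
  have e: "int (lb W) * (int c + 3) = int (lb W * (c + 3))" "int (lb n) * 2 + 6 = int (cbits n)" "0 \<le> int (lb W * (c + 3))"
    by (simp_all add: cbits_def)
  have l2: "int (lb n) * 2 \<le> X" using X(4) by (simp add: cbits_def)
  show ?thesis
    using s X L l2 nX IX by (simp add: sizes_def Let_def bnd_def big_def W' lb e del: of_nat_mult of_nat_add)
qed

lemma powers_spec:
  fixes W :: nat
  assumes s: "regs s rLL = int (lb (lb W))" "regs s rLn = int (lb n)" "regs s rB = int (cbits n)"
    and X: "4 * int (ncand n W) \<le> X"
  shows "SF powers s \<and> (let t = EV powers s in regs t rS = 2 ^ cbits n \<and> regs t rCnt = int (ncand n W) \<and>
    regs t rPM = 4 * int (ncand n W) \<and> regs t rSq = int (rsize n W))"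
proof -
  let ?c1 = "Op rt1 Times (Reg rLL) (Const 2) ;; Op rt1 Plus (Reg rt1) (Reg rB) ;; Op rt1 Plus (Reg rt1) (Const 6)"
  let ?c2 = "Op rPM Times (Reg rCnt) (Const 4) ;; Op rt1 Plus (Reg rLn) (Reg rLL) ;; Op rt1 Plus (Reg rt1) (Const 7)"
  let ?k = "lb n + lb (lb W) + 7"
  define s1 where "s1 = EV (pow2 rS rB) s"
  define s2 where "s2 = EV ?c1 s1"
  define s3 where "s3 = EV (pow2 rCnt rt1) s2"
  define s4 where "s4 = EV ?c2 s3"
  have N: "int (ncand n W) = 2 ^ esize n W" by (simp add: ncand_def)
  have pX: "2 ^ k \<le> X" if "k \<le> esize n W" for k
  proof -
    have "(2::int) ^ k \<le> 2 ^ esize n W" using that by (intro power_increasing) auto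
    then show ?thesis using X N zero_le_power[of "2::int" "esize n W"] by linarith
  qed
  have kX: "int k \<le> X" if "k \<le> esize n W" for k
  proof -
    have "int k < 2 ^ k" by (metis less_exp of_nat_less_numeral_power_cancel_iff)
    then show ?thesis using pX[OF that] by linarith
  qed
  have e: "cbits n \<le> esize n W" "?k \<le> esize n W" "2 * lb (lb W) \<le> esize n W" "2 * lb (lb W) + cbits n \<le> esize n W" "lb n + lb (lb W) \<le> esize n W"
    by (auto simp: esize_def cbits_def)
  have p1: "SF (pow2 rS rB) s" "regs s1 rS = 2 ^ cbits n"
    using pow2_spec[OF s(3) pX[OF e(1)], of rS] by (auto simp: s1_def big_def)
  have f1: "regs s1 rLL = int (lb (lb W))" "regs s1 rLn = int (lb n)" "regs s1 rB = int (cbits n)"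
    using s by (auto simp: s1_def ev_regs)
  have q1: "SF ?c1 s1"
    using f1 kX[OF e(3)] kX[OF e(4)] kX[of "esize n W"] IX by (simp add: bnd_def big_def esize_def)
  have f2: "regs s2 rt1 = int (esize n W)" "regs s2 rLL = int (lb (lb W))" "regs s2 rLn = int (lb n)" "regs s2 rS = 2 ^ cbits n"
    using f1 p1 by (auto simp: s2_def esize_def)
  have p2: "SF (pow2 rCnt rt1) s2" "regs s3 rCnt = int (ncand n W)"
    using pow2_spec[OF f2(1) pX, of rCnt] N by (auto simp: s3_def big_def)
  have f3: "regs s3 rLL = int (lb (lb W))" "regs s3 rLn = int (lb n)" "regs s3 rS = 2 ^ cbits n"
    using f2 by (auto simp: s3_def ev_regs)
  have q2: "SF ?c2 s3"
    using f3 p2(2) X kX[OF e(2)] kX[OF e(5)] IX by (simp add: bnd_def big_def mult.commute)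
  have f4: "regs s4 rt1 = int ?k" "regs s4 rS = 2 ^ cbits n" "regs s4 rCnt = int (ncand n W)" "regs s4 rPM = 4 * int (ncand n W)"
    using f3 p2 by (auto simp: s4_def)
  have p3: "SF (pow2 rSq rt1) s4" "regs (EV (pow2 rSq rt1) s4) rSq = 2 ^ ?k"
    using pow2_spec[OF f4(1) pX[OF e(2)], of rSq] by (auto simp: big_def)
  have ev: "EV powers s = EV (pow2 rSq rt1) s4"
    by (simp add: powers_def s4_def s3_def s2_def s1_def)
  have "SF powers s"
    using p1(1) q1 p2(1) q2 p3(1) by (simp add: powers_def s4_def s3_def s2_def s1_def)
  then show ?thesis unfolding ev using p3(2) f4 by (simp add: Let_def ev_regs rsize_def)
qed

lemma bound_spec:
  fixes W :: nat
  assumes s: "regs s rN = int n" "regs s rW = int W" "regs s rS = S" "\<bar>S\<bar> \<le> X" and Y: "2 * int W ^ n + 1 \<le> Y"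
  shows "SF bound s \<and> (let t = EV bound s in regs t rBnd = 2 * int W ^ n \<and> regs t rM = 1 \<and> regs t rX = 0 \<and> regs t rQ = S)"
proof -
  let ?l = "For ri1 rN (Op rBnd Times (Reg rBnd) (Reg rW))"
  define s1 where "s1 = EV (mov rBnd (Const 2)) s"
  define s2 where "s2 = EV ?l s1"
  have f1: "regs s1 rN = int n" "regs s1 rW = int W" "regs s1 rS = S" "regs s1 rBnd = 2" using s by (auto simp: s1_def)
  let ?J = "\<lambda>\<kappa> (t :: state). regs t rBnd = 2 * int W ^ \<kappa>"
  have L: "SF ?l s1 \<and> ?J n (EV ?l s1)"
  proof (rule For_rule[where Inv = ?J])
    fix \<kappa> s' assume \<kappa>: "\<kappa> < n" and J: "?J \<kappa> s'" and sm: "same ?l s1 s'"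
    have w: "regs s' rW = int W" using sameD(1)[OF sm, of rW] f1 by simp
    have "2 * int W ^ Suc \<kappa> \<le> Y"
    proof (cases "W = 0")
      case False
      then have "int W ^ Suc \<kappa> \<le> int W ^ n" using \<kappa> by (intro power_increasing) auto
      then show ?thesis using Y by simp
    qed (use IX XY in simp)
    then show "SF (Op rBnd Times (Reg rBnd) (Reg rW)) s' \<and> ?J (Suc \<kappa>) (EV (Op rBnd Times (Reg rBnd) (Reg rW)) s')"
      using J w IX by (simp add: bnd_def big_def mult.commute)
  qed (use f1 in auto)
  have f2: "regs s2 rS = S" using f1 by (simp add: s2_def ev_regs del: ev.simps)
  have ev: "EV bound s = EV (mov rM (Const 1) ;; mov rX (Const 0) ;; mov rQ (Reg rS)) s2"
    by (simp add: bound_def s2_def s1_def del: ev.simps(8))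
  have "SF bound s \<longleftrightarrow> SF (mov rBnd (Const 2)) s \<and> SF ?l s1 \<and> SF (mov rM (Const 1) ;; mov rX (Const 0) ;; mov rQ (Reg rS)) s2"
    by (simp add: bound_def s2_def s1_def del: ev.simps(8) safe.simps(8))
  then have "SF bound s" using L f2 s(4) IX XY by (simp add: bnd_def big_def del: safe.simps(8))
  then show ?thesis unfolding ev using L f2 by (simp add: Let_def s2_def[symmetric] del: ev.simps(8))
qed

end

section \<open>The whole run: setup, main loop, centering\<close>

definition prepare :: "nat \<Rightarrow> com" where
  "prepare c = Inp rN (Const 0) ;; Inp rNz (Const 1) ;; max_entry ;; sizes c ;; powers ;; bound"

lemma det_com_prepare:
  "ev xs \<omega> (det_com c) s = ev xs \<omega> center (ev xs \<omega> (For ri0 rCnt candidate) (ev xs \<omega> (prepare c) s))"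
  "safe xs \<omega> X Y I (det_com c) s \<longleftrightarrow> safe xs \<omega> X Y I (prepare c) s \<and>
     safe xs \<omega> X Y I (For ri0 rCnt candidate) (ev xs \<omega> (prepare c) s) \<and>
     safe xs \<omega> X Y I center (ev xs \<omega> (For ri0 rCnt candidate) (ev xs \<omega> (prepare c) s))"
  "ct xs \<omega> w w' (det_com c) s = ct xs \<omega> w w' (prepare c) s +
     ct xs \<omega> w w' (For ri0 rCnt candidate) (ev xs \<omega> (prepare c) s) +
     ct xs \<omega> w w' center (ev xs \<omega> (For ri0 rCnt candidate) (ev xs \<omega> (prepare c) s))"
  by (simp_all add: det_com_def prepare_def del: ev.simps(8) safe.simps(8) ct.simps(8))

lemma wr_setup_parts [simp]:
  "wr (sizes c) = {rW, rt1, rL, rLn, rLL, rB, rT, rN2}" "wr powers = {rS, ri1, rt1, rCnt, rPM, rSq}"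
  "wr bound = {rBnd, ri1, rM, rX, rQ}" "\<not> flips (prepare c)"
  by (auto simp: sizes_def powers_def bound_def prepare_def com_defs)

text \<open>All parameters derive from \<open>W\<close>, which uses the actual largest entry. It is
  compared with \<open>n * U\<close> only when sizes are estimated.\<close>

locale det_run = det_program +
  fixes c W :: nat
  assumes head: "input_at xs 0 = int n" "input_at xs 1 = int m"
    and W: "W = n * max_abs ent m"
    and W_X: "int W \<le> X" "int (lb W * (c + 3)) \<le> X" "int c + 3 \<le> X" "4 * int (4 * ncand n W) * int (4 * ncand n W) \<le> X"
    and W_Y: "2 * ((2 * int W ^ n + 1) * int (4 * ncand n W)) * int (4 * ncand n W) \<le> Y"
    and entries: "\<And>i j. i < n \<Longrightarrow> j < n \<Longrightarrow> \<bar>A i j\<bar> \<le> int (max_abs ent m)"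
begin

lemma rsize_sq: "4 * ncand n W = rsize n W * rsize n W"
proof -
  have "esize n W + 2 = (lb n + lb (lb W) + 7) + (lb n + lb (lb W) + 7)" by (simp add: esize_def cbits_def)
  then have "(2::nat) ^ (esize n W + 2) = rsize n W * rsize n W" unfolding rsize_def by (simp only: power_add)
  then show ?thesis by (simp add: ncand_def)
qed

lemma sizes_X: "4 * int (ncand n W) \<le> X" "int (cbits n) \<le> X" "int (rsize n W) + 2 \<le> X" "2 ^ cbits n + ncand n W < 4 * ncand n W"
proof -
  let ?N = "ncand n W" and ?R = "rsize n W"
  have R: "128 \<le> ?R"
  proof -
    have "(2::nat) ^ 7 \<le> 2 ^ (lb n + lb (lb W) + 7)" by (intro power_increasing) auto
    then show ?thesis by (simp add: rsize_def)
  qed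
  then have RR: "?R * 1 \<le> ?R * ?R" by (intro mult_left_mono) auto
  have N1: "1 \<le> ?N" by (simp add: ncand_def)
  then have NN: "int ?N * 1 \<le> int ?N * int ?N" by (intro mult_left_mono) auto
  have W4: "64 * (int ?N * int ?N) \<le> X" using W_X(4) by simp
  show a: "4 * int ?N \<le> X" using NN N1 W4 by linarith
  have "int ?R + 2 \<le> 4 * (int (?R * ?R))" using RR R by linarith
  then have "int ?R + 2 \<le> 16 * int ?N" unfolding rsize_sq[symmetric] by simp
  then show "int ?R + 2 \<le> X" using NN N1 W4 by linarith
  have "cbits n < 2 ^ cbits n" by (rule less_exp)
  moreover have c: "(2::nat) ^ cbits n \<le> ?N" unfolding ncand_def by (intro power_increasing) (auto simp: esize_def)
  ultimately show "int (cbits n) \<le> X" using a by linarith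
  show "2 ^ cbits n + ?N < 4 * ?N" using c N1 by linarith
qed

lemma prepare_spec:
  "SF (prepare c) start \<and> main_env (cbits n) (lb W * (c + 3)) (4 * ncand n W) (rsize n W) (2 * int W ^ n) (EV (prepare c) start) \<and>
   main_inv (cbits n) (lb W * (c + 3)) (2 ^ cbits n) (2 * int W ^ n) 0 (EV (prepare c) start) \<and>
   regs (EV (prepare c) start) rCnt = int (ncand n W)"
proof -
  define s1 where "s1 = EV (Inp rN (Const 0) ;; Inp rNz (Const 1)) start"
  define s2 where "s2 = EV max_entry s1"
  define s3 where "s3 = EV (sizes c) s2"
  define s4 where "s4 = EV powers s3"
  have ev: "EV (prepare c) start = EV bound s4" by (simp add: prepare_def s4_def s3_def s2_def s1_def)
  have f1: "regs s1 rN = int n" "regs s1 rNz = int m" "regs s1 rU = 0"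
    using head by (auto simp: s1_def start_def)
  have S1: "SF (Inp rN (Const 0) ;; Inp rNz (Const 1)) start" using head nX mX IX by (simp add: start_def)
  have m: "SF max_entry s1" "regs s2 rU = int (max_abs ent m)" using max_entry_spec[OF f1(2,3)] by (auto simp: s2_def)
  have f2: "regs s2 rN = int n" "regs s2 rNz = int m" using f1 by (auto simp: s2_def ev_regs)
  have z: "SF (sizes c) s2" "regs s3 rW = int W" "regs s3 rLn = int (lb n)" "regs s3 rLL = int (lb (lb W))"
      "regs s3 rB = int (cbits n)" "regs s3 rT = int (lb W * (c + 3))" "regs s3 rN2 = 2 * int n"
    using sizes_spec[OF f2(1) m(2) W W_X(1-3) sizes_X(2)] unfolding Let_def s3_def by blast+
  have f3: "regs s3 rN = int n" "regs s3 rNz = int m" using f2 by (auto simp: s3_def ev_regs)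
  have p: "SF powers s3" "regs s4 rS = 2 ^ cbits n" "regs s4 rCnt = int (ncand n W)"
      "regs s4 rPM = 4 * int (ncand n W)" "regs s4 rSq = int (rsize n W)"
    using powers_spec[OF z(4,3,5) sizes_X(1)] unfolding Let_def s4_def by blast+
  have f4: "regs s4 rN = int n" "regs s4 rNz = int m" "regs s4 rW = int W" "regs s4 rB = int (cbits n)"
      "regs s4 rT = int (lb W * (c + 3))" "regs s4 rN2 = 2 * int n"
    using f3 z by (auto simp: s4_def ev_regs)
  have SX: "\<bar>(2::int) ^ cbits n\<bar> \<le> X"
  proof -
    have "int (2 ^ cbits n) \<le> X" using sizes_X(1,4) by linarith
    then show ?thesis by simp
  qed
  have BY: "2 * int W ^ n + 1 \<le> Y"
  proof -
    define B where "B = 2 * int W ^ n + 1"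
    define P where "P = int (4 * ncand n W)"
    have P1: "1 \<le> P" using sizes_X(4) unfolding P_def by linarith
    have B0: "0 \<le> B" by (simp add: B_def)
    have 1: "B * 1 \<le> B * P" using P1 B0 by (intro mult_left_mono) auto
    have 2: "(B * P) * 1 \<le> (B * P) * P" using P1 B0 by (intro mult_left_mono) auto
    have "2 * ((B * P) * P) \<le> Y" using W_Y unfolding B_def P_def by (simp only: mult.assoc)
    then show ?thesis unfolding B_def[symmetric] using 1 2 B0 by linarith
  qed
  have b: "SF bound s4" "regs (EV bound s4) rBnd = 2 * int W ^ n" "regs (EV bound s4) rM = 1"
      "regs (EV bound s4) rX = 0" "regs (EV bound s4) rQ = 2 ^ cbits n"
    using bound_spec[OF f4(1,3) p(2) SX BY] unfolding Let_def by auto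
  have "SF (prepare c) start" using S1 m(1) z(1) p(1) b(1)
    unfolding prepare_def safe.simps(6) s4_def s3_def s2_def s1_def by (simp add: ev.simps(6))
  moreover have "main_env (cbits n) (lb W * (c + 3)) (4 * ncand n W) (rsize n W) (2 * int W ^ n) (EV bound s4)"
    using f4 p b by (simp add: main_env_def ev_regs)
  moreover have "cn (EV bound s4) = 0"
    unfolding ev[symmetric] by (simp add: ev_cn start_def)
  then have "main_inv (cbits n) (lb W * (c + 3)) (2 ^ cbits n) (2 * int W ^ n) 0 (EV bound s4)"
    using b by (simp add: main_inv_def)
  moreover have "regs (EV bound s4) rCnt = int (ncand n W)" using p by (simp add: ev_regs)
  ultimately show ?thesis unfolding ev by blast
qed

lemma det_com_spec:
  "SF (det_com c) start"
  "\<forall>i<ncand n W. active (2 ^ cbits n) (2 * int W ^ n) i \<longrightarrow>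
     prime_ok \<omega> n A (cbits n) (lb W * (c + 3))
       (ks (2 ^ cbits n) (2 * int W ^ n) i * (lb W * (c + 3) * (5 * n * cbits n))) (int (2 ^ cbits n + i + 1)) \<Longrightarrow>
   regs (EV (det_com c) start) 0 = detn n A"
proof -
  let ?s = "EV (prepare c) start" and ?B = "2 * int W ^ n" and ?b = "cbits n" and ?N = "ncand n W"
  let ?t = "EV (For ri0 rCnt candidate) ?s" and ?M = "Ms (2 ^ cbits n) (2 * int W ^ n) (ncand n W)"
  have B0: "0 \<le> ?B" by simp
  note S = prepare_spec
  have L: "SF (For ri0 rCnt candidate) ?s" "main_inv ?b (lb W * (c + 3)) (2 ^ ?b) ?B ?N ?t"
    using main_loop_spec[OF S[THEN conjunct2, THEN conjunct1] S[THEN conjunct2, THEN conjunct2, THEN conjunct1]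
      S[THEN conjunct2, THEN conjunct2, THEN conjunct2] refl sizes_X(4) rsize_sq W_X(4) sizes_X(3) B0 W_Y] by auto
  have t: "regs ?t rX = regs ?t rX" "regs ?t rM = ?M" "0 \<le> regs ?t rX" "regs ?t rX < ?M"
    using L(2) unfolding main_inv_def by auto
  have MY: "2 * ?M \<le> Y"
  proof -
    let ?P = "int (4 * ?N)"
    have P1: "1 \<le> ?P" using sizes_X(4) by linarith
    have "?M \<le> (?B + 1) * int (2 ^ ?b + ?N + 1)" by (rule Ms_le) simp
    also have "\<dots> \<le> (?B + 1) * ?P" using sizes_X(4) by (intro mult_left_mono) (linarith, simp)
    finally have 1: "?M \<le> (?B + 1) * ?P" .
    have 2: "((?B + 1) * ?P) * 1 \<le> ((?B + 1) * ?P) * ?P" using P1 by (intro mult_left_mono) auto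
    have 3: "2 * ((?B + 1) * ?P) * ?P = 2 * (((?B + 1) * ?P) * ?P)" by (rule mult.assoc)
    show ?thesis using 1 2 W_Y unfolding 3 by linarith
  qed
  note C = center_spec[OF t MY]
  show "SF (det_com c) start" unfolding det_com_prepare(2) using S L(1) C(1) by blast
  assume "\<forall>i<?N. active (2 ^ ?b) ?B i \<longrightarrow>
     prime_ok \<omega> n A ?b (lb W * (c + 3)) (ks (2 ^ ?b) ?B i * (lb W * (c + 3) * (5 * n * ?b))) (int (2 ^ ?b + i + 1))"
  then have cg: "[regs ?t rX = detn n A] (mod ?M)" using L(2) unfolding main_inv_def by blast
  have "W = 0 \<or> n \<le> W" using W by auto
  then have "?B < ?M" using moduli_suffice(1) n by blast
  moreover have "\<bar>detn n A\<bar> \<le> int W ^ n" unfolding W by (rule detn_bound[OF n entries])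
  ultimately have "2 * \<bar>detn n A\<bar> < ?M" by linarith
  then show "regs (EV (det_com c) start) 0 = detn n A" unfolding det_com_prepare(1) using C(2)[OF cg] by blast
qed

end

section \<open>Running time\<close>

text \<open>\<open>lr c\<close> collects the registers that bound loops in \<open>c\<close>; as long as \<open>c\<close> does not overwrite them,
  their values \<open>g\<close> determine the cost bound \<open>cb g w W c\<close>.\<close>

primrec lr :: "com \<Rightarrow> nat set" where
  "lr (Op r f x y) = {}"
| "lr (Ld r k i) = {}"
| "lr (St k i x) = {}"
| "lr (Inp r x) = {}"
| "lr (Flip r) = {}"
| "lr (c ;; d) = lr c \<union> lr d"
| "lr (IfP r c) = lr c"
| "lr (For i N c) = insert N (lr c)"
| "lr (Bits r t) = {}"

primrec nobits :: "com \<Rightarrow> bool" where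
  "nobits (Op r f x y) = True"
| "nobits (Ld r k i) = True"
| "nobits (St k i x) = True"
| "nobits (Inp r x) = True"
| "nobits (Flip r) = True"
| "nobits (c ;; d) = (nobits c \<and> nobits d)"
| "nobits (IfP r c) = nobits c"
| "nobits (For i N c) = nobits c"
| "nobits (Bits r t) = False"

primrec cb :: "(nat \<Rightarrow> nat) \<Rightarrow> nat \<Rightarrow> nat \<Rightarrow> com \<Rightarrow> nat" where
  "cb g w W (Op r f x y) = (if big r \<or> bigo x \<or> bigo y then W else w)"
| "cb g w W (Ld r k i) = 3 * w"
| "cb g w W (St k i x) = 3 * w"
| "cb g w W (Inp r x) = w"
| "cb g w W (Flip r) = w"
| "cb g w W (c ;; d) = cb g w W c + cb g w W d"
| "cb g w W (IfP r c) = 2 * (if big r then W else w) + cb g w W c"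
| "cb g w W (For i N c) = 3 * w + g N * (4 * w + cb g w W c)"
| "cb g w W (Bits r t) = 0"

text \<open>\<open>Bits\<close> is excluded because its cost depends on a value and not on a loop
  bound; branches are charged as if taken.\<close>

lemma ct_le_cb:
  assumes "nobits c" "lr c \<inter> wr c = {}" "\<And>N. N \<in> lr c \<Longrightarrow> regs s N = int (g N)"
  shows "ct xs \<omega> w W c s \<le> cb g w W c"
  using assms
proof (induction c arbitrary: s)
  case (Seq c d)
  have "ct xs \<omega> w W c s \<le> cb g w W c" using Seq.prems by (intro Seq.IH(1)) auto
  moreover have "ct xs \<omega> w W d (ev xs \<omega> c s) \<le> cb g w W d"
  proof (rule Seq.IH(2))
    fix N assume N: "N \<in> lr d"
    then have "N \<notin> wr c" using Seq.prems(2) by auto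
    then show "regs (ev xs \<omega> c s) N = int (g N)" using Seq.prems(3) N by (simp add: ev_regs)
  qed (use Seq.prems in auto)
  ultimately show ?case by simp
next
  case (For i N c)
  let ?F = "\<lambda>s. ev xs \<omega> c (set_reg i (regs s i - 1) s)"
  have fr: "regs ((?F ^^ k) s) r = regs s r" if "r \<notin> insert i (wr c)" for k r s
    using that by (induction k) (auto simp: ev_regs)
  have "ct xs \<omega> w W c ((\<lambda>s. set_reg i (regs s i - 1) s) ((?F ^^ k) (set_reg i (regs s N) s))) \<le> cb g w W c" for k
  proof (rule For.IH)
    fix r assume r: "r \<in> lr c"
    then have n: "r \<notin> insert i (wr c)" using For.prems(2) by auto
    then have "regs ((?F ^^ k) (set_reg i (regs s N) s)) r = regs s r"
      using fr[OF n, of k "set_reg i (regs s N) s"] by simp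
    then show "regs (set_reg i (regs ((?F ^^ k) (set_reg i (regs s N) s)) i - 1) ((?F ^^ k) (set_reg i (regs s N) s))) r = int (g r)"
      using n For.prems(3)[of r] r by simp
  qed (use For.prems in auto)
  then have "(\<Sum>k<g N. 4 * w + ct xs \<omega> w W c ((\<lambda>s. set_reg i (regs s i - 1) s) ((?F ^^ k) (set_reg i (regs s N) s))))
      \<le> (\<Sum>k<g N. 4 * w + cb g w W c)" by (intro sum_mono add_left_mono)
  then show ?case using For.prems(3)[of N] by simp
qed auto

text \<open>Rounds may have different bounds under an invariant. This serves the loop over
  candidates, where few rounds are expensive.\<close>

lemma For_cost:
  assumes i: "i \<notin> wr c" and N: "regs s N = int n"
    and init: "Inv 0 s" and stable: "\<And>k s v. Inv k s \<Longrightarrow> Inv k (set_reg i v s)"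
    and step: "\<And>k s'. k < n \<Longrightarrow> same (For i N c) s s' \<Longrightarrow> Inv k s' \<Longrightarrow>
      ct xs \<omega> w W c s' \<le> f k \<and> Inv (Suc k) (ev xs \<omega> c s')"
  shows "ct xs \<omega> w W (For i N c) s \<le> 3 * w + (\<Sum>k<n. 4 * w + f k)"
proof -
  let ?D = "\<lambda>s. set_reg i (regs s i - 1) s"
  let ?F = "\<lambda>s. ev xs \<omega> c (?D s)"
  define s0 where "s0 = set_reg i (int n) s"
  have loop: "same (For i N c) s ((?F ^^ k) s0) \<and> Inv k ((?F ^^ k) s0) \<and>
      (\<forall>j<k. ct xs \<omega> w W c (?D ((?F ^^ j) s0)) \<le> f j)" if "k \<le> n" for k
    using that
  proof (induction k)
    case 0
    then show ?case using init stable by (auto simp: s0_def same_def)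
  next
    case (Suc k)
    define t where "t = ?D ((?F ^^ k) s0)"
    have IH: "same (For i N c) s ((?F ^^ k) s0)" "Inv k ((?F ^^ k) s0)"
      "\<forall>j<k. ct xs \<omega> w W c (?D ((?F ^^ j) s0)) \<le> f j" using Suc by auto
    have t: "same (For i N c) s t" "Inv k t"
      using IH stable by (auto simp: t_def same_def)
    have st: "ct xs \<omega> w W c t \<le> f k" "Inv (Suc k) (ev xs \<omega> c t)"
      using step[OF _ t] Suc.prems by auto
    have "same (For i N c) s (ev xs \<omega> c t)"
      using t(1) same_ev[of c t xs \<omega>] by (simp add: same_def)
    moreover have "(?F ^^ Suc k) s0 = ev xs \<omega> c t" by (simp add: t_def)
    ultimately show ?case using st IH(3) by (simp add: less_Suc_eq t_def[symmetric])
  qed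
  have "(\<Sum>k<n. 4 * w + ct xs \<omega> w W c (?D ((?F ^^ k) s0))) \<le> (\<Sum>k<n. 4 * w + f k)"
    using loop[of n] by (intro sum_mono add_left_mono) auto
  then show ?thesis by (simp add: N s0_def)
qed

lemma lr_candidate_parts [simp]:
  "lr trial = {rN, rB, rN2, rNz, rPM}" "lr crt = {rPM}" "lr prime_test = {rSq}" "lr prime_body = {rT, rN, rB, rN2, rNz, rPM}"
  by (auto simp: com_defs)

lemma nobits_candidate_parts [simp]: "nobits prime_body" "nobits prime_test"
  by (simp_all add: com_defs)

definition env :: "nat \<Rightarrow> nat \<Rightarrow> nat \<Rightarrow> nat \<Rightarrow> nat \<Rightarrow> nat \<Rightarrow> nat \<Rightarrow> nat" where
  "env n m b PM SQ T = (\<lambda>_. 0)(rN := n, rNz := m, rN2 := 2 * n, rB := b, rPM := PM, rSq := SQ, rT := T)"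

text \<open>The four terms stand for drawing random numbers, dense vector work, sparse products and
  the final quotient search.\<close>

lemma cb_trial:
  assumes "n \<ge> 1" "PM \<ge> 1" "b \<ge> 1"
  shows "cb (env n m b PM SQ T) w W trial \<le> 1000 * (w * (n * b) + w * (n * n) + w * (n * m) + w * PM)"
proof -
  have a: "w \<le> PM * w" "n * w \<le> n * (n * w)" "n * w \<le> b * (n * w)" using assms by auto
  show ?thesis
    by (simp add: com_defs env_def big_def algebra_simps) (use a in linarith)
qed

lemma cb_prime_body:
  assumes "n \<ge> 1" "PM \<ge> 1" "b \<ge> 1"
  shows "cb (env n m b PM SQ T) w W prime_body \<le>
    1010 * (T * (w * (n * b) + w * (n * n) + w * (n * m) + w * PM)) + 100 * (w * PM + W)"
proof -
  let ?t = "w * (n * b) + w * (n * n) + w * (n * m) + w * PM"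
  have a: "w \<le> w * PM" and a': "w \<le> PM * w" using assms by auto
  define t where "t = ?t"
  have wt: "w \<le> t" unfolding t_def using a le_add2 le_trans by blast
  then have "4 * w + cb (env n m b PM SQ T) w W trial \<le> 1010 * t"
    using cb_trial[OF assms, of m SQ T w W] unfolding t_def[symmetric] by linarith
  then have "T * (4 * w + cb (env n m b PM SQ T) w W trial) \<le> T * (1010 * t)" by (rule mult_le_mono2)
  then have t: "T * (4 * w + cb (env n m b PM SQ T) w W trial) \<le> 1010 * (T * t)" by (simp only: mult.left_commute)
  have c: "cb (env n m b PM SQ T) w W crt \<le> 50 * (w * PM + W)"
    by (simp add: crt_def solve_def env_def big_def algebra_simps) (use a' in linarith)
  have "env n m b PM SQ T rT = T" by (simp add: env_def)
  then have "cb (env n m b PM SQ T) w W prime_body =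
      w + (3 * w + T * (4 * w + cb (env n m b PM SQ T) w W trial) + cb (env n m b PM SQ T) w W crt)"
    by (simp add: prime_body_def big_def)
  moreover have "x = w + (3 * w + u + k) \<Longrightarrow> u \<le> 1010 * v \<Longrightarrow> k \<le> 50 * (p + W) \<Longrightarrow> w \<le> p \<Longrightarrow>
      x \<le> 1010 * v + 100 * (p + W)" for x u v k p :: nat by simp
  ultimately show ?thesis unfolding t_def[symmetric] using t c a by blast
qed

lemma cb_prime_test: "cb (env n m b PM SQ T) w W prime_test \<le> 50 * (w * SQ + w)"
  by (simp add: prime_test_def env_def big_def algebra_simps)

lemma lr_setup_parts [simp]: "lr max_entry = {rNz}" "lr (pow2 r e) = {e}" "lr bound = {rN}"
  by (auto simp: com_defs)

lemma nobits_setup_parts [simp]: "nobits max_entry" "nobits (pow2 r e)" "nobits bound"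
  by (simp_all add: com_defs)

section \<open>Cost of the setup and of the loop over candidates\<close>

lemma max_entry_cost:
  assumes "regs s rNz = int m"
  shows "ct xs \<omega> w w' max_entry s \<le> 20 * (w * m + w)"
proof -
  have "ct xs \<omega> w w' max_entry s \<le> cb (\<lambda>_. m) w w' max_entry"
    using assms by (intro ct_le_cb) auto
  then show ?thesis by (simp add: max_entry_def big_def algebra_simps)
qed

lemma pow2_cost:
  assumes "regs s e = int k" "e \<noteq> r" "e \<noteq> ri1" "\<not> big r"
  shows "ct xs \<omega> w w' (pow2 r e) s \<le> 5 * (w * k + w)"
proof -
  have "ct xs \<omega> w w' (pow2 r e) s \<le> cb (\<lambda>_. k) w w' (pow2 r e)"
    using assms by (intro ct_le_cb) auto
  moreover have "cb (\<lambda>_. k) w w' (pow2 r e) \<le> 5 * (w * k + w)" using assms(4) by (simp add: pow2_def algebra_simps)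
  ultimately show ?thesis by (rule le_trans)
qed

lemma bound_cost:
  assumes "regs s rN = int n" "w \<le> w'"
  shows "ct xs \<omega> w w' bound s \<le> 10 * (w' * n + w')"
proof -
  have "ct xs \<omega> w w' bound s \<le> cb (\<lambda>_. n) w w' bound"
    using assms by (intro ct_le_cb) auto
  moreover have "cb (\<lambda>_. n) w w' bound \<le> 10 * (w' * n + w')"
  proof -
    have "cb (\<lambda>_. n) w w' bound = 3 * w' + 4 * w + 4 * (w * n) + w' * n"
      by (simp add: bound_def big_def algebra_simps)
    moreover have "w * n \<le> w' * n" using assms(2) by simp
    ultimately show ?thesis using assms(2) unfolding distrib_left by linarith
  qed
  ultimately show ?thesis by (rule le_trans)
qed

lemma sizes_cost:
  assumes "regs s rN = int n" "regs s rU = int U"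
  shows "ct xs \<omega> w w' (sizes c) s \<le> 30 * w + 4 * w * (lb (n * U) + lb n + lb (lb (n * U)))"
proof -
  have lb: "bitlen (int x) = int (lb x)" for x by (simp add: lb_def bitlen_nonneg)
  have U: "int n * int U = int (n * U)" by simp
  show ?thesis using assms
    by (simp add: sizes_def big_def U lb del: of_nat_mult) (simp add: algebra_simps)
qed

lemma powers_cost:
  assumes s: "regs s rLL = int (lb (lb W))" "regs s rLn = int (lb n)" "regs s rB = int (cbits n)"
  shows "ct xs \<omega> w w' powers s \<le> 30 * w + 5 * w * (cbits n + 2 * esize n W)"
proof -
  let ?c1 = "Op rt1 Times (Reg rLL) (Const 2) ;; Op rt1 Plus (Reg rt1) (Reg rB) ;; Op rt1 Plus (Reg rt1) (Const 6)"
  let ?c2 = "Op rPM Times (Reg rCnt) (Const 4) ;; Op rt1 Plus (Reg rLn) (Reg rLL) ;; Op rt1 Plus (Reg rt1) (Const 7)"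
  let ?k = "lb n + lb (lb W) + 7"
  define s1 where "s1 = ev xs \<omega> (pow2 rS rB) s"
  define s2 where "s2 = ev xs \<omega> ?c1 s1"
  define s3 where "s3 = ev xs \<omega> (pow2 rCnt rt1) s2"
  define s4 where "s4 = ev xs \<omega> ?c2 s3"
  have f1: "regs s1 rLL = int (lb (lb W))" "regs s1 rLn = int (lb n)" "regs s1 rB = int (cbits n)"
    using s by (auto simp: s1_def ev_regs)
  have f2: "regs s2 rt1 = int (esize n W)" "regs s2 rLL = int (lb (lb W))" "regs s2 rLn = int (lb n)"
    using f1 by (auto simp: s2_def esize_def)
  have f3: "regs s3 rLL = int (lb (lb W))" "regs s3 rLn = int (lb n)"
    using f2 by (auto simp: s3_def ev_regs)
  have f4: "regs s4 rt1 = int ?k" using f3 by (simp add: s4_def)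
  have "ct xs \<omega> w w' powers s = ct xs \<omega> w w' (pow2 rS rB) s + 3 * w + ct xs \<omega> w w' (pow2 rCnt rt1) s2 + 3 * w +
      ct xs \<omega> w w' (pow2 rSq rt1) s4"
    by (simp add: powers_def s4_def s3_def s2_def s1_def big_def)
  also have "\<dots> \<le> 5 * (w * cbits n + w) + 3 * w + 5 * (w * esize n W + w) + 3 * w + 5 * (w * ?k + w)"
    by (intro add_mono pow2_cost s(3) f2(1) f4) (auto simp: big_def)
  also have "\<dots> \<le> 30 * w + 5 * w * (cbits n + 2 * esize n W)"
  proof -
    have "w * ?k \<le> w * esize n W" by (intro mult_left_mono) (auto simp: esize_def cbits_def)
    then show ?thesis by (simp add: distrib_left)
  qed
  finally show ?thesis .
qed

text \<open>Separates the roughly \<open>n\<close> primes that pay for trials from the roughly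
  \<open>n^2\<close> candidates that pay only for the tests.\<close>

lemma sum_active: "(\<Sum>k<N. if active S B k then P else 0) = ks S B N * (P :: nat)"
  by (induction N) (auto simp: ks_Suc)

context det_program
begin

text \<open>The outer branch requires the modulus to be within the bound and the inner one
  primality. Together they are \<open>active\<close>, so only used primes are charged for
  \<open>prime_body\<close>.\<close>

lemma candidate_cost:
  assumes e: "main_env b T PM SQ B s" and inv: "main_inv b T S B j s"
    and q: "1 < int (S + j + 1)" "int (S + j + 1) \<le> int SQ * int SQ" "int (S + j + 1) \<le> X" "int SQ + 2 \<le> X"
    and P: "PM \<ge> 1" "b \<ge> 1"
  shows "ct xs \<omega> w w' candidate s \<le> 3 * w + 4 * w' + 50 * (w * SQ + w) +
    (if active S B j then 1010 * (T * (w * (n * b) + w * (n * n) + w * (n * m) + w * PM)) + 100 * (w * PM + w') else 0)"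
proof -
  let ?c = "Op rQ Plus (Reg rQ) (Const 1) ;; Op rBig Minus (Reg rBnd) (Reg rM) ;; Op rBig Plus (Reg rBig) (Const 1)"
  let ?g = "env n m b PM SQ T"
  define s1 where "s1 = EV ?c s"
  define s2 where "s2 = EV prime_test s1"
  have f1: "regs s1 rQ = int (S + j + 1)" "regs s1 rBig = B - Ms S B j + 1" "main_env b T PM SQ B s1"
    using e inv by (auto simp: s1_def main_env_def main_inv_def)
  have sq: "regs s1 rSq = int SQ" using f1(3) by (simp add: main_env_def)
  have pr: "regs s2 rPr = (if prime (int (S + j + 1)) then 1 else 0)"
    using prime_test_spec[OF f1(1) sq q] by (simp add: s2_def)
  have e2: "main_env b T PM SQ B s2" using f1(3) by (simp add: s2_def main_env_def ev_regs)
  have t: "ct xs \<omega> w w' prime_test s1 \<le> 50 * (w * SQ + w)"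
  proof -
    have "ct xs \<omega> w w' prime_test s1 \<le> cb ?g w w' prime_test"
      using sq by (intro ct_le_cb) (auto simp: env_def)
    then show ?thesis using cb_prime_test le_trans by blast
  qed
  have p: "ct xs \<omega> w w' prime_body s2 \<le> 1010 * (T * (w * (n * b) + w * (n * n) + w * (n * m) + w * PM)) + 100 * (w * PM + w')"
  proof -
    have "ct xs \<omega> w w' prime_body s2 \<le> cb ?g w w' prime_body"
      using e2 by (intro ct_le_cb) (auto simp: env_def main_env_def)
    then show ?thesis using cb_prime_body[OF n P] le_trans by blast
  qed
  have "ct xs \<omega> w w' candidate s = w + 2 * w' + 2 * w' +
      (if regs s1 rBig > 0 then ct xs \<omega> w w' prime_test s1 + 2 * w +
        (if regs s2 rPr > 0 then ct xs \<omega> w w' prime_body s2 else 0) else 0)"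
    by (simp add: candidate_def s2_def s1_def big_def)
  moreover have "active S B j" if "regs s1 rBig > 0" "regs s2 rPr > 0"
    using that f1(2) pr by (auto simp: active_def split: if_splits)
  ultimately show ?thesis using t p by auto
qed

end

context det_run
begin

definition prime_cost :: "nat \<Rightarrow> nat \<Rightarrow> nat" where
  "prime_cost w w' = 1010 * (lb W * (c + 3) * (w * (n * cbits n) + w * (n * n) + w * (n * m) + w * (4 * ncand n W))) +
     100 * (w * (4 * ncand n W) + w')"

lemma det_com_cost:
  assumes w: "w \<le> w'"
  shows "ct xs \<omega> w w' (det_com c) start \<le> 100 * w + 20 * (w * m) + 4 * w * (lb W + lb n + lb (lb W)) +
    5 * w * (cbits n + 2 * esize n W) + 10 * (w' * n) + 20 * w' +
    ncand n W * (7 * w + 4 * w' + 50 * (w * rsize n W + w)) + (n * lb W + 1) * prime_cost w w'"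
proof -
  let ?s = "EV (prepare c) start" and ?B = "2 * int W ^ n" and ?b = "cbits n" and ?N = "ncand n W"
  let ?T = "lb W * (c + 3)" and ?S = "2 ^ cbits n :: nat" and ?R = "rsize n W"
  define s1 where "s1 = EV (Inp rN (Const 0) ;; Inp rNz (Const 1)) start"
  define s2 where "s2 = EV max_entry s1"
  define s3 where "s3 = EV (sizes c) s2"
  define s4 where "s4 = EV powers s3"
  have f1: "regs s1 rN = int n" "regs s1 rNz = int m" "regs s1 rU = 0"
    using head by (auto simp: s1_def start_def)
  have f2: "regs s2 rN = int n" "regs s2 rU = int (max_abs ent m)"
    using f1 max_entry_spec[OF f1(2,3)] by (auto simp: s2_def ev_regs)
  have f3: "regs s3 rN = int n" "regs s3 rLn = int (lb n)" "regs s3 rLL = int (lb (lb W))" "regs s3 rB = int ?b"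
    using f2 sizes_spec[OF f2 W W_X(1-3) sizes_X(2)] unfolding Let_def by (auto simp: s3_def ev_regs)
  have f4: "regs s4 rN = int n" using f3 by (simp add: s4_def ev_regs)
  have "ct xs \<omega> w w' (prepare c) start = 2 * w + ct xs \<omega> w w' max_entry s1 + ct xs \<omega> w w' (sizes c) s2 +
      ct xs \<omega> w w' powers s3 + ct xs \<omega> w w' bound s4"
    by (simp add: prepare_def s4_def s3_def s2_def s1_def)
  also have "\<dots> \<le> 2 * w + 20 * (w * m + w) + (30 * w + 4 * w * (lb W + lb n + lb (lb W))) +
      (30 * w + 5 * w * (?b + 2 * esize n W)) + 10 * (w' * n + w')"
    using sizes_cost[OF f2] unfolding W[symmetric]
    by (intro add_mono max_entry_cost powers_cost bound_cost f1 f3 f4 w) auto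
  finally have prep: "ct xs \<omega> w w' (prepare c) start \<le> 82 * w + 20 * (w * m) + 4 * w * (lb W + lb n + lb (lb W)) +
      5 * w * (?b + 2 * esize n W) + 10 * (w' * n) + 10 * w'" by simp
  note S = prepare_spec
  let ?f = "\<lambda>j. 3 * w + 4 * w' + 50 * (w * ?R + w) + (if active ?S ?B j then prime_cost w w' else 0)"
  have "ct xs \<omega> w w' (For ri0 rCnt candidate) ?s \<le> 3 * w + (\<Sum>j<?N. 4 * w + ?f j)"
  proof (rule For_cost[where Inv = "main_inv ?b ?T ?S ?B"])
    fix j s' assume j: "j < ?N" and sm: "same (For ri0 rCnt candidate) ?s s'" and iv: "main_inv ?b ?T ?S ?B j s'"
    have e: "main_env ?b ?T (4 * ?N) ?R ?B s'"
      using S sameD(1)[OF sm] by (simp add: main_env_def)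
    have q0: "?S + j + 1 \<le> 4 * ?N" using j sizes_X(4) by linarith
    have q: "int (?S + j + 1) \<le> int ?R * int ?R"
      using q0 unfolding rsize_sq by (metis of_nat_le_iff of_nat_mult)
    have qX: "int (?S + j + 1) \<le> X" using q0 sizes_X(1) by linarith
    have S1: "1 \<le> ?S" by simp
    have q1: "1 < int (?S + j + 1)" using S1 by linarith
    have N1: "1 \<le> 4 * ?N" using q0 by linarith
    have "ct xs \<omega> w w' candidate s' \<le> ?f j"
      using candidate_cost[OF e iv q1 q qX sizes_X(3) N1, of w w'] unfolding prime_cost_def by (simp add: cbits_def)
    moreover have "main_inv ?b ?T ?S ?B (Suc j) (EV candidate s')"
      using candidate_spec[OF e iv j refl sizes_X(4) rsize_sq W_X(4) sizes_X(3) _ W_Y] by simp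
    ultimately show "ct xs \<omega> w w' candidate s' \<le> ?f j \<and> main_inv ?b ?T ?S ?B (Suc j) (EV candidate s')" by blast
  qed (use S in \<open>auto simp: main_inv_def\<close>)
  also have "(\<Sum>j<?N. 4 * w + ?f j) = ?N * (7 * w + 4 * w' + 50 * (w * ?R + w)) + ks ?S ?B ?N * prime_cost w w'"
    unfolding sum.distrib sum_active by (simp add: algebra_simps)
  also have "ks ?S ?B ?N * prime_cost w w' \<le> (n * lb W + 1) * prime_cost w w'"
  proof (rule mult_right_mono)
    have "?B < 2 ^ (n * lb W + 1)"
    proof (cases "W = 0")
      case True
      then have "?B = 0" using n by simp
      moreover have "0 < (2::int) ^ (n * lb W + 1)" by (rule zero_less_power) simp
      ultimately show ?thesis by linarith
    next
      case False
      then have "W = 0 \<or> n \<le> W" "W \<ge> 1" using W by auto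
      then show ?thesis using moduli_suffice(2) n by blast
    qed
    then show "ks ?S ?B ?N \<le> n * lb W + 1" by (rule ks_bound)
  qed simp
  finally have loop: "ct xs \<omega> w w' (For ri0 rCnt candidate) ?s \<le>
      3 * w + (?N * (7 * w + 4 * w' + 50 * (w * ?R + w)) + (n * lb W + 1) * prime_cost w w')" by simp
  have "ct xs \<omega> w w' center (EV (For ri0 rCnt candidate) ?s) \<le> 5 * w'" by (simp add: center_def big_def)
  then show ?thesis unfolding det_com_prepare(3) using prep loop w by linarith
qed

end

text \<open>Here \<open>l\<close> stands for the logarithm. The exponent 6 comes from about
  \<open>n l\<close> primes, \<open>t l\<close> trials for each, and \<open>n (m + n) l^4\<close>
  per trial, where \<open>w * P\<close> contributes \<open>l^2\<close> twice. The candidate tests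
  need only \<open>n^3 l^5\<close>. Powers of two are rounded up generously.\<close>

lemma total_cost:
  fixes n m l a t w w' L Ln LL b E T P N R :: nat
  assumes n: "n \<ge> 1" and l: "l \<ge> 1" and t: "t \<ge> 1" and a: "a \<ge> 1"
    and w: "w \<le> a * l ^ 2" "w' \<le> a * (n * l ^ 2)"
    and L: "L \<le> l" "Ln \<le> l" "LL \<le> l" "b \<le> 8 * l" "E \<le> 16 * l" "T \<le> t * l"
    and P: "P \<le> 2 ^ 18 * (n * n * l ^ 2)" "N \<le> P" "R \<le> 2 ^ 9 * (n * l)"
  shows "100 * w + 20 * (w * m) + 4 * w * (L + Ln + LL) + 5 * w * (b + 2 * E) + 10 * (w' * n) + 20 * w' +
    N * (7 * w + 4 * w' + 50 * (w * R + w)) +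
    (n * L + 1) * (1010 * (T * (w * (n * b) + w * (n * n) + w * (n * m) + w * P)) + 100 * (w * P + w'))
    \<le> 2 ^ 45 * (a * t) * (n * n * (m + n) * l ^ 6)"
proof -
  let ?Q = "n * n * (m + n) * l ^ 6"
  have mon: "x * l ^ k \<le> y * l ^ j" if "x \<le> y" "k \<le> j" for x y k j :: nat
    using that l by (intro mult_le_mono power_increasing) auto
  have nn: "n \<le> n * (m + n)" "n * n \<le> n * (m + n)" "n * m \<le> n * (m + n)" using n by auto
  have at: "a \<le> a * t" "1 \<le> a * t" using a t by auto
  have wP: "w * P \<le> 2 ^ 18 * (a * (n * (m + n) * l ^ 4))"
  proof -
    have "w * P \<le> (a * l ^ 2) * (2 ^ 18 * (n * n * l ^ 2))" by (intro mult_le_mono w P)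
    also have "\<dots> = 2 ^ 18 * (a * (n * n * l ^ 4))" by (simp add: algebra_simps power_add[symmetric])
    also have "\<dots> \<le> 2 ^ 18 * (a * (n * (m + n) * l ^ 4))" using nn by (intro mult_le_mono) auto
    finally show ?thesis .
  qed
  have w1: "w' \<le> a * (n * (m + n) * l ^ 4)"
  proof -
    have "n * l ^ 2 \<le> n * (m + n) * l ^ 4" using nn by (intro mon) auto
    then have "a * (n * l ^ 2) \<le> a * (n * (m + n) * l ^ 4)" by (rule mult_le_mono2)
    then show ?thesis using w(2) by linarith
  qed
  have w4: "w * x \<le> a * (x * l ^ 2)" for x
  proof -
    have "w * x \<le> (a * l ^ 2) * x" by (intro mult_le_mono w order_refl)
    then show ?thesis by (simp only: mult_ac)
  qed
  have i1: "w * (n * b) \<le> 8 * (a * (n * (m + n) * l ^ 4))"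
  proof -
    have "w * (n * b) \<le> (a * l ^ 2) * (n * (8 * l))" by (intro mult_le_mono w L order_refl)
    also have "\<dots> = 8 * (a * (n * l ^ 3))" by (simp add: algebra_simps power2_eq_square power3_eq_cube)
    also have "\<dots> \<le> 8 * (a * (n * (m + n) * l ^ 4))" using nn by (intro mult_le_mono2 mon) auto
    finally show ?thesis .
  qed
  have i2: "w * (n * n) \<le> a * (n * (m + n) * l ^ 4)"
  proof -
    have "a * (n * n * l ^ 2) \<le> a * (n * (m + n) * l ^ 4)" using nn by (intro mult_le_mono2 mon) auto
    then show ?thesis using w4[of "n * n"] by linarith
  qed
  have i3: "w * (n * m) \<le> a * (n * (m + n) * l ^ 4)"
  proof -
    have "a * (n * m * l ^ 2) \<le> a * (n * (m + n) * l ^ 4)" using nn by (intro mult_le_mono2 mon) auto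
    then show ?thesis using w4[of "n * m"] by linarith
  qed
  define Z where "Z = a * (n * (m + n) * l ^ 4)"
  have "T * (w * (n * b) + w * (n * n) + w * (n * m) + w * P) \<le> (t * l) * ((10 + 2 ^ 18) * Z)"
    using i1 i2 i3 wP unfolding Z_def[symmetric] by (intro mult_le_mono L) simp
  moreover have "w * P + w' \<le> (t * l) * ((1 + 2 ^ 18) * Z)"
  proof -
    have "1 * ((1 + 2 ^ 18) * Z) \<le> (t * l) * ((1 + 2 ^ 18) * Z)" using t l by (intro mult_le_mono1) simp
    moreover have "w * P + w' \<le> (1 + 2 ^ 18) * Z" using wP w1 unfolding Z_def[symmetric] by simp
    ultimately show ?thesis by linarith
  qed
  ultimately have body: "1010 * (T * (w * (n * b) + w * (n * n) + w * (n * m) + w * P)) + 100 * (w * P + w') \<le> 2 ^ 29 * (t * l * Z)"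
    by (simp add: algebra_simps)
  have nL: "n * L + 1 \<le> 2 * (n * l)"
  proof -
    have "n * L \<le> n * l" "1 \<le> n * l" using L n l by auto
    then show ?thesis by linarith
  qed
  have Q1: "(n * L + 1) * (1010 * (T * (w * (n * b) + w * (n * n) + w * (n * m) + w * P)) + 100 * (w * P + w'))
      \<le> 2 ^ 30 * ((a * t) * ?Q)"
  proof -
    have "(n * L + 1) * (1010 * (T * (w * (n * b) + w * (n * n) + w * (n * m) + w * P)) + 100 * (w * P + w'))
        \<le> (2 * (n * l)) * (2 ^ 29 * (t * l * Z))" by (intro mult_le_mono nL body)
    also have "\<dots> = 2 ^ 30 * ((a * t) * (n * n * (m + n) * (l * l * l ^ 4)))" unfolding Z_def by (simp only: mult_ac) simp
    also have "l * l * l ^ 4 = l ^ 6" by (simp add: eval_nat_numeral)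
    finally show ?thesis .
  qed
  have q: "x * l ^ k \<le> ?Q" if "x \<le> n * n * (m + n)" "k \<le> 6" for x k
    using that by (rule mon)
  have n3: "n * n * n \<le> n * n * (m + n)" "n * n \<le> n * n * (m + n)" "n \<le> n * n * (m + n)" "1 \<le> n * n * (m + n)" "m \<le> n * n * (m + n)"
  proof -
    have "1 * 1 \<le> n * n" using n by (intro mult_le_mono) auto
    then have nn: "1 \<le> n * n" by simp
    show "n * n * n \<le> n * n * (m + n)" "n * n \<le> n * n * (m + n)" using n by auto
    have "1 * (m + n) \<le> n * n * (m + n)" using nn by (intro mult_le_mono1)
    then have "m + n \<le> n * n * (m + n)" by simp
    then show "n \<le> n * n * (m + n)" "m \<le> n * n * (m + n)" "1 \<le> n * n * (m + n)"
      using n add_leD1 add_leD2 le_trans by blast+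
  qed
  have aq: "a * y \<le> (a * t) * ?Q" if "y \<le> ?Q" for y using that at by (intro mult_le_mono) auto
  have Q2: "N * (7 * w + 4 * w' + 50 * (w * R + w)) \<le> 2 ^ 40 * ((a * t) * ?Q)"
  proof -
    have 1: "w * R \<le> 2 ^ 9 * (a * (n * l ^ 3))"
    proof -
      have "w * R \<le> (a * l ^ 2) * (2 ^ 9 * (n * l))" by (intro mult_le_mono w P)
      also have "\<dots> = 2 ^ 9 * (a * (n * l ^ 3))" by (simp add: algebra_simps power2_eq_square power3_eq_cube)
      finally show ?thesis .
    qed
    have "1 * l ^ 2 \<le> n * l ^ 3" using n by (intro mon) auto
    then have "a * l ^ 2 \<le> a * (n * l ^ 3)" by simp
    then have 2: "w \<le> a * (n * l ^ 3)" using w(1) by linarith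
    have "n * l ^ 2 \<le> n * l ^ 3" by (intro mon) auto
    then have "a * (n * l ^ 2) \<le> a * (n * l ^ 3)" by (rule mult_le_mono2)
    then have 3: "w' \<le> a * (n * l ^ 3)" using w(2) by linarith
    have "7 * w + 4 * w' + 50 * (w * R + w) \<le> 2 ^ 15 * (a * (n * l ^ 3))" using 1 2 3 by (simp add: distrib_left)
    then have "N * (7 * w + 4 * w' + 50 * (w * R + w)) \<le> (2 ^ 18 * (n * n * l ^ 2)) * (2 ^ 15 * (a * (n * l ^ 3)))"
      using P by (intro mult_le_mono) auto
    also have "\<dots> = 2 ^ 33 * (a * (n * n * n * l ^ 5))" by (simp add: algebra_simps power_add[symmetric])
    also have "\<dots> \<le> 2 ^ 33 * ((a * t) * ?Q)" using n3 by (intro mult_le_mono2 aq q) auto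
    finally show ?thesis by (rule le_trans) simp
  qed
  have l2: "a * (x * l ^ 2) \<le> (a * t) * ?Q" if "x \<le> n * n * (m + n)" for x
    using that by (intro aq q) auto
  have r1: "w \<le> (a * t) * ?Q" using w(1) l2[OF n3(4)] unfolding mult_1 by (rule le_trans)
  have r2: "w * m \<le> (a * t) * ?Q" using w4[of m] l2[OF n3(5)] by (rule le_trans)
  have r3: "w * (L + Ln + LL) \<le> 3 * ((a * t) * ?Q)"
  proof -
    have "w * (L + Ln + LL) \<le> (a * l ^ 2) * (3 * l)" using L by (intro mult_le_mono w) auto
    also have "\<dots> = 3 * (a * (1 * l ^ 3))" by (simp add: algebra_simps power2_eq_square power3_eq_cube)
    also have "\<dots> \<le> 3 * ((a * t) * ?Q)" using n3 by (intro mult_le_mono2 aq q) auto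
    finally show ?thesis .
  qed
  have r4: "w * (b + 2 * E) \<le> 40 * ((a * t) * ?Q)"
  proof -
    have "w * (b + 2 * E) \<le> (a * l ^ 2) * (40 * l)" using L by (intro mult_le_mono w) auto
    also have "\<dots> = 40 * (a * (1 * l ^ 3))" by (simp add: algebra_simps power2_eq_square power3_eq_cube)
    also have "\<dots> \<le> 40 * ((a * t) * ?Q)" using n3 by (intro mult_le_mono2 aq q) auto
    finally show ?thesis .
  qed
  have r5: "w' * n \<le> (a * t) * ?Q"
  proof -
    have "w' * n \<le> (a * (n * l ^ 2)) * n" using w(2) by simp
    also have "\<dots> = a * (n * n * l ^ 2)" by simp
    also have "\<dots> \<le> (a * t) * ?Q" using n3 by (intro aq q) auto
    finally show ?thesis .
  qed
  have r6: "w' \<le> (a * t) * ?Q" using w(2) l2[OF n3(3)] by (rule le_trans)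
  have fin: "100 * w + 20 * x2 + 4 * x3 + 5 * x4 + 10 * x5 + 20 * w' + y2 + y1 \<le> 2 ^ 45 * q"
    if "y1 \<le> 2 ^ 30 * q" "y2 \<le> 2 ^ 40 * q" "w \<le> q" "x2 \<le> q" "x3 \<le> 3 * q" "x4 \<le> 40 * q" "x5 \<le> q" "w' \<le> q"
    for x2 x3 x4 x5 y1 y2 q :: nat
    using that by simp
  have "4 * w * (L + Ln + LL) = 4 * (w * (L + Ln + LL))" "5 * w * (b + 2 * E) = 5 * (w * (b + 2 * E))"
    "2 ^ 45 * (a * t) * ?Q = 2 ^ 45 * ((a * t) * ?Q)" by (simp_all only: mult.assoc)
  then show ?thesis using fin[OF Q1 Q2 r1 r2 r3 r4 r5 r6] by (simp only:)
qed

section \<open>Sizes\<close>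

lemma nbits_less_power: "0 \<le> x \<Longrightarrow> x < 2 ^ k \<Longrightarrow> nbits x \<le> k + 1"
  using bitlen_le_iff_power[of x "int k"] by (simp add: nbits_def)

text \<open>Rounding to powers of two loses a factor 2 for \<open>n\<close> and for the logarithm.
  Each occurs squared in \<open>4 * ncand\<close>, so \<open>2^14\<close> becomes
  \<open>2^18\<close>.\<close>

lemma ncand_rsize_bound:
  assumes n: "n \<ge> 1" and W: "W \<le> V" and V: "V \<ge> 1"
  shows "4 * ncand n W \<le> 2 ^ 18 * (n * n * lb V ^ 2)" "rsize n W \<le> 2 ^ 9 * (n * lb V)"
proof -
  let ?l = "lb V" and ?a = "2 ^ lb (lb W) :: nat" and ?b = "2 ^ lb n :: nat"
  have l1: "1 \<le> ?l" using lb_pos V by simp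
  have a: "?a \<le> 2 * ?l"
  proof (cases "lb W = 0")
    case True
    then show ?thesis using l1 by (simp add: lb_def)
  next
    case False
    then have "?a \<le> 2 * lb W" by (intro lb_le) simp
    then show ?thesis using lb_mono[OF W] by linarith
  qed
  have b: "?b \<le> 2 * n" using lb_le n by simp
  have "esize n W + 2 = 14 + ((lb (lb W) + lb (lb W)) + (lb n + lb n))" by (simp add: esize_def cbits_def)
  then have "(2::nat) ^ (esize n W + 2) = 2 ^ 14 * ((?a * ?a) * (?b * ?b))" by (simp only: power_add)
  then have "4 * ncand n W = 2 ^ 14 * ((?a * ?a) * (?b * ?b))" by (simp add: ncand_def)
  also have "\<dots> \<le> 2 ^ 14 * (((2 * ?l) * (2 * ?l)) * ((2 * n) * (2 * n)))" by (intro mult_le_mono a b order_refl)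
  also have "\<dots> = 2 ^ 18 * (n * n * ?l ^ 2)" by (simp add: power2_eq_square)
  finally show "4 * ncand n W \<le> 2 ^ 18 * (n * n * lb V ^ 2)" .
  have "rsize n W = 2 ^ 7 * (?a * ?b)" by (simp add: rsize_def power_add)
  also have "\<dots> \<le> 2 ^ 7 * ((2 * ?l) * (2 * n))" by (intro mult_le_mono a b order_refl)
  finally show "rsize n W \<le> 2 ^ 9 * (n * lb V)" by (simp add: mult.commute)
qed

text \<open>The largest short quantity is \<open>4 PM^2\<close> with
  \<open>PM \<le> 2^18 V^4\<close>, giving \<open>2^38 V^8\<close>. With the determinant bound
  included, \<open>large_bound\<close> has to cover \<open>6 * 2^36 V^(n + 8)\<close>. Both fit
  under \<open>2^39\<close>; the summand \<open>c\<close> absorbs the number of trials.\<close>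

definition small_bound :: "nat \<Rightarrow> nat \<Rightarrow> int" where
  "small_bound c V = (2 ^ 39 + int c) * int V ^ 8"

definition large_bound :: "nat \<Rightarrow> nat \<Rightarrow> nat \<Rightarrow> int" where
  "large_bound c n V = (2 ^ 39 + int c) * int V ^ (n + 8)"

lemma small_large: "V \<ge> 1 \<Longrightarrow> small_bound c V \<le> large_bound c n V"
  unfolding small_bound_def large_bound_def by (intro mult_left_mono power_increasing) auto

lemma small_bound_ge:
  assumes "V \<ge> 1" "k \<le> 8" "x \<le> (2 ^ 39 + int c) * int V ^ k"
  shows "x \<le> small_bound c V"
proof -
  have "(2 ^ 39 + int c) * int V ^ k \<le> small_bound c V"
    unfolding small_bound_def using assms by (intro mult_left_mono power_increasing) auto
  then show ?thesis using assms(3) by linarith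
qed

lemma product_bounds:
  fixes p v w c :: int
  assumes p: "0 \<le> p" "p \<le> 2 ^ 18 * v ^ 4" and v: "1 \<le> v" and c: "0 \<le> c" and w: "0 \<le> w" "w \<le> v ^ n"
  shows "4 * p * p \<le> (2 ^ 39 + c) * v ^ 8" "2 * ((2 * w + 1) * p) * p \<le> (2 ^ 39 + c) * v ^ (n + 8)"
proof -
  have "p * p \<le> (2 ^ 18 * v ^ 4) * (2 ^ 18 * v ^ 4)" using p by (intro mult_mono) auto
  also have "\<dots> = 2 ^ 36 * (v ^ 4 * v ^ 4)" by simp
  also have "v ^ 4 * v ^ 4 = v ^ 8" unfolding power_add[symmetric] by simp
  finally have pp: "p * p \<le> 2 ^ 36 * v ^ 8" .
  have vp: "0 \<le> v ^ k" "1 \<le> v ^ k" for k using v by auto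
  have "4 * (p * p) \<le> 4 * (2 ^ 36 * v ^ 8)" using pp by (rule mult_left_mono) simp
  also have "\<dots> = (4 * 2 ^ 36) * v ^ 8" by (rule mult.assoc[symmetric])
  also have "\<dots> \<le> (2 ^ 39 + c) * v ^ 8" using c vp(1) by (intro mult_right_mono) auto
  finally show "4 * p * p \<le> (2 ^ 39 + c) * v ^ 8" by (simp only: mult.assoc)
  have "2 * w + 1 \<le> 3 * v ^ n" using w(2) vp(2)[of n] by linarith
  then have "(2 * w + 1) * (p * p) \<le> (3 * v ^ n) * (2 ^ 36 * v ^ 8)"
    using w(1) p(1) vp(1)[of n] by (intro mult_mono[OF _ pp]) auto
  then have "2 * ((2 * w + 1) * (p * p)) \<le> 2 * ((3 * v ^ n) * (2 ^ 36 * v ^ 8))" by (rule mult_left_mono) simp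
  also have "\<dots> = (2 * 3 * 2 ^ 36) * (v ^ n * v ^ 8)" by (simp only: mult_ac)
  also have "\<dots> \<le> (2 ^ 39 + c) * (v ^ n * v ^ 8)" using c vp(1) by (intro mult_right_mono mult_nonneg_nonneg) auto
  finally show "2 * ((2 * w + 1) * p) * p \<le> (2 ^ 39 + c) * v ^ (n + 8)" by (simp only: mult.assoc power_add)
qed

lemma sizes_small:
  assumes n: "n \<ge> 1" "n \<le> V" and m: "m \<le> n * n" and W: "W \<le> V"
  shows "64 + 16 * int (2 * n + 1 + 1) \<le> small_bound c V" "3 * int m + 4 \<le> small_bound c V"
    "int V \<le> small_bound c V" "int (lb W * (c + 3)) \<le> small_bound c V" "int c + 3 \<le> small_bound c V"
    "4 * int (4 * ncand n W) * int (4 * ncand n W) \<le> small_bound c V"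
    "2 * ((2 * int W ^ n + 1) * int (4 * ncand n W)) * int (4 * ncand n W) \<le> large_bound c n V"
proof -
  have V: "V \<ge> 1" using n by simp
  have V0: "1 \<le> int V" using V by simp
  have cV: "(2 ^ 39 + int c) * int V ^ 1 = 2 ^ 39 * int V + int c * int V" "0 \<le> int c * int V"
    by (simp_all add: distrib_right)
  have nV: "int n \<le> int V" using n by simp
  have "64 + 16 * int (2 * n + 1 + 1) \<le> 2 ^ 39 * int V + int c * int V" "int V \<le> 2 ^ 39 * int V + int c * int V"
  proof -
    have "96 + 32 * int n \<le> 549755813888 * int V + int c * int V" "int V \<le> 549755813888 * int V + int c * int V"
      using nV V0 cV(2) by linarith+
    then show "64 + 16 * int (2 * n + 1 + 1) \<le> 2 ^ 39 * int V + int c * int V" "int V \<le> 2 ^ 39 * int V + int c * int V"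
      by simp_all
  qed
  then show "64 + 16 * int (2 * n + 1 + 1) \<le> small_bound c V" "int V \<le> small_bound c V"
    using small_bound_ge[OF V, of 1] cV(1) by simp_all
  show "int c + 3 \<le> small_bound c V"
    by (rule small_bound_ge[OF V, of 0]) simp_all
  show "3 * int m + 4 \<le> small_bound c V"
  proof (rule small_bound_ge[OF V, of 2])
    have "n * n \<le> V * V" using n by (intro mult_le_mono) auto
    then have "int m \<le> int V ^ 2" using m by (metis le_trans of_nat_le_iff of_nat_power power2_eq_square)
    moreover have "1 \<le> int V ^ 2" using V0 by simp
    moreover have "0 \<le> int c * int V ^ 2" by simp
    ultimately have "3 * int m + 4 \<le> 549755813888 * int V ^ 2 + int c * int V ^ 2" by linarith
    then show "3 * int m + 4 \<le> (2 ^ 39 + int c) * int V ^ 2" by (simp add: distrib_right)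
  qed simp
  have "lb W \<le> V" using lb_le_self[of W] W by linarith
  then have "lb W * (c + 3) \<le> V * (c + 3)" by (rule mult_le_mono1)
  then have lT: "int (lb W * (c + 3)) \<le> int (V * (c + 3))" by (simp only: of_nat_le_iff)
  show "int (lb W * (c + 3)) \<le> small_bound c V"
  proof (rule small_bound_ge[OF V, of 1])
    have "int (V * (c + 3)) \<le> (2 ^ 39 + int c) * int V ^ 1" by (simp add: distrib_left distrib_right mult.commute)
    then show "int (lb W * (c + 3)) \<le> (2 ^ 39 + int c) * int V ^ 1" using lT by linarith
  qed simp
  let ?P = "int (4 * ncand n W)"
  have P: "?P \<le> 2 ^ 18 * int V ^ 4"
  proof -
    have "n * n * lb V ^ 2 \<le> V * V * V ^ 2" using n lb_le_self[of V] by (intro mult_le_mono power_mono) auto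
    then have "2 ^ 18 * (n * n * lb V ^ 2) \<le> 2 ^ 18 * (V * V * V ^ 2)" by (rule mult_le_mono2)
    moreover have "V * V * V ^ 2 = V ^ 4" by (simp add: power2_eq_square power4_eq_xxxx)
    ultimately have "4 * ncand n W \<le> 2 ^ 18 * V ^ 4"
      using ncand_rsize_bound(1)[OF n(1) W V] by (simp only: le_trans)
    then have "?P \<le> int (2 ^ 18 * V ^ 4)" by (simp only: of_nat_le_iff)
    then show ?thesis by simp
  qed
  have P0: "0 \<le> ?P" by simp
  have WV: "0 \<le> int W ^ n" "int W ^ n \<le> int V ^ n" using W by (auto intro: power_mono)
  show "4 * ?P * ?P \<le> small_bound c V" "2 * ((2 * int W ^ n + 1) * ?P) * ?P \<le> large_bound c n V"
    unfolding small_bound_def large_bound_def using product_bounds[OF P0 P V0 _ WV] by auto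
qed

text \<open>The leading factor takes at most \<open>41 + c\<close> bits and each factor
  \<open>V\<close> takes \<open>lb V\<close>. In the long case 50 is
  \<open>41 + 8 + 1\<close>.\<close>

lemma nbits_bounds:
  assumes n: "n \<ge> 1" and V: "V \<ge> 1"
  shows "nbits (small_bound c V) \<le> (50 + c) * lb V" "nbits (large_bound c n V) \<le> (50 + c) * (n * lb V)"
proof -
  let ?l = "lb V"
  have l1: "1 \<le> ?l" using lb_pos V by simp
  have Vl: "int V < 2 ^ ?l" using lb_less[of V] by (metis of_nat_less_iff of_nat_numeral of_nat_power)
  have gen: "nbits ((2 ^ 39 + int c) * int V ^ k) \<le> 41 + c + k * ?l" for k
  proof -
    have "int c < 2 ^ c" by (metis less_exp of_nat_less_numeral_power_cancel_iff)
    moreover have "(1::int) \<le> 2 ^ c" by simp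
    ultimately have "549755813888 + int c < 1099511627776 * 2 ^ c" by linarith
    then have "2 ^ 39 + int c < 2 ^ 40 * 2 ^ c" by simp
    moreover have "int V ^ k \<le> (2 ^ ?l) ^ k" using Vl by (intro power_mono) auto
    moreover have "0 < int V ^ k" using V by simp
    ultimately have "(2 ^ 39 + int c) * int V ^ k < (2 ^ 40 * 2 ^ c) * (2 ^ ?l) ^ k"
      by (intro mult_less_le_imp_less) auto
    also have "\<dots> = 2 ^ (40 + c + k * ?l)" by (simp add: power_add power_mult[symmetric] mult.commute)
    finally have "nbits ((2 ^ 39 + int c) * int V ^ k) \<le> 40 + c + k * ?l + 1"
      by (intro nbits_less_power) auto
    then show ?thesis by simp
  qed
  have cl: "c \<le> c * ?l" "41 \<le> 41 * ?l" using l1 by auto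
  then show "nbits (small_bound c V) \<le> (50 + c) * ?l"
    using gen[of 8] unfolding small_bound_def add_mult_distrib by linarith
  have "?l \<le> n * ?l" "c * ?l \<le> c * (n * ?l)" using n by auto
  then show "nbits (large_bound c n V) \<le> (50 + c) * (n * ?l)"
    using gen[of "n + 8"] cl unfolding large_bound_def add_mult_distrib by linarith
qed

section \<open>Reading the input\<close>

lemma nth_concat_triples:
  assumes "k < length ps" "j < 3" "\<And>p. length (f p) = 3"
  shows "concat (map f ps) ! (3 * k + j) = f (ps ! k) ! j"
  using assms(1)
proof (induction ps arbitrary: k)
  case (Cons p ps)
  show ?case
  proof (cases k)
    case 0
    then show ?thesis using assms(2,3) by (simp add: nth_append)
  next
    case (Suc k')
    then have "k' < length ps" using Cons.prems by simp
    then show ?thesis using Suc Cons.IH[of k'] assms(3) by (simp add: nth_append)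
  qed
qed simp

lemma length_concat_triples:
  assumes "\<And>p. length (f p) = 3"
  shows "length (concat (map f ps)) = 3 * length ps"
  using assms by (induction ps) auto

text \<open>Distinctness of the list makes positions and nonzero entries correspond one to one, so a
  row sum can be reindexed by input positions.\<close>

lemma encoding:
  assumes n: "n \<ge> 1" and A: "A \<in> carrier_mat n n" and xs: "sparse_encoding A xs"
  obtains row col :: "nat \<Rightarrow> nat" and ent :: "nat \<Rightarrow> int" where
    "input_at xs 0 = int n" "input_at xs 1 = int (nnz A)"
    "\<And>k. k < nnz A \<Longrightarrow> input_at xs (3 * int k + 2) = int (row k) \<and> row k < n"
    "\<And>k. k < nnz A \<Longrightarrow> input_at xs (3 * int k + 3) = int (col k) \<and> col k < n"
    "\<And>k. k < nnz A \<Longrightarrow> input_at xs (3 * int k + 4) = ent k"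
    "\<And>i v. i < n \<Longrightarrow> (\<Sum>j<n. A $$ (i, j) * v j) = (\<Sum>k<nnz A. if row k = i then ent k * v (col k) else 0)"
    "\<And>k. k < nnz A \<Longrightarrow> \<exists>i<n. \<exists>j<n. ent k = A $$ (i, j)"
    "\<And>i j. i < n \<Longrightarrow> j < n \<Longrightarrow> A $$ (i, j) = 0 \<or> (\<exists>k<nnz A. A $$ (i, j) = ent k)"
    "nnz A \<le> n * n"
proof -
  obtain ps where ps: "distinct ps" "set ps = nonzeros A"
      and xs': "xs = [int (dim_row A), int (length ps)] @ concat (map (\<lambda>(i, j). [int i, int j, A $$ (i, j)]) ps)"
    using xs unfolding sparse_encoding_def by blast
  let ?f = "\<lambda>(i, j). [int i, int j, A $$ (i, j)]"
  have dims: "dim_row A = n" "dim_col A = n" using A by auto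
  have m: "nnz A = length ps" unfolding nnz_def ps(2)[symmetric] using distinct_card[OF ps(1)] by simp
  have len3: "length (?f p) = 3" for p by (cases p) simp
  have lenc: "length (concat (map ?f ps)) = 3 * length ps" by (rule length_concat_triples[OF len3])
  have inp: "input_at xs (3 * int k + (2 + int j)) = ?f (ps ! k) ! j" if "k < length ps" "j < 3" for k j
  proof -
    have "3 * int k + (2 + int j) = int (Suc (Suc (3 * k + j)))" by simp
    moreover have "Suc (Suc (3 * k + j)) < length xs" unfolding xs' using lenc that by simp
    then have "input_at xs (int (Suc (Suc (3 * k + j)))) = xs ! Suc (Suc (3 * k + j))"
      unfolding input_at_def by (simp only: nat_int of_nat_less_iff of_nat_0_le_iff if_True simp_thms)
    ultimately have "input_at xs (3 * int k + (2 + int j)) = xs ! Suc (Suc (3 * k + j))"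
      by (simp only:)
    also have "\<dots> = concat (map ?f ps) ! (3 * k + j)" unfolding xs' by simp
    finally show ?thesis using nth_concat_triples[OF that, of ?f] len3 by simp
  qed
  have mem: "fst (ps ! k) < n \<and> snd (ps ! k) < n" if "k < length ps" for k
  proof -
    have "ps ! k \<in> nonzeros A" using that ps(2) nth_mem by blast
    then show ?thesis by (auto simp: nonzeros_def dims)
  qed
  have sub: "nonzeros A \<subseteq> {..<n} \<times> {..<n}" by (auto simp: nonzeros_def dims)
  show thesis
  proof (rule that[of "\<lambda>k. fst (ps ! k)" "\<lambda>k. snd (ps ! k)" "\<lambda>k. A $$ (ps ! k)"])
    show "input_at xs 0 = int n" "input_at xs 1 = int (nnz A)"
      unfolding xs' m by (simp_all add: input_at_def dims)
    fix k assume k: "k < nnz A"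
    then have k': "k < length ps" by (simp add: m)
    obtain i j where ij: "ps ! k = (i, j)" by fastforce
    show "input_at xs (3 * int k + 2) = int (fst (ps ! k)) \<and> fst (ps ! k) < n"
      using inp[OF k', of 0] mem[OF k'] ij by simp
    show "input_at xs (3 * int k + 3) = int (snd (ps ! k)) \<and> snd (ps ! k) < n"
      using inp[OF k', of 1] mem[OF k'] ij by simp
    show "input_at xs (3 * int k + 4) = A $$ (ps ! k)"
      using inp[OF k', of 2] ij by (simp add: numeral_2_eq_2)
    show "\<exists>i<n. \<exists>j<n. A $$ (ps ! k) = A $$ (i, j)"
      using mem[OF k'] by (metis prod.collapse)
  next
    fix i :: nat and v :: "nat \<Rightarrow> int" assume i: "i < n"
    let ?g = "\<lambda>p. if fst p = i then A $$ p * v (snd p) else 0"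
    have "(\<Sum>k<nnz A. ?g (ps ! k)) = (\<Sum>p\<in>set ps. ?g p)"
      unfolding m using bij_betw_nth[OF ps(1) refl refl] by (rule sum.reindex_bij_betw)
    also have "\<dots> = (\<Sum>p\<in>{..<n} \<times> {..<n}. ?g p)"
      unfolding ps(2) by (rule sum.mono_neutral_left) (use sub in \<open>auto simp: nonzeros_def dims\<close>)
    also have "\<dots> = (\<Sum>a<n. \<Sum>b<n. ?g (a, b))"
      by (subst sum.cartesian_product) (auto intro!: sum.cong)
    also have "\<dots> = (\<Sum>a<n. if a = i then (\<Sum>b<n. A $$ (i, b) * v b) else 0)"
      by (intro sum.cong) auto
    also have "\<dots> = (\<Sum>b<n. A $$ (i, b) * v b)" using i by simp
    finally show "(\<Sum>j<n. A $$ (i, j) * v j) =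
      (\<Sum>k<nnz A. if fst (ps ! k) = i then A $$ (ps ! k) * v (snd (ps ! k)) else 0)" by simp
  next
    fix i j assume ij: "i < n" "j < n"
    show "A $$ (i, j) = 0 \<or> (\<exists>k<nnz A. A $$ (i, j) = A $$ (ps ! k))"
    proof (cases "A $$ (i, j) = 0")
      case False
      then have "(i, j) \<in> set ps" using ij by (simp add: ps(2) nonzeros_def dims)
      then obtain k where "k < length ps" "ps ! k = (i, j)" by (auto simp: in_set_conv_nth)
      then show ?thesis unfolding m by metis
    qed simp
  next
    have "card (nonzeros A) \<le> card ({..<n} \<times> {..<n})" using sub by (intro card_mono) auto
    then show "nnz A \<le> n * n" by (simp add: nnz_def)
  qed
qed

lemma detn_mat: "A \<in> carrier_mat n n \<Longrightarrow> detn n (\<lambda>i j. A $$ (i, j)) = Determinant.det A"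
  unfolding detn_def by (rule arg_cong[of _ _ Determinant.det]) auto

section \<open>The theorem\<close>

text \<open>A union bound over the used primes. The coins of each prime start at a position given by
  \<open>ks\<close>, hence fixed beforehand; a prime dividing the determinant contributes the empty
  event.\<close>

lemma failure_event:
  fixes c n W :: nat and A :: "nat \<Rightarrow> nat \<Rightarrow> int"
  assumes n: "n \<ge> 1"
  defines "b \<equiv> cbits n" and "T \<equiv> lb W * (c + 3)" and "S \<equiv> 2 ^ cbits n" and "B \<equiv> 2 * int W ^ n" and "N \<equiv> ncand n W"
  obtains bad where "bad \<in> sets coin_space" "measure coin_space bad \<le> real (ks S B N) * (1 / 2) ^ T"
    "\<And>\<omega> i. \<omega> \<notin> bad \<Longrightarrow> i < N \<Longrightarrow> active S B i \<Longrightarrow> prime_ok \<omega> n A b T (ks S B i * (T * (5 * n * b))) (int (S + i + 1))"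
proof -
  interpret prob_space coin_space by (rule prob_space_coin_space)
  define q where "q i = int (S + i + 1)" for i
  define E where "E i = (if q i dvd detn n A then {} else
    {\<omega>. \<forall>t<T. \<not> good_trial (q i) n A (\<lambda>j. draw \<omega> (ks S B i * (T * (5 * n * b))) b (t * (5 * n) + j))})" for i
  define J where "J = {i. i < N \<and> active S B i}"
  have fin: "finite J" by (simp add: J_def)
  have bb: "int (32 * n * n) \<le> 2 ^ b"
  proof -
    have "cbits n = lb n + lb n + 6" by (simp add: cbits_def)
    then have "(2::nat) ^ cbits n = 64 * (2 ^ lb n * 2 ^ lb n)" by (simp only: power_add) simp
    moreover have "n * n \<le> 2 ^ lb n * 2 ^ lb n" using lb_less[of n] by (intro mult_le_mono) auto
    ultimately have "32 * n * n \<le> 2 ^ cbits n" by linarith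
    then have "int (32 * n * n) \<le> int (2 ^ cbits n)" by (simp only: of_nat_le_iff)
    then show ?thesis by (simp add: b_def)
  qed
  have E: "E i \<in> sets coin_space \<and> measure coin_space (E i) \<le> (1 / 2) ^ T" if "i \<in> J" for i
  proof (cases "q i dvd detn n A")
    case False
    have "prime (q i)" using that by (simp add: J_def active_def q_def)
    moreover have "2 ^ b \<le> q i" by (simp add: q_def S_def b_def)
    ultimately show ?thesis using bad_trials_measure[OF _ n False _ bb] False unfolding E_def by simp
  qed (simp add: E_def)
  show thesis
  proof (rule that[of "\<Union>i\<in>J. E i"])
    show "(\<Union>i\<in>J. E i) \<in> sets coin_space" using E fin by (intro sets.finite_UN) auto
    have "measure coin_space (\<Union>i\<in>J. E i) \<le> (\<Sum>i\<in>J. measure coin_space (E i))"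
      using E fin by (intro finite_measure_subadditive_finite) auto
    also have "\<dots> \<le> (\<Sum>i\<in>J. (1 / 2) ^ T)" using E by (intro sum_mono) blast
    also have "\<dots> = real (ks S B N) * (1 / 2) ^ T" by (simp add: J_def ks_def)
    finally show "measure coin_space (\<Union>i\<in>J. E i) \<le> real (ks S B N) * (1 / 2) ^ T" .
    fix \<omega> i assume "\<omega> \<notin> (\<Union>i\<in>J. E i)" "i < N" "active S B i"
    then have "\<omega> \<notin> E i" by (auto simp: J_def)
    then show "prime_ok \<omega> n A b T (ks S B i * (T * (5 * n * b))) (int (S + i + 1))"
      by (auto simp: E_def prime_ok_def q_def split: if_splits)
  qed
qed

text \<open>Of the \<open>lb W * (c0 + 3)\<close> trials, \<open>3 * lb W\<close> outweigh the
  number of primes, which is at most \<open>2 ^ (3 * lb W)\<close>. The remaining ones give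
  \<open>n\<close> to the power \<open>- c0\<close>, because \<open>n < 2 ^ lb W\<close>.\<close>

lemma failure_small:
  fixes c :: real and c0 n W :: nat
  assumes n: "n \<ge> 1" and W: "W = 0 \<or> n \<le> W" and c: "c \<le> real c0"
  shows "real (ks S (2 * int W ^ n) N) * (1 / 2) ^ (lb W * (c0 + 3)) \<le> real n powr (- c)"
proof (cases "W = 0")
  \<comment> \<open>For the zero matrix the bound is 0, so no prime is ever used and nothing can
    fail.\<close>
  case True
  then have "2 * int W ^ n < 2 ^ 0" using n by (simp add: power_0_left)
  then have "ks S (2 * int W ^ n) N \<le> 0" by (rule ks_bound)
  then show ?thesis by simp
next
  case False
  then have W1: "W \<ge> 1" "n \<le> W" using W by auto
  let ?L = "lb W"
  have L: "n < 2 ^ ?L" "?L < 2 ^ ?L" "1 \<le> ?L" using lb_less[of W] W1 lb_pos by (auto intro: le_less_trans)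
  have "ks S (2 * int W ^ n) N \<le> n * ?L + 1" using ks_bound[OF moduli_suffice(2)[OF n W W1(1)]] .
  also have "\<dots> \<le> 2 ^ ?L * 2 ^ ?L + 2 ^ ?L * 2 ^ ?L"
    using L by (intro add_mono mult_le_mono) auto
  also have "\<dots> \<le> 2 ^ ?L * (2 ^ ?L * 2 ^ ?L)"
  proof -
    have "(2::nat) ^ 1 \<le> 2 ^ ?L" using L(3) by (intro power_increasing) auto
    then have "2 * (2 ^ ?L * 2 ^ ?L) \<le> 2 ^ ?L * (2 ^ ?L * (2 ^ ?L :: nat))" by (intro mult_le_mono1) simp
    then show ?thesis by (simp only: mult_2)
  qed
  finally have "real (ks S (2 * int W ^ n) N) \<le> real (2 ^ ?L * (2 ^ ?L * 2 ^ ?L))" by (simp only: of_nat_le_iff)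
  then have k: "real (ks S (2 * int W ^ n) N) \<le> 2 ^ (?L * 3)"
    by (simp add: power_mult power3_eq_cube)
  have "real (ks S (2 * int W ^ n) N) * (1 / 2) ^ (?L * (c0 + 3)) \<le> 2 ^ (?L * 3) * (1 / 2) ^ (?L * (c0 + 3))"
    using k by (intro mult_right_mono) auto
  also have "\<dots> = (1 / 2) ^ (?L * c0)"
    by (simp add: distrib_left power_add power_one_over)
  also have "\<dots> = 1 / (2 ^ ?L) ^ c0" by (simp add: power_mult power_one_over)
  also have "\<dots> \<le> 1 / real n ^ c0"
  proof -
    have "real n < real (2 ^ ?L)" using L(1) by (simp only: of_nat_less_iff)
    then have "real n ^ c0 \<le> (2 ^ ?L) ^ c0" by (intro power_mono) auto
    then show ?thesis using n by (intro divide_left_mono) auto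
  qed
  also have "\<dots> = real n powr (- real c0)" using n by (simp add: powr_minus powr_realpow divide_inverse)
  also have "\<dots> \<le> real n powr (- c)" using n c by (intro powr_mono) auto
  finally show ?thesis .
qed

text \<open>\<open>lb V\<close> exceeds the logarithm by at most 1, which doubling absorbs for
  \<open>V \<ge> 2\<close>. At \<open>V = 1\<close> the logarithm is 0, hence the guard in the final
  bounds.\<close>

lemma lb_le_log:
  assumes "V \<ge> 2"
  shows "real (lb V) \<le> 2 * log 2 (real V)"
proof -
  have V: "real V > 0" using assms by simp
  have "real (2 ^ lb V) \<le> real (2 * V)" using lb_le[of V] assms by (simp only: of_nat_le_iff)
  then have "2 powr real (lb V) \<le> 2 * real V" by (simp add: powr_realpow)
  then have "real (lb V) \<le> log 2 (2 * real V)" using V by (subst le_log_iff) auto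
  also have "\<dots> = 1 + log 2 (real V)" using V by (simp add: log_mult)
  also have "1 \<le> log 2 (real V)" using assms by (subst le_log_iff) auto
  finally show ?thesis by simp
qed

text \<open>\<open>W\<close> is chosen before \<open>\<omega>\<close>, so one failure event can be
  formed from it, whereas halting and the cost bounds hold for every
  \<open>\<omega>\<close>.\<close>

lemma det_com_run:
  fixes c n U :: nat and A :: "int mat"
  assumes n: "n \<ge> 1" and U: "U \<ge> 1" and A: "A \<in> carrier_mat n n"
    and AU: "\<forall>i<n. \<forall>j<n. A $$ (i, j) \<in> {- int U..int U}" and xs: "sparse_encoding A xs"
  obtains W where "W = 0 \<or> n \<le> W"
    "\<And>\<omega>. \<exists>t. halted (comp 0 (det_com c)) (run (comp 0 (det_com c)) xs \<omega> t) \<and>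
       ((\<forall>i<ncand n W. active (2 ^ cbits n) (2 * int W ^ n) i \<longrightarrow>
          prime_ok \<omega> n (\<lambda>i j. A $$ (i, j)) (cbits n) (lb W * (c + 3))
            (ks (2 ^ cbits n) (2 * int W ^ n) i * (lb W * (c + 3) * (5 * n * cbits n))) (int (2 ^ cbits n + i + 1))) \<longrightarrow>
        mem (run (comp 0 (det_com c)) xs \<omega> t) 0 = Determinant.det A) \<and>
       time_used (comp 0 (det_com c)) xs \<omega> t \<le> 2 ^ 45 * (12 * (50 + c) ^ 2 * (c + 3)) * (n * n * (nnz A + n) * lb (n * U) ^ 6) \<and>
       space_used (comp 0 (det_com c)) xs \<omega> t \<le> 116 * (50 + c) * (n * lb (n * U))"
proof -
  let ?m = "nnz A" and ?A = "\<lambda>i j. A $$ (i, j)" and ?P = "comp 0 (det_com c)"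
  obtain row col ent where e: "input_at xs 0 = int n" "input_at xs 1 = int ?m"
    "\<And>k. k < ?m \<Longrightarrow> input_at xs (3 * int k + 2) = int (row k) \<and> row k < n"
    "\<And>k. k < ?m \<Longrightarrow> input_at xs (3 * int k + 3) = int (col k) \<and> col k < n"
    "\<And>k. k < ?m \<Longrightarrow> input_at xs (3 * int k + 4) = ent k"
    "\<And>i v. i < n \<Longrightarrow> (\<Sum>j<n. A $$ (i, j) * v j) = (\<Sum>k<?m. if row k = i then ent k * v (col k) else 0)"
    "\<And>k. k < ?m \<Longrightarrow> \<exists>i<n. \<exists>j<n. ent k = A $$ (i, j)"
    "\<And>i j. i < n \<Longrightarrow> j < n \<Longrightarrow> A $$ (i, j) = 0 \<or> (\<exists>k<?m. A $$ (i, j) = ent k)"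
    "?m \<le> n * n"
    using encoding[OF n A xs] by blast
  define V where "V = n * U"
  define l where "l = lb V"
  define W where "W = n * max_abs ent ?m"
  define X where "X = small_bound c V"
  define Y where "Y = large_bound c n V"
  have nV: "n \<le> V" and V1: "V \<ge> 1" using n U by (auto simp: V_def)
  have UV: "U \<le> V" using n by (simp add: V_def)
  have entU: "\<bar>ent k\<bar> \<le> int U" if k: "k < ?m" for k
  proof -
    obtain i j where ij: "i < n" "j < n" "ent k = A $$ (i, j)" using e(7)[OF k] by blast
    then have "A $$ (i, j) \<in> {- int U..int U}" using AU by blast
    then show ?thesis unfolding ij(3) by auto
  qed
  have maxU: "max_abs ent ?m \<le> U" using max_abs_le[of "int U" ?m ent] entU by simp
  then have WV: "W \<le> V" unfolding W_def V_def by (rule mult_le_mono2)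
  note sz = sizes_small[OF n nV e(9) WV, of c, folded X_def Y_def]
  have XY: "X \<le> Y" unfolding X_def Y_def using V1 by (rule small_large)
  have I: "64 + 16 * int ((2 * n + 1) + 1) \<le> X" using sz(1) .
  have rm: "ram X Y (2 * n + 1)" using I XY by unfold_locales
  have l1: "l \<ge> 1" unfolding l_def using V1 by (rule lb_pos)
  have nb: "nbits X \<le> (50 + c) * l" "nbits Y \<le> (50 + c) * (n * l)"
    unfolding X_def Y_def l_def using nbits_bounds[OF n V1] by blast+
  show thesis
  proof (rule that[of W])
    show "W = 0 \<or> n \<le> W" by (auto simp: W_def)
    fix \<omega>
    interpret R: det_run xs \<omega> X Y "2 * n + 1" n ?m ?A row col ent c W
    proof unfold_locales
      show "64 + 16 * int (2 * n + 1 + 1) \<le> X" by (rule I)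
      have "\<bar>ent k\<bar> \<le> X" if "k < ?m" for k using entU[OF that] UV sz(3) by linarith
      then show "input_at xs (3 * int k + 4) = ent k \<and> \<bar>ent k\<bar> \<le> X" if "k < ?m" for k using that e(5) by blast
      show "int W \<le> X" using WV sz(3) by linarith
      show "\<bar>A $$ (i, j)\<bar> \<le> int (max_abs ent ?m)" if "i < n" "j < n" for i j
        using e(8)[OF that] max_abs_ge[of _ ?m ent] by auto
    qed (use n XY sz e W_def in auto)
    interpret M: ram ?P xs \<omega> X Y "2 * n + 1" by (rule rm)
    have w: "M.w \<le> 12 * (50 + c) ^ 2 * l ^ 2"
    proof -
      have "nbits X * nbits X \<le> ((50 + c) * l) * ((50 + c) * l)" by (intro mult_le_mono nb)
      then have "12 * (nbits X * nbits X) \<le> 12 * (((50 + c) * l) * ((50 + c) * l))" by (rule mult_le_mono2)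
      also have "\<dots> = 12 * (50 + c) ^ 2 * l ^ 2" unfolding power2_eq_square by (simp only: mult_ac)
      finally show ?thesis unfolding M.w_def .
    qed
    have w': "M.W \<le> 12 * (50 + c) ^ 2 * (n * l ^ 2)"
    proof -
      have "nbits X * nbits Y \<le> ((50 + c) * l) * ((50 + c) * (n * l))" by (intro mult_le_mono nb)
      then have "12 * (nbits X * nbits Y) \<le> 12 * (((50 + c) * l) * ((50 + c) * (n * l)))" by (rule mult_le_mono2)
      also have "\<dots> = 12 * (50 + c) ^ 2 * (n * l ^ 2)" unfolding power2_eq_square by (simp only: mult_ac)
      finally show ?thesis unfolding M.W_def .
    qed
    have ww: "M.w \<le> M.W" unfolding M.w_def M.W_def using M.bits(2) by (intro mult_le_mono2)
    have Ls: "lb W \<le> l" "lb n \<le> l" "lb (lb W) \<le> l" "cbits n \<le> 8 * l" "esize n W \<le> 16 * l" "lb W * (c + 3) \<le> (c + 3) * l"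
    proof -
      show 1: "lb W \<le> l" "lb n \<le> l" unfolding l_def using WV nV by (auto intro: lb_mono)
      then show 2: "lb (lb W) \<le> l" using lb_le_self[of "lb W"] by linarith
      show "cbits n \<le> 8 * l" "esize n W \<le> 16 * l" using 1 2 l1 by (auto simp: cbits_def esize_def)
      show "lb W * (c + 3) \<le> (c + 3) * l" using 1(1) by (simp add: mult.commute)
    qed
    note Ps = ncand_rsize_bound[OF n WV V1, folded l_def]
    have time: "ct xs \<omega> M.w M.W (det_com c) start \<le> 2 ^ 45 * (12 * (50 + c) ^ 2 * (c + 3)) * (n * n * (?m + n) * l ^ 6)"
      using R.det_com_cost[OF ww] unfolding R.prime_cost_def
      by (rule le_trans) (rule total_cost[OF n l1 _ _ w w' Ls Ps(1) _ Ps(2)], simp_all)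
    have space: "4 * nbits Y + (64 + 16 * (2 * n + 1)) * nbits X \<le> 116 * (50 + c) * (n * l)"
    proof -
      have "(64 + 16 * (2 * n + 1)) * nbits X \<le> (112 * n) * ((50 + c) * l)"
        using n by (intro mult_le_mono nb) simp
      also have "\<dots> = 112 * ((50 + c) * (n * l))" by (simp only: mult_ac)
      finally have "4 * nbits Y + (64 + 16 * (2 * n + 1)) * nbits X \<le> 116 * ((50 + c) * (n * l))" using nb(2) by linarith
      then show ?thesis by (simp only: mult.assoc)
    qed
    obtain t where t: "halted ?P (run ?P xs \<omega> t)" "mem (run ?P xs \<omega> t) 0 = regs (ev xs \<omega> (det_com c) start) 0"
        "time_used ?P xs \<omega> t \<le> ct xs \<omega> M.w M.W (det_com c) start"
        "space_used ?P xs \<omega> t \<le> 4 * nbits Y + (64 + 16 * (2 * n + 1)) * nbits X"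
      using compiled_run[OF rm wf_det_com R.det_com_spec(1) refl] by blast
    show "\<exists>t. halted ?P (run ?P xs \<omega> t) \<and>
       ((\<forall>i<ncand n W. active (2 ^ cbits n) (2 * int W ^ n) i \<longrightarrow>
          prime_ok \<omega> n ?A (cbits n) (lb W * (c + 3))
            (ks (2 ^ cbits n) (2 * int W ^ n) i * (lb W * (c + 3) * (5 * n * cbits n))) (int (2 ^ cbits n + i + 1))) \<longrightarrow>
        mem (run ?P xs \<omega> t) 0 = Determinant.det A) \<and>
       time_used ?P xs \<omega> t \<le> 2 ^ 45 * (12 * (50 + c) ^ 2 * (c + 3)) * (n * n * (?m + n) * lb (n * U) ^ 6) \<and>
       space_used ?P xs \<omega> t \<le> 116 * (50 + c) * (n * lb (n * U))"
      using t(1) R.det_com_spec(2)[folded t(2), unfolded detn_mat[OF A]]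
        le_trans[OF t(3) time, unfolded l_def V_def] le_trans[OF t(4) space, unfolded l_def V_def] by blast
  qed
qed

theorem theorem5p3:
  fixes c :: real
  assumes "c > 0"
  shows "\<exists>(P :: program) (C :: real) (k :: nat) (D :: real).
    \<forall>(n :: nat) (U :: nat) (A :: int mat) (xs :: int list).
      n \<ge> 1 \<longrightarrow> U \<ge> 1 \<longrightarrow> A \<in> carrier_mat n n \<longrightarrow>
      (\<forall>i<n. \<forall>j<n. A $$ (i, j) \<in> {- int U..int U}) \<longrightarrow>
      sparse_encoding A xs \<longrightarrow>
        measure coin_space {\<omega>. outputs P xs \<omega> (Determinant.det A)} \<ge> 1 - real n powr (- c) \<and>
        (\<forall>\<omega>. \<exists>t. halted P (run P xs \<omega> t) \<and>
          (n * U \<ge> 2 \<longrightarrow>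
            real (time_used P xs \<omega> t)
              \<le> C * (real n ^ 2 * (real (nnz A) + real n)) * log 2 (real n * real U) ^ k \<and>
            real (space_used P xs \<omega> t) \<le> D * (real n * log 2 (real n * real U))))"
proof -
  define c0 where "c0 = nat \<lceil>c\<rceil>"
  have c0: "c \<le> real c0" using assms by (simp add: c0_def)
  define P where "P = comp 0 (det_com c0)"
  define K where "K = 2 ^ 45 * (12 * (50 + c0) ^ 2 * (c0 + 3))"
  define K' where "K' = 116 * (50 + c0)"
  \<comment> \<open>The exponent \<open>c\<close> enters the program only through its ceiling
    \<open>c0\<close>. The factors \<open>2 ^ 6\<close> and \<open>2\<close> convert
    \<open>lb\<close> into \<open>log 2\<close>.\<close>
  show ?thesis
  proof (rule exI[of _ P], rule exI[of _ "real K * 2 ^ 6"], rule exI[of _ "6 :: nat"], rule exI[of _ "real K' * 2"],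
      intro allI impI)
    fix n U :: nat and A :: "int mat" and xs :: "int list"
    assume n: "n \<ge> 1" and U: "U \<ge> 1" and A: "A \<in> carrier_mat n n"
      and AU: "\<forall>i<n. \<forall>j<n. A $$ (i, j) \<in> {- int U..int U}" and xs: "sparse_encoding A xs"
    interpret prob_space coin_space by (rule prob_space_coin_space)
    obtain W where W: "W = 0 \<or> n \<le> W" and run: "\<And>\<omega>. \<exists>t. halted P (run P xs \<omega> t) \<and>
       ((\<forall>i<ncand n W. active (2 ^ cbits n) (2 * int W ^ n) i \<longrightarrow>
          prime_ok \<omega> n (\<lambda>i j. A $$ (i, j)) (cbits n) (lb W * (c0 + 3))
            (ks (2 ^ cbits n) (2 * int W ^ n) i * (lb W * (c0 + 3) * (5 * n * cbits n))) (int (2 ^ cbits n + i + 1))) \<longrightarrow>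
        mem (run P xs \<omega> t) 0 = Determinant.det A) \<and>
       time_used P xs \<omega> t \<le> K * (n * n * (nnz A + n) * lb (n * U) ^ 6) \<and>
       space_used P xs \<omega> t \<le> K' * (n * lb (n * U))"
      unfolding P_def K_def K'_def using det_com_run[OF n U A AU xs] by metis
    obtain bad where bad: "bad \<in> sets coin_space"
        "measure coin_space bad \<le> real (ks (2 ^ cbits n) (2 * int W ^ n) (ncand n W)) * (1 / 2) ^ (lb W * (c0 + 3))"
        "\<And>\<omega> i. \<omega> \<notin> bad \<Longrightarrow> i < ncand n W \<Longrightarrow> active (2 ^ cbits n) (2 * int W ^ n) i \<Longrightarrow>
          prime_ok \<omega> n (\<lambda>i j. A $$ (i, j)) (cbits n) (lb W * (c0 + 3))
            (ks (2 ^ cbits n) (2 * int W ^ n) i * (lb W * (c0 + 3) * (5 * n * cbits n))) (int (2 ^ cbits n + i + 1))"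
      using failure_event[OF n, of W c0 "\<lambda>i j. A $$ (i, j)"] by blast
    let ?G = "{\<omega>. outputs P xs \<omega> (Determinant.det A)}"
    have sub: "space coin_space - bad \<subseteq> ?G"
    proof
      fix \<omega> assume "\<omega> \<in> space coin_space - bad"
      then have "\<omega> \<notin> bad" by simp
      then show "\<omega> \<in> ?G" using run[of \<omega>] bad(3)[of \<omega>] unfolding outputs_def by blast
    qed
    have "measure coin_space bad \<le> real n powr (- c)" using bad(2) failure_small[OF n W c0] by (rule order_trans)
    then have "1 - real n powr (- c) \<le> measure coin_space (space coin_space - bad)" using prob_compl[OF bad(1)] by linarith
    also have "\<dots> \<le> measure coin_space ?G" using sub outputs_sets by (rule finite_measure_mono)
    finally have prob: "1 - real n powr (- c) \<le> measure coin_space ?G" .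
    have "\<exists>t. halted P (run P xs \<omega> t) \<and> (n * U \<ge> 2 \<longrightarrow>
        real (time_used P xs \<omega> t) \<le> real K * 2 ^ 6 * (real n ^ 2 * (real (nnz A) + real n)) * log 2 (real n * real U) ^ 6 \<and>
        real (space_used P xs \<omega> t) \<le> real K' * 2 * (real n * log 2 (real n * real U)))" for \<omega>
    proof -
      obtain t where t: "halted P (run P xs \<omega> t)" "time_used P xs \<omega> t \<le> K * (n * n * (nnz A + n) * lb (n * U) ^ 6)"
          "space_used P xs \<omega> t \<le> K' * (n * lb (n * U))" using run by blast
      have "real (time_used P xs \<omega> t) \<le> real K * 2 ^ 6 * (real n ^ 2 * (real (nnz A) + real n)) * log 2 (real n * real U) ^ 6 \<and>
        real (space_used P xs \<omega> t) \<le> real K' * 2 * (real n * log 2 (real n * real U))" if V: "n * U \<ge> 2"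
      proof
        let ?l = "real (lb (n * U))" and ?g = "log 2 (real n * real U)"
        have l: "?l \<le> 2 * ?g" using lb_le_log[OF V] by simp
        have "real (time_used P xs \<omega> t) \<le> real (K * (n * n * (nnz A + n) * lb (n * U) ^ 6))"
          using t(2) by (simp only: of_nat_le_iff)
        also have "\<dots> = real K * (real n ^ 2 * (real (nnz A) + real n)) * ?l ^ 6" by (simp add: power2_eq_square)
        also have "\<dots> \<le> real K * (real n ^ 2 * (real (nnz A) + real n)) * (2 * ?g) ^ 6"
          using l by (intro mult_left_mono power_mono) auto
        also have "\<dots> = real K * 2 ^ 6 * (real n ^ 2 * (real (nnz A) + real n)) * ?g ^ 6"
          by (simp only: power_mult_distrib mult_ac)
        finally show "real (time_used P xs \<omega> t) \<le> real K * 2 ^ 6 * (real n ^ 2 * (real (nnz A) + real n)) * ?g ^ 6" .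
        have "real (space_used P xs \<omega> t) \<le> real (K' * (n * lb (n * U)))" using t(3) by (simp only: of_nat_le_iff)
        also have "\<dots> = real K' * (real n * ?l)" by simp
        also have "\<dots> \<le> real K' * (real n * (2 * ?g))" using l by (intro mult_left_mono) auto
        finally show "real (space_used P xs \<omega> t) \<le> real K' * 2 * (real n * ?g)" by (simp only: mult_ac)
      qed
      then show ?thesis using t(1) by blast
    qed
    then show "measure coin_space ?G \<ge> 1 - real n powr (- c) \<and>
        (\<forall>\<omega>. \<exists>t. halted P (run P xs \<omega> t) \<and> (n * U \<ge> 2 \<longrightarrow>
          real (time_used P xs \<omega> t) \<le> real K * 2 ^ 6 * (real n ^ 2 * (real (nnz A) + real n)) * log 2 (real n * real U) ^ 6 \<and>
          real (space_used P xs \<omega> t) \<le> real K' * 2 * (real n * log 2 (real n * real U))))"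
      using prob by blast
  qed
qed

end
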